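(* Let $T$ be an isotropic and stationary Gaussian $\mathrm{SPHAR}(1)$ process on $\mathbb{S}^2\times\mathbb{Z}$ (with continuous autoregressive kernel, see the context) whose autoregressive operator has eigenvalues $\phi_\ell=G_0\ell^{-\alpha_0}$, $\ell\in\{1,2,\dots\}$, with $0<|G_0|<1$ and $a_1\le\alpha_0\le a_2$, $1<a_1<a_2<\infty$, and whose driving spherical white noise has angular power spectrum $C_{\ell;Z}=H\ell^{-\gamma}$, with $H>0$, $\gamma>2$. Let the truncation multipoles $L_N$ satisfy $L_N\to\infty$ and $(\log L_N)^2/\sqrt N\to0$ as $N\to\infty$. Let $\widehat\alpha_N$ be the nonlinear least squares estimator of $\alpha_0$ defined in the context. Then, as $N\to\infty$, $$\sqrt N(\widehat\alpha_N-\alpha_0)\overset{d}{\to}\mathcal N(0,\sigma^2(\theta)),$$ where $$\sigma^2(\theta)=\frac{4}{G_0^2}\,\frac{\sum_{\ell\ge1}\left(2\log\ell+\frac{D'(\alpha_0)}{D(\alpha_0)}\right)^2\ell^{-2\alpha_0}(2\ell+1)C_\ell(0)C_{\ell;Z}}{\left(\sum_{\ell\ge1}\left(2\log\ell+\frac{D'(\alpha_0)}{D(\alpha_0)}\right)^2\ell^{-2\alpha_0}(2\ell+1)C_\ell(0)\right)^2}.$$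
   Context: Multipoles are indexed by $\ell\in\mathbb{N}=\{1,2,\dots\}$. Let $\{Y_{\ell,m}\}_{\ell\in\mathbb N,\,-\ell\le m\le\ell}$ be the real spherical harmonics, orthonormal in $L^2(\mathbb{S}^2)$. The field $\{T(x,t):(x,t)\in\mathbb{S}^2\times\mathbb{Z}\}$ is real-valued, centered, mean-square continuous, Gaussian, isotropic in space and stationary in time (i.e. $T(R\,\cdot,\cdot+\tau)\overset{d}{=}T(\cdot,\cdot)$ for all $R\in SO(3)$, $\tau\in\mathbb{Z}$). It is $\mathrm{SPHAR}(1)$: $T(x,t)=(\Phi T(\cdot,t-1))(x)+Z(x,t)$, where $(\Phi f)(x)=\int_{\mathbb{S}^2}k(\langle x,y\rangle)f(y)\,dy$, $f\in L^2(\mathbb{S}^2)$, for some continuous $k:[-1,1]\to\mathbb{R}$ (the autoregressive kernel), with $k(\langle x,y\rangle)=\sum_{\ell\in\mathbb N}\phi_\ell\frac{2\ell+1}{4\pi}P_\ell(\langle x,y\rangle)$ in the $L^2$ sense ($P_\ell$ the Legendre polynomials), so that the $\phi_\ell$ are the eigenvalues of $\Phi$; and $Z$ is a Gaussian spherical white noise: the fields $Z(\cdot,t)$, $t\in\mathbb{Z}$, are i.i.d. centered isotropic Gaussian, $Z(\cdot,t)$ is independent of $\{T(\cdot,s):s<t\}$, with angular power spectrum $C_{\ell;Z}=\mathbb{E}|a_{\ell,m;Z}(t)|^2$, where $a_{\ell,m;Z}(t)=\int_{\mathbb{S}^2}Z(x,t)Y_{\ell,m}(x)\,dx$. Put $a_{\ell,m}(t)=\int_{\mathbb{S}^2}T(x,t)Y_{\ell,m}(x)\,dx$;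 then $a_{\ell,m}(t)=\phi_\ell a_{\ell,m}(t-1)+a_{\ell,m;Z}(t)$ and $C_\ell(0)=\mathbb{E}[a_{\ell,m}(t)^2]=C_{\ell;Z}/(1-\phi_\ell^2)$. Let $A=[a_1,a_2]$ and $\Theta=\left((-1,1)\setminus\{0\}\right)\times A$; the parameter is $\theta=(G,\alpha)$, with true value $(G_0,\alpha_0)$. For $N>1$ the estimator is $$(\widehat G_N,\widehat\alpha_N)=\underset{(G,\alpha)\in\Theta}{\mathrm{argmin}}\ R_N(G,\alpha),\qquad R_N(G,\alpha)=\frac1N\sum_{t=1}^N\sum_{\ell=1}^{L_N}\sum_{m=-\ell}^{\ell}\left(a_{\ell,m}(t)-G\ell^{-\alpha}a_{\ell,m}(t-1)\right)^2 .$$ By first minimizing in $G$, the minimization problem is rewritten as $\widehat\alpha_N=\mathrm{argmax}_{\alpha\in A}\widehat U_N(\alpha)^2/\widehat D_N(\alpha)$, where $\widehat U_N(\alpha)=\frac1N\sum_{t=1}^N\sum_{\ell=1}^{L_N}\sum_{m=-\ell}^{\ell}a_{\ell,m}(t)a_{\ell,m}(t-1)\ell^{-\alpha}$ and $\widehat D_N(\alpha)=\frac1N\sum_{t=1}^N\sum_{\ell=1}^{L_N}\sum_{m=-\ell}^{\ell}a_{\ell,m}(t-1)^2\ell^{-2\alpha}$. Finally $D(\alpha)=\sum_{\ell\ge1}(2\ell+1)C_\ell(0)\ell^{-2\alpha}$ and $D'(\alpha)=-2\sum_{\ell\ge1}(2\ell+1)C_\ell(0)\ell^{-2\alpha}\log\ell$,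 where $C_\ell(0)$ is computed at the true parameters. $\overset{d}{\to}$ is convergence in distribution.
   Formalization: The true exponent is assumed to satisfy a_1 < α_0 < a_2 strictly: at an endpoint the estimator, being confined to [a_1,a_2], makes √N(α̂_N−α_0) one-signed, so it cannot converge to a normal law with positive variance. *)

theory Defs
  imports "HOL-Probability.Probability" "HOL-Computational_Algebra.Polynomial"
begin

abbreviation S2 :: "(real^3) set" where
  "S2 \<equiv> sphere 0 1"

text \<open>
  The surface measure, as a measure whose space is the sphere itself. In polar coordinates
  \<open>dv = r\<^sup>2 dr dx\<close>, so the area of \<open>E\<close> is three times the volume of the cone
  \<open>{r x | x \<in> E, 0 < r < 1}\<close>; the total mass is \<open>4 * pi\<close>.
\<close>
definition surface :: "(real^3) measure" where
  "surface = scale_measure 3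
     (distr (restrict_space lborel (ball 0 1 - {0})) (restrict_space borel S2)
        (\<lambda>v. v /\<^sub>R norm v))"

text \<open>Rodrigues' formula.\<close>
definition legendre :: "nat \<Rightarrow> real poly" where
  "legendre l = smult (1 / (2 ^ l * fact l)) ((pderiv ^^ l) ([:-1, 0, 1:] ^ l))"

text \<open>
  Real spherical harmonics, orthonormal in \<open>L\<^sup>2\<close> of the sphere, in Cartesian form. At the point with
  colatitude \<open>\<theta>\<close> and longitude \<open>\<phi>\<close> one has \<open>(x\<^sub>1 + i x\<^sub>2)\<^sup>n = sin\<^sup>n \<theta> exp(i n \<phi>)\<close>, and
  \<open>sin\<^sup>n \<theta>\<close> times the \<open>n\<close>-th derivative of the Legendre polynomial at \<open>cos \<theta>\<close> is the associated
  Legendre function (without Condon-Shortley sign), so the angular factor is \<open>cos(m \<phi>)\<close>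
  for \<open>m \<ge> 0\<close> and \<open>sin(\<bar>m\<bar> \<phi>)\<close> for \<open>m < 0\<close>.
\<close>
definition sph_harm :: "nat \<Rightarrow> int \<Rightarrow> real^3 \<Rightarrow> real" where
  "sph_harm l m x =
     (let n = nat \<bar>m\<bar>; w = Complex (x $ 1) (x $ 2) ^ n in
      sqrt ((if m = 0 then 1 else 2) * real (2 * l + 1) / (4 * pi) * fact (l - n) / fact (l + n))
      * poly ((pderiv ^^ n) (legendre l)) (x $ 3)
      * (if m \<ge> 0 then Re w else Im w))"

definition kernel_op :: "(real \<Rightarrow> real) \<Rightarrow> (real^3 \<Rightarrow> real) \<Rightarrow> real^3 \<Rightarrow> real" where
  "kernel_op k f x = (\<integral>y. k (x \<bullet> y) * f y \<partial>surface)"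

text \<open>
  \<open>k (x \<bullet> y) = (\<Sum>l\<ge>1. \<phi> l * (2 l + 1) / (4 pi) * P\<^sub>l (x \<bullet> y))\<close>, with convergence in \<open>L\<^sup>2\<close> of the
  product of the sphere with itself.
\<close>
definition legendre_expansion :: "(real \<Rightarrow> real) \<Rightarrow> (nat \<Rightarrow> real) \<Rightarrow> bool" where
  "legendre_expansion k \<phi> \<longleftrightarrow>
     (\<lambda>n. \<integral>(x, y). (k (x \<bullet> y)
          - (\<Sum>l = 1..n. \<phi> l * real (2 * l + 1) / (4 * pi) * poly (legendre l) (x \<bullet> y)))\<^sup>2
        \<partial>(surface \<Otimes>\<^sub>M surface)) \<longlonglongrightarrow> 0"

text \<open>The law of the whole family \<open>(X i)\<close>, \<open>i \<in> I\<close>, on the product sigma-algebra.\<close>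
definition process_law :: "'w measure \<Rightarrow> 'i set \<Rightarrow> ('i \<Rightarrow> 'w \<Rightarrow> real) \<Rightarrow> ('i \<Rightarrow> real) measure" where
  "process_law M I X = distr M (\<Pi>\<^sub>M i\<in>I. borel) (\<lambda>\<omega>. \<lambda>i\<in>I. X i \<omega>)"

text \<open>A univariate normal law, possibly degenerate.\<close>
definition gaussian_rv :: "'w measure \<Rightarrow> ('w \<Rightarrow> real) \<Rightarrow> bool" where
  "gaussian_rv M X \<longleftrightarrow> X \<in> borel_measurable M \<and>
     (\<exists>\<mu> \<sigma>. \<sigma> \<ge> 0 \<and>
        distr M borel X = (if \<sigma> = 0 then return borel \<mu> else density lborel (normal_density \<mu> \<sigma>)))"

definition gaussian_process :: "'w measure \<Rightarrow> 'i set \<Rightarrow> ('i \<Rightarrow> 'w \<Rightarrow> real) \<Rightarrow> bool" where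
  "gaussian_process M I X \<longleftrightarrow>
     (\<forall>J c. finite J \<and> J \<subseteq> I \<longrightarrow> gaussian_rv M (\<lambda>\<omega>. \<Sum>i\<in>J. c i * X i \<omega>))"

definition centered :: "'w measure \<Rightarrow> 'i set \<Rightarrow> ('i \<Rightarrow> 'w \<Rightarrow> real) \<Rightarrow> bool" where
  "centered M I X \<longleftrightarrow> (\<forall>i\<in>I. (\<integral>\<omega>. X i \<omega> \<partial>M) = 0)"

text \<open>
  Measurability jointly in the point of the sphere and in the outcome: this is what gives a meaning
  to the integrals over the sphere of the sample paths.
\<close>
definition spherical_field :: "'w measure \<Rightarrow> (real^3 \<Rightarrow> int \<Rightarrow> 'w \<Rightarrow> real) \<Rightarrow> bool" where
  "spherical_field M X \<longleftrightarrow>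
     (\<forall>t. (\<lambda>(\<omega>, x). X x t \<omega>) \<in> borel_measurable (M \<Otimes>\<^sub>M surface))"

definition ms_continuous :: "'w measure \<Rightarrow> (real^3 \<Rightarrow> int \<Rightarrow> 'w \<Rightarrow> real) \<Rightarrow> bool" where
  "ms_continuous M X \<longleftrightarrow>
     (\<forall>t. \<forall>x\<in>S2. ((\<lambda>y. \<integral>\<omega>. (X y t \<omega> - X x t \<omega>)\<^sup>2 \<partial>M) \<longlongrightarrow> 0) (at x within S2))"

definition isotropic_stationary :: "'w measure \<Rightarrow> (real^3 \<Rightarrow> int \<Rightarrow> 'w \<Rightarrow> real) \<Rightarrow> bool" where
  "isotropic_stationary M X \<longleftrightarrow>
     (\<forall>R \<tau>. rotation_matrix R \<longrightarrow>
        process_law M (S2 \<times> UNIV) (\<lambda>(x, t). X (R *v x) (t + \<tau>))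
        = process_law M (S2 \<times> UNIV) (\<lambda>(x, t). X x t))"

definition gaussian_white_noise :: "'w measure \<Rightarrow> (real^3 \<Rightarrow> int \<Rightarrow> 'w \<Rightarrow> real) \<Rightarrow> bool" where
  "gaussian_white_noise M Z \<longleftrightarrow>
     spherical_field M Z \<and>
     (\<forall>t. gaussian_process M S2 (\<lambda>x. Z x t) \<and> centered M S2 (\<lambda>x. Z x t)) \<and>
     (\<forall>t R. rotation_matrix R \<longrightarrow>
        process_law M S2 (\<lambda>x. Z (R *v x) t) = process_law M S2 (\<lambda>x. Z x t)) \<and>
     (\<forall>s t. process_law M S2 (\<lambda>x. Z x s) = process_law M S2 (\<lambda>x. Z x t)) \<and>
     prob_space.indep_vars M (\<lambda>t. \<Pi>\<^sub>M x\<in>S2. borel) (\<lambda>t \<omega>. \<lambda>x\<in>S2. Z x t \<omega>) UNIV"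

text \<open>
  The autoregressive equation is an equality of random variables for every \<open>x\<close> and \<open>t\<close>. In the
  independence of \<open>Z(\<cdot>, t)\<close> from the past of \<open>T\<close>, the noise is indexed by \<open>S2 \<times> {t}\<close> because
  \<open>indep_var\<close> needs both variables to have the same type.
\<close>
definition sphar1 :: "'w measure \<Rightarrow> (real \<Rightarrow> real) \<Rightarrow> (nat \<Rightarrow> real) \<Rightarrow>
    (real^3 \<Rightarrow> int \<Rightarrow> 'w \<Rightarrow> real) \<Rightarrow> (real^3 \<Rightarrow> int \<Rightarrow> 'w \<Rightarrow> real) \<Rightarrow> bool" where
  "sphar1 M k \<phi> T Z \<longleftrightarrow>
     continuous_on {-1..1} k \<and> legendre_expansion k \<phi> \<and>
     spherical_field M T \<and>
     gaussian_process M (S2 \<times> UNIV) (\<lambda>(x, t). T x t) \<and>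
     centered M (S2 \<times> UNIV) (\<lambda>(x, t). T x t) \<and>
     ms_continuous M T \<and> isotropic_stationary M T \<and>
     gaussian_white_noise M Z \<and>
     (\<forall>t. prob_space.indep_var M
        (\<Pi>\<^sub>M p\<in>S2 \<times> {t}. borel) (\<lambda>\<omega>. \<lambda>(x, s)\<in>S2 \<times> {t}. Z x s \<omega>)
        (\<Pi>\<^sub>M p\<in>S2 \<times> {..<t}. borel) (\<lambda>\<omega>. \<lambda>(x, s)\<in>S2 \<times> {..<t}. T x s \<omega>)) \<and>
     (\<forall>x\<in>S2. \<forall>t. AE \<omega> in M. T x t \<omega> = kernel_op k (\<lambda>y. T y (t - 1) \<omega>) x + Z x t \<omega>)"

definition harm_coeff ::
    "(real^3 \<Rightarrow> int \<Rightarrow> 'w \<Rightarrow> real) \<Rightarrow> nat \<Rightarrow> int \<Rightarrow> int \<Rightarrow> 'w \<Rightarrow> real" where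
  "harm_coeff X l m t \<omega> = (\<integral>x. X x t \<omega> * sph_harm l m x \<partial>surface)"

definition has_power_spectrum ::
    "'w measure \<Rightarrow> (real^3 \<Rightarrow> int \<Rightarrow> 'w \<Rightarrow> real) \<Rightarrow> (nat \<Rightarrow> real) \<Rightarrow> bool" where
  "has_power_spectrum M X C \<longleftrightarrow>
     (\<forall>l\<ge>1. \<forall>m\<in>{- int l..int l}. \<forall>t. (\<integral>\<omega>. (harm_coeff X l m t \<omega>)\<^sup>2 \<partial>M) = C l)"

text \<open>
  \<open>C\<^sub>l(0)\<close>. For an isotropic stationary field the variance does not depend on \<open>m\<close> and \<open>t\<close>; the
  values \<open>m = 0\<close> and \<open>t = 0\<close> are used.
\<close>
definition power_spectrum ::
    "'w measure \<Rightarrow> (real^3 \<Rightarrow> int \<Rightarrow> 'w \<Rightarrow> real) \<Rightarrow> nat \<Rightarrow> real" where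
  "power_spectrum M X l = (\<integral>\<omega>. (harm_coeff X l 0 0 \<omega>)\<^sup>2 \<partial>M)"

definition Theta :: "real \<Rightarrow> real \<Rightarrow> (real \<times> real) set" where
  "Theta a1 a2 = ({-1<..<1} - {0}) \<times> {a1..a2}"

text \<open>The criterion \<open>R\<^sub>N\<close>, with truncation multipole \<open>L\<close> in the place of \<open>L\<^sub>N\<close>.\<close>
definition nls_criterion ::
    "(real^3 \<Rightarrow> int \<Rightarrow> 'w \<Rightarrow> real) \<Rightarrow> nat \<Rightarrow> nat \<Rightarrow> 'w \<Rightarrow> real \<times> real \<Rightarrow> real" where
  "nls_criterion T L N \<omega> = (\<lambda>(G, \<alpha>). 1 / real N *
     (\<Sum>t = 1..int N. \<Sum>l = 1..L. \<Sum>m = - int l..int l.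
        (harm_coeff T l m t \<omega> - G * real l powr (- \<alpha>) * harm_coeff T l m (t - 1) \<omega>)\<^sup>2))"

text \<open>
  Random variables that minimise the criterion over \<open>Theta\<close>. Since \<open>Theta\<close> is not compact, a
  minimiser may fail to exist for some outcomes; there the value of the estimator is unconstrained.
\<close>
definition nls_estimator :: "'w measure \<Rightarrow> (real^3 \<Rightarrow> int \<Rightarrow> 'w \<Rightarrow> real) \<Rightarrow> real \<Rightarrow> real \<Rightarrow>
    (nat \<Rightarrow> nat) \<Rightarrow> (nat \<Rightarrow> 'w \<Rightarrow> real) \<Rightarrow> (nat \<Rightarrow> 'w \<Rightarrow> real) \<Rightarrow> bool" where
  "nls_estimator M T a1 a2 L Ghat \<alpha>hat \<longleftrightarrow>
     (\<forall>N>1. Ghat N \<in> borel_measurable M \<and> \<alpha>hat N \<in> borel_measurable M \<and>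
        (AE \<omega> in M.
           (\<exists>\<theta>. is_arg_min (nls_criterion T (L N) N \<omega>) (\<lambda>\<theta>. \<theta> \<in> Theta a1 a2) \<theta>) \<longrightarrow>
           is_arg_min (nls_criterion T (L N) N \<omega>) (\<lambda>\<theta>. \<theta> \<in> Theta a1 a2)
             (Ghat N \<omega>, \<alpha>hat N \<omega>)))"

definition D_fun :: "(nat \<Rightarrow> real) \<Rightarrow> real \<Rightarrow> real" where
  "D_fun C \<alpha> = (\<Sum>\<^sub>\<infinity>l\<in>{1..}. real (2 * l + 1) * C l * real l powr (- 2 * \<alpha>))"

definition D'_fun :: "(nat \<Rightarrow> real) \<Rightarrow> real \<Rightarrow> real" where
  "D'_fun C \<alpha> =
     - 2 * (\<Sum>\<^sub>\<infinity>l\<in>{1..}. real (2 * l + 1) * C l * real l powr (- 2 * \<alpha>) * ln (real l))"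

text \<open>Here \<open>C\<close> is the spectrum \<open>C\<^sub>l(0)\<close> of the field and \<open>CZ\<close> that of the noise.\<close>
definition asymp_var :: "(nat \<Rightarrow> real) \<Rightarrow> (nat \<Rightarrow> real) \<Rightarrow> real \<Rightarrow> real \<Rightarrow> real" where
  "asymp_var C CZ G \<alpha> = 4 / G\<^sup>2 *
     ((\<Sum>\<^sub>\<infinity>l\<in>{1..}. (2 * ln (real l) + D'_fun C \<alpha> / D_fun C \<alpha>)\<^sup>2
         * real l powr (- 2 * \<alpha>) * real (2 * l + 1) * C l * CZ l)
      / (\<Sum>\<^sub>\<infinity>l\<in>{1..}. (2 * ln (real l) + D'_fun C \<alpha> / D_fun C \<alpha>)\<^sup>2
         * real l powr (- 2 * \<alpha>) * real (2 * l + 1) * C l)\<^sup>2)"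

end

(*
  By the addition theorem the kernel operator acts on sph_harm l m as multiplication by phi_l, so the
  harmonic coefficients satisfy scalar autoregressions. Isotropy makes the coefficients of the noise
  uncorrelated across (l, m): an invariant bilinear form on the span of the harmonics is diagonal, by
  the infinitesimal rotations that raise and lower m and by the eigenvalues l (l + 1). Being jointly
  Gaussian, they are independent.

  Given the statistics m_l = sum_m (mean of innovation times past) and S_l = sum_m (mean of squared
  past), the criterion is a constant plus sum_l (2 m_l delta_l + S_l delta_l^2), where
  delta_l = G_0 l^(-alpha_0) - G l^(-alpha). The first two multipoles identify (G, alpha), and
  E |m_l| and E |S_l - (2 l + 1) C_l(0)| are at most a summable sequence over sqrt N. This gives the
  rate 1 / sqrt N uniformly in the truncation, and then the score equations express
  sqrt N (alphahat - alpha_0), up to a vanishing error, through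
  sqrt N sum_l m_l l^(-alpha_0) (log l - mu), with mu = - D'(alpha_0) / (2 D(alpha_0)). For finitely
  many l this is a martingale whose increments are conditionally Gaussian, so that its characteristic
  function converges by the law of large numbers for the conditional variance; the remaining l are
  negligible in L1.
*)

theory Submission
  imports Defs
begin

subsection \<open>Legendre polynomials\<close>

text \<open>The addition theorem is itself obtained from rotations: the sum over m is constant along
  rotations about two axes, which bring one of the two points to the pole, where only m = 0
  survives. Taken on the diagonal it also fixes the norm of the harmonics. The hypotheses speak of
  the fields at points of an uncountable set, while the coefficients are path integrals. Mean-square
  continuity bridges the gap: a coefficient is an L2 limit, and along a subsequence an almost sure
  limit, of finite sums of point values, and so inherits normality and independence. The truncation
  grows with N, so every estimate is an L1 bound summed over l: logarithms are absorbed by powers of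
  l with exponent at least 1, and (2 l + 1) C_l(0) is summable because gamma > 2. Averages of
  squares are controlled by a telescoping identity that expresses them through two martingales and
  boundary values.\<close>

lemma funpow_pderiv_smult: "(pderiv ^^ n) (smult c p) = smult c ((pderiv ^^ n) (p :: real poly))"
  by (induction n) (simp_all add: pderiv_smult)

lemma funpow_pderiv_add:
  "(pderiv ^^ n) (p + q) = (pderiv ^^ n) p + (pderiv ^^ n) (q :: real poly)"
  by (induction n) (simp_all add: pderiv_add)

text \<open>The Leibniz rule: only two terms survive, since the second derivative of a linear factor
  is 0. At n = 0 the truncated \<open>n - 1\<close> does no harm, its coefficient being 0.\<close>

lemma funpow_pderiv_X_mult:
  "(pderiv ^^ n) ([:0, 1:] * p)
     = [:0, 1:] * (pderiv ^^ n) p + smult (of_nat n) ((pderiv ^^ (n - 1)) (p :: real poly))"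
proof (induction n)
  case (Suc n)
  have "(pderiv ^^ Suc n) ([:0, 1:] * p)
      = pderiv ([:0, 1:] * (pderiv ^^ n) p + smult (of_nat n) ((pderiv ^^ (n - 1)) p))"
    using Suc by simp
  also have "\<dots> = [:0, 1:] * (pderiv ^^ Suc n) p + (pderiv ^^ n) p
      + smult (of_nat n) (pderiv ((pderiv ^^ (n - 1)) p))"
    by (simp add: pderiv_add pderiv_mult pderiv_smult pderiv_pCons)
  also have "smult (of_nat n) (pderiv ((pderiv ^^ (n - 1)) p)) = smult (of_nat n) ((pderiv ^^ n) p)"
    by (cases n) simp_all
  finally show ?case
    by (simp add: algebra_simps smult_add_left)
qed simp

lemma degree_funpow_pderiv: "degree ((pderiv ^^ n) (p :: real poly)) = degree p - n"
  by (induction n) (simp_all add: degree_pderiv)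

text \<open>Each derivative takes one factor X - 1 away and multiplies the value of the cofactor at
  1 by the current exponent; the exponents multiply up to the quotient of factorials.\<close>

lemma funpow_pderiv_power_at_1:
  fixes q :: "real poly"
  assumes "k \<le> n"
  shows "\<exists>r. (pderiv ^^ k) ([:-1, 1:] ^ n * q) = [:-1, 1:] ^ (n - k) * r
             \<and> poly r 1 = fact n / fact (n - k) * poly q 1"
  using assms
proof (induction k)
  case 0
  then show ?case by (intro exI[of _ q]) simp
next
  case (Suc k)
  then obtain r where r: "(pderiv ^^ k) ([:-1, 1:] ^ n * q) = [:-1, 1:] ^ (n - k) * r"
    "poly r 1 = fact n / fact (n - k) * poly q 1"
    by auto
  define d where "d = n - Suc k"
  have d: "n - k = Suc d"
    using Suc.prems by (simp add: d_def)
  have "(pderiv ^^ Suc k) ([:-1, 1:] ^ n * q) = pderiv ([:-1, 1:] ^ Suc d * r)"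
    using r d by simp
  also have "\<dots> = [:-1, 1:] ^ d * ([:-1, 1:] * pderiv r + smult (of_nat (Suc d)) r)"
    by (simp only: pderiv_mult pderiv_power_Suc) (simp add: pderiv_pCons algebra_simps)
  finally have "(pderiv ^^ Suc k) ([:-1, 1:] ^ n * q)
      = [:-1, 1:] ^ d * ([:-1, 1:] * pderiv r + smult (of_nat (Suc d)) r)" .
  moreover have "poly ([:-1, 1:] * pderiv r + smult (of_nat (Suc d)) r) 1 = fact n / fact d * poly q 1"
    using r(2) unfolding d fact_Suc by (simp del: of_nat_Suc)
  ultimately show ?case
    unfolding d_def by blast
qed

text \<open>Writing (X^2 - 1)^l as (X - 1)^l (X + 1)^l, the l-th derivative at 1 is l! 2^l, which is
  the denominator in Rodrigues' formula.\<close>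

lemma poly_legendre_1: "poly (legendre l) 1 = 1"
proof -
  have "[:-1, 0, 1:] ^ l = [:-1, 1:] ^ l * ([:1, 1:] ^ l :: real poly)"
    by (simp flip: power_mult_distrib)
  then obtain r :: "real poly" where
    "(pderiv ^^ l) ([:-1, 0, 1:] ^ l) = [:-1, 1:] ^ (l - l) * r"
    "poly r 1 = fact l / fact (l - l) * poly ([:1, 1:] ^ l) 1"
    using funpow_pderiv_power_at_1[of l l "[:1, 1:] ^ l"] by auto
  then show ?thesis
    by (simp add: legendre_def)
qed

lemma degree_legendre: "degree (legendre l) = l"
proof -
  have "degree ([:-1, 0, 1:] ^ l :: real poly) = 2 * l"
    by (simp add: degree_power_eq)
  then show ?thesis
    by (simp add: legendre_def degree_funpow_pderiv)
qed

abbreviation dlegendre :: "nat \<Rightarrow> nat \<Rightarrow> real \<Rightarrow> real" where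
  "dlegendre l n x \<equiv> poly ((pderiv ^^ n) (legendre l)) x"

lemma funpow_pderiv_eq_0:
  assumes "degree (p :: real poly) < n"
  shows "(pderiv ^^ n) p = 0"
proof -
  obtain m where n: "n = Suc m" and m: "degree p \<le> m"
    using assms by (cases n) auto
  have "degree ((pderiv ^^ m) p) = 0"
    using m by (simp add: degree_funpow_pderiv)
  then show ?thesis
    using n by (simp add: pderiv_eq_0_iff)
qed

lemma dlegendre_Suc_self: "dlegendre l (Suc l) x = 0"
  using funpow_pderiv_eq_0[of "legendre l" "Suc l"] by (simp add: degree_legendre del: funpow.simps)

text \<open>The derivative of order \<open>l + n\<close> of \<open>(x\<^sup>2 - 1) u' = 2 l x u\<close>, where \<open>u = (x\<^sup>2 - 1)\<^sup>l\<close>.\<close>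

lemma legendre_ode:
  assumes n: "n \<ge> 1"
  shows "(1 - x\<^sup>2) * dlegendre l (Suc n) x - 2 * real n * x * dlegendre l n x
           + (real l + real n) * (real l - real n + 1) * dlegendre l (n - 1) x = 0"
proof -
  define X where "X = ([:0, 1:] :: real poly)"
  define u where "u = (X * X - 1) ^ l"
  have X2: "X * X - 1 = [:-1, 0, 1:]"
    by (simp add: X_def one_pCons)
  define D where "D k = (pderiv ^^ k) u" for k
  have DS: "pderiv (D k) = D (Suc k)" for k
    by (simp add: D_def)
  have u': "(X * X - 1) * pderiv u = smult (2 * real l) (X * u)"
  proof (cases l)
    case (Suc k)
    then show ?thesis
      unfolding u_def Suc pderiv_power_Suc
      by (simp add: pderiv_diff pderiv_mult X_def pderiv_pCons algebra_simps one_pCons)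
  qed (simp add: u_def)
  define N where "N = l + n"
  have N: "N \<ge> 1"
    using n by (simp add: N_def)
  have XD: "(pderiv ^^ k) (X * (pderiv ^^ j) u) = X * D (k + j) + smult (real k) (D (k - 1 + j))"
    for k j
    unfolding X_def funpow_pderiv_X_mult by (simp add: D_def funpow_add)
  have "(pderiv ^^ N) (X * (X * pderiv u)) = X * (pderiv ^^ N) (X * pderiv u)
      + smult (real N) ((pderiv ^^ (N - 1)) (X * pderiv u))"
    unfolding X_def funpow_pderiv_X_mult ..
  also have "\<dots> = X * (X * D (Suc N)) + smult (real N) (X * D N)
      + smult (real N) (X * D N + smult (real (N - 1)) (D (N - 2 + 1)))"
    using XD[of N 1] XD[of "N - 1" 1] N by (simp add: algebra_simps numeral_2_eq_2)
  \<comment> \<open>For N = 1 truncated subtraction makes the two indices differ, but then the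
    coefficient is 0.\<close>
  also have "smult (real (N - 1)) (D (N - 2 + 1)) = smult (real (N - 1)) (D (N - 1))"
    using N by (cases "N = 1") (auto simp: Suc_diff_le numeral_2_eq_2 Suc_diff_Suc)
  finally have e1: "(pderiv ^^ N) (X * (X * pderiv u)) = X * (X * D (Suc N)) + smult (real N) (X * D N)
      + smult (real N) (X * D N + smult (real (N - 1)) (D (N - 1)))" .
  have e2: "(pderiv ^^ N) (X * (X * pderiv u))
      = D (Suc N) + smult (2 * real l) (X * D N + smult (real N) (D (N - 1)))"
  proof -
    have "X * (X * pderiv u) = pderiv u + smult (2 * real l) (X * u)"
      using u' by (simp add: algebra_simps)
    then have "(pderiv ^^ N) (X * (X * pderiv u)) = (pderiv ^^ N) (pderiv u)
        + smult (2 * real l) ((pderiv ^^ N) (X * u))"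
      by (simp only: funpow_pderiv_add funpow_pderiv_smult)
    then show ?thesis
      using XD[of N 0] by (simp add: D_def funpow_swap1)
  qed
  define d where "d k = poly (D k) x" for k
  have "poly (X * (X * D (Suc N)) + smult (real N) (X * D N)
      + smult (real N) (X * D N + smult (real (N - 1)) (D (N - 1)))) x
      = poly (D (Suc N) + smult (2 * real l) (X * D N + smult (real N) (D (N - 1)))) x"
    using e1 e2 by simp
  then have "x * (x * d (Suc N)) + N * (x * d N) + N * (x * d N + (real N - 1) * d (N - 1))
      = d (Suc N) + 2 * l * (x * d N + N * d (N - 1))"
    using N by (simp add: d_def X_def of_nat_diff algebra_simps)
  then have eq: "(1 - x\<^sup>2) * d (Suc N) - 2 * real n * x * d N
      + (real l + real n) * (real l - real n + 1) * d (N - 1) = 0"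
    unfolding N_def by (simp add: algebra_simps power2_eq_square)
  have dl: "dlegendre l k x = 1 / (2 ^ l * fact l) * d (l + k)" for k
    unfolding legendre_def funpow_pderiv_smult d_def D_def u_def X2
    by (simp add: add.commute[of l k] funpow_add)
  have dm: "dlegendre l (n - 1) x = 1 / (2 ^ l * fact l) * d (N - 1)"
    using n by (simp add: dl N_def)
  have scale: "(1 - x\<^sup>2) * (c * a) - 2 * real n * x * (c * b)
      + (real l + real n) * (real l - real n + 1) * (c * e)
    = c * ((1 - x\<^sup>2) * a - 2 * real n * x * b + (real l + real n) * (real l - real n + 1) * e)"
    for a b c e :: real
    by (simp only: distrib_left right_diff_distrib mult_ac)
  show ?thesis
    unfolding dm unfolding dl add_Suc_right N_def[symmetric] scale eq by simp
qed

subsection \<open>Infinitesimal rotations of the spherical harmonics\<close>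

text \<open>The factor sqrt 2 that \<open>sph_harm\<close> carries for nonzero m is left out, so
  that raising and lowering the order has one form from order 1 on.\<close>

definition qnorm :: "nat \<Rightarrow> nat \<Rightarrow> real" where
  "qnorm l n = sqrt (real (2 * l + 1) / (4 * pi) * (fact (l - n) / fact (l + n)))"

text \<open>\<open>harm_u\<close> and \<open>harm_v\<close> are the real and imaginary parts of the
  normalised complex spherical harmonic of order n. Working with them separately keeps everything
  real while the algebra is that of the complex harmonics.\<close>

definition harm_u :: "nat \<Rightarrow> nat \<Rightarrow> real^3 \<Rightarrow> real" where
  "harm_u l n x = qnorm l n * dlegendre l n (x $ 3) * Re (Complex (x $ 1) (x $ 2) ^ n)"

definition harm_v :: "nat \<Rightarrow> nat \<Rightarrow> real^3 \<Rightarrow> real" where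
  "harm_v l n x = qnorm l n * dlegendre l n (x $ 3) * Im (Complex (x $ 1) (x $ 2) ^ n)"

lemma harm_v_0 [simp]: "harm_v l 0 x = 0"
  by (simp add: harm_v_def)

lemma sph_harm_0: "sph_harm l 0 = harm_u l 0"
  by (simp add: fun_eq_iff sph_harm_def harm_u_def qnorm_def)

lemma sqrt_weight: "sqrt (2 + 4 * real l) = sqrt 2 * sqrt (1 + 2 * real l)"
  by (simp add: real_sqrt_mult[symmetric] algebra_simps)

lemma sph_harm_pos: "n \<ge> 1 \<Longrightarrow> sph_harm l (int n) = (\<lambda>x. sqrt 2 * harm_u l n x)"
  by (simp add: fun_eq_iff sph_harm_def harm_u_def qnorm_def real_sqrt_mult real_sqrt_divide
      sqrt_weight)

lemma sph_harm_neg: "n \<ge> 1 \<Longrightarrow> sph_harm l (- int n) = (\<lambda>x. sqrt 2 * harm_v l n x)"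
  by (simp add: fun_eq_iff sph_harm_def harm_v_def qnorm_def real_sqrt_mult real_sqrt_divide
      sqrt_weight)

section \<open>Rotations about the third and the first axis and their generators\<close>

definition rotz :: "real \<Rightarrow> real^3^3" where
  "rotz \<theta> = vector [vector [cos \<theta>, - sin \<theta>, 0], vector [sin \<theta>, cos \<theta>, 0], vector [0, 0, 1]]"

definition rotx :: "real \<Rightarrow> real^3^3" where
  "rotx \<theta> = vector [vector [1, 0, 0], vector [0, cos \<theta>, - sin \<theta>], vector [0, sin \<theta>, cos \<theta>]]"

lemma rotz_apply [simp]:
  "(rotz \<theta> *v x) $ 1 = cos \<theta> * x $ 1 - sin \<theta> * x $ 2"
  "(rotz \<theta> *v x) $ 2 = sin \<theta> * x $ 1 + cos \<theta> * x $ 2"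
  "(rotz \<theta> *v x) $ 3 = x $ 3"
  by (simp_all add: rotz_def matrix_vector_mult_def sum_3)

lemma rotx_apply [simp]:
  "(rotx \<theta> *v x) $ 1 = x $ 1"
  "(rotx \<theta> *v x) $ 2 = cos \<theta> * x $ 2 - sin \<theta> * x $ 3"
  "(rotx \<theta> *v x) $ 3 = sin \<theta> * x $ 2 + cos \<theta> * x $ 3"
  by (simp_all add: rotx_def matrix_vector_mult_def sum_3)

lemma rotation_rotz: "rotation_matrix (rotz \<theta>)"
proof -
  have "sin \<theta> * sin \<theta> + cos \<theta> * cos \<theta> = 1" "cos \<theta> * cos \<theta> + sin \<theta> * sin \<theta> = 1"
    using sin_cos_squared_add[of \<theta>] by (simp_all add: power2_eq_square)
  then show ?thesis
    unfolding rotation_matrix_def orthogonal_matrix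
    by (simp add: det_3 rotz_def vec_eq_iff matrix_matrix_mult_def transpose_def sum_3 forall_3 mat_def)
qed

lemma rotation_rotx: "rotation_matrix (rotx \<theta>)"
proof -
  have "sin \<theta> * sin \<theta> + cos \<theta> * cos \<theta> = 1" "cos \<theta> * cos \<theta> + sin \<theta> * sin \<theta> = 1"
    using sin_cos_squared_add[of \<theta>] by (simp_all add: power2_eq_square)
  then show ?thesis
    unfolding rotation_matrix_def orthogonal_matrix
    by (simp add: det_3 rotx_def vec_eq_iff matrix_matrix_mult_def transpose_def sum_3 forall_3 mat_def)
qed

lemma rotation_orthogonal: "rotation_matrix R \<Longrightarrow> orthogonal_transformation ((*v) (R :: real^3^3))"
  by (simp add: rotation_matrix_def orthogonal_transformation_matrix)

lemma rotation_inner: "rotation_matrix R \<Longrightarrow> (R *v x) \<bullet> (R *v y) = x \<bullet> (y :: real^3)"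
  using rotation_orthogonal[of R] by (simp add: orthogonal_transformation_def)

lemma rotation_norm: "rotation_matrix R \<Longrightarrow> norm (R *v (x :: real^3)) = norm x"
  by (simp add: norm_eq_sqrt_inner rotation_inner)

lemma rotation_in_S2: "rotation_matrix R \<Longrightarrow> x \<in> S2 \<Longrightarrow> R *v x \<in> S2"
  by (simp add: rotation_norm)

lemma rotz_0: "rotz 0 *v x = x" and rotx_0: "rotx 0 *v x = x"
  by (simp_all add: vec_eq_iff forall_3)

text \<open>The generator of the one-parameter group \<open>R\<close>. The derivative is demanded at
  every angle, with f' at the moved point, so that no group law has to be invoked later.\<close>

definition infgen :: "(real \<Rightarrow> real^3^3) \<Rightarrow> (real^3 \<Rightarrow> real) \<Rightarrow> (real^3 \<Rightarrow> real) \<Rightarrow> bool" where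
  "infgen R f f' \<longleftrightarrow>
     (\<forall>x\<in>S2. \<forall>\<theta>. ((\<lambda>\<theta>. f (R \<theta> *v x)) has_real_derivative f' (R \<theta> *v x)) (at \<theta>))"

lemma infgen_add:
  "infgen R f f' \<Longrightarrow> infgen R g g' \<Longrightarrow> infgen R (\<lambda>x. f x + g x) (\<lambda>x. f' x + g' x)"
  unfolding infgen_def by (auto intro: derivative_intros)

lemma infgen_cmult: "infgen R f f' \<Longrightarrow> infgen R (\<lambda>x. c * f x) (\<lambda>x. c * f' x)"
  unfolding infgen_def by (auto intro: DERIV_cmult)

text \<open>The matrix element sqrt (l (l + 1) - n (n + 1)) of the raising operator of angular
  momentum.\<close>

definition ladder :: "nat \<Rightarrow> nat \<Rightarrow> real" where
  "ladder l n = sqrt ((real l - real n) * (real l + real n + 1))"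

lemma ladder_self [simp]: "ladder l l = 0"
  by (simp add: ladder_def)

lemma qnorm_ladder:
  assumes "n < l"
  shows "qnorm l n = ladder l n * qnorm l (Suc n)"
proof -
  have 1: "(fact (l - n) :: real) = (real l - real n) * fact (l - Suc n)"
    using assms by (metis Suc_diff_Suc fact_Suc of_nat_diff less_imp_le of_nat_mult of_nat_fact)
  have 2: "(fact (l + Suc n) :: real) = (real l + real n + 1) * fact (l + n)"
    by (simp add: algebra_simps)
  have p: "real l + real n + 1 \<noteq> 0"
    by linarith
  show ?thesis
    unfolding qnorm_def ladder_def real_sqrt_mult[symmetric] 1 2
    using p by (intro arg_cong[where f = sqrt]) (simp add: divide_simps)
qed

lemma ladder_sq: "n \<le> l \<Longrightarrow> (ladder l n)\<^sup>2 = (real l - real n) * (real l + real n + 1)"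
  by (simp add: ladder_def)

text \<open>A rotation about the third axis multiplies x1 + i x2 by exp (i theta), hence its n-th
  power by exp (i n theta).\<close>

lemma infgen_rotz_complex:
  "((\<lambda>\<theta>. Complex ((rotz \<theta> *v x) $ 1) ((rotz \<theta> *v x) $ 2) ^ n) has_vector_derivative
      of_nat n * \<i> * Complex ((rotz \<theta> *v x) $ 1) ((rotz \<theta> *v x) $ 2) ^ n) (at \<theta>)"
proof -
  have eq: "Complex ((rotz \<theta> *v x) $ 1) ((rotz \<theta> *v x) $ 2) = cis \<theta> * Complex (x $ 1) (x $ 2)" for \<theta>
    by (simp add: complex_eq_iff)
  have "((\<lambda>\<theta>. exp (\<theta> *\<^sub>R (of_nat n * \<i>))) has_vector_derivative
      (of_nat n * \<i>) * exp (\<theta> *\<^sub>R (of_nat n * \<i>))) (at \<theta>)"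
    using exp_scaleR_has_vector_derivative_left[of "of_nat n * \<i>" \<theta>] by simp
  then have "((\<lambda>\<theta>. exp (\<theta> *\<^sub>R (of_nat n * \<i>)) * Complex (x $ 1) (x $ 2) ^ n) has_vector_derivative
      (of_nat n * \<i>) * exp (\<theta> *\<^sub>R (of_nat n * \<i>)) * Complex (x $ 1) (x $ 2) ^ n) (at \<theta>)"
    by (rule has_vector_derivative_mult_left)
  moreover have "exp (\<theta> *\<^sub>R (of_nat n * \<i>)) = cis \<theta> ^ n" for \<theta>
    by (simp add: exp_of_nat_mult[symmetric] cis_conv_exp scaleR_conv_of_real mult_ac)
  ultimately show ?thesis
    unfolding eq power_mult_distrib by (simp add: mult.assoc)
qed

lemma infgen_rotz_u: "infgen rotz (harm_u l n) (\<lambda>x. - real n * harm_v l n x)"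
  unfolding infgen_def harm_u_def harm_v_def
proof (intro ballI allI)
  fix x \<theta>
  show "((\<lambda>\<theta>. qnorm l n * dlegendre l n ((rotz \<theta> *v x) $ 3)
      * Re (Complex ((rotz \<theta> *v x) $ 1) ((rotz \<theta> *v x) $ 2) ^ n))
      has_real_derivative - real n * (qnorm l n * dlegendre l n ((rotz \<theta> *v x) $ 3)
      * Im (Complex ((rotz \<theta> *v x) $ 1) ((rotz \<theta> *v x) $ 2) ^ n))) (at \<theta>)"
    using DERIV_cmult[OF bounded_linear.has_vector_derivative[OF bounded_linear_Re
        infgen_rotz_complex[of x n \<theta>], folded has_real_derivative_iff_has_vector_derivative],
        of "qnorm l n * dlegendre l n (x $ 3)"]
    by (simp add: mult_ac)
qed

lemma infgen_rotz_v: "infgen rotz (harm_v l n) (\<lambda>x. real n * harm_u l n x)"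
  unfolding infgen_def harm_u_def harm_v_def
proof (intro ballI allI)
  fix x \<theta>
  show "((\<lambda>\<theta>. qnorm l n * dlegendre l n ((rotz \<theta> *v x) $ 3)
      * Im (Complex ((rotz \<theta> *v x) $ 1) ((rotz \<theta> *v x) $ 2) ^ n))
      has_real_derivative real n * (qnorm l n * dlegendre l n ((rotz \<theta> *v x) $ 3)
      * Re (Complex ((rotz \<theta> *v x) $ 1) ((rotz \<theta> *v x) $ 2) ^ n))) (at \<theta>)"
    using DERIV_cmult[OF bounded_linear.has_vector_derivative[OF bounded_linear_Im
        infgen_rotz_complex[of x n \<theta>], folded has_real_derivative_iff_has_vector_derivative],
        of "qnorm l n * dlegendre l n (x $ 3)"]
    by (simp add: mult_ac)
qed

lemma S2_sum_squares: "x \<in> S2 \<longleftrightarrow> (x $ 1)\<^sup>2 + (x $ 2)\<^sup>2 + (x $ 3)\<^sup>2 = 1"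
  by (simp add: norm_eq_1 inner_vec_def sum_3 power2_eq_square)

text \<open>Along the rotation z' = y and y' = - z. The product rule gives a term with y w^n; there
  y = - (i / 2) (w - cnj w), and w cnj w = 1 - z^2 on the sphere, so \<open>legendre_ode\<close>
  replaces (1 - z^2) times the derivative of order n + 1. The term of order n cancels and the
  neighbouring orders remain.\<close>

lemma infgen_rotx_complex:
  fixes l n :: nat and x :: "real^3" and \<theta> :: real
  assumes x: "x \<in> S2" and n: "n \<ge> 1"
  defines "w \<equiv> \<lambda>\<theta>. Complex ((rotx \<theta> *v x) $ 1) ((rotx \<theta> *v x) $ 2)"
    and "p \<equiv> \<lambda>k \<theta>. complex_of_real (dlegendre l k ((rotx \<theta> *v x) $ 3))"
  shows "((\<lambda>\<theta>. p n \<theta> * w \<theta> ^ n) has_vector_derivative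
      (- \<i> / 2) * (p (Suc n) \<theta> * w \<theta> ^ Suc n
         + of_real ((real l + real n) * (real l - real n + 1)) * (p (n - 1) \<theta> * w \<theta> ^ (n - 1)))) (at \<theta>)"
proof -
  define y z where "y = (\<lambda>\<theta>. (rotx \<theta> *v x) $ 2)" and "z = (\<lambda>\<theta>. (rotx \<theta> *v x) $ 3)"
  have dz: "(z has_real_derivative y \<theta>) (at \<theta>)"
    unfolding y_def z_def rotx_apply by (auto intro!: derivative_eq_intros)
  have dy: "(y has_real_derivative - z \<theta>) (at \<theta>)"
    unfolding y_def z_def rotx_apply by (auto intro!: derivative_eq_intros)
  have weq: "w \<theta> = of_real (x $ 1) + of_real (y \<theta>) * \<i>" for \<theta>
    by (simp add: w_def y_def complex_eq_iff)
  have dw: "(w has_vector_derivative - of_real (z \<theta>) * \<i>) (at \<theta>)"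
    unfolding weq[abs_def]
    using has_vector_derivative_add[OF has_vector_derivative_const
        has_vector_derivative_mult_left[OF has_vector_derivative_of_real[OF dy]]] by simp
  have pw: "((\<lambda>w. w ^ n) has_field_derivative of_nat n * w \<theta> ^ (n - 1)) (at (w \<theta>))"
    by (auto intro!: derivative_eq_intros)
  have dwn: "((\<lambda>\<theta>. w \<theta> ^ n) has_vector_derivative
      of_nat n * w \<theta> ^ (n - 1) * (- of_real (z \<theta>) * \<i>)) (at \<theta>)"
    using field_vector_diff_chain_at[OF dw pw] by (simp add: o_def mult_ac)
  have "((\<lambda>\<theta>. dlegendre l n (z \<theta>)) has_real_derivative dlegendre l (Suc n) (z \<theta>) * y \<theta>) (at \<theta>)"
    using DERIV_chain2[OF poly_DERIV dz] by simp
  then have dp: "(p n has_vector_derivative of_real (dlegendre l (Suc n) (z \<theta>) * y \<theta>)) (at \<theta>)"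
    unfolding p_def using has_vector_derivative_of_real by (fastforce simp: z_def)
  have D: "((\<lambda>\<theta>. p n \<theta> * w \<theta> ^ n) has_vector_derivative
      p n \<theta> * (of_nat n * w \<theta> ^ (n - 1) * (- of_real (z \<theta>) * \<i>))
      + of_real (dlegendre l (Suc n) (z \<theta>) * y \<theta>) * w \<theta> ^ n) (at \<theta>)"
    by (rule has_vector_derivative_mult[OF dp dwn])
  have "rotx \<theta> *v x \<in> S2"
    using x rotation_rotx rotation_in_S2 by blast
  then have sph: "(x $ 1)\<^sup>2 + (y \<theta>)\<^sup>2 = 1 - (z \<theta>)\<^sup>2"
    unfolding S2_sum_squares y_def z_def by simp
  have "w \<theta> * cnj (w \<theta>) = of_real ((x $ 1)\<^sup>2 + (y \<theta>)\<^sup>2)"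
    unfolding complex_mult_cnj weq by simp
  then have ww: "w \<theta> * cnj (w \<theta>) = of_real (1 - (z \<theta>)\<^sup>2)"
    by (simp add: sph)
  have yw: "of_real (y \<theta>) = (- \<i> / 2) * (w \<theta> - cnj (w \<theta>))"
    by (simp add: weq complex_eq_iff)
  obtain m where m: "n = Suc m"
    using n by (cases n) auto
  define P Q where "P = dlegendre l n (z \<theta>)" and "Q = dlegendre l (Suc n) (z \<theta>)"
  define O' where "O' = (real l + real n) * (real l - real n + 1) * dlegendre l (n - 1) (z \<theta>)"
  have ode: "(1 - (z \<theta>)\<^sup>2) * Q = 2 * real n * z \<theta> * P - O'"
    using legendre_ode[OF n, of "z \<theta>" l] by (simp add: P_def Q_def O'_def)
  have "of_real (Q * y \<theta>) * w \<theta> ^ n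
      = (- \<i> / 2) * (of_real Q * w \<theta> ^ Suc n - of_real Q * (w \<theta> * cnj (w \<theta>)) * w \<theta> ^ (n - 1))"
    by (simp add: yw m algebra_simps)
  also have "of_real Q * (w \<theta> * cnj (w \<theta>)) = of_real (2 * real n * z \<theta> * P - O')"
    unfolding ww of_real_mult[symmetric] ode[symmetric] by (simp add: mult.commute)
  finally have "P * (of_nat n * w \<theta> ^ (n - 1) * (- of_real (z \<theta>) * \<i>)) + of_real (Q * y \<theta>) * w \<theta> ^ n
    = (- \<i> / 2) * (of_real Q * w \<theta> ^ Suc n + of_real O' * w \<theta> ^ (n - 1))"
    by (simp add: algebra_simps)
  moreover have "p n \<theta> = of_real P" "p (Suc n) \<theta> = of_real Q"
    "of_real ((real l + real n) * (real l - real n + 1)) * (p (n - 1) \<theta> * w \<theta> ^ (n - 1))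
       = of_real O' * w \<theta> ^ (n - 1)"
    unfolding p_def z_def[symmetric] P_def Q_def O'_def by (simp_all add: z_def)
  moreover have "p n \<theta> * (of_nat n * w \<theta> ^ (n - 1) * (- of_real (z \<theta>) * \<i>))
      + of_real (dlegendre l (Suc n) (z \<theta>) * y \<theta>) * w \<theta> ^ n
    = P * (of_nat n * w \<theta> ^ (n - 1) * (- of_real (z \<theta>) * \<i>)) + of_real (Q * y \<theta>) * w \<theta> ^ n"
    unfolding Q_def[symmetric] calculation(2) ..
  ultimately show ?thesis
    using D by (simp only:)
qed


lemma qnorm_dlegendre_Suc:
  "n \<le> l \<Longrightarrow> qnorm l n * dlegendre l (Suc n) z = ladder l n * (qnorm l (Suc n) * dlegendre l (Suc n) z)"
  using dlegendre_Suc_self[of l z] by (cases "n = l") (simp_all add: qnorm_ladder)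

lemma qnorm_ladder_pred:
  assumes "1 \<le> n" "n \<le> l"
  shows "qnorm l n * ((real l + real n) * (real l - real n + 1)) = ladder l (n - 1) * qnorm l (n - 1)"
proof -
  obtain m where m: "n = Suc m"
    using assms by (cases n) auto
  have "ladder l m * qnorm l m = (ladder l m)\<^sup>2 * qnorm l (Suc m)"
    using assms m by (simp add: qnorm_ladder power2_eq_square)
  then show ?thesis
    using assms m by (simp add: ladder_sq algebra_simps)
qed

text \<open>The x-generator turns a harmonic into half a combination of its two neighbours in order.
  With a name for it, \<open>comb_left\<close> and \<open>comb_right\<close> can expand bilinear
  forms as simp rules.\<close>

definition half_comb ::
    "real \<Rightarrow> (real^3 \<Rightarrow> real) \<Rightarrow> real \<Rightarrow> (real^3 \<Rightarrow> real) \<Rightarrow> real^3 \<Rightarrow> real" where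
  "half_comb a f b g x = (a * f x + b * g x) / 2"

lemma continuous_half_comb [simp]:
  "continuous_on A f \<Longrightarrow> continuous_on A g \<Longrightarrow> continuous_on A (half_comb a f b g)"
  unfolding half_comb_def[abs_def] by (intro continuous_intros) auto

lemma infgen_half_comb:
  assumes "infgen R f f'" "infgen R g g'"
  shows "infgen R (half_comb a f b g) (half_comb a f' b g')"
proof -
  have "infgen R (\<lambda>x. (a / 2) * f x + (b / 2) * g x) (\<lambda>x. (a / 2) * f' x + (b / 2) * g' x)"
    by (intro infgen_add infgen_cmult assms)
  then show ?thesis
    by (simp add: half_comb_def[abs_def] add_divide_distrib)
qed

lemma infgen_rotx_uv:
  assumes n: "1 \<le> n" "n \<le> l"
  shows "infgen rotx (harm_u l n)
           (half_comb (ladder l n) (harm_v l (Suc n)) (ladder l (n - 1)) (harm_v l (n - 1)))"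
    and "infgen rotx (harm_v l n)
           (half_comb (- ladder l n) (harm_u l (Suc n)) (- ladder l (n - 1)) (harm_u l (n - 1)))"
proof -
  define f where "f k x = complex_of_real (dlegendre l k (x $ 3)) * Complex (x $ 1) (x $ 2) ^ k"
    for k and x :: "real^3"
  have uf: "harm_u l k x = qnorm l k * Re (f k x)" and vf: "harm_v l k x = qnorm l k * Im (f k x)" for k x
    by (simp_all add: harm_u_def harm_v_def f_def)
  define g where "g x = (- \<i> / 2) * (f (Suc n) x
      + of_real ((real l + real n) * (real l - real n + 1)) * f (n - 1) x)" for x
  have d: "((\<lambda>\<theta>. f n (rotx \<theta> *v x)) has_vector_derivative g (rotx \<theta> *v x)) (at \<theta>)"
    if "x \<in> S2" for x \<theta>
    using infgen_rotx_complex[OF that n(1), of l \<theta>] unfolding f_def g_def .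
  have q1: "qnorm l n * Re (f (Suc n) x) = ladder l n * (qnorm l (Suc n) * Re (f (Suc n) x))"
    "qnorm l n * Im (f (Suc n) x) = ladder l n * (qnorm l (Suc n) * Im (f (Suc n) x))" for x
    using qnorm_dlegendre_Suc[OF n(2), of "x $ 3"] unfolding f_def Re_complex_of_real
    by (simp_all del: funpow.simps power_Suc add: mult.assoc[symmetric])
  have q2: "qnorm l n * (((real l + real n) * (real l - real n + 1)) * r)
      = ladder l (n - 1) * (qnorm l (n - 1) * r)" for r
    using qnorm_ladder_pred[OF n] by (simp add: mult.assoc[symmetric])
  have eq: "half_comb (ladder l n) (harm_v l (Suc n)) (ladder l (n - 1)) (harm_v l (n - 1)) x
      = qnorm l n * Re (g x)"
    "half_comb (- ladder l n) (harm_u l (Suc n)) (- ladder l (n - 1)) (harm_u l (n - 1)) x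
      = qnorm l n * Im (g x)" for x
    unfolding half_comb_def uf vf mult_minus_left q1[symmetric] q2[symmetric] g_def
    by (simp_all add: algebra_simps add_divide_distrib diff_divide_distrib)
  have "((\<lambda>\<theta>. qnorm l n * Re (f n (rotx \<theta> *v x))) has_real_derivative
      qnorm l n * Re (g (rotx \<theta> *v x))) (at \<theta>)"
    "((\<lambda>\<theta>. qnorm l n * Im (f n (rotx \<theta> *v x))) has_real_derivative
      qnorm l n * Im (g (rotx \<theta> *v x))) (at \<theta>)" if "x \<in> S2" for x \<theta>
    using bounded_linear.has_vector_derivative[OF bounded_linear_Re d[OF that]]
      bounded_linear.has_vector_derivative[OF bounded_linear_Im d[OF that]]
    by (auto simp: has_real_derivative_iff_has_vector_derivative[symmetric] intro!: DERIV_cmult)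
  then show "infgen rotx (harm_u l n)
           (half_comb (ladder l n) (harm_v l (Suc n)) (ladder l (n - 1)) (harm_v l (n - 1)))"
    and "infgen rotx (harm_v l n)
           (half_comb (- ladder l n) (harm_u l (Suc n)) (- ladder l (n - 1)) (harm_u l (n - 1)))"
    unfolding infgen_def eq unfolding uf vf by blast+
qed

text \<open>At order 0 the two neighbours have orders 1 and -1, which are conjugate up to sign;
  their halves merge into one full term.\<close>

lemma infgen_rotx_u0: "infgen rotx (harm_u l 0) (\<lambda>x. ladder l 0 * harm_v l 1 x)"
  unfolding infgen_def
proof (intro ballI allI)
  fix x :: "real^3" and \<theta>
  have dz: "((\<lambda>\<theta>. (rotx \<theta> *v x) $ 3) has_real_derivative (rotx \<theta> *v x) $ 2) (at \<theta>)"
    unfolding rotx_apply by (auto intro!: derivative_eq_intros)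
  have "((\<lambda>\<theta>. qnorm l 0 * dlegendre l 0 ((rotx \<theta> *v x) $ 3)) has_real_derivative
      qnorm l 0 * (dlegendre l 1 ((rotx \<theta> *v x) $ 3) * (rotx \<theta> *v x) $ 2)) (at \<theta>)"
    using DERIV_cmult[OF DERIV_chain2[OF poly_DERIV dz]] by simp
  moreover have "qnorm l 0 * dlegendre l 1 z = ladder l 0 * (qnorm l 1 * dlegendre l 1 z)" for z
    using qnorm_dlegendre_Suc[of 0 l z] by simp
  ultimately show "((\<lambda>\<theta>. harm_u l 0 (rotx \<theta> *v x)) has_real_derivative
      ladder l 0 * harm_v l 1 (rotx \<theta> *v x)) (at \<theta>)"
    by (simp only: harm_u_def harm_v_def mult.assoc[symmetric] power_0 power_one_right
        complex.sel one_complex.sel mult_1_right)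
qed

subsection \<open>The addition theorem\<close>

lemma infgen_imp_const:
  assumes "\<And>\<theta>. ((\<lambda>\<theta>. f (R \<theta> *v x) (R \<theta> *v y)) has_real_derivative (0::real)) (at \<theta>)"
    and "R 0 *v x = x" and "R 0 *v y = y"
  shows "f (R \<theta> *v x) (R \<theta> *v y) = f x y"
  using DERIV_isconst_all[of "\<lambda>\<theta>. f (R \<theta> *v x) (R \<theta> *v y)" \<theta> 0] assms by simp

text \<open>The reproducing kernel of the harmonics of degree l.\<close>

definition zonal :: "nat \<Rightarrow> real^3 \<Rightarrow> real^3 \<Rightarrow> real" where
  "zonal l x y = (\<Sum>m = - int l..int l. sph_harm l m x * sph_harm l m y)"

lemma sum_int_symmetric:
  fixes f :: "int \<Rightarrow> 'a::comm_monoid_add"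
  shows "(\<Sum>m = - int l..int l. f m) = f 0 + (\<Sum>n = 1..l. f (int n) + f (- int n))"
proof (induction l)
  case (Suc l)
  have "{- int (Suc l)..int (Suc l)} = insert (int (Suc l)) (insert (- int (Suc l)) {- int l..int l})"
    by auto
  then show ?case
    using Suc by (simp add: add_ac)
qed simp

lemma zonal_uv:
  "zonal l x y = harm_u l 0 x * harm_u l 0 y
     + 2 * (\<Sum>n = 1..l. harm_u l n x * harm_u l n y + harm_v l n x * harm_v l n y)"
proof -
  have sqrt2: "sqrt 2 * (sqrt 2 * a) = 2 * a" for a :: real
    by (simp flip: mult.assoc)
  show ?thesis
    unfolding zonal_def sum_int_symmetric sum_distrib_left
    by (auto simp: sqrt2 sph_harm_0 sph_harm_pos sph_harm_neg algebra_simps intro!: sum.cong)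
qed

lemma zonal_rotz:
  assumes "x \<in> S2" "y \<in> S2"
  shows "zonal l (rotz \<theta> *v x) (rotz \<theta> *v y) = zonal l x y"
proof (rule infgen_imp_const[where R = rotz and f = "zonal l"])
  fix \<theta>
  show "((\<lambda>\<theta>. zonal l (rotz \<theta> *v x) (rotz \<theta> *v y)) has_real_derivative 0) (at \<theta>)"
    unfolding zonal_uv
    by (rule derivative_eq_intros refl
          infgen_rotz_u[unfolded infgen_def, rule_format] infgen_rotz_v[unfolded infgen_def, rule_format]
          assms)+ (simp add: algebra_simps)
qed (simp_all add: rotz_0)

text \<open>The derivative of the sum over orders telescopes: order n contributes half of
  \<open>E n - E (n - 1)\<close>, order 0 contributes \<open>E 0\<close>, and \<open>E l = 0\<close>
  because the ladder ends at \<open>ladder l l = 0\<close>.\<close>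

lemma zonal_rotx:
  assumes "x \<in> S2" "y \<in> S2"
  shows "zonal l (rotx \<theta> *v x) (rotx \<theta> *v y) = zonal l x y"
proof (rule infgen_imp_const[where R = rotx and f = "zonal l"])
  fix \<theta>
  define x' y' where "x' = rotx \<theta> *v x" and "y' = rotx \<theta> *v y"
  define E where "E n = ladder l n * (harm_v l (Suc n) x' * harm_u l n y' + harm_u l n x' * harm_v l (Suc n) y'
      - harm_u l (Suc n) x' * harm_v l n y' - harm_v l n x' * harm_u l (Suc n) y')" for n
  have *: "((\<lambda>\<theta>. harm_u l n (rotx \<theta> *v x) * harm_u l n (rotx \<theta> *v y)
          + harm_v l n (rotx \<theta> *v x) * harm_v l n (rotx \<theta> *v y))
        has_real_derivative (E n - E (n - 1)) / 2) (at \<theta>)" if n: "n \<in> {1..l}" for n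
  proof -
    have n': "1 \<le> n" "n \<le> l" "Suc (n - 1) = n"
      using n by auto
    note du = infgen_rotx_uv(1)[OF n'(1,2), unfolded infgen_def, rule_format]
    note dv = infgen_rotx_uv(2)[OF n'(1,2), unfolded infgen_def, rule_format]
    have "((\<lambda>\<theta>. harm_u l n (rotx \<theta> *v x) * harm_u l n (rotx \<theta> *v y)
          + harm_v l n (rotx \<theta> *v x) * harm_v l n (rotx \<theta> *v y)) has_real_derivative
        half_comb (ladder l n) (harm_v l (Suc n)) (ladder l (n - 1)) (harm_v l (n - 1)) x' * harm_u l n y'
        + half_comb (ladder l n) (harm_v l (Suc n)) (ladder l (n - 1)) (harm_v l (n - 1)) y' * harm_u l n x'
        + (half_comb (- ladder l n) (harm_u l (Suc n)) (- ladder l (n - 1)) (harm_u l (n - 1)) x' * harm_v l n y'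
        + half_comb (- ladder l n) (harm_u l (Suc n)) (- ladder l (n - 1)) (harm_u l (n - 1)) y' * harm_v l n x'))
        (at \<theta>)"
      unfolding x'_def y'_def
      by (intro DERIV_add DERIV_mult du dv assms)
    then show ?thesis
      unfolding E_def n'(3) half_comb_def by (rule back_subst[where P = "\<lambda>d. (_ has_real_derivative d) _"])
        (simp add: field_simps)
  qed
  have "((\<lambda>\<theta>. harm_u l 0 (rotx \<theta> *v x) * harm_u l 0 (rotx \<theta> *v y)) has_real_derivative
      ladder l 0 * harm_v l 1 x' * harm_u l 0 y' + ladder l 0 * harm_v l 1 y' * harm_u l 0 x') (at \<theta>)"
    unfolding x'_def y'_def
    by (intro DERIV_mult infgen_rotx_u0[unfolded infgen_def, rule_format] assms)
  also have "ladder l 0 * harm_v l 1 x' * harm_u l 0 y' + ladder l 0 * harm_v l 1 y' * harm_u l 0 x' = E 0"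
    by (simp add: E_def algebra_simps)
  finally have "((\<lambda>\<theta>. harm_u l 0 (rotx \<theta> *v x) * harm_u l 0 (rotx \<theta> *v y)
     + 2 * (\<Sum>n = 1..l. harm_u l n (rotx \<theta> *v x) * harm_u l n (rotx \<theta> *v y)
          + harm_v l n (rotx \<theta> *v x) * harm_v l n (rotx \<theta> *v y))) has_real_derivative
     E 0 + 2 * (\<Sum>n = 1..l. (E n - E (n - 1)) / 2)) (at \<theta>)"
    by (intro DERIV_add DERIV_cmult DERIV_sum *)
  moreover have "E 0 + 2 * (\<Sum>n = 1..k. (E n - E (n - 1)) / 2) = E k" for k
    by (induction k) (simp_all add: field_simps)
  moreover have "E l = 0"
    by (simp add: E_def)
  ultimately show "((\<lambda>\<theta>. zonal l (rotx \<theta> *v x) (rotx \<theta> *v y)) has_real_derivative 0) (at \<theta>)"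
    unfolding zonal_uv by simp
qed (simp_all add: rotx_0)

lemma rotate_to_pole:
  assumes "y \<in> S2"
  shows "\<exists>s t. rotx t *v (rotz s *v y) = axis 3 1"
proof -
  \<comment> \<open>The angle is counted from the second axis, so that \<open>rotz s\<close>
    annihilates the first coordinate and leaves y in the plane that \<open>rotx\<close>
    turns.\<close>
  obtain r s where s: "y $ 2 = r * cos s" "y $ 1 = r * sin s"
    using polar_Ex by metis
  have "(y $ 1)\<^sup>2 + (y $ 2)\<^sup>2 = r\<^sup>2 * ((sin s)\<^sup>2 + (cos s)\<^sup>2)"
    unfolding s by (simp only: power_mult_distrib distrib_left)
  then have "(y $ 3)\<^sup>2 + r\<^sup>2 = 1"
    using assms unfolding S2_sum_squares by simp
  then obtain t where t: "y $ 3 = cos t" "r = sin t"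
    using sincos_total_2pi by metis
  have "sin s * (r * sin s) + cos s * (r * cos s) = r * (cos s * cos s + sin s * sin s)"
    by (simp only: distrib_left mult_ac add_ac)
  then have rr: "sin s * (r * sin s) + cos s * (r * cos s) = r"
    by (simp only: sin_cos_squared_add3 mult_1_right)
  have "rotx t *v (rotz s *v y) = axis 3 1"
    unfolding vec_eq_iff forall_3 rotx_apply rotz_apply s rr
    using sin_cos_squared_add[of t] by (simp add: t axis_def power2_eq_square)
  then show ?thesis
    by blast
qed

lemma harm_at_pole:
  "harm_u l 0 (axis 3 1) = sqrt (real (2 * l + 1) / (4 * pi))"
  "n \<ge> 1 \<Longrightarrow> harm_u l n (axis 3 1) = 0" "harm_v l n (axis 3 1) = 0"
  by (simp_all add: harm_u_def harm_v_def qnorm_def axis_def poly_legendre_1 Complex_eq zero_power)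

text \<open>Both sides are unchanged when x and y are rotated together. With y at the pole every
  harmonic of nonzero order vanishes there, and the third coordinate of the rotated x is the inner
  product.\<close>

theorem addition_theorem:
  assumes "x \<in> S2" "y \<in> S2"
  shows "zonal l x y = real (2 * l + 1) / (4 * pi) * poly (legendre l) (x \<bullet> y)"
proof -
  obtain s t where st: "rotx t *v (rotz s *v y) = axis 3 1"
    using rotate_to_pole[OF assms(2)] by blast
  define x' where "x' = rotx t *v (rotz s *v x)"
  have S: "rotz s *v x \<in> S2" "rotz s *v y \<in> S2"
    using assms rotation_in_S2 rotation_rotz by blast+
  have "zonal l x y = zonal l x' (axis 3 1)"
    unfolding x'_def st[symmetric] zonal_rotx[OF S] zonal_rotz[OF assms] ..
  also have "\<dots> = qnorm l 0 * poly (legendre l) (x' $ 3) * sqrt (real (2 * l + 1) / (4 * pi))"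
    by (simp add: zonal_uv harm_at_pole) (simp add: harm_u_def)
  also have "\<dots> = (sqrt (real (2 * l + 1) / (4 * pi)))\<^sup>2 * poly (legendre l) (x' $ 3)"
    unfolding power2_eq_square by (simp only: qnorm_def) (simp del: real_sqrt_mult_self)
  also have "\<dots> = real (2 * l + 1) / (4 * pi) * poly (legendre l) (x' $ 3)"
    by (subst real_sqrt_pow2) simp_all
  also have "x' $ 3 = x' \<bullet> axis 3 1"
    by (simp add: inner_axis)
  also have "\<dots> = x \<bullet> y"
    unfolding x'_def st[symmetric] by (simp add: rotation_inner rotation_rotx rotation_rotz)
  finally show ?thesis .
qed


subsection \<open>Rotation invariant bilinear forms\<close>

lemma continuous_harm [continuous_intros, simp]:
  "continuous_on A (harm_u l n)" "continuous_on A (harm_v l n)"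
proof -
  have "continuous_on A (\<lambda>x :: real^3. Complex (x $ 1) (x $ 2) ^ n)"
    unfolding Complex_eq by (intro continuous_intros)
  then show "continuous_on A (harm_u l n)" "continuous_on A (harm_v l n)"
    unfolding harm_u_def[abs_def] harm_v_def[abs_def] by (intro continuous_intros; simp)+
qed

lemma continuous_sph_harm [simp]: "continuous_on A (sph_harm l m)"
proof -
  obtain n where "m = int n \<or> m = - int n"
    using int_cases2 by metis
  then show ?thesis
    by (cases "n = 0") (auto simp: sph_harm_0 sph_harm_pos sph_harm_neg intro!: continuous_intros)
qed

lemma harm_eq_0: "l < n \<Longrightarrow> harm_u l n = (\<lambda>x. 0)" "l < n \<Longrightarrow> harm_v l n = (\<lambda>x. 0)"
  using funpow_pderiv_eq_0[of "legendre l" n] by (auto simp: harm_u_def harm_v_def degree_legendre)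

text \<open>Supplies the second derivatives that the Taylor estimate in \<open>skew\<close> asks
  for.\<close>

lemma infgen_rotx_ex:
  "\<exists>f'. continuous_on UNIV f' \<and> infgen rotx (harm_u l n) f'"
  "\<exists>f'. continuous_on UNIV f' \<and> infgen rotx (harm_v l n) f'"
proof -
  have zero: "infgen rotx (\<lambda>x. 0) (\<lambda>x. 0)"
    by (simp add: infgen_def)
  consider "n = 0" | "l < n" | "1 \<le> n" "n \<le> l"
    by linarith
  then have "(\<exists>f'. continuous_on UNIV f' \<and> infgen rotx (harm_u l n) f')
    \<and> (\<exists>f'. continuous_on UNIV f' \<and> infgen rotx (harm_v l n) f')"
  proof cases
    case 1
    then show ?thesis
      using infgen_rotx_u0[of l] zero continuous_on_mult_left[OF continuous_harm(2), of UNIV "ladder l 0" l 1]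
        continuous_on_const[of UNIV "0 :: real"]
      unfolding 1 harm_v_0[abs_def] by blast
  next
    case 2
    then show ?thesis
      using zero by (auto simp: harm_eq_0 intro!: exI[of _ "\<lambda>x :: real^3. 0 :: real"] continuous_intros)
  next
    case 3
    then show ?thesis
      using infgen_rotx_uv[OF 3] by (blast intro: continuous_half_comb continuous_harm)
  qed
  then show "\<exists>f'. continuous_on UNIV f' \<and> infgen rotx (harm_u l n) f'"
    "\<exists>f'. continuous_on UNIV f' \<and> infgen rotx (harm_v l n) f'"
    by auto
qed

lemma infgen_taylor:
  assumes f: "infgen R f f'" "infgen R f' f''" and x: "x \<in> S2"
    and R: "\<And>\<theta>. rotation_matrix (R \<theta>)" "\<And>x. R 0 *v x = x"
    and C: "\<And>x. x \<in> S2 \<Longrightarrow> \<bar>f'' x\<bar> \<le> C" and \<theta>: "0 < \<theta>"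
  shows "\<bar>f (R \<theta> *v x) - f x - \<theta> * f' x\<bar> \<le> C * \<theta>\<^sup>2"
proof -
  have S: "R s *v x \<in> S2" for s
    using rotation_in_S2[OF R(1) x] .
  have "\<exists>\<xi>. 0 < \<xi> \<and> \<xi> < \<theta> \<and> f (R \<theta> *v x) - f (R 0 *v x) = (\<theta> - 0) * f' (R \<xi> *v x)"
    using \<theta> f(1) x by (intro MVT2) (auto simp: infgen_def)
  then obtain \<xi> where \<xi>: "0 < \<xi>" "\<xi> < \<theta>" "f (R \<theta> *v x) - f x = \<theta> * f' (R \<xi> *v x)"
    by (auto simp: R)
  have "\<exists>\<eta>. 0 < \<eta> \<and> \<eta> < \<xi> \<and> f' (R \<xi> *v x) - f' (R 0 *v x) = (\<xi> - 0) * f'' (R \<eta> *v x)"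
    using \<xi> f(2) x by (intro MVT2) (auto simp: infgen_def)
  then obtain \<eta> where \<eta>: "f' (R \<xi> *v x) - f' x = \<xi> * f'' (R \<eta> *v x)"
    by (auto simp: R)
  have "f (R \<theta> *v x) - f x - \<theta> * f' x = \<theta> * (f' (R \<xi> *v x) - f' x)"
    using \<xi>(3) by (simp add: algebra_simps)
  also have "\<bar>\<dots>\<bar> = \<theta> * (\<xi> * \<bar>f'' (R \<eta> *v x)\<bar>)"
    using \<theta> \<xi> by (simp add: \<eta> abs_mult)
  also have "\<dots> \<le> \<theta> * (\<theta> * C)"
    using \<theta> \<xi> C[OF S] by (intro mult_left_mono mult_mono) auto
  finally show ?thesis
    by (simp add: power2_eq_square mult_ac)
qed

text \<open>Two forms will be instances: the inner product over the sphere, and the covariance of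
  the noise integrated against test functions. The sup-norm bound is the analytic input: it lets
  invariance be differentiated although nothing is known about a kernel of the form.\<close>

locale invariant_form =
  fixes B :: "(real^3 \<Rightarrow> real) \<Rightarrow> (real^3 \<Rightarrow> real) \<Rightarrow> real" and K :: real
  assumes add_left: "\<And>f g h. continuous_on UNIV f \<Longrightarrow> continuous_on UNIV g \<Longrightarrow> continuous_on UNIV h \<Longrightarrow>
      B (\<lambda>x. f x + g x) h = B f h + B g h"
    and scale_left: "\<And>c f g. continuous_on UNIV f \<Longrightarrow> continuous_on UNIV g \<Longrightarrow>
      B (\<lambda>x. c * f x) g = c * B f g"
    and commute: "\<And>f g. continuous_on UNIV f \<Longrightarrow> continuous_on UNIV g \<Longrightarrow> B f g = B g f"
    and bound: "\<And>f g a b. continuous_on UNIV f \<Longrightarrow> continuous_on UNIV g \<Longrightarrow>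
      (\<And>x. x \<in> S2 \<Longrightarrow> \<bar>f x\<bar> \<le> a) \<Longrightarrow> (\<And>x. x \<in> S2 \<Longrightarrow> \<bar>g x\<bar> \<le> b) \<Longrightarrow> \<bar>B f g\<bar> \<le> K * a * b"
    and invariant: "\<And>R f g. rotation_matrix R \<Longrightarrow> continuous_on UNIV f \<Longrightarrow> continuous_on UNIV g \<Longrightarrow>
      B (\<lambda>x. f (R *v x)) (\<lambda>x. g (R *v x)) = B f g"
begin

lemma add_right: "continuous_on UNIV f \<Longrightarrow> continuous_on UNIV g \<Longrightarrow> continuous_on UNIV h \<Longrightarrow>
    B h (\<lambda>x. f x + g x) = B h f + B h g"
  using add_left[of f g h] commute[of h "\<lambda>x. f x + g x"] commute[of h f] commute[of h g]
  by (simp add: continuous_on_add)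

lemma scale_right: "continuous_on UNIV f \<Longrightarrow> continuous_on UNIV g \<Longrightarrow> B f (\<lambda>x. c * g x) = c * B f g"
  using scale_left[of g f c] commute[of f "\<lambda>x. c * g x"] commute[of f g]
  by (simp add: continuous_on_mult_left)

lemma zero_left: "continuous_on UNIV g \<Longrightarrow> B (\<lambda>x. 0) g = 0"
  using scale_left[of "\<lambda>x. 0" g 0] by simp

lemma zero_right: "continuous_on UNIV g \<Longrightarrow> B g (\<lambda>x. 0) = 0"
  using scale_right[of g "\<lambda>x. 0" 0] by simp

lemma comb_left [simp]:
  assumes "continuous_on UNIV f" "continuous_on UNIV g" "continuous_on UNIV h"
  shows "B (half_comb a f b g) h = (a * B f h + b * B g h) / 2"
proof -
  have "half_comb a f b g = (\<lambda>x. (a / 2) * f x + (b / 2) * g x)"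
    by (simp add: fun_eq_iff half_comb_def field_simps)
  then show ?thesis
    using assms add_left[of "\<lambda>x. (a / 2) * f x" "\<lambda>x. (b / 2) * g x" h]
      scale_left[of f h "a / 2"] scale_left[of g h "b / 2"]
    by (simp add: continuous_on_mult_left add_divide_distrib del: times_divide_eq_left)
qed

lemma comb_right [simp]:
  assumes "continuous_on UNIV f" "continuous_on UNIV g" "continuous_on UNIV h"
  shows "B h (half_comb a f b g) = (a * B h f + b * B h g) / 2"
  using comb_left[OF assms] commute[OF assms(3)] assms by simp

text \<open>The derivative at 0 of the constant B (f o R) (g o R), computed by Taylor expansion of
  the arguments: the remainders are quadratic in the angle, so dividing by it and letting it tend to
  0 leaves the first-order term.\<close>

lemma skew:
  assumes f: "infgen R f f'" "infgen R f' f''" and g: "infgen R g g'" "infgen R g' g''"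
    and R: "\<And>\<theta>. rotation_matrix (R \<theta>)" "\<And>x. R 0 *v x = x"
    and cf: "continuous_on UNIV f" "continuous_on UNIV f'" "continuous_on UNIV f''"
    and cg: "continuous_on UNIV g" "continuous_on UNIV g'" "continuous_on UNIV g''"
  shows "B f' g + B f g' = 0"
proof -
  have "\<exists>C. \<forall>x\<in>S2. \<bar>h x\<bar> \<le> C" if "continuous_on UNIV h" for h :: "real^3 \<Rightarrow> real"
  proof -
    have "compact (h ` S2)"
      using that by (intro compact_continuous_image compact_sphere) (rule continuous_on_subset, auto)
    then show ?thesis
      using compact_imp_bounded bounded_iff[of "h ` S2"] by fastforce
  qed
  then have "\<exists>C. \<forall>h\<in>{f, f', f'', g, g', g''}. \<forall>x\<in>S2. \<bar>h x\<bar> \<le> C h"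
    using cf cg by (intro bchoice) auto
  then obtain C0 where C0: "\<And>h x. h \<in> {f, f', f'', g, g', g''} \<Longrightarrow> x \<in> S2 \<Longrightarrow> \<bar>h x\<bar> \<le> C0 h"
    by blast
  define C where "C = Max (C0 ` {f, f', f'', g, g', g''})"
  have C: "\<bar>h x\<bar> \<le> C" if "h \<in> {f, f', f'', g, g', g''}" "x \<in> S2" for h x
    using C0[OF that] that(1) Max_ge[of "C0 ` {f, f', f'', g, g', g''}" "C0 h"] unfolding C_def
    by (meson finite.emptyI finite_imageI finite_insert imageI order_trans)
  have ne: "axis 3 1 \<in> (S2 :: (real^3) set)"
    by simp
  have C_nonneg: "0 \<le> C"
    using C[of f "axis 3 1"] ne by (meson abs_ge_zero insertI1 order_trans)
  have K_nonneg: "0 \<le> K"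
    using bound[of "\<lambda>x. 1" "\<lambda>x. 1" 1 1] by simp
  \<comment> \<open>Four terms of second order remain, each at most K C^2 times the squared angle;
    for the one of third order this uses that the angle is at most 1.\<close>
  have main: "\<bar>B f' g + B f g'\<bar> \<le> (4 * K * C * C) * \<theta>" if \<theta>: "0 < \<theta>" "\<theta> \<le> 1" for \<theta>
  proof -
    define F G where "F x = f (R \<theta> *v x)" and "G x = g (R \<theta> *v x)" for x
    have cR: "continuous_on UNIV (\<lambda>x. h (R \<theta> *v x))" if "continuous_on UNIV h" for h :: "real^3 \<Rightarrow> real"
      using that by (rule continuous_on_compose2[where g = h]) (auto intro: matrix_vector_mult_linear_continuous_on)
    have cF: "continuous_on UNIV F" "continuous_on UNIV G"
      unfolding F_def[abs_def] G_def[abs_def] using cf cg by (auto intro: cR)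
    define e d where "e x = F x - f x - \<theta> * f' x" and "d x = G x - g x - \<theta> * g' x" for x
    have ce: "continuous_on UNIV e" "continuous_on UNIV d"
      unfolding e_def[abs_def] d_def[abs_def] using cf cg cF by (auto intro!: continuous_intros)
    have be: "\<bar>e x\<bar> \<le> C * \<theta>\<^sup>2" "\<bar>d x\<bar> \<le> C * \<theta>\<^sup>2" if "x \<in> S2" for x
      unfolding e_def d_def F_def G_def
      by (auto intro!: infgen_taylor[OF f that R _ \<theta>(1)] infgen_taylor[OF g that R _ \<theta>(1)] C simp del: mem_sphere_0)
    have bG: "\<bar>G x\<bar> \<le> C" "\<bar>f x\<bar> \<le> C" "\<bar>f' x\<bar> \<le> C" "\<bar>g' x\<bar> \<le> C" if "x \<in> S2" for x
      unfolding G_def using rotation_in_S2[OF R(1) that] that by (auto intro!: C simp del: mem_sphere_0)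
    have Fe: "F = (\<lambda>x. (f x + \<theta> * f' x) + e x)" and Ge: "G = (\<lambda>x. (g x + \<theta> * g' x) + d x)"
      by (simp_all add: e_def d_def fun_eq_iff)
    have "B f g = B F G"
      unfolding F_def[abs_def] G_def[abs_def] using invariant[OF R(1) cf(1) cg(1)] by simp
    also have "\<dots> = B f G + \<theta> * B f' G + B e G"
      unfolding Fe using cf ce cF
      by (simp add: add_left scale_left continuous_on_add continuous_on_mult_left)
    also have "B f G = B f g + \<theta> * B f g' + B f d"
      unfolding Ge using cf cg ce cF
      by (simp add: add_right scale_right continuous_on_add continuous_on_mult_left)
    also have "B f' G = B f' g + \<theta> * B f' g' + B f' d"
      unfolding Ge using cf cg ce cF
      by (simp add: add_right scale_right continuous_on_add continuous_on_mult_left)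
    finally have "\<theta> * (B f' g + B f g') = - (B f d + \<theta> * (\<theta> * B f' g' + B f' d) + B e G)"
      by (simp add: algebra_simps)
    then have "\<bar>\<theta> * (B f' g + B f g')\<bar> \<le> \<bar>B f d\<bar> + \<theta> * (\<theta> * \<bar>B f' g'\<bar> + \<bar>B f' d\<bar>) + \<bar>B e G\<bar>"
    proof -
      have "\<bar>\<theta> * (\<theta> * B f' g' + B f' d)\<bar> \<le> \<theta> * (\<theta> * \<bar>B f' g'\<bar> + \<bar>B f' d\<bar>)"
        using \<theta> abs_triangle_ineq[of "\<theta> * B f' g'" "B f' d"] by (simp add: abs_mult)
      then show ?thesis
        using \<open>\<theta> * (B f' g + B f g') = _\<close> by linarith
    qed
    also have "\<bar>B f d\<bar> \<le> K * C * (C * \<theta>\<^sup>2)"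
      by (intro bound cf ce be bG)
    also have "\<bar>B e G\<bar> \<le> K * (C * \<theta>\<^sup>2) * C"
      by (intro bound cF ce be bG)
    also have "\<theta> * (\<theta> * \<bar>B f' g'\<bar> + \<bar>B f' d\<bar>) \<le> \<theta> * (\<theta> * (K * C * C) + \<theta> * (K * C * C))"
    proof (intro mult_left_mono add_mono)
      show "\<bar>B f' g'\<bar> \<le> K * C * C"
        by (intro bound cf cg be bG)
      have "\<bar>B f' d\<bar> \<le> K * C * (C * \<theta>\<^sup>2)"
        by (intro bound cf ce be bG)
      also have "\<dots> = \<theta>\<^sup>2 * (K * C * C)"
        by simp
      also have "\<dots> \<le> \<theta> * (K * C * C)"
        using \<theta> K_nonneg C_nonneg by (intro mult_right_mono) (auto simp: power2_eq_square mult_left_le)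
      finally show "\<bar>B f' d\<bar> \<le> \<theta> * (K * C * C)" .
    qed (use \<theta> in auto)
    finally have "\<bar>\<theta> * (B f' g + B f g')\<bar> \<le> \<theta> * ((4 * K * C * C) * \<theta>)"
      by (simp add: power2_eq_square algebra_simps)
    moreover have "\<bar>\<theta> * (B f' g + B f g')\<bar> = \<theta> * \<bar>B f' g + B f g'\<bar>"
      using \<theta> by (simp only: abs_mult abs_of_pos)
    ultimately show ?thesis
      using \<theta> by (simp only: mult_le_cancel_left_pos)
  qed
  have "(\<lambda>n. (4 * K * C * C) * (1 / real (Suc n))) \<longlonglongrightarrow> (4 * K * C * C) * 0"
    by (intro tendsto_mult_left LIMSEQ_Suc lim_1_over_n)
  moreover have "\<bar>B f' g + B f g'\<bar> \<le> (4 * K * C * C) * (1 / real (Suc n))" for n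
    by (rule main) simp_all
  ultimately have "\<bar>B f' g + B f g'\<bar> \<le> (4 * K * C * C) * 0"
    by (meson LIMSEQ_le_const)
  then show ?thesis
    by simp
qed

lemma skew_z:
  "- (real n * B (harm_v l n) (harm_u l' n')) - real n' * B (harm_u l n) (harm_v l' n') = 0"
  "- (real n * B (harm_v l n) (harm_v l' n')) + real n' * B (harm_u l n) (harm_u l' n') = 0"
  "real n * B (harm_u l n) (harm_u l' n') - real n' * B (harm_v l n) (harm_v l' n') = 0"
  "real n * B (harm_u l n) (harm_v l' n') + real n' * B (harm_v l n) (harm_u l' n') = 0"
proof -
  have u2: "infgen rotz (\<lambda>x. - real k * harm_v j k x) (\<lambda>x. - real k * (real k * harm_u j k x))"
    and v2: "infgen rotz (\<lambda>x. real k * harm_u j k x) (\<lambda>x. real k * (- real k * harm_v j k x))" for j k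
    by (intro infgen_cmult infgen_rotz_u infgen_rotz_v)+
  note uu = skew[OF infgen_rotz_u u2 infgen_rotz_u u2 rotation_rotz rotz_0, of l n l' n']
    and uv = skew[OF infgen_rotz_u u2 infgen_rotz_v v2 rotation_rotz rotz_0, of l n l' n']
    and vu = skew[OF infgen_rotz_v v2 infgen_rotz_u u2 rotation_rotz rotz_0, of l n l' n']
    and vv = skew[OF infgen_rotz_v v2 infgen_rotz_v v2 rotation_rotz rotz_0, of l n l' n']
  show "- (real n * B (harm_v l n) (harm_u l' n')) - real n' * B (harm_u l n) (harm_v l' n') = 0"
    using uu scale_left[of "harm_v l n" "harm_u l' n'" "- real n"]
      scale_right[of "harm_u l n" "harm_v l' n'" "- real n'"]
    by (simp add: continuous_intros)
  show "- (real n * B (harm_v l n) (harm_v l' n')) + real n' * B (harm_u l n) (harm_u l' n') = 0"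
    using uv scale_left[of "harm_v l n" "harm_v l' n'" "- real n"]
      scale_right[of "harm_u l n" "harm_u l' n'" "real n'"]
    by (simp add: continuous_intros)
  show "real n * B (harm_u l n) (harm_u l' n') - real n' * B (harm_v l n) (harm_v l' n') = 0"
    using vu scale_left[of "harm_u l n" "harm_u l' n'" "real n"]
      scale_right[of "harm_v l n" "harm_v l' n'" "- real n'"]
    by (simp add: continuous_intros)
  show "real n * B (harm_u l n) (harm_v l' n') + real n' * B (harm_v l n) (harm_u l' n') = 0"
    using vv scale_left[of "harm_u l n" "harm_v l' n'" "real n"]
      scale_right[of "harm_v l n" "harm_u l' n'" "real n'"]
    by (simp add: continuous_intros)
qed

text \<open>The relations from z-rotations pair the unknowns up. Inserting one relation into the
  other multiplies each unknown by n^2 on one side and by n'^2 on the other.\<close>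

lemma orthogonal_order:
  assumes "n \<noteq> n'"
  shows "B (harm_u l n) (harm_u l' n') = 0" "B (harm_v l n) (harm_v l' n') = 0"
    "B (harm_u l n) (harm_v l' n') = 0" "B (harm_v l n) (harm_u l' n') = 0"
proof -
  have ne: "real n * real n \<noteq> real n' * real n'"
    using assms by (metis of_nat_eq_iff of_nat_0_le_iff abs_of_nonneg power2_eq_iff power2_eq_square
        real_sqrt_abs2)
  \<comment> \<open>The sign s separates the two pairs of unknowns: (uu, vv) with s = 1 and (uv, vu)
    with s = -1.\<close>
  have *: "a = 0 \<and> b = 0" if "real n * a = s * (real n' * b)" "real n * b = s * (real n' * a)" "s * s = 1"
    for a b s :: real
  proof -
    have "real n * (real n * a) = (s * s) * (real n' * real n' * a)"
      "real n * (real n * b) = (s * s) * (real n' * real n' * b)"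
      unfolding that(1,2) mult.left_commute[of "real n" s] mult.left_commute[of "real n" "real n'"]
      unfolding that(1,2) by simp_all
    then have "(real n * real n - real n' * real n') * a = 0"
      "(real n * real n - real n' * real n') * b = 0"
      unfolding that(3) by (simp_all add: algebra_simps)
    then show ?thesis
      using ne by simp
  qed
  show "B (harm_u l n) (harm_u l' n') = 0" "B (harm_v l n) (harm_v l' n') = 0"
    using *[of "B (harm_u l n) (harm_u l' n')" 1 "B (harm_v l n) (harm_v l' n')"]
      skew_z(2)[of n l l' n'] skew_z(3)[of n l l' n'] by simp_all
  show "B (harm_u l n) (harm_v l' n') = 0" "B (harm_v l n) (harm_u l' n') = 0"
    using *[of "B (harm_u l n) (harm_v l' n')" "-1" "B (harm_v l n) (harm_u l' n')"]
      skew_z(1)[of n l l' n'] skew_z(4)[of n l l' n'] by simp_all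
qed

lemma same_order:
  assumes "n \<ge> 1"
  shows "B (harm_v l n) (harm_v l' n) = B (harm_u l n) (harm_u l' n)"
    and "B (harm_v l n) (harm_u l' n) = - B (harm_u l n) (harm_v l' n)"
  using skew_z(3)[of n l l' n] skew_z(4)[of n l l' n] assms
  by (simp_all add: right_diff_distrib[symmetric] distrib_left[symmetric] add_eq_0_iff)

lemma skew_x:
  assumes f: "infgen rotx f f'" and g: "infgen rotx g g'"
    and "continuous_on UNIV f" "continuous_on UNIV f'" "continuous_on UNIV g" "continuous_on UNIV g'"
    and "\<exists>f''. continuous_on UNIV f'' \<and> infgen rotx f' f''"
    and "\<exists>g''. continuous_on UNIV g'' \<and> infgen rotx g' g''"
  shows "B f' g + B f g' = 0"
  using assms skew[OF f _ g _ rotation_rotx rotx_0] by blast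

end

lemma infgen_rotx_ex_comb:
  assumes "\<exists>f'. continuous_on UNIV f' \<and> infgen rotx f f'" "\<exists>g'. continuous_on UNIV g' \<and> infgen rotx g g'"
  shows "\<exists>h'. continuous_on UNIV h' \<and> infgen rotx (half_comb a f b g) h'"
  using assms infgen_half_comb continuous_half_comb by meson

context invariant_form
begin

text \<open>\<open>skew\<close> for the x-rotation, applied to harmonics of orders n and n + 1 or of
  equal type and neighbouring order: of the four products that appear, two have different orders and
  vanish by \<open>orthogonal_order\<close>.\<close>

lemma ladder_relations:
  assumes n: "1 \<le> n"
  shows "n \<le> l \<Longrightarrow> Suc n \<le> l' \<Longrightarrow>
      ladder l n * B (harm_v l (Suc n)) (harm_v l' (Suc n)) = ladder l' n * B (harm_u l n) (harm_u l' n)"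
    and "Suc n \<le> l \<Longrightarrow> n \<le> l' \<Longrightarrow>
      ladder l n * B (harm_u l n) (harm_u l' n) = ladder l' n * B (harm_v l (Suc n)) (harm_v l' (Suc n))"
    and "n \<le> l \<Longrightarrow> Suc n \<le> l' \<Longrightarrow>
      ladder l n * B (harm_v l (Suc n)) (harm_u l' (Suc n)) = - ladder l' n * B (harm_u l n) (harm_v l' n)"
    and "Suc n \<le> l \<Longrightarrow> n \<le> l' \<Longrightarrow>
      ladder l n * B (harm_v l n) (harm_u l' n) = - ladder l' n * B (harm_u l (Suc n)) (harm_v l' (Suc n))"
proof -
  note ex = infgen_rotx_ex infgen_rotx_ex_comb
  note rule = skew_x[OF infgen_rotx_uv(1) infgen_rotx_uv(2)] skew_x[OF infgen_rotx_uv(2) infgen_rotx_uv(1)]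
    skew_x[OF infgen_rotx_uv(1) infgen_rotx_uv(1)]
  have Suc1: "Suc 0 \<le> Suc n"
    by simp
  have nn: "n - 1 \<noteq> Suc n" "n \<noteq> Suc (Suc n)" "Suc n \<noteq> n - 1"
    using n by auto
  {
    assume l: "n \<le> l" "Suc n \<le> l'"
    show "ladder l n * B (harm_v l (Suc n)) (harm_v l' (Suc n)) = ladder l' n * B (harm_u l n) (harm_u l' n)"
      using rule(1)[OF n l(1) _ l(2)] nn
      by (simp add: ex continuous_intros orthogonal_order Suc1)
    show "ladder l n * B (harm_v l (Suc n)) (harm_u l' (Suc n)) = - ladder l' n * B (harm_u l n) (harm_v l' n)"
      using rule(3)[OF n l(1) _ l(2)] nn
      by (simp add: ex continuous_intros orthogonal_order Suc1)
  next
    assume l: "Suc n \<le> l" "n \<le> l'"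
    show "ladder l n * B (harm_u l n) (harm_u l' n) = ladder l' n * B (harm_v l (Suc n)) (harm_v l' (Suc n))"
      using rule(2)[OF _ l(1) n l(2)] nn
      by (simp add: ex continuous_intros orthogonal_order Suc1)
    show "ladder l n * B (harm_v l n) (harm_u l' n) = - ladder l' n * B (harm_u l (Suc n)) (harm_v l' (Suc n))"
      using rule(3)[OF _ l(1) n l(2)] nn
      by (simp add: ex continuous_intros orthogonal_order Suc1)
  }
qed

text \<open>The factor 2 arises because the generator at order 0 yields a full term and at order 1
  half terms.\<close>

lemma ladder_relations_0:
  shows "1 \<le> l' \<Longrightarrow> 2 * ladder l 0 * B (harm_v l 1) (harm_v l' 1) = ladder l' 0 * B (harm_u l 0) (harm_u l' 0)"
    and "1 \<le> l \<Longrightarrow> ladder l 0 * B (harm_u l 0) (harm_u l' 0) = 2 * ladder l' 0 * B (harm_v l 1) (harm_v l' 1)"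
proof -
  note ex = infgen_rotx_ex infgen_rotx_ex_comb
  have ex0: "\<exists>f''. continuous_on UNIV f'' \<and> infgen rotx (\<lambda>x. ladder l 0 * harm_v l (Suc 0) x) f''" for l
    using infgen_rotx_ex(2)[of l "Suc 0"] infgen_cmult continuous_on_mult_left by blast
  {
    assume l: "1 \<le> l'"
    show "2 * ladder l 0 * B (harm_v l 1) (harm_v l' 1) = ladder l' 0 * B (harm_u l 0) (harm_u l' 0)"
      using skew_x[OF infgen_rotx_u0 infgen_rotx_uv(2)[OF _ l], of l]
      by (simp add: ex ex0 continuous_intros scale_left orthogonal_order)
  next
    assume l: "1 \<le> l"
    show "ladder l 0 * B (harm_u l 0) (harm_u l' 0) = 2 * ladder l' 0 * B (harm_v l 1) (harm_v l' 1)"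
      using skew_x[OF infgen_rotx_uv(2)[OF _ l] infgen_rotx_u0, of l']
      by (simp add: ex ex0 continuous_intros scale_right orthogonal_order)
  }
qed

lemma ladder_pos: "n < l \<Longrightarrow> 0 < ladder l n"
  by (simp add: ladder_def)

lemma ladder_less: "l < l' \<Longrightarrow> n \<le> l \<Longrightarrow> ladder l n < ladder l' n"
  unfolding ladder_def by (intro real_sqrt_less_mono mult_strict_mono') auto

text \<open>Combining both relations multiplies a by the difference of the squared ladder
  coefficients, which is l' (l' + 1) - l (l + 1): the Casimir eigenvalues separate the
  degrees.\<close>

lemma ladder_elim:
  assumes "ladder l n * b = ladder l' n * a" "ladder l n * a = ladder l' n * b" "l < l'" "n \<le> l"
  shows "a = 0"
proof -
  have p: "0 \<le> ladder l n" "ladder l n < ladder l' n"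
    using ladder_less[of l l' n] assms by (simp_all add: ladder_def)
  have "ladder l n * (ladder l n * a) = ladder l n * (ladder l' n * b)"
    by (simp only: assms(2))
  also have "\<dots> = ladder l' n * (ladder l n * b)"
    by (rule mult.left_commute)
  also have "\<dots> = ladder l' n * (ladder l' n * a)"
    by (simp only: assms(1))
  finally have "((ladder l' n)\<^sup>2 - (ladder l n)\<^sup>2) * a = 0"
    unfolding power2_eq_square left_diff_distrib mult.assoc by linarith
  moreover have "(ladder l n)\<^sup>2 < (ladder l' n)\<^sup>2"
    using p by (intro power_strict_mono) auto
  ultimately show ?thesis
    by (metis diff_gt_0_iff_gt less_irrefl mult_eq_0_iff)
qed

lemma orthogonal_degree_less:
  assumes l: "l < l'" and n: "n \<le> l"
  shows "B (harm_u l n) (harm_u l' n) = 0" and "B (harm_u l n) (harm_v l' n) = 0"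
proof -
  have Z: "B (\<lambda>x. 0) (harm_v l' k) = 0" "B (\<lambda>x. 0) (harm_u l' k) = 0" for k
    by (simp_all add: zero_left)
  have "B (harm_u l n) (harm_u l' n) = 0 \<and> B (harm_u l n) (harm_v l' n) = 0"
  proof (cases "n = 0")
    case True
    have "B (harm_u l 0) (harm_u l' 0) = 0"
    proof (cases "l = 0")
      case True
      then show ?thesis
        using ladder_relations_0(1)[of l' l] ladder_pos[of 0 l'] l Z by (simp add: harm_eq_0)
    next
      case False
      have "ladder l 0 * (2 * B (harm_v l 1) (harm_v l' 1)) = ladder l' 0 * B (harm_u l 0) (harm_u l' 0)"
        using ladder_relations_0(1)[of l' l] l by (simp only: mult_ac)
      moreover have "ladder l 0 * B (harm_u l 0) (harm_u l' 0) = ladder l' 0 * (2 * B (harm_v l 1) (harm_v l' 1))"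
        using ladder_relations_0(2)[of l l'] False by (simp only: mult_ac)
      ultimately show ?thesis
        by (rule ladder_elim[OF _ _ l]) simp
    qed
    then show ?thesis
      using True zero_right[of "harm_u l 0"] by (simp add: harm_v_0[abs_def])
  next
    case False
    then have n1: "1 \<le> n" "1 \<le> Suc n"
      by auto
    show ?thesis
    \<comment> \<open>At the top order the raised harmonic of degree l is 0, so a single ladder
      relation already gives the claim.\<close>
    proof (cases "n = l")
      case True
      then show ?thesis
        using ladder_relations(1,3)[OF n1(1), of l l'] ladder_pos[of n l'] l Z by (simp add: harm_eq_0)
    next
      case False
      then have nl: "n \<le> l" "Suc n \<le> l" "n \<le> l'" "Suc n \<le> l'"
        using n l by auto
      have "B (harm_u l n) (harm_u l' n) = 0"
        by (rule ladder_elim[OF ladder_relations(1)[OF n1(1) nl(1,4)] ladder_relations(2)[OF n1(1) nl(2,3)] l n])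
      moreover have "ladder l n * B (harm_u l (Suc n)) (harm_v l' (Suc n)) = ladder l' n * B (harm_u l n) (harm_v l' n)"
        using ladder_relations(3)[OF n1(1) nl(1,4)] unfolding same_order(2)[OF n1(2)]
        by (simp only: mult_minus_left mult_minus_right neg_equal_iff_equal)
      moreover have "ladder l n * B (harm_u l n) (harm_v l' n) = ladder l' n * B (harm_u l (Suc n)) (harm_v l' (Suc n))"
        using ladder_relations(4)[OF n1(1) nl(2,3)] unfolding same_order(2)[OF n1(1)]
        by (simp only: mult_minus_left mult_minus_right neg_equal_iff_equal)
      ultimately show ?thesis
        using ladder_elim[OF _ _ l n] by blast
    qed
  qed
  then show "B (harm_u l n) (harm_u l' n) = 0" and "B (harm_u l n) (harm_v l' n) = 0"
    by auto
qed

text \<open>On the diagonal the ladder relations make all values of orders 1 to l equal; the step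
  from order 0 to order 1 halves the value.\<close>

lemma harm_values:
  shows "B (harm_u l n) (harm_u l' n') = (if l = l' \<and> n = n' \<and> n \<le> l
           then B (harm_u l 0) (harm_u l 0) / (if n = 0 then 1 else 2) else 0)"
    and "B (harm_u l n) (harm_v l' n') = 0"
    and "B (harm_v l n) (harm_v l' n') = (if l = l' \<and> n = n' \<and> n \<le> l \<and> n \<noteq> 0
           then B (harm_u l 0) (harm_u l 0) / 2 else 0)"
proof -
  have less: "B (harm_u j k) (harm_u j' k) = 0 \<and> B (harm_u j k) (harm_v j' k) = 0" if "j < j'" for j j' k
  proof (cases "k \<le> j")
    case True
    then show ?thesis
      using orthogonal_degree_less[OF that] by simp
  next
    case False
    then show ?thesis
      using zero_left by (simp add: harm_eq_0)
  qed
  have uv0: "B (harm_u j k) (harm_v j' k) = 0" for j j' k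
  proof (cases "k = 0")
    case True
    then show ?thesis
      using zero_right[of "harm_u j k"] by (simp add: harm_v_0[abs_def])
  next
    case False
    then have s: "B (harm_v a k) (harm_u b k) = - B (harm_u a k) (harm_v b k)" for a b
      by (intro same_order) simp
    consider "j < j'" | "j' < j" | "j = j'"
      by linarith
    then show ?thesis
    proof cases
      case 2
      then show ?thesis
        using less[of j' j k] s[of j' j] commute[of "harm_u j k" "harm_v j' k"] by simp
    next
      \<comment> \<open>For equal degrees the mixed value is antisymmetric by
        \<open>same_order\<close> and symmetric by \<open>commute\<close>, hence 0.\<close>
      case 3
      then show ?thesis
        unfolding 3[symmetric]
        using s[of j j] commute[OF continuous_harm(1)[of UNIV j k] continuous_harm(2)[of UNIV j k]]
        by linarith
    qed (use less in auto)
  qed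
  then show "B (harm_u l n) (harm_v l' n') = 0"
    using orthogonal_order(3)[of n n'] by (cases "n = n'") auto
  have diag: "B (harm_u l k) (harm_u l k) = B (harm_u l 0) (harm_u l 0) / 2" if "1 \<le> k" "k \<le> l" for k
    using that
  proof (induction k rule: nat_induct_at_least)
    case base
    then show ?case
      using ladder_relations_0(1)[of l l] ladder_pos[of 0 l] same_order(1)[of 1 l l] by simp
  next
    case (Suc k)
    then show ?case
      using ladder_relations(1)[of k l l] ladder_pos[of k l] same_order(1)[of "Suc k" l l] by simp
  qed
  have u: "B (harm_u l n) (harm_u l' n') = (if l = l' \<and> n = n' \<and> n \<le> l
           then B (harm_u l 0) (harm_u l 0) / (if n = 0 then 1 else 2) else 0)" for n n'
  proof -
    consider "n \<noteq> n'" | "n = n'" "l < l'" | "n = n'" "l' < l" | "n = n'" "l = l'"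
      by linarith
    then show ?thesis
    proof cases
      case 1
      then show ?thesis by (simp add: orthogonal_order)
    next
      case 2
      then show ?thesis using less by simp
    next
      case 3
      then show ?thesis using less commute[of "harm_u l n" "harm_u l' n"] by simp
    next
      case 4
      then show ?thesis
        using diag[of n] zero_left[of "harm_u l n"] by (cases "n \<le> l") (auto simp: harm_eq_0)
    qed
  qed
  show "B (harm_u l n) (harm_u l' n') = (if l = l' \<and> n = n' \<and> n \<le> l
           then B (harm_u l 0) (harm_u l 0) / (if n = 0 then 1 else 2) else 0)"
    by (rule u)
  show "B (harm_v l n) (harm_v l' n') = (if l = l' \<and> n = n' \<and> n \<le> l \<and> n \<noteq> 0
           then B (harm_u l 0) (harm_u l 0) / 2 else 0)"
  proof (cases "n = n' \<and> n \<noteq> 0")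
    case True
    then show ?thesis
      using u[of n n] same_order(1)[of n l l'] by simp
  next
    case False
    then show ?thesis
      using orthogonal_order(2)[of n n' l l'] zero_right[of "harm_v l n"] by (auto simp: harm_v_0[abs_def])
  qed
qed

text \<open>The factors sqrt 2 in \<open>sph_harm\<close> compensate the halving in
  \<open>harm_values\<close>, so that all orders of one degree get the same value.\<close>

theorem sph_harm_values:
  assumes m: "m \<in> {- int l..int l}" and m': "m' \<in> {- int l'..int l'}"
  shows "B (sph_harm l m) (sph_harm l' m') = (if l = l' \<and> m = m' then B (sph_harm l 0) (sph_harm l 0) else 0)"
proof -
  have rep: "\<exists>n. n \<le> j \<and> (k = 0 \<and> n = 0 \<and> sph_harm j k = harm_u j 0
      \<or> n \<noteq> 0 \<and> k = int n \<and> sph_harm j k = (\<lambda>x. sqrt 2 * harm_u j n x)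
      \<or> n \<noteq> 0 \<and> k = - int n \<and> sph_harm j k = (\<lambda>x. sqrt 2 * harm_v j n x))" if k: "k \<in> {- int j..int j}" for j k
  proof -
    consider "k = 0" | n where "k = int n" "n \<noteq> 0" | n where "k = - int n" "n \<noteq> 0"
      using int_cases2[of k] by (metis of_nat_0 minus_zero)
    then show ?thesis
    proof cases
      case 1
      then show ?thesis by (intro exI[of _ 0]) (simp add: sph_harm_0)
    next
      case (2 n)
      then show ?thesis using k by (intro exI[of _ n]) (simp add: sph_harm_pos)
    next
      case (3 n)
      then show ?thesis using k by (intro exI[of _ n]) (simp add: sph_harm_neg)
    qed
  qed
  have uv: "B (harm_v a b) (harm_u c d) = 0" for a b c d
    using harm_values(2)[of c d a b] commute[of "harm_v a b" "harm_u c d"] by simp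
  have sc: "B (\<lambda>x. s * f x) (\<lambda>x. t * g x) = s * (t * B f g)"
    if "continuous_on UNIV f" "continuous_on UNIV g" for s t f g
    using that by (subst scale_left) (auto simp: scale_right intro!: continuous_intros)
  obtain n where n: "n \<le> l" "m = 0 \<and> n = 0 \<and> sph_harm l m = harm_u l 0
      \<or> n \<noteq> 0 \<and> m = int n \<and> sph_harm l m = (\<lambda>x. sqrt 2 * harm_u l n x)
      \<or> n \<noteq> 0 \<and> m = - int n \<and> sph_harm l m = (\<lambda>x. sqrt 2 * harm_v l n x)"
    using rep[OF m] by blast
  obtain n' where n': "n' \<le> l'" "m' = 0 \<and> n' = 0 \<and> sph_harm l' m' = harm_u l' 0
      \<or> n' \<noteq> 0 \<and> m' = int n' \<and> sph_harm l' m' = (\<lambda>x. sqrt 2 * harm_u l' n' x)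
      \<or> n' \<noteq> 0 \<and> m' = - int n' \<and> sph_harm l' m' = (\<lambda>x. sqrt 2 * harm_v l' n' x)"
    using rep[OF m'] by blast
  define pw where "pw j = B (harm_u j 0) (harm_u j 0)" for j
  note hv = harm_values[folded pw_def]
  show ?thesis
    using n n' by (elim disjE conjE; simp add: sc scale_left scale_right hv uv sph_harm_0)
qed

end


subsection \<open>The surface measure\<close>

lemma space_surface [simp]: "space surface = S2"
  by (simp add: surface_def space_scale_measure space_restrict_space)

lemma sets_surface [measurable_cong]: "sets surface = sets (restrict_space borel S2)"
  by (simp add: surface_def)

abbreviation cone :: "(real^3) set \<Rightarrow> (real^3) set" where
  "cone A \<equiv> {v \<in> ball 0 1 - {0}. v /\<^sub>R norm v \<in> A}"

lemma normalize_measurable: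
  "(\<lambda>v. v /\<^sub>R norm v) \<in> restrict_space lborel (ball 0 1 - {0}) \<rightarrow>\<^sub>M restrict_space borel S2"
proof (rule measurable_restrict_space2)
  show "(\<lambda>v. v /\<^sub>R norm v) \<in> borel_measurable (restrict_space lborel (ball 0 1 - {0}))"
    by (intro measurable_restrict_space1) measurable
qed (auto simp: space_restrict_space)

lemma sets_cone:
  assumes "A \<in> sets surface"
  shows "cone A \<in> sets borel"
proof -
  have "(\<lambda>v. v /\<^sub>R norm v) -` A \<inter> space (restrict_space lborel (ball 0 1 - {0}))
      \<in> sets (restrict_space lborel (ball 0 1 - {0}))"
    using assms by (intro measurable_sets[OF normalize_measurable]) (simp add: sets_surface)
  moreover have "(\<lambda>v. v /\<^sub>R norm v) -` A \<inter> space (restrict_space lborel (ball 0 1 - {0})) = cone A"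
    by (auto simp: space_restrict_space)
  ultimately show ?thesis
    by (simp add: sets_restrict_space_iff)
qed

lemma emeasure_surface:
  assumes "A \<in> sets surface"
  shows "emeasure surface A = 3 * emeasure lborel (cone A)"
proof -
  have eq: "(\<lambda>v. v /\<^sub>R norm v) -` A \<inter> space (restrict_space lborel (ball 0 1 - {0})) = cone A"
    by (auto simp: space_restrict_space)
  have "emeasure surface A = 3 * emeasure (distr (restrict_space lborel (ball 0 1 - {0}))
      (restrict_space borel S2) (\<lambda>v. v /\<^sub>R norm v)) A"
    by (simp only: surface_def emeasure_scale_measure)
  also have "\<dots> = 3 * emeasure (restrict_space lborel (ball 0 1 - {0})) (cone A)"
    using assms by (simp only: emeasure_distr[OF normalize_measurable] sets_surface eq)
  also have "emeasure (restrict_space lborel (ball 0 1 - {0})) (cone A) = emeasure lborel (cone A)"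
    by (rule emeasure_restrict_space) auto
  finally show ?thesis .
qed

lemma emeasure_surface_S2: "emeasure surface S2 = ennreal (4 * pi)"
proof -
  have "S2 \<in> sets surface"
    using sets.top[of surface] by simp
  then have "emeasure surface S2 = 3 * emeasure lborel (cone S2)"
    by (rule emeasure_surface)
  also have "cone S2 = ball 0 1 - {0}"
    by auto
  also have "emeasure lborel (ball (0::real^3) 1 - {0}) = emeasure lborel (ball (0::real^3) 1) - emeasure lborel {0::real^3}"
    by (rule emeasure_Diff) auto
  also have "\<dots> = ennreal (unit_ball_vol (real DIM(real^3)))"
    by (simp add: emeasure_ball)
  also have "3 * \<dots> = ennreal (4 * pi)"
    by (simp add: eval_unit_ball_vol ennreal_mult'[symmetric] flip: ennreal_numeral)
  finally show ?thesis .
qed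

interpretation surface: finite_measure surface
  by (rule finite_measureI) (simp add: emeasure_surface_S2)

lemma measure_surface_S2: "measure surface S2 = 4 * pi"
  using emeasure_surface_S2 by (simp add: measure_def)

text \<open>Invariance is available for Lebesgue measurable sets of finite measure. Inclusion in the
  ball gives finiteness, and the image is shown to be Borel as a preimage under the inverse, which
  allows the return to \<open>lborel\<close>.\<close>

lemma sets_rotate_image:
  fixes f :: "real^3 \<Rightarrow> real^3"
  assumes "orthogonal_transformation f" "A \<in> sets borel" "A \<subseteq> ball 0 1"
  shows "emeasure lborel (f ` A) = emeasure lborel A"
proof -
  have bij: "bij f" "linear f"
    using assms(1) by (auto intro: orthogonal_transformation_bij orthogonal_transformation_linear)
  have inv: "orthogonal_transformation (inv f)"
    by (rule orthogonal_transformation_inv[OF assms(1)])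
  then have "bounded_linear (inv f)"
    by (simp add: orthogonal_transformation_linear linear_conv_bounded_linear[symmetric])
  then have "inv f \<in> borel_measurable borel"
    by (intro borel_measurable_continuous_onI linear_continuous_on)
  then have "inv f -` A \<inter> space borel \<in> sets borel"
    using assms(2) by (rule measurable_sets)
  moreover have "inv f -` A \<inter> space borel = f ` A"
    using bij_vimage_eq_inv_image[OF bij_imp_bij_inv[OF bij(1)], of A] inv_inv_eq[OF bij(1)] by simp
  ultimately have fA: "f ` A \<in> sets borel"
    by simp
  have A: "A \<in> lmeasurable"
    by (rule bounded_set_imp_lmeasurable) (use assms in \<open>auto intro: bounded_subset[OF bounded_ball]\<close>)
  have "measure lebesgue (f ` A) = measure lebesgue A" "f ` A \<in> lmeasurable"
    using measure_orthogonal_image[OF assms(1) A] measurable_orthogonal_image[OF assms(1) A] by auto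
  then have "emeasure lebesgue (f ` A) = emeasure lebesgue A"
    using A by (simp only: emeasure_eq_measure2)
  then show ?thesis
    using fA assms(2) by simp
qed

lemma rotation_measurable [measurable]:
  assumes "rotation_matrix R"
  shows "(*v) R \<in> surface \<rightarrow>\<^sub>M surface"
proof -
  have "(*v) R \<in> restrict_space borel S2 \<rightarrow>\<^sub>M restrict_space borel S2"
  proof (rule measurable_restrict_space2)
    show "(*v) R \<in> borel_measurable (restrict_space borel S2)"
      by (intro measurable_restrict_space1 borel_measurable_continuous_onI
          matrix_vector_mult_linear_continuous_on)
    show "(*v) R \<in> space (restrict_space borel S2) \<rightarrow> S2"
      using rotation_in_S2[OF assms] by (auto simp: space_restrict_space simp del: mem_sphere_0)
  qed
  then show ?thesis
    by (simp add: measurable_cong_sets[OF sets_surface sets_surface])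
qed

text \<open>A rotation maps the cone over the preimage of A onto the cone over A, and it preserves
  volume.\<close>

lemma surface_rotate:
  assumes R: "rotation_matrix R"
  shows "distr surface surface ((*v) R) = surface"
proof (rule measure_eqI)
  fix A assume "A \<in> sets (distr surface surface ((*v) R))"
  then have A: "A \<in> sets surface"
    by simp
  have V: "(*v) R -` A \<inter> space surface \<in> sets surface"
    using rotation_measurable[OF R] A by (rule measurable_sets)
  have orth: "orthogonal_transformation ((*v) R)"
    by (rule rotation_orthogonal[OF R])
  have "(*v) R ` cone ((*v) R -` A \<inter> space surface) = cone A"
  proof (intro set_eqI iffI)
    fix w assume "w \<in> (*v) R ` cone ((*v) R -` A \<inter> space surface)"
    then obtain v where v: "w = R *v v" "v \<in> cone ((*v) R -` A \<inter> space surface)"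
      by blast
    have "norm (R *v v) = norm v" "v \<noteq> 0"
      using v(2) by (auto intro: rotation_norm[OF R])
    then show "w \<in> cone A"
      using v(2) unfolding v(1) by (auto simp: matrix_vector_mult_scaleR)
  next
    fix w assume w: "w \<in> cone A"
    obtain v where v: "w = R *v v"
      using orthogonal_transformation_surj[OF orth] by (metis surjD)
    have "v \<noteq> 0"
      using w v by auto
    then have "v \<in> cone ((*v) R -` A \<inter> space surface)"
      using w rotation_norm[OF R, of v] unfolding v by (auto simp: matrix_vector_mult_scaleR)
    then show "w \<in> (*v) R ` cone ((*v) R -` A \<inter> space surface)"
      using v by blast
  qed
  moreover have "cone ((*v) R -` A \<inter> space surface) \<subseteq> ball 0 1"
    by auto
  ultimately have "emeasure lborel (cone ((*v) R -` A \<inter> space surface)) = emeasure lborel (cone A)"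
    using sets_rotate_image[OF orth sets_cone[OF V]] by metis
  then show "emeasure (distr surface surface ((*v) R)) A = emeasure surface A"
    unfolding emeasure_distr[OF rotation_measurable[OF R] A] emeasure_surface[OF A] emeasure_surface[OF V]
    by simp
qed simp

lemma integral_surface_rotate:
  fixes f :: "real^3 \<Rightarrow> 'a::{banach, second_countable_topology}"
  assumes "rotation_matrix R" "f \<in> borel_measurable surface"
  shows "(\<integral>x. f (R *v x) \<partial>surface) = (\<integral>x. f x \<partial>surface)"
  using integral_distr[OF rotation_measurable[OF assms(1)] assms(2)] surface_rotate[OF assms(1)] by simp

lemma continuous_on_imp_measurable_surface:
  fixes f :: "real^3 \<Rightarrow> 'a::topological_space"
  assumes "continuous_on S2 f"
  shows "f \<in> borel_measurable surface"
  using borel_measurable_continuous_on_restrict[OF assms]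
  by (simp add: measurable_cong_sets[OF sets_surface refl])

lemma continuous_measurable_surface:
  fixes f :: "real^3 \<Rightarrow> 'a::topological_space"
  assumes "continuous_on UNIV f"
  shows "f \<in> borel_measurable surface"
  using assms by (intro continuous_on_imp_measurable_surface) (rule continuous_on_subset, auto)

lemma continuous_bounded_S2:
  fixes f :: "real^3 \<Rightarrow> real"
  assumes "continuous_on S2 f"
  shows "\<exists>C\<ge>0. \<forall>x\<in>S2. \<bar>f x\<bar> \<le> C"
proof -
  have "compact (f ` S2)"
    using assms by (intro compact_continuous_image compact_sphere)
  then obtain C where C: "\<And>x. x \<in> S2 \<Longrightarrow> \<bar>f x\<bar> \<le> C"
    using compact_imp_bounded bounded_iff[of "f ` S2"] by fastforce
  have "axis 3 1 \<in> (S2 :: (real^3) set)"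
    by simp
  then have "0 \<le> C"
    using C by (meson abs_ge_zero order_trans)
  then show ?thesis
    using C by blast
qed

lemma integrable_surface_bounded:
  fixes f :: "real^3 \<Rightarrow> real"
  assumes "f \<in> borel_measurable surface" "\<And>x. x \<in> S2 \<Longrightarrow> \<bar>f x\<bar> \<le> C"
  shows "integrable surface f"
  using assms by (intro surface.integrable_const_bound[where B = C]) (auto intro!: AE_I2)

lemma integrable_surface_continuous:
  fixes f :: "real^3 \<Rightarrow> real"
  assumes "continuous_on UNIV f"
  shows "integrable surface f"
proof -
  have "continuous_on S2 f"
    using assms continuous_on_subset by blast
  then obtain C where C: "\<And>x. x \<in> S2 \<Longrightarrow> \<bar>f x\<bar> \<le> C"
    using continuous_bounded_S2 by blast
  show ?thesis
    by (rule integrable_surface_bounded[OF continuous_measurable_surface[OF assms] C])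
qed

lemma integral_surface_bounded:
  fixes f :: "real^3 \<Rightarrow> real"
  assumes "f \<in> borel_measurable surface" "\<And>x. x \<in> S2 \<Longrightarrow> \<bar>f x\<bar> \<le> C"
  shows "\<bar>\<integral>x. f x \<partial>surface\<bar> \<le> 4 * pi * C"
proof -
  have "\<bar>\<integral>x. f x \<partial>surface\<bar> \<le> (\<integral>x. \<bar>f x\<bar> \<partial>surface)"
    using integral_norm_bound[of surface f] by simp
  also have "\<dots> \<le> (\<integral>x. C \<partial>surface)"
    using assms integrable_surface_bounded[OF assms] by (intro integral_mono) auto
  finally show ?thesis
    by (simp add: measure_surface_S2)
qed

subsection \<open>Orthonormality\<close>

interpretation L2: invariant_form "\<lambda>f g. \<integral>x. f x * g x \<partial>surface" "4 * pi"
proof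
  have int: "integrable surface (\<lambda>x. f x * g x)"
    if "continuous_on UNIV f" "continuous_on UNIV g" for f g :: "real^3 \<Rightarrow> real"
    using that by (intro integrable_surface_continuous continuous_intros)
  fix f g h :: "real^3 \<Rightarrow> real"
  assume f: "continuous_on UNIV f" and g: "continuous_on UNIV g"
  show "(\<integral>x. (f x + g x) * h x \<partial>surface) = (\<integral>x. f x * h x \<partial>surface) + (\<integral>x. g x * h x \<partial>surface)"
    if "continuous_on UNIV h"
    using f g that by (simp add: distrib_right int)
  show "(\<integral>x. c * f x * g x \<partial>surface) = c * (\<integral>x. f x * g x \<partial>surface)" for c
    by (simp add: mult.assoc)
  show "(\<integral>x. f x * g x \<partial>surface) = (\<integral>x. g x * f x \<partial>surface)"
    by (simp add: mult.commute)
  show "\<bar>\<integral>x. f x * g x \<partial>surface\<bar> \<le> 4 * pi * a * b"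
    if "\<And>x. x \<in> S2 \<Longrightarrow> \<bar>f x\<bar> \<le> a" "\<And>x. x \<in> S2 \<Longrightarrow> \<bar>g x\<bar> \<le> b" for a b
  proof -
    have "\<bar>f x * g x\<bar> \<le> a * b" if "x \<in> S2" for x
      unfolding abs_mult
      using \<open>\<And>x. x \<in> S2 \<Longrightarrow> \<bar>f x\<bar> \<le> a\<close>[OF that] \<open>\<And>x. x \<in> S2 \<Longrightarrow> \<bar>g x\<bar> \<le> b\<close>[OF that]
      by (intro mult_mono) auto
    then show ?thesis
      using integral_surface_bounded[of "\<lambda>x. f x * g x" "a * b"] f g
      by (simp add: continuous_measurable_surface continuous_on_mult)
  qed
  show "(\<integral>x. f (R *v x) * g (R *v x) \<partial>surface) = (\<integral>x. f x * g x \<partial>surface)"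
    if "rotation_matrix R" for R
    using f g that by (intro integral_surface_rotate continuous_measurable_surface continuous_intros)
qed

text \<open>Invariance leaves one unknown, the common squared norm s in degree l. Integrating the
  addition theorem on the diagonal, where the Legendre polynomial is 1, gives (2 l + 1) s = 2 l +
  1.\<close>

theorem sph_harm_orthonormal:
  assumes m: "m \<in> {- int l..int l}" and m': "m' \<in> {- int l'..int l'}"
  shows "(\<integral>x. sph_harm l m x * sph_harm l' m' x \<partial>surface) = (if l = l' \<and> m = m' then 1 else 0)"
proof -
  define s where "s = (\<integral>x. sph_harm l 0 x * sph_harm l 0 x \<partial>surface)"
  have int: "integrable surface (\<lambda>x. sph_harm l m x * sph_harm l m x)" if m: "m \<in> {- int l..int l}" for m
    using m by (intro integrable_surface_continuous continuous_intros) auto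
  have "real (2 * l + 1) = (\<integral>x. real (2 * l + 1) / (4 * pi) \<partial>surface)"
    by (simp add: measure_surface_S2)
  also have "\<dots> = (\<integral>x. zonal l x x \<partial>surface)"
  proof (rule Bochner_Integration.integral_cong)
    fix x assume "x \<in> space surface"
    then have x: "x \<in> S2"
      by simp
    then have "x \<bullet> x = 1"
      by (simp add: dot_square_norm)
    then show "real (2 * l + 1) / (4 * pi) = zonal l x x"
      using addition_theorem[OF x x, of l] by (simp add: poly_legendre_1)
  qed simp
  also have "\<dots> = (\<Sum>m = - int l..int l. \<integral>x. sph_harm l m x * sph_harm l m x \<partial>surface)"
    unfolding zonal_def by (rule Bochner_Integration.integral_sum) (rule int)
  also have "\<dots> = (\<Sum>m = - int l..int l. s)"
  proof (intro sum.cong refl)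
    fix m assume "m \<in> {- int l..int l}"
    then show "(\<integral>x. sph_harm l m x * sph_harm l m x \<partial>surface) = s"
      using L2.sph_harm_values[of m l m l] unfolding s_def by (simp only: simp_thms if_True)
  qed
  also have "\<dots> = real (2 * l + 1) * s"
    by simp
  finally have "s = 1"
    by (simp del: of_nat_add of_nat_mult)
  moreover have "(\<integral>x. sph_harm l m x * sph_harm l' m' x \<partial>surface) = (if l = l' \<and> m = m' then s else 0)"
    unfolding s_def by (rule L2.sph_harm_values[OF m m'])
  ultimately show ?thesis
    by simp
qed


subsection \<open>Centered normal variables\<close>

lemma normal_rv_moments:
  fixes X :: "'w \<Rightarrow> real"
  assumes X: "X \<in> borel_measurable M" and \<sigma>: "0 < \<sigma>"
    and d: "distr M borel X = density lborel (normal_density 0 \<sigma>)"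
  shows "has_bochner_integral M X 0" "has_bochner_integral M (\<lambda>\<omega>. (X \<omega>)\<^sup>2) (\<sigma>\<^sup>2)"
    "has_bochner_integral M (\<lambda>\<omega>. (X \<omega>) ^ 4) (3 * \<sigma> ^ 4)"
proof -
  have *: "has_bochner_integral M (\<lambda>\<omega>. (X \<omega>) ^ k) c"
    if "has_bochner_integral lborel (\<lambda>x. normal_density 0 \<sigma> x * x ^ k) c" for k c
  proof -
    have "has_bochner_integral (density lborel (normal_density 0 \<sigma>)) (\<lambda>x. x ^ k) c"
      using that by (intro has_bochner_integral_density) auto
    then have "has_bochner_integral (distr M borel X) (\<lambda>x. x ^ k) c"
      by (simp only: d)
    then show ?thesis
      using X by (simp add: has_bochner_integral_iff integrable_distr_eq integral_distr)
  qed
  show "has_bochner_integral M X 0"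
    using *[of 1 0] normal_moment_odd[OF \<sigma>, of 0 0] by simp
  show "has_bochner_integral M (\<lambda>\<omega>. (X \<omega>)\<^sup>2) (\<sigma>\<^sup>2)"
    using *[of 2 "\<sigma>\<^sup>2"] normal_moment_even[OF \<sigma>, of 0 1] by simp
  show "has_bochner_integral M (\<lambda>\<omega>. (X \<omega>) ^ 4) (3 * \<sigma> ^ 4)"
    using *[of 4 "3 * \<sigma> ^ 4"] normal_moment_even[OF \<sigma>, of 0 2] \<sigma>
    by (simp add: fact_numeral power2_eq_square field_simps power4_eq_xxxx)
qed

lemma (in prob_space) expectation_abs_le_sqrt:
  fixes X :: "'a \<Rightarrow> real"
  assumes [measurable]: "X \<in> borel_measurable M" and X: "integrable M (\<lambda>\<omega>. (X \<omega>)\<^sup>2)"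
  shows "integrable M X" "expectation (\<lambda>\<omega>. \<bar>X \<omega>\<bar>) \<le> sqrt (expectation (\<lambda>\<omega>. (X \<omega>)\<^sup>2))"
proof -
  show i: "integrable M X"
    by (rule square_integrable_imp_integrable[OF _ X]) simp
  have "0 \<le> variance (\<lambda>\<omega>. \<bar>X \<omega>\<bar>)"
    by simp
  also have "variance (\<lambda>\<omega>. \<bar>X \<omega>\<bar>) = expectation (\<lambda>\<omega>. \<bar>X \<omega>\<bar>\<^sup>2) - (expectation (\<lambda>\<omega>. \<bar>X \<omega>\<bar>))\<^sup>2"
    using X i by (intro variance_eq) simp_all
  finally have "(expectation (\<lambda>\<omega>. \<bar>X \<omega>\<bar>))\<^sup>2 \<le> expectation (\<lambda>\<omega>. (X \<omega>)\<^sup>2)"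
    by simp
  then show "expectation (\<lambda>\<omega>. \<bar>X \<omega>\<bar>) \<le> sqrt (expectation (\<lambda>\<omega>. (X \<omega>)\<^sup>2))"
    by (rule real_le_rsqrt)
qed

lemma integrable_mult_squares:
  fixes X Y :: "'w \<Rightarrow> real"
  assumes [measurable]: "X \<in> borel_measurable M" "Y \<in> borel_measurable M"
    and "integrable M (\<lambda>\<omega>. (X \<omega>)\<^sup>2)" "integrable M (\<lambda>\<omega>. (Y \<omega>)\<^sup>2)"
  shows "integrable M (\<lambda>\<omega>. X \<omega> * Y \<omega>)"
proof (rule Bochner_Integration.integrable_bound)
  show "integrable M (\<lambda>\<omega>. (X \<omega>)\<^sup>2 + (Y \<omega>)\<^sup>2)"
    using assms by simp
  have "\<bar>x * y\<bar> \<le> x\<^sup>2 + y\<^sup>2" for x y :: real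
  proof -
    have "0 \<le> \<bar>x\<bar> * \<bar>y\<bar>" "2 * \<bar>x\<bar> * \<bar>y\<bar> \<le> x\<^sup>2 + y\<^sup>2"
      using sum_squares_bound[of "\<bar>x\<bar>" "\<bar>y\<bar>"] by simp_all
    then show ?thesis
      unfolding abs_mult by linarith
  qed
  then show "AE \<omega> in M. norm (X \<omega> * Y \<omega>) \<le> norm ((X \<omega>)\<^sup>2 + (Y \<omega>)\<^sup>2)"
    by (intro AE_I2) (simp add: abs_mult)
qed simp

lemma integrable_sum_squares:
  fixes D :: "nat \<Rightarrow> 'w \<Rightarrow> real"
  assumes "\<And>t. D t \<in> borel_measurable M" "\<And>t. integrable M (\<lambda>\<omega>. (D t \<omega>)\<^sup>2)"
  shows "integrable M (\<lambda>\<omega>. (\<Sum>t<n. D t \<omega>)\<^sup>2)"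
proof (induction n)
  case (Suc n)
  have [measurable]: "\<And>t. D t \<in> borel_measurable M"
    by fact
  have "(\<lambda>\<omega>. (\<Sum>t<Suc n. D t \<omega>)\<^sup>2)
      = (\<lambda>\<omega>. (\<Sum>t<n. D t \<omega>)\<^sup>2 + 2 * ((\<Sum>t<n. D t \<omega>) * D n \<omega>) + (D n \<omega>)\<^sup>2)"
    by (simp add: power2_sum fun_eq_iff)
  moreover have "integrable M (\<lambda>\<omega>. (\<Sum>t<n. D t \<omega>) * D n \<omega>)"
    using Suc assms by (intro integrable_mult_squares) auto
  ultimately show ?case
    using Suc assms by simp
qed simp

text \<open>Each increment is only asked to be orthogonal to the sum of its predecessors, which is
  the form in which martingale differences provide orthogonality.\<close>

lemma expectation_sum_orthogonal:
  fixes D :: "nat \<Rightarrow> 'w \<Rightarrow> real"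
  assumes D: "\<And>t. D t \<in> borel_measurable M" "\<And>t. integrable M (\<lambda>\<omega>. (D t \<omega>)\<^sup>2)"
    and orth: "\<And>n. (\<integral>\<omega>. (\<Sum>t<n. D t \<omega>) * D n \<omega> \<partial>M) = 0"
  shows "(\<integral>\<omega>. (\<Sum>t<n. D t \<omega>)\<^sup>2 \<partial>M) = (\<Sum>t<n. \<integral>\<omega>. (D t \<omega>)\<^sup>2 \<partial>M)"
proof (induction n)
  case (Suc n)
  have [measurable]: "\<And>t. D t \<in> borel_measurable M"
    by fact
  have "(\<lambda>\<omega>. (\<Sum>t<Suc n. D t \<omega>)\<^sup>2)
      = (\<lambda>\<omega>. (\<Sum>t<n. D t \<omega>)\<^sup>2 + 2 * ((\<Sum>t<n. D t \<omega>) * D n \<omega>) + (D n \<omega>)\<^sup>2)"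
    by (simp add: power2_sum fun_eq_iff)
  moreover have "integrable M (\<lambda>\<omega>. (\<Sum>t<n. D t \<omega>) * D n \<omega>)"
    using D integrable_sum_squares[OF D] by (intro integrable_mult_squares) auto
  ultimately show ?case
    using Suc D integrable_sum_squares[OF D] orth by simp
qed simp

subsection \<open>An array of autoregressive sequences\<close>

text \<open>Indexed by the time before the step: at t it is the noise that enters at time
  \<open>Suc t\<close>. The products \<open>e j t * a j t\<close> are then the increments of the
  score, and this is why the independence assumption below labels the innovation by
  \<open>Suc t\<close>.\<close>

definition innov :: "('j \<Rightarrow> real) \<Rightarrow> ('j \<Rightarrow> nat \<Rightarrow> 'w \<Rightarrow> real) \<Rightarrow> 'j \<Rightarrow> nat \<Rightarrow> 'w \<Rightarrow> real" where
  "innov \<phi> a j t \<omega> = a j (Suc t) \<omega> - \<phi> j * a j t \<omega>"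

text \<open>The probabilistic half of the argument, freed from the sphere; the index j will be a
  pair (l, m). \<open>innov_char\<close> says that the innovations at one time are jointly normal
  and independent. Stationarity is present as the constancy in t of the second moments
  \<open>C j\<close>.\<close>

locale ar_array = prob_space M for M :: "'w measure" +
  fixes a :: "'j \<Rightarrow> nat \<Rightarrow> 'w \<Rightarrow> real" and \<phi> C CZ :: "'j \<Rightarrow> real" and I :: "'j set" and r :: real
  assumes a_measurable [measurable]: "\<And>j t. a j t \<in> borel_measurable M"
    and phi: "\<And>j. j \<in> I \<Longrightarrow> \<bar>\<phi> j\<bar> \<le> r" and r: "r < 1"
    and CZ_pos: "\<And>j. j \<in> I \<Longrightarrow> 0 < CZ j"
    and a_sq: "\<And>j t. j \<in> I \<Longrightarrow> has_bochner_integral M (\<lambda>\<omega>. (a j t \<omega>)\<^sup>2) (C j)"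
    and innov_distr: "\<And>j t. j \<in> I \<Longrightarrow>
      distr M borel (innov \<phi> a j t) = density lborel (normal_density 0 (sqrt (CZ j)))"
    and innov_char: "\<And>J c t. finite J \<Longrightarrow> J \<subseteq> I \<Longrightarrow>
      (CLINT \<omega>|M. iexp (\<Sum>j\<in>J. c j * innov \<phi> a j t \<omega>)) = exp (- (\<Sum>j\<in>J. (c j)\<^sup>2 * CZ j) / 2)"
    and indep: "\<And>J t. finite J \<Longrightarrow> J \<subseteq> I \<Longrightarrow>
      indep_var (PiM (J \<times> {Suc t}) (\<lambda>_. borel)) (\<lambda>\<omega>. \<lambda>(j, s)\<in>J \<times> {Suc t}. innov \<phi> a j t \<omega>)
        (PiM (J \<times> {..t}) (\<lambda>_. borel)) (\<lambda>\<omega>. \<lambda>(j, s)\<in>J \<times> {..t}. a j s \<omega>)"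
begin

abbreviation e :: "'j \<Rightarrow> nat \<Rightarrow> 'w \<Rightarrow> real" where
  "e \<equiv> innov \<phi> a"

lemma e_measurable [measurable]: "e j t \<in> borel_measurable M"
  unfolding innov_def[abs_def] by measurable

lemma e_moments:
  assumes "j \<in> I"
  shows "has_bochner_integral M (e j t) 0" "has_bochner_integral M (\<lambda>\<omega>. (e j t \<omega>)\<^sup>2) (CZ j)"
    "has_bochner_integral M (\<lambda>\<omega>. (e j t \<omega>) ^ 4) (3 * (CZ j)\<^sup>2)"
proof -
  have s4: "sqrt (CZ j) ^ 4 = (CZ j)\<^sup>2" "(sqrt (CZ j))\<^sup>2 = CZ j"
    using CZ_pos[OF assms] by (simp_all add: power4_eq_xxxx power2_eq_square)
  have p: "0 < sqrt (CZ j)"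
    using CZ_pos[OF assms] by simp
  show "has_bochner_integral M (e j t) 0" "has_bochner_integral M (\<lambda>\<omega>. (e j t \<omega>)\<^sup>2) (CZ j)"
    "has_bochner_integral M (\<lambda>\<omega>. (e j t \<omega>) ^ 4) (3 * (CZ j)\<^sup>2)"
    using normal_rv_moments[OF e_measurable p innov_distr[OF assms, of t]] unfolding s4 by simp_all
qed

text \<open>The generated sigma-algebra, as a measure space, so that functions of the past can be
  handled by the usual closure rules of measurability.\<close>

definition past :: "'j set \<Rightarrow> nat \<Rightarrow> 'w measure" where
  "past J t = vimage_algebra (space M) (\<lambda>\<omega>. \<lambda>(j, s)\<in>J \<times> {..t}. a j s \<omega>) (PiM (J \<times> {..t}) (\<lambda>_. borel))"

definition present :: "'j set \<Rightarrow> nat \<Rightarrow> 'w measure" where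
  "present J t = vimage_algebra (space M) (\<lambda>\<omega>. \<lambda>(j, s)\<in>J \<times> {Suc t}. e j t \<omega>) (PiM (J \<times> {Suc t}) (\<lambda>_. borel))"

lemma space_past [simp]: "space (past J t) = space M" "space (present J t) = space M"
  by (simp_all add: past_def present_def)

lemma past_map_measurable:
  "(\<lambda>\<omega>. \<lambda>(j, s)\<in>J \<times> {..t}. a j s \<omega>) \<in> M \<rightarrow>\<^sub>M PiM (J \<times> {..t}) (\<lambda>_. borel)"
  unfolding case_prod_beta by (intro measurable_restrict) (auto simp: case_prod_beta)

lemma present_map_measurable:
  "(\<lambda>\<omega>. \<lambda>(j, s)\<in>J \<times> {Suc t}. e j t \<omega>) \<in> M \<rightarrow>\<^sub>M PiM (J \<times> {Suc t}) (\<lambda>_. borel)"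
  unfolding case_prod_beta by (intro measurable_restrict) (auto simp: case_prod_beta)

lemma past_le: "sets (past J t) \<subseteq> sets M"
  unfolding past_def by (rule sets_image_in_sets) (simp_all add: past_map_measurable)

lemma present_le: "sets (present J t) \<subseteq> sets M"
  unfolding present_def by (rule sets_image_in_sets) (simp_all add: present_map_measurable)

lemma measurable_past_imp: "X \<in> past J t \<rightarrow>\<^sub>M N \<Longrightarrow> X \<in> M \<rightarrow>\<^sub>M N"
  using past_le[of J t] by (auto simp: measurable_def)

lemma measurable_present_imp: "X \<in> present J t \<rightarrow>\<^sub>M N \<Longrightarrow> X \<in> M \<rightarrow>\<^sub>M N"
  using present_le[of J t] by (auto simp: measurable_def)

lemma e_present:
  assumes "j \<in> J"
  shows "e j t \<in> borel_measurable (present J t)"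
proof -
  have "(\<lambda>\<omega>. \<lambda>(j, s)\<in>J \<times> {Suc t}. e j t \<omega>) \<in> present J t \<rightarrow>\<^sub>M PiM (J \<times> {Suc t}) (\<lambda>_. borel)"
    unfolding present_def using present_map_measurable[where J = J and t = t]
    by (intro measurable_vimage_algebra1) (auto simp: measurable_def)
  moreover have "(\<lambda>f. f (j, Suc t)) \<in> PiM (J \<times> {Suc t}) (\<lambda>_. borel) \<rightarrow>\<^sub>M (borel :: real measure)"
    using assms by (intro measurable_component_singleton) auto
  ultimately have "(\<lambda>\<omega>. (\<lambda>(j, s)\<in>J \<times> {Suc t}. e j t \<omega>) (j, Suc t)) \<in> borel_measurable (present J t)"
    by (rule measurable_compose)
  then show ?thesis
    using assms by simp
qed

lemma a_past:
  assumes "j \<in> J" "s \<le> t"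
  shows "a j s \<in> borel_measurable (past J t)"
proof -
  have "(\<lambda>\<omega>. \<lambda>(j, s)\<in>J \<times> {..t}. a j s \<omega>) \<in> past J t \<rightarrow>\<^sub>M PiM (J \<times> {..t}) (\<lambda>_. borel)"
    unfolding past_def using past_map_measurable[where J = J and t = t]
    by (intro measurable_vimage_algebra1) (auto simp: measurable_def)
  moreover have "(\<lambda>f. f (j, s)) \<in> PiM (J \<times> {..t}) (\<lambda>_. borel) \<rightarrow>\<^sub>M (borel :: real measure)"
    using assms by (intro measurable_component_singleton) auto
  ultimately have "(\<lambda>\<omega>. (\<lambda>(j, s)\<in>J \<times> {..t}. a j s \<omega>) (j, s)) \<in> borel_measurable (past J t)"
    by (rule measurable_compose)
  then show ?thesis
    using assms by simp
qed

lemma e_past: "j \<in> J \<Longrightarrow> s < t \<Longrightarrow> e j s \<in> borel_measurable (past J t)"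
  unfolding innov_def[abs_def] by (intro borel_measurable_diff borel_measurable_times a_past) auto

lemma prob_present_past:
  assumes J: "finite J" "J \<subseteq> I" and "A \<in> sets (present J t)" "B \<in> sets (past J t)"
  shows "prob (A \<inter> B) = prob A * prob B"
proof -
  have "indep_set (sets (present J t)) (sets (past J t))"
    using indep[OF J, of t] unfolding indep_var_eq present_def past_def sets_vimage_algebra by auto
  then show ?thesis
    using assms(3,4) by (rule indep_setD)
qed

text \<open>Independence is expressed as a product of laws because \<open>indep_var\<close> forces
  both variables into one type, while \<open>conditional_char\<close> pairs a vector of innovations
  with a complex number and a vector.\<close>

lemma distr_present_past:
  assumes J: "finite J" "J \<subseteq> I" and X: "X \<in> present J t \<rightarrow>\<^sub>M S" and Y: "Y \<in> past J t \<rightarrow>\<^sub>M N"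
  shows "distr M S X \<Otimes>\<^sub>M distr M N Y = distr M (S \<Otimes>\<^sub>M N) (\<lambda>\<omega>. (X \<omega>, Y \<omega>))"
proof (rule pair_measure_eqI)
  have X' [measurable]: "X \<in> M \<rightarrow>\<^sub>M S" and Y' [measurable]: "Y \<in> M \<rightarrow>\<^sub>M N"
    using measurable_present_imp[OF X] measurable_past_imp[OF Y] by auto
  show "sigma_finite_measure (distr M S X)" "sigma_finite_measure (distr M N Y)"
    by (intro prob_space_imp_sigma_finite prob_space_distr X' Y')+
  show "sets (distr M S X \<Otimes>\<^sub>M distr M N Y) = sets (distr M (S \<Otimes>\<^sub>M N) (\<lambda>\<omega>. (X \<omega>, Y \<omega>)))"
    by (simp cong: sets_pair_measure_cong)
  fix A B assume "A \<in> sets (distr M S X)" "B \<in> sets (distr M N Y)"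
  then have AB [measurable]: "A \<in> sets S" "B \<in> sets N"
    by auto
  have "X -` A \<inter> space (present J t) \<in> sets (present J t)" "Y -` B \<inter> space (past J t) \<in> sets (past J t)"
    by (rule measurable_sets[OF X AB(1)], rule measurable_sets[OF Y AB(2)])
  from prob_present_past[OF J this] have "prob ((X -` A \<inter> space M) \<inter> (Y -` B \<inter> space M))
      = prob (X -` A \<inter> space M) * prob (Y -` B \<inter> space M)"
    by simp
  moreover have "(\<lambda>\<omega>. (X \<omega>, Y \<omega>)) -` (A \<times> B) \<inter> space M = (X -` A \<inter> space M) \<inter> (Y -` B \<inter> space M)"
    by auto
  ultimately show "emeasure (distr M S X) A * emeasure (distr M N Y) B
      = emeasure (distr M (S \<Otimes>\<^sub>M N) (\<lambda>\<omega>. (X \<omega>, Y \<omega>))) (A \<times> B)"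
    by (simp add: emeasure_distr emeasure_eq_measure ennreal_mult'')
qed

lemma expectation_innov_past:
  fixes X :: "'w \<Rightarrow> real"
  assumes j: "j \<in> I" and X: "X \<in> borel_measurable (past {j} t)" and Xi: "integrable M X"
    and g [measurable]: "g \<in> borel_measurable borel" and gi: "integrable M (\<lambda>\<omega>. g (e j t \<omega>))"
  shows "has_bochner_integral M (\<lambda>\<omega>. g (e j t \<omega>) * X \<omega>) (expectation (\<lambda>\<omega>. g (e j t \<omega>)) * expectation X)"
proof -
  have ge: "(\<lambda>\<omega>. g (e j t \<omega>)) \<in> borel_measurable (present {j} t)"
    by (rule measurable_compose[OF e_present g]) simp
  have "indep_var borel (\<lambda>\<omega>. g (e j t \<omega>)) borel X"
    using distr_present_past[OF _ _ ge X] j measurable_present_imp[OF ge] measurable_past_imp[OF X]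
    unfolding indep_var_distribution_eq by simp
  then show ?thesis
    using Xi gi by (simp add: has_bochner_integral_iff indep_var_integrable indep_var_lebesgue_integral)
qed

lemma a_integrable:
  assumes "j \<in> I"
  shows "integrable M (\<lambda>\<omega>. (a j t \<omega>)\<^sup>2)" "integrable M (a j t)"
  using a_sq[OF assms, of t] expectation_abs_le_sqrt(1)[of "a j t"] by (auto simp: has_bochner_integral_iff)

lemma innov_a_sq:
  assumes j: "j \<in> I"
  shows "has_bochner_integral M (\<lambda>\<omega>. (e j t \<omega> * a j t \<omega>)\<^sup>2) (CZ j * C j)"
proof -
  have "has_bochner_integral M (\<lambda>\<omega>. (e j t \<omega>)\<^sup>2 * (a j t \<omega>)\<^sup>2)
      (expectation (\<lambda>\<omega>. (e j t \<omega>)\<^sup>2) * expectation (\<lambda>\<omega>. (a j t \<omega>)\<^sup>2))"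
    using e_moments(2)[OF j, of t] a_sq[OF j, of t] a_past[of j "{j}" t t]
    by (intro expectation_innov_past[OF j, of "\<lambda>\<omega>. (a j t \<omega>)\<^sup>2" t "\<lambda>x. x\<^sup>2"])
      (auto simp: has_bochner_integral_iff)
  then show ?thesis
    using e_moments(2)[OF j, of t] a_sq[OF j, of t]
    by (simp add: has_bochner_integral_iff power_mult_distrib)
qed

text \<open>The increments are martingale differences: everything but the last innovation is a
  function of the past, and that innovation is centered and independent of it.\<close>

lemma sum_innov_a_sq:
  assumes j: "j \<in> I"
  shows "has_bochner_integral M (\<lambda>\<omega>. (\<Sum>t<n. e j t \<omega> * a j t \<omega>)\<^sup>2) (real n * (CZ j * C j))"
proof -
  define D where "D t \<omega> = e j t \<omega> * a j t \<omega>" for t \<omega>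
  have D [measurable]: "D t \<in> borel_measurable M" for t
    unfolding D_def[abs_def] by measurable
  have D2: "integrable M (\<lambda>\<omega>. (D t \<omega>)\<^sup>2)" for t
    using innov_a_sq[OF j] by (simp add: D_def has_bochner_integral_iff)
  have orth: "expectation (\<lambda>\<omega>. (\<Sum>t<n. D t \<omega>) * D n \<omega>) = 0" for n
  proof -
    have "integrable M (\<lambda>\<omega>. (\<Sum>t<n. D t \<omega>) * a j n \<omega>)"
      using a_integrable[OF j] by (intro integrable_mult_squares integrable_sum_squares D D2) auto
    moreover have "(\<lambda>\<omega>. (\<Sum>t<n. D t \<omega>) * a j n \<omega>) \<in> borel_measurable (past {j} n)"
      unfolding D_def by (intro borel_measurable_times borel_measurable_sum e_past a_past) auto
    ultimately have "has_bochner_integral M (\<lambda>\<omega>. e j n \<omega> * ((\<Sum>t<n. D t \<omega>) * a j n \<omega>))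
        (expectation (e j n) * expectation (\<lambda>\<omega>. (\<Sum>t<n. D t \<omega>) * a j n \<omega>))"
      using e_moments(1)[OF j, of n]
      by (intro expectation_innov_past[OF j, where g = "\<lambda>x. x"]) (auto simp: has_bochner_integral_iff)
    then show ?thesis
      using e_moments(1)[OF j, of n] by (simp add: has_bochner_integral_iff D_def mult_ac)
  qed
  show ?thesis
    using expectation_sum_orthogonal[OF D D2 orth] integrable_sum_squares[OF D D2]
      innov_a_sq[OF j] by (simp add: has_bochner_integral_iff D_def)
qed

lemma sum_innov_sq:
  assumes j: "j \<in> I"
  shows "has_bochner_integral M (\<lambda>\<omega>. (\<Sum>t<n. (e j t \<omega>)\<^sup>2 - CZ j)\<^sup>2) (real n * (2 * (CZ j)\<^sup>2))"
proof -
  define D where "D t \<omega> = (e j t \<omega>)\<^sup>2 - CZ j" for t \<omega>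
  have D [measurable]: "D t \<in> borel_measurable M" for t
    unfolding D_def[abs_def] by measurable
  have D2: "has_bochner_integral M (\<lambda>\<omega>. (D t \<omega>)\<^sup>2) (2 * (CZ j)\<^sup>2)" for t
  proof -
    have "(\<lambda>\<omega>. (D t \<omega>)\<^sup>2) = (\<lambda>\<omega>. (e j t \<omega>) ^ 4 - (2 * CZ j) * (e j t \<omega>)\<^sup>2 + (CZ j)\<^sup>2)"
      by (simp add: D_def fun_eq_iff power2_diff flip: power_mult)
    moreover have "has_bochner_integral M (\<lambda>\<omega>. (e j t \<omega>) ^ 4 - (2 * CZ j) * (e j t \<omega>)\<^sup>2 + (CZ j)\<^sup>2)
       (3 * (CZ j)\<^sup>2 - (2 * CZ j) * CZ j + (CZ j)\<^sup>2)"
      using e_moments[OF j, of t] by (simp add: has_bochner_integral_iff prob_space)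
    ultimately show ?thesis
      by (simp add: power2_eq_square)
  qed
  have D1: "has_bochner_integral M (D t) 0" for t
    unfolding D_def[abs_def] using e_moments(2)[OF j, of t] by (simp add: has_bochner_integral_iff prob_space)
  have D2i: "integrable M (\<lambda>\<omega>. (D t \<omega>)\<^sup>2)" for t
    using D2[of t] by (simp add: has_bochner_integral_iff)
  have orth: "expectation (\<lambda>\<omega>. (\<Sum>t<n. D t \<omega>) * D n \<omega>) = 0" for n
  proof -
    have "(\<lambda>\<omega>. (\<Sum>t<n. D t \<omega>)) \<in> borel_measurable (past {j} n)"
      unfolding D_def by (intro borel_measurable_sum borel_measurable_diff borel_measurable_power e_past) auto
    then have "has_bochner_integral M (\<lambda>\<omega>. ((e j n \<omega>)\<^sup>2 - CZ j) * (\<Sum>t<n. D t \<omega>))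
        (expectation (\<lambda>\<omega>. (e j n \<omega>)\<^sup>2 - CZ j) * expectation (\<lambda>\<omega>. (\<Sum>t<n. D t \<omega>)))"
      using D1 by (intro expectation_innov_past[OF j, where g = "\<lambda>x. x\<^sup>2 - CZ j"])
        (auto simp: has_bochner_integral_iff D_def[abs_def])
    then show ?thesis
      using D1[of n] by (simp add: has_bochner_integral_iff D_def[abs_def] mult_ac)
  qed
  show ?thesis
    using expectation_sum_orthogonal[OF D D2i orth] integrable_sum_squares[OF D D2i]
      D2 by (simp add: has_bochner_integral_iff D_def)
qed

lemma innov_a_mean:
  assumes j: "j \<in> I"
  shows "has_bochner_integral M (\<lambda>\<omega>. e j t \<omega> * a j t \<omega>) 0"
  using expectation_innov_past[OF j, of "a j t" t "\<lambda>x. x"] e_moments(1)[OF j, of t] a_integrable[OF j, of t]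
    a_past[of j "{j}" t t] by (simp add: has_bochner_integral_iff)

lemma variance_stationary:
  assumes j: "j \<in> I"
  shows "CZ j = (1 - (\<phi> j)\<^sup>2) * C j"
proof -
  have "(\<lambda>\<omega>. (a j (Suc 0) \<omega>)\<^sup>2)
      = (\<lambda>\<omega>. (\<phi> j)\<^sup>2 * (a j 0 \<omega>)\<^sup>2 + 2 * \<phi> j * (e j 0 \<omega> * a j 0 \<omega>) + (e j 0 \<omega>)\<^sup>2)"
    by (simp add: fun_eq_iff innov_def power2_eq_square algebra_simps)
  moreover have "has_bochner_integral M
      (\<lambda>\<omega>. (\<phi> j)\<^sup>2 * (a j 0 \<omega>)\<^sup>2 + 2 * \<phi> j * (e j 0 \<omega> * a j 0 \<omega>) + (e j 0 \<omega>)\<^sup>2)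
      ((\<phi> j)\<^sup>2 * C j + 2 * \<phi> j * 0 + CZ j)"
    by (intro has_bochner_integral_add has_bochner_integral_mult_right a_sq innov_a_mean e_moments j)
  ultimately have "C j = (\<phi> j)\<^sup>2 * C j + CZ j"
    using a_sq[OF j, of "Suc 0"] has_bochner_integral_eq by fastforce
  then show ?thesis
    by (simp add: algebra_simps)
qed

lemma phi_sq: "j \<in> I \<Longrightarrow> (\<phi> j)\<^sup>2 \<le> r\<^sup>2" "j \<in> I \<Longrightarrow> r\<^sup>2 < 1"
proof -
  have "(\<phi> j)\<^sup>2 \<le> r\<^sup>2 \<and> r\<^sup>2 < 1" if "j \<in> I"
  proof -
    have "0 \<le> r"
      using phi[OF that] by linarith
    then show ?thesis
      using phi[OF that] r by (auto simp: abs_le_square_iff[symmetric] abs_square_less_1)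
  qed
  then show "j \<in> I \<Longrightarrow> (\<phi> j)\<^sup>2 \<le> r\<^sup>2" "j \<in> I \<Longrightarrow> r\<^sup>2 < 1"
    by auto
qed

lemma C_pos:
  assumes "j \<in> I"
  shows "0 < C j" "CZ j \<le> C j"
proof -
  have p: "0 < 1 - (\<phi> j)\<^sup>2"
    using phi_sq[OF assms] by simp
  show "0 < C j"
    using variance_stationary[OF assms] CZ_pos[OF assms] p by (metis zero_less_mult_pos)
  then show "CZ j \<le> C j"
    unfolding variance_stationary[OF assms] by (simp add: mult_left_le_one_le[of "C j"] p less_imp_le
      mult_le_cancel_right1)
qed

section \<open>Time averages of products and squares, with their L1 rates\<close>

definition cross_mean :: "nat \<Rightarrow> 'j \<Rightarrow> 'w \<Rightarrow> real" where
  "cross_mean N j \<omega> = (\<Sum>t<N. e j t \<omega> * a j t \<omega>) / real N"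

definition square_mean :: "nat \<Rightarrow> 'j \<Rightarrow> 'w \<Rightarrow> real" where
  "square_mean N j \<omega> = (\<Sum>t<N. (a j t \<omega>)\<^sup>2) / real N"

lemma mean_measurable [measurable]:
  "cross_mean N j \<in> borel_measurable M" "square_mean N j \<in> borel_measurable M"
  unfolding cross_mean_def[abs_def] square_mean_def[abs_def] by measurable

lemma cross_mean_bound:
  assumes j: "j \<in> I"
  shows "integrable M (cross_mean N j)"
    and "expectation (\<lambda>\<omega>. \<bar>cross_mean N j \<omega>\<bar>) \<le> sqrt (CZ j * C j) / sqrt (real N)"
proof -
  have i: "integrable M (\<lambda>\<omega>. \<Sum>t<N. e j t \<omega> * a j t \<omega>)"
    using innov_a_mean[OF j] by (auto simp: has_bochner_integral_iff)
  then show "integrable M (cross_mean N j)"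
    unfolding cross_mean_def[abs_def] by simp
  have "expectation (\<lambda>\<omega>. \<bar>\<Sum>t<N. e j t \<omega> * a j t \<omega>\<bar>) \<le> sqrt (real N * (CZ j * C j))"
    using expectation_abs_le_sqrt(2)[of "\<lambda>\<omega>. \<Sum>t<N. e j t \<omega> * a j t \<omega>"] sum_innov_a_sq[OF j, of N]
    by (simp add: has_bochner_integral_iff)
  then have "expectation (\<lambda>\<omega>. \<bar>\<Sum>t<N. e j t \<omega> * a j t \<omega>\<bar>) / real N \<le> sqrt (real N * (CZ j * C j)) / real N"
    by (rule divide_right_mono) simp
  also have "\<dots> = sqrt (CZ j * C j) / sqrt (real N)"
    by (cases "N = 0") (simp_all add: real_sqrt_mult field_simps)
  finally show "expectation (\<lambda>\<omega>. \<bar>cross_mean N j \<omega>\<bar>) \<le> sqrt (CZ j * C j) / sqrt (real N)"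
    by (simp add: cross_mean_def)
qed

text \<open>The autoregression turns the deviation of the average into boundary terms and two
  martingales. Each of the three contributions to the expectation is at most 2 sqrt N times
  \<open>C j\<close>, whence the constant 6; the division by \<open>1 - r\<^sup>2\<close> undoes the
  factor in the identity.\<close>

lemma square_mean_bound:
  assumes j: "j \<in> I" and N: "N \<ge> 1"
  shows "integrable M (square_mean N j)"
    and "expectation (\<lambda>\<omega>. \<bar>square_mean N j \<omega> - C j\<bar>) \<le> 6 / (1 - r\<^sup>2) * C j / sqrt (real N)"
proof -
  show i: "integrable M (square_mean N j)"
    unfolding square_mean_def[abs_def] using a_integrable[OF j] by simp
  define A B where "A \<omega> = (\<Sum>t<N. e j t \<omega> * a j t \<omega>)" and "B \<omega> = (\<Sum>t<N. (e j t \<omega>)\<^sup>2 - CZ j)" for \<omega>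
  have AB [measurable]: "A \<in> borel_measurable M" "B \<in> borel_measurable M"
    unfolding A_def[abs_def] B_def[abs_def] by measurable
  \<comment> \<open>Sum the squared autoregressive equation over time: the two sums of squares
    differ only by the first and the last term, which leaves the factor 1 minus the squared
    coefficient in front.\<close>
  have id: "(1 - (\<phi> j)\<^sup>2) * ((\<Sum>t<n. (a j t \<omega>)\<^sup>2) - real n * C j)
      = (a j 0 \<omega>)\<^sup>2 - (a j n \<omega>)\<^sup>2 + 2 * \<phi> j * (\<Sum>t<n. e j t \<omega> * a j t \<omega>) + (\<Sum>t<n. (e j t \<omega>)\<^sup>2 - CZ j)" for n \<omega>
  proof (induction n)
    case (Suc n)
    have "(a j (Suc n) \<omega>)\<^sup>2 = (\<phi> j)\<^sup>2 * (a j n \<omega>)\<^sup>2 + 2 * \<phi> j * (e j n \<omega> * a j n \<omega>) + (e j n \<omega>)\<^sup>2"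
      by (simp add: innov_def power2_eq_square algebra_simps)
    moreover have "(1 - (\<phi> j)\<^sup>2) * ((s + x) - real (Suc n) * C j)
        = (1 - (\<phi> j)\<^sup>2) * (s - real n * C j) + (1 - (\<phi> j)\<^sup>2) * x - CZ j" for s x
      unfolding variance_stationary[OF j] by (simp add: algebra_simps)
    ultimately show ?case
      using Suc by (simp add: algebra_simps)
  qed simp
  have iA: "integrable M A" "expectation (\<lambda>\<omega>. \<bar>A \<omega>\<bar>) \<le> sqrt (real N * (CZ j * C j))"
    using expectation_abs_le_sqrt[OF AB(1)] sum_innov_a_sq[OF j, of N]
    by (simp_all add: has_bochner_integral_iff A_def)
  have iB: "integrable M B" "expectation (\<lambda>\<omega>. \<bar>B \<omega>\<bar>) \<le> sqrt (real N * (2 * (CZ j)\<^sup>2))"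
    using expectation_abs_le_sqrt[OF AB(2)] sum_innov_sq[OF j, of N]
    by (simp_all add: has_bochner_integral_iff B_def)
  have p: "0 < 1 - r\<^sup>2" "1 - r\<^sup>2 \<le> 1 - (\<phi> j)\<^sup>2" "\<bar>\<phi> j\<bar> \<le> 1"
    using phi_sq[OF j] phi[OF j] r by auto
  have sN: "1 \<le> sqrt (real N)" "real N = sqrt (real N) * sqrt (real N)"
    using N by simp_all
  have C: "0 < C j" "CZ j \<le> C j" "0 < CZ j"
    using C_pos[OF j] CZ_pos[OF j] by auto
  have "expectation (\<lambda>\<omega>. (1 - r\<^sup>2) * real N * \<bar>square_mean N j \<omega> - C j\<bar>)
      \<le> expectation (\<lambda>\<omega>. (a j 0 \<omega>)\<^sup>2 + (a j N \<omega>)\<^sup>2 + 2 * \<bar>A \<omega>\<bar> + \<bar>B \<omega>\<bar>)"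
  proof (rule integral_mono)
    fix \<omega>
    have "(1 - r\<^sup>2) * real N * \<bar>square_mean N j \<omega> - C j\<bar>
        \<le> (1 - (\<phi> j)\<^sup>2) * real N * \<bar>square_mean N j \<omega> - C j\<bar>"
      using p by (intro mult_right_mono) auto
    also have "\<dots> = \<bar>(1 - (\<phi> j)\<^sup>2) * ((\<Sum>t<N. (a j t \<omega>)\<^sup>2) - real N * C j)\<bar>"
    proof -
      have "(1 - (\<phi> j)\<^sup>2) * ((\<Sum>t<N. (a j t \<omega>)\<^sup>2) - real N * C j)
          = ((1 - (\<phi> j)\<^sup>2) * real N) * (square_mean N j \<omega> - C j)"
        using N by (simp add: square_mean_def right_diff_distrib)
      moreover have "0 < (1 - (\<phi> j)\<^sup>2) * real N"
        using p N by simp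
      ultimately show ?thesis
        by (simp only: abs_mult[of "(1 - (\<phi> j)\<^sup>2) * real N"] abs_of_pos)
    qed
    also have "\<dots> = \<bar>(a j 0 \<omega>)\<^sup>2 - (a j N \<omega>)\<^sup>2 + 2 * \<phi> j * A \<omega> + B \<omega>\<bar>"
      unfolding id A_def B_def ..
    also have "\<dots> \<le> (a j 0 \<omega>)\<^sup>2 + (a j N \<omega>)\<^sup>2 + 2 * (\<bar>\<phi> j\<bar> * \<bar>A \<omega>\<bar>) + \<bar>B \<omega>\<bar>"
    proof -
      have "\<bar>2 * \<phi> j * A \<omega>\<bar> = 2 * (\<bar>\<phi> j\<bar> * \<bar>A \<omega>\<bar>)"
        by (simp add: abs_mult)
      then show ?thesis
        using zero_le_power2[of "a j 0 \<omega>"] zero_le_power2[of "a j N \<omega>"] by linarith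
    qed
    also have "\<bar>\<phi> j\<bar> * \<bar>A \<omega>\<bar> \<le> 1 * \<bar>A \<omega>\<bar>"
      using p by (intro mult_right_mono) auto
    finally show "(1 - r\<^sup>2) * real N * \<bar>square_mean N j \<omega> - C j\<bar>
        \<le> (a j 0 \<omega>)\<^sup>2 + (a j N \<omega>)\<^sup>2 + 2 * \<bar>A \<omega>\<bar> + \<bar>B \<omega>\<bar>"
      by simp
  qed (use i iA iB a_integrable[OF j] in auto)
  also have "\<dots> = 2 * C j + 2 * expectation (\<lambda>\<omega>. \<bar>A \<omega>\<bar>) + expectation (\<lambda>\<omega>. \<bar>B \<omega>\<bar>)"
    using iA iB a_sq[OF j] by (simp add: has_bochner_integral_iff)
  also have "\<dots> \<le> 2 * (sqrt (real N) * C j) + 2 * (sqrt (real N) * C j) + 2 * (sqrt (real N) * C j)"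
  proof (intro add_mono mult_left_mono)
    show "C j \<le> sqrt (real N) * C j"
      using C sN by simp
    have "sqrt (real N * (CZ j * C j)) \<le> sqrt (real N * (C j * C j))"
      using C by (intro real_sqrt_le_mono mult_left_mono mult_right_mono) auto
    then show "expectation (\<lambda>\<omega>. \<bar>A \<omega>\<bar>) \<le> sqrt (real N) * C j"
      using iA(2) C by (simp add: real_sqrt_mult)
    have "sqrt (real N * (2 * (CZ j)\<^sup>2)) \<le> sqrt (real N * (2\<^sup>2 * (C j)\<^sup>2))"
      using C by (intro real_sqrt_le_mono mult_left_mono mult_mono power_mono) auto
    also have "\<dots> = 2 * (sqrt (real N) * C j)"
      using C by (simp add: real_sqrt_mult)
    finally show "expectation (\<lambda>\<omega>. \<bar>B \<omega>\<bar>) \<le> 2 * (sqrt (real N) * C j)"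
      using iB(2) by simp
  qed auto
  also have "\<dots> = 6 * sqrt (real N) * C j"
    by simp
  finally have "(1 - r\<^sup>2) * real N * expectation (\<lambda>\<omega>. \<bar>square_mean N j \<omega> - C j\<bar>) \<le> 6 * sqrt (real N) * C j"
    by simp
  then have "(1 - r\<^sup>2) * sqrt (real N) * expectation (\<lambda>\<omega>. \<bar>square_mean N j \<omega> - C j\<bar>) \<le> 6 * C j"
    using sN by (metis (no_types, lifting) mult.assoc mult.left_commute mult_le_cancel_left_pos
        less_le_trans zero_less_one)
  then show "expectation (\<lambda>\<omega>. \<bar>square_mean N j \<omega> - C j\<bar>) \<le> 6 / (1 - r\<^sup>2) * C j / sqrt (real N)"
    using p sN by (simp add: field_simps)
qed

subsection \<open>Central limit theorem\<close>

text \<open>The past is frozen: on the product of the two laws Fubini integrates the innovations out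
  first, and there \<open>innov_char\<close> applies with constant coefficients. This takes the
  place of conditional expectations.\<close>

lemma conditional_char:
  fixes P :: "'w \<Rightarrow> complex" and c :: "'j \<Rightarrow> 'w \<Rightarrow> real"
  assumes J: "finite J" "J \<subseteq> I" and P: "P \<in> borel_measurable (past J t)"
    and Pb: "\<And>\<omega>. \<omega> \<in> space M \<Longrightarrow> norm (P \<omega>) \<le> K"
    and c: "\<And>j. j \<in> J \<Longrightarrow> c j \<in> borel_measurable (past J t)"
  shows "(CLINT \<omega>|M. P \<omega> * iexp (\<Sum>j\<in>J. c j \<omega> * e j t \<omega>))
       = (CLINT \<omega>|M. P \<omega> * exp (- (\<Sum>j\<in>J. (c j \<omega>)\<^sup>2 * CZ j) / 2))"
proof -
  define S where "S = PiM J (\<lambda>_. borel :: real measure)"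
  define X where "X \<omega> = (\<lambda>j\<in>J. e j t \<omega>)" for \<omega>
  define Y where "Y \<omega> = (P \<omega>, \<lambda>j\<in>J. c j \<omega>)" for \<omega>
  have X: "X \<in> present J t \<rightarrow>\<^sub>M S"
    unfolding X_def S_def by (intro measurable_restrict e_present)
  have Y: "Y \<in> past J t \<rightarrow>\<^sub>M borel \<Otimes>\<^sub>M S"
    unfolding Y_def S_def by (intro measurable_Pair P measurable_restrict c)
  have X' [measurable]: "X \<in> M \<rightarrow>\<^sub>M S" and Y' [measurable]: "Y \<in> M \<rightarrow>\<^sub>M borel \<Otimes>\<^sub>M S"
    using measurable_present_imp[OF X] measurable_past_imp[OF Y] by auto
  define h where "h x y = fst y * iexp (\<Sum>j\<in>J. snd y j * x j)" for x :: "'j \<Rightarrow> real" and y :: "complex \<times> ('j \<Rightarrow> real)"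
  have h [measurable]: "(\<lambda>(x, y). h x y) \<in> borel_measurable (S \<Otimes>\<^sub>M (borel \<Otimes>\<^sub>M S))"
  proof -
    have [measurable]: "(\<lambda>p. (snd (snd p)) j * (fst p) j) \<in> borel_measurable (S \<Otimes>\<^sub>M ((borel :: complex measure) \<Otimes>\<^sub>M S))"
      if "j \<in> J" for j
      using that unfolding S_def by measurable
    show ?thesis
      unfolding h_def case_prod_beta by measurable
  qed
  interpret DX: prob_space "distr M S X"
    by (rule prob_space_distr) simp
  interpret DY: prob_space "distr M (borel \<Otimes>\<^sub>M S) Y"
    by (rule prob_space_distr) simp
  interpret DXY: pair_prob_space "distr M S X" "distr M (borel \<Otimes>\<^sub>M S) Y" ..
  have eq: "distr M S X \<Otimes>\<^sub>M distr M (borel \<Otimes>\<^sub>M S) Y = distr M (S \<Otimes>\<^sub>M (borel \<Otimes>\<^sub>M S)) (\<lambda>\<omega>. (X \<omega>, Y \<omega>))"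
    by (rule distr_present_past[OF J X Y])
  have hXY: "h (X \<omega>) (Y \<omega>) = P \<omega> * iexp (\<Sum>j\<in>J. c j \<omega> * e j t \<omega>)" for \<omega>
    by (simp add: h_def X_def Y_def)
  have [measurable]: "P \<in> borel_measurable M" "\<And>j. j \<in> J \<Longrightarrow> c j \<in> borel_measurable M"
    using measurable_past_imp[OF P] measurable_past_imp[OF c] by auto
  have "integrable M (\<lambda>\<omega>. h (X \<omega>) (Y \<omega>))"
    unfolding hXY by (rule integrable_const_bound[where B = K]) (use Pb in \<open>auto simp: norm_mult\<close>)
  then have hi: "integrable (distr M S X \<Otimes>\<^sub>M distr M (borel \<Otimes>\<^sub>M S) Y) (\<lambda>(x, y). h x y)"
    unfolding eq by (subst integrable_distr_eq) (auto simp: case_prod_beta)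
  have inner: "(\<integral>x. h x y \<partial>distr M S X) = fst y * exp (- (\<Sum>j\<in>J. (snd y j)\<^sup>2 * CZ j) / 2)" for y
  proof -
    have "(\<lambda>x. h x y) \<in> borel_measurable S"
    proof -
      have [measurable]: "(\<lambda>x. x j) \<in> borel_measurable S" if "j \<in> J" for j
        using that unfolding S_def by measurable
      show ?thesis
        unfolding h_def by measurable
    qed
    then have "(\<integral>x. h x y \<partial>distr M S X) = (CLINT \<omega>|M. h (X \<omega>) y)"
      by (subst integral_distr) auto
    also have "\<dots> = (CLINT \<omega>|M. fst y * iexp (\<Sum>j\<in>J. snd y j * e j t \<omega>))"
      by (simp add: h_def X_def)
    also have "\<dots> = fst y * exp (- (\<Sum>j\<in>J. (snd y j)\<^sup>2 * CZ j) / 2)"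
      using innov_char[OF J, of "snd y" t] by simp
    finally show ?thesis .
  qed
  have "(CLINT \<omega>|M. P \<omega> * iexp (\<Sum>j\<in>J. c j \<omega> * e j t \<omega>)) = (CLINT \<omega>|M. (\<lambda>(x, y). h x y) (X \<omega>, Y \<omega>))"
    by (simp add: hXY)
  also have "\<dots> = (\<integral>p. (\<lambda>(x, y). h x y) p \<partial>(distr M S X \<Otimes>\<^sub>M distr M (borel \<Otimes>\<^sub>M S) Y))"
    unfolding eq by (subst integral_distr) auto
  also have "\<dots> = (\<integral>y. (\<integral>x. h x y \<partial>distr M S X) \<partial>distr M (borel \<Otimes>\<^sub>M S) Y)"
    using DXY.integral_snd[OF hi] by (simp only:)
  also have "\<dots> = (\<integral>y. fst y * exp (- (\<Sum>j\<in>J. (snd y j)\<^sup>2 * CZ j) / 2) \<partial>distr M (borel \<Otimes>\<^sub>M S) Y)"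
    by (simp only: inner)
  also have "\<dots> = (CLINT \<omega>|M. P \<omega> * exp (- (\<Sum>j\<in>J. (c j \<omega>)\<^sup>2 * CZ j) / 2))"
  proof -
    have [measurable]: "(\<lambda>y :: complex \<times> ('j \<Rightarrow> real). snd y j) \<in> borel_measurable (borel \<Otimes>\<^sub>M S)" if "j \<in> J" for j
      using that unfolding S_def by measurable
    show ?thesis
      by (subst integral_distr) (auto simp: Y_def)
  qed
  finally show ?thesis .
qed

lemma abs_exp_minus_one_le:
  fixes x b :: real
  assumes "x \<le> b" "0 \<le> b"
  shows "\<bar>1 - exp x\<bar> \<le> \<bar>x\<bar> * exp b"
proof (cases "0 \<le> x")
  case True
  have "1 - x \<le> exp (- x)"
    using exp_ge_add_one_self[of "- x"] by simp
  then have "(1 - x) * exp x \<le> 1"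
    by (simp add: exp_minus field_simps)
  then have "exp x - 1 \<le> x * exp x"
    by (simp add: algebra_simps)
  also have "\<dots> \<le> x * exp b"
    using True assms by (intro mult_left_mono) auto
  finally show ?thesis
    using True by simp
next
  case False
  have "1 - exp x \<le> - x"
    using exp_ge_add_one_self[of x] by linarith
  also have "\<dots> \<le> - x * exp b"
    using False assms by (simp add: mult_le_cancel_left1)
  finally show ?thesis
    using False by simp
qed

text \<open>
  The conditional characteristic functions are known exactly, so the product \<open>P\<close> below has
  expectation one; the indicator \<open>B\<close> stops the accumulated conditional variance from exceeding its
  limit by more than one, which keeps \<open>P\<close> bounded.
\<close>

lemma clt_bound:
  fixes w :: "'j \<Rightarrow> real" and u :: real
  assumes J: "finite J" "J \<subseteq> I" and N: "N \<ge> 1"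
  defines "V \<equiv> \<Sum>j\<in>J. (w j)\<^sup>2 * CZ j * C j"
  shows "norm ((CLINT \<omega>|M. iexp (u * (sqrt (real N) * (\<Sum>j\<in>J. w j * cross_mean N j \<omega>)))) - exp (- u\<^sup>2 * V / 2))
    \<le> (1 + exp (u\<^sup>2 / 2)) * (1 + u\<^sup>2 / 2)
       * (\<Sum>j\<in>J. (w j)\<^sup>2 * CZ j * (6 / (1 - r\<^sup>2) * C j / sqrt (real N)))"
proof -
  define v where "v t \<omega> = (\<Sum>j\<in>J. (w j)\<^sup>2 * CZ j * (a j t \<omega>)\<^sup>2)" for t \<omega>
  define x where "x t \<omega> = (\<Sum>j\<in>J. w j * (e j t \<omega> * a j t \<omega>))" for t \<omega>
  define W where "W n \<omega> = (\<Sum>t<n. v t \<omega>) / real N" for n \<omega>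
  \<comment> \<open>\<open>W (Suc t)\<close> involves the array only up to time t, so the decision
    to stop is known before the innovation \<open>e j t\<close>; it includes \<open>v t\<close>, so
    the limit V + 1 is not overshot.\<close>
  define B where "B t \<omega> = (if W (Suc t) \<omega> \<le> V + 1 then 1 else 0 :: real)" for t \<omega>
  define s where "s = u / sqrt (real N)"
  have s2: "s\<^sup>2 = u\<^sup>2 / real N"
    by (simp add: s_def power_divide)
  have CZ0: "0 \<le> CZ j" "0 < C j" if "j \<in> J" for j
    using CZ_pos[of j] C_pos[of j] J that by (auto intro: less_imp_le)
  have v0: "0 \<le> v t \<omega>" for t \<omega>
    unfolding v_def using CZ0 by (intro sum_nonneg mult_nonneg_nonneg) auto
  have V0: "0 \<le> V"
    unfolding V_def using CZ0 by (intro sum_nonneg mult_nonneg_nonneg) (auto intro: less_imp_le)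
  have Wmono: "W m \<omega> \<le> W n \<omega>" if "m \<le> n" for m n \<omega>
    unfolding W_def using that v0 by (intro divide_right_mono sum_mono2) auto
  define P where "P n \<omega> = (\<Prod>t<n. iexp (s * B t \<omega> * x t \<omega>) * exp (s\<^sup>2 * B t \<omega> * v t \<omega> / 2))" for n \<omega>
  \<comment> \<open>If the last indicator is 1, the whole accumulated variance is within the limit;
    if it is 0, nothing is added.\<close>
  have Bsum: "(\<Sum>t<n. B t \<omega> * v t \<omega>) \<le> real N * (V + 1)" for n \<omega>
  proof (induction n)
    case 0
    then show ?case using V0 by simp
  next
    case (Suc n)
    show ?case
    proof (cases "B n \<omega> = 1")
      case True
      have "(\<Sum>t<Suc n. B t \<omega> * v t \<omega>) \<le> (\<Sum>t<Suc n. v t \<omega>)"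
        using v0 by (intro sum_mono) (auto simp: B_def)
      also have "\<dots> = real N * W (Suc n) \<omega>"
        using N by (simp add: W_def)
      also have "\<dots> \<le> real N * (V + 1)"
        using True by (intro mult_left_mono) (auto simp: B_def split: if_splits)
      finally show ?thesis .
    next
      case False
      then have "B n \<omega> = 0"
        unfolding B_def by (auto split: if_splits)
      then show ?thesis
        using Suc by simp
    qed
  qed
  have normP: "norm (P n \<omega>) = exp (s\<^sup>2 * (\<Sum>t<n. B t \<omega> * v t \<omega>) / 2)" for n \<omega>
    by (simp add: P_def prod_norm[symmetric] norm_mult exp_sum[symmetric] sum_distrib_left sum_divide_distrib mult.assoc)
  have bound: "exp (s\<^sup>2 * (\<Sum>t<n. B t \<omega> * v t \<omega>) / 2) \<le> exp (u\<^sup>2 * (V + 1) / 2)" for n \<omega>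
  proof -
    have "s\<^sup>2 * (\<Sum>t<n. B t \<omega> * v t \<omega>) \<le> s\<^sup>2 * (real N * (V + 1))"
      by (intro mult_left_mono Bsum) simp
    also have "\<dots> = u\<^sup>2 * (V + 1)"
      using N by (simp add: s2)
    finally show ?thesis
      by simp
  qed
  have Pb: "norm (P n \<omega>) \<le> exp (u\<^sup>2 * (V + 1) / 2)" for n \<omega>
    unfolding normP by (rule bound)
  have v_past: "v t \<in> borel_measurable (past J n)" if "t \<le> n" for t n
    unfolding v_def[abs_def] using that
    by (intro borel_measurable_sum borel_measurable_times borel_measurable_power borel_measurable_const a_past) auto
  have x_past: "x t \<in> borel_measurable (past J n)" if "t < n" for t n
    unfolding x_def[abs_def] using that
    by (intro borel_measurable_sum borel_measurable_times borel_measurable_const a_past e_past) auto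
  have B_past: "B t \<in> borel_measurable (past J n)" if "t \<le> n" for t n
  proof -
    have W [measurable]: "W (Suc t) \<in> borel_measurable (past J n)"
      unfolding W_def[abs_def] using that
      by (intro borel_measurable_divide borel_measurable_sum borel_measurable_const v_past) auto
    show ?thesis
      unfolding B_def[abs_def] by measurable
  qed
  have factor_past: "(\<lambda>\<omega>. iexp (s * B t \<omega> * x t \<omega>) * exp (s\<^sup>2 * B t \<omega> * v t \<omega> / 2)) \<in> borel_measurable (past J n)"
    if "t < n" for t n
  proof -
    have [measurable]: "B t \<in> borel_measurable (past J n)" "x t \<in> borel_measurable (past J n)"
      "v t \<in> borel_measurable (past J n)"
      using that by (auto intro: B_past x_past v_past)
    show ?thesis
      by measurable
  qed
  have P_past: "P n \<in> borel_measurable (past J n)" for n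
    unfolding P_def[abs_def] by (intro borel_measurable_prod factor_past) auto
  have EP: "(CLINT \<omega>|M. P n \<omega>) = 1" for n
  proof (induction n)
    case 0
    then show ?case by (simp add: P_def prob_space)
  next
    case (Suc n)
    define Q where "Q \<omega> = P n \<omega> * exp (s\<^sup>2 * B n \<omega> * v n \<omega> / 2)" for \<omega>
    have Q: "Q \<in> borel_measurable (past J n)"
    proof -
      have [measurable]: "B n \<in> borel_measurable (past J n)" "v n \<in> borel_measurable (past J n)"
        "P n \<in> borel_measurable (past J n)"
        by (auto intro: B_past v_past P_past)
      show ?thesis
        unfolding Q_def[abs_def] by measurable
    qed
    have c: "(\<lambda>\<omega>. s * B n \<omega> * (w j * a j n \<omega>)) \<in> borel_measurable (past J n)" if "j \<in> J" for j
      using that by (intro borel_measurable_times borel_measurable_const B_past a_past) auto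
    have Qb: "norm (Q \<omega>) \<le> exp (u\<^sup>2 * (V + 1) / 2)" for \<omega>
    proof -
      have "norm (Q \<omega>) = exp (s\<^sup>2 * (\<Sum>t<Suc n. B t \<omega> * v t \<omega>) / 2)"
        by (simp add: Q_def norm_mult normP exp_add[symmetric] algebra_simps add_divide_distrib)
      then show ?thesis
        by (simp only: bound)
    qed
    have "(CLINT \<omega>|M. P (Suc n) \<omega>) = (CLINT \<omega>|M. Q \<omega> * iexp (\<Sum>j\<in>J. s * B n \<omega> * (w j * a j n \<omega>) * e j n \<omega>))"
      by (simp add: P_def Q_def x_def sum_distrib_left mult_ac)
    also have "\<dots> = (CLINT \<omega>|M. Q \<omega> * exp (- (\<Sum>j\<in>J. (s * B n \<omega> * (w j * a j n \<omega>))\<^sup>2 * CZ j) / 2))"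
      by (rule conditional_char[OF J Q Qb c])
    also have "\<dots> = (CLINT \<omega>|M. P n \<omega>)"
    proof (rule Bochner_Integration.integral_cong)
      fix \<omega>
      have "(B n \<omega>)\<^sup>2 = B n \<omega>"
        by (simp add: B_def)
      then have "(\<Sum>j\<in>J. (s * B n \<omega> * (w j * a j n \<omega>))\<^sup>2 * CZ j) = s\<^sup>2 * B n \<omega> * v n \<omega>"
        by (simp add: v_def sum_distrib_left power_mult_distrib mult_ac)
      then show "Q \<omega> * exp (- (\<Sum>j\<in>J. (s * B n \<omega> * (w j * a j n \<omega>))\<^sup>2 * CZ j) / 2) = P n \<omega>"
        by (simp add: Q_def exp_minus field_simps)
    qed simp
    finally show ?case
      using Suc by simp
  qed
  have P_M [measurable]: "P n \<in> borel_measurable M" for n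
    using measurable_past_imp[OF P_past] .
  have sq_int: "integrable M (\<lambda>\<omega>. \<bar>square_mean N j \<omega> - C j\<bar>)" if "j \<in> J" for j
    using square_mean_bound(1)[OF _ N, of j] J that by auto
  have WN: "W N \<omega> - V = (\<Sum>j\<in>J. (w j)\<^sup>2 * CZ j * (square_mean N j \<omega> - C j))" for \<omega>
  proof -
    have "(\<Sum>t<N. v t \<omega>) = (\<Sum>j\<in>J. (w j)\<^sup>2 * CZ j * (\<Sum>t<N. (a j t \<omega>)\<^sup>2))"
      unfolding v_def by (subst sum.swap) (simp add: sum_distrib_left)
    then have "W N \<omega> = (\<Sum>j\<in>J. (w j)\<^sup>2 * CZ j * square_mean N j \<omega>)"
      by (simp only: W_def square_mean_def times_divide_eq_right sum_divide_distrib[symmetric])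
    then show ?thesis
      by (simp add: V_def sum_subtractf right_diff_distrib)
  qed
  define R where "R \<omega> = (\<Sum>j\<in>J. (w j)\<^sup>2 * CZ j * \<bar>square_mean N j \<omega> - C j\<bar>)" for \<omega>
  have WR: "\<bar>W N \<omega> - V\<bar> \<le> R \<omega>" for \<omega>
    unfolding WN R_def using CZ0 by (intro sum_abs[THEN order_trans] sum_mono) (simp add: abs_mult)
  have Ri: "integrable M R"
    unfolding R_def[abs_def] using sq_int by simp
  define f where "f \<omega> = iexp (u * (sqrt (real N) * (\<Sum>j\<in>J. w j * cross_mean N j \<omega>)))" for \<omega>
  have f_eq: "f \<omega> = iexp (s * (\<Sum>t<N. x t \<omega>))" for \<omega>
  proof -
    have "(\<Sum>t<N. x t \<omega>) = (\<Sum>j\<in>J. w j * (\<Sum>t<N. e j t \<omega> * a j t \<omega>))"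
      unfolding x_def by (subst sum.swap) (simp add: sum_distrib_left)
    also have "\<dots> = real N * (\<Sum>j\<in>J. w j * cross_mean N j \<omega>)"
      using N unfolding cross_mean_def times_divide_eq_right sum_divide_distrib[symmetric] by simp
    finally have "s * (\<Sum>t<N. x t \<omega>) = u * (real N / sqrt (real N)) * (\<Sum>j\<in>J. w j * cross_mean N j \<omega>)"
      by (simp add: s_def)
    then show ?thesis
      by (simp add: f_def real_div_sqrt mult.assoc)
  qed
  have f_M [measurable]: "f \<in> borel_measurable M"
    unfolding f_def[abs_def] by measurable
  have fi: "integrable M f" and Pi: "integrable M (P N)"
    by (rule integrable_const_bound[where B = 1], simp_all add: f_def)
      (rule integrable_const_bound[where B = "exp (u\<^sup>2 * (V + 1) / 2)"], simp_all add: Pb)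
  \<comment> \<open>One constant that dominates those of both cases of \<open>pw\<close>: no
    stopping, where the two exponentials are compared, and stopping, where \<open>R\<close> is at
    least 1 and a trivial bound suffices.\<close>
  define K where "K = (1 + exp (u\<^sup>2 / 2)) * (1 + u\<^sup>2 / 2)"
  have K1: "exp (u\<^sup>2 / 2) * (u\<^sup>2 / 2) \<le> K" "1 + exp (u\<^sup>2 / 2) \<le> K"
    by (simp_all add: K_def algebra_simps add_nonneg_nonneg)
  define q where "q = exp (- u\<^sup>2 * V / 2)"
  have pw: "norm (f \<omega> - of_real q * P N \<omega>) \<le> K * R \<omega>" for \<omega>
  proof (cases "W N \<omega> \<le> V + 1")
    case True
    have B1: "B t \<omega> = 1" if "t < N" for t
      using True Wmono[of "Suc t" N \<omega>] that by (auto simp: B_def)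
    have "P N \<omega> = (\<Prod>t<N. iexp (s * x t \<omega>) * exp (s\<^sup>2 * v t \<omega> / 2))"
      unfolding P_def by (intro prod.cong) (auto simp: B1)
    also have "\<dots> = f \<omega> * of_real (exp (s\<^sup>2 * (\<Sum>t<N. v t \<omega>) / 2))"
      by (simp add: f_eq prod.distrib exp_sum[symmetric] sum_distrib_left sum_divide_distrib flip: exp_of_real)
    also have "s\<^sup>2 * (\<Sum>t<N. v t \<omega>) = u\<^sup>2 * W N \<omega>"
      by (simp add: s2 W_def)
    finally have "of_real q * P N \<omega> = f \<omega> * of_real (q * exp (u\<^sup>2 * W N \<omega> / 2))"
      by simp
    also have "q * exp (u\<^sup>2 * W N \<omega> / 2) = exp (u\<^sup>2 / 2 * (W N \<omega> - V))"
      unfolding q_def exp_add[symmetric] by (simp add: algebra_simps diff_divide_distrib)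
    finally have "f \<omega> - of_real q * P N \<omega> = f \<omega> * of_real (1 - exp (u\<^sup>2 / 2 * (W N \<omega> - V)))"
      by (simp add: right_diff_distrib)
    then have "norm (f \<omega> - of_real q * P N \<omega>) = \<bar>1 - exp (u\<^sup>2 / 2 * (W N \<omega> - V))\<bar>"
      by (simp only: norm_mult norm_of_real) (simp add: f_def)
    also have "\<dots> \<le> \<bar>u\<^sup>2 / 2 * (W N \<omega> - V)\<bar> * exp (u\<^sup>2 / 2)"
      using True mult_left_mono[of "W N \<omega> - V" 1 "u\<^sup>2 / 2"] by (intro abs_exp_minus_one_le) auto
    also have "\<dots> = exp (u\<^sup>2 / 2) * (u\<^sup>2 / 2) * \<bar>W N \<omega> - V\<bar>"
      by (simp add: abs_mult)
    also have "\<dots> \<le> K * R \<omega>"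
      using K1 WR by (intro mult_mono) (auto simp: K_def)
    finally show ?thesis .
  next
    case False
    then have R1: "1 \<le> R \<omega>"
      using WR[of \<omega>] by linarith
    have "norm (of_real q * P N \<omega>) \<le> q * exp (u\<^sup>2 * (V + 1) / 2)"
      using Pb[of N \<omega>] by (simp add: norm_mult q_def)
    also have "\<dots> = exp (u\<^sup>2 / 2)"
      unfolding q_def exp_add[symmetric] by (simp add: algebra_simps add_divide_distrib)
    finally have "norm (f \<omega> - of_real q * P N \<omega>) \<le> 1 + exp (u\<^sup>2 / 2)"
      using norm_triangle_ineq4[of "f \<omega>" "of_real q * P N \<omega>"] by (simp add: f_def)
    also have "\<dots> \<le> K * 1"
      using K1 by simp
    also have "\<dots> \<le> K * R \<omega>"
      using R1 by (intro mult_left_mono) (auto simp: K_def)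
    finally show ?thesis .
  qed
  have "(CLINT \<omega>|M. f \<omega>) - of_real q = (CLINT \<omega>|M. f \<omega> - of_real q * P N \<omega>)"
    using fi Pi EP[of N] by simp
  then have "norm ((CLINT \<omega>|M. f \<omega>) - of_real q) \<le> expectation (\<lambda>\<omega>. norm (f \<omega> - of_real q * P N \<omega>))"
    using integral_norm_bound[of M "\<lambda>\<omega>. f \<omega> - of_real q * P N \<omega>"] by simp
  also have "\<dots> \<le> expectation (\<lambda>\<omega>. K * R \<omega>)"
    using fi Pi Ri pw by (intro integral_mono) auto
  also have "\<dots> = K * (\<Sum>j\<in>J. (w j)\<^sup>2 * CZ j * expectation (\<lambda>\<omega>. \<bar>square_mean N j \<omega> - C j\<bar>))"
    using sq_int by (simp add: R_def)
  also have "\<dots> \<le> K * (\<Sum>j\<in>J. (w j)\<^sup>2 * CZ j * (6 / (1 - r\<^sup>2) * C j / sqrt (real N)))"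
    using square_mean_bound(2)[OF _ N] J CZ0
    by (intro mult_left_mono sum_mono) (auto simp: K_def)
  finally show ?thesis
    by (simp add: f_def q_def K_def)
qed

end


subsection \<open>The least squares criterion\<close>

text \<open>From ln l <= l, and from ln l <= 2 sqrt l for the square, which gives the 4. The bounds
  are uniform in l, and through them the later estimates contain no power of log of the
  truncation.\<close>

lemma ln_powr_bounds:
  assumes "1 \<le> l" "1 \<le> \<alpha>"
  shows "0 \<le> ln (real l)" "real l powr - \<alpha> \<le> 1" "ln (real l) * real l powr - \<alpha> \<le> 1"
    "(ln (real l))\<^sup>2 * real l powr - \<alpha> \<le> 4"
proof -
  have l: "1 \<le> real l"
    using assms by simp
  show ln0: "0 \<le> ln (real l)"
    using l by simp
  have p: "real l powr - \<alpha> \<le> real l powr - 1"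
    using l assms by (intro powr_mono) auto
  then have p1: "real l powr - \<alpha> \<le> 1 / real l"
    using l by (simp add: powr_minus_divide)
  then show "real l powr - \<alpha> \<le> 1"
    using l divide_le_eq_1_pos[of "real l" 1] by linarith
  have "ln (real l) \<le> real l"
    using ln_bound[of "real l"] l by simp
  then have "ln (real l) * real l powr - \<alpha> \<le> real l * (1 / real l)"
    using p1 ln0 by (intro mult_mono) auto
  then show "ln (real l) * real l powr - \<alpha> \<le> 1"
    using l by simp
  have "ln (sqrt (real l)) \<le> sqrt (real l)"
    using ln_bound[of "sqrt (real l)"] l by simp
  then have "ln (real l) \<le> 2 * sqrt (real l)"
    using l by (simp add: ln_sqrt)
  then have "(ln (real l))\<^sup>2 \<le> (2 * sqrt (real l))\<^sup>2"
    using ln0 by (intro power_mono) auto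
  then have "(ln (real l))\<^sup>2 * real l powr - \<alpha> \<le> (4 * real l) * (1 / real l)"
    using p1 l by (intro mult_mono) (auto simp: power_mult_distrib)
  then show "(ln (real l))\<^sup>2 * real l powr - \<alpha> \<le> 4"
    using l by simp
qed

lemma powr_diff_mvt:
  fixes x \<alpha> \<beta> :: real
  assumes "0 < x"
  obtains \<xi> where "min \<alpha> \<beta> \<le> \<xi>" "\<xi> \<le> max \<alpha> \<beta>"
    "x powr - \<alpha> - x powr - \<beta> = (\<beta> - \<alpha>) * (ln x * x powr - \<xi>)"
proof -
  have d: "((\<lambda>t. x powr - t) has_real_derivative - (ln x * x powr - t)) (at t)" for t
    using assms by (auto intro!: derivative_eq_intros simp: powr_def)
  consider "\<alpha> < \<beta>" | "\<beta> < \<alpha>" | "\<alpha> = \<beta>"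
    by linarith
  then show ?thesis
  proof cases
    case 1
    then obtain \<xi> where "\<alpha> < \<xi>" "\<xi> < \<beta>" "x powr - \<beta> - x powr - \<alpha> = (\<beta> - \<alpha>) * - (ln x * x powr - \<xi>)"
      using MVT2[OF 1, of "\<lambda>t. x powr - t" "\<lambda>t. - (ln x * x powr - t)"] d by blast
    then show ?thesis
      by (intro that[of \<xi>]) (auto simp: algebra_simps)
  next
    case 2
    then obtain \<xi> where "\<beta> < \<xi>" "\<xi> < \<alpha>" "x powr - \<alpha> - x powr - \<beta> = (\<alpha> - \<beta>) * - (ln x * x powr - \<xi>)"
      using MVT2[OF 2, of "\<lambda>t. x powr - t" "\<lambda>t. - (ln x * x powr - t)"] d by blast
    then show ?thesis
      by (intro that[of \<xi>]) (auto simp: algebra_simps)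
  next
    case 3
    then show ?thesis
      by (intro that[of \<alpha>]) auto
  qed
qed

text \<open>The mean value theorem, used once for the first two bounds and a second time at the
  intermediate exponent for the quadratic remainder. Intermediate exponents stay at least 1, so
  \<open>ln_powr_bounds\<close> applies to them.\<close>

lemma powr_diff_bounds:
  assumes l: "1 \<le> l" and \<alpha>: "1 \<le> \<alpha>" "1 \<le> \<beta>"
  shows "\<bar>real l powr - \<alpha> - real l powr - \<beta>\<bar> \<le> \<bar>\<alpha> - \<beta>\<bar>"
    and "\<bar>real l powr - \<alpha> - real l powr - \<beta>\<bar> * ln (real l) \<le> 4 * \<bar>\<alpha> - \<beta>\<bar>"
    and "\<bar>real l powr - \<beta> - real l powr - \<alpha> - (\<alpha> - \<beta>) * ln (real l) * real l powr - \<beta>\<bar> \<le> 4 * (\<alpha> - \<beta>)\<^sup>2"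
proof -
  have l0: "0 < real l"
    using l by simp
  obtain \<xi> where \<xi>: "min \<alpha> \<beta> \<le> \<xi>" "\<xi> \<le> max \<alpha> \<beta>"
    "real l powr - \<alpha> - real l powr - \<beta> = (\<beta> - \<alpha>) * (ln (real l) * real l powr - \<xi>)"
    using powr_diff_mvt[OF l0] by blast
  have \<xi>1: "1 \<le> \<xi>"
    using \<xi>(1) \<alpha> by (auto simp: min_def split: if_splits)
  note b = ln_powr_bounds[OF l \<xi>1]
  have eq: "\<bar>real l powr - \<alpha> - real l powr - \<beta>\<bar> = \<bar>\<alpha> - \<beta>\<bar> * (ln (real l) * real l powr - \<xi>)"
    unfolding \<xi>(3) using b by (simp add: abs_mult abs_minus_commute)
  show "\<bar>real l powr - \<alpha> - real l powr - \<beta>\<bar> \<le> \<bar>\<alpha> - \<beta>\<bar>"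
    unfolding eq using b(3) by (simp add: mult_left_le)
  have "\<bar>real l powr - \<alpha> - real l powr - \<beta>\<bar> * ln (real l)
      = \<bar>\<alpha> - \<beta>\<bar> * ((ln (real l))\<^sup>2 * real l powr - \<xi>)"
    unfolding eq by (simp add: power2_eq_square)
  also have "\<dots> \<le> \<bar>\<alpha> - \<beta>\<bar> * 4"
    using b(4) by (intro mult_left_mono) auto
  finally show "\<bar>real l powr - \<alpha> - real l powr - \<beta>\<bar> * ln (real l) \<le> 4 * \<bar>\<alpha> - \<beta>\<bar>"
    by simp
  obtain \<eta> where \<eta>: "min \<xi> \<beta> \<le> \<eta>" "\<eta> \<le> max \<xi> \<beta>"
    "real l powr - \<xi> - real l powr - \<beta> = (\<beta> - \<xi>) * (ln (real l) * real l powr - \<eta>)"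
    using powr_diff_mvt[OF l0] by blast
  have \<eta>1: "1 \<le> \<eta>"
    using \<eta>(1) \<xi>1 \<alpha> by (auto simp: min_def split: if_splits)
  have "real l powr - \<beta> - real l powr - \<alpha> - (\<alpha> - \<beta>) * ln (real l) * real l powr - \<beta>
      = (\<alpha> - \<beta>) * (ln (real l) * (real l powr - \<xi> - real l powr - \<beta>))"
    using \<xi>(3) by (simp add: algebra_simps)
  also have "\<dots> = (\<alpha> - \<beta>) * ((\<beta> - \<xi>) * ((ln (real l))\<^sup>2 * real l powr - \<eta>))"
    unfolding \<eta>(3) by (simp add: power2_eq_square)
  also have "\<bar>\<dots>\<bar> = \<bar>\<alpha> - \<beta>\<bar> * (\<bar>\<beta> - \<xi>\<bar> * ((ln (real l))\<^sup>2 * real l powr - \<eta>))"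
    by (simp add: abs_mult)
  also have "\<dots> \<le> \<bar>\<alpha> - \<beta>\<bar> * (\<bar>\<alpha> - \<beta>\<bar> * 4)"
    using ln_powr_bounds(4)[OF l \<eta>1] \<xi>(1,2)
    by (intro mult_left_mono mult_mono) (auto simp: min_def max_def split: if_splits)
  finally show "\<bar>real l powr - \<beta> - real l powr - \<alpha> - (\<alpha> - \<beta>) * ln (real l) * real l powr - \<beta>\<bar>
      \<le> 4 * (\<alpha> - \<beta>)\<^sup>2"
    unfolding power2_abs[of "\<alpha> - \<beta>", symmetric] by (simp only: power2_eq_square mult_ac)
qed

section \<open>Deterministic analysis: identification, minimisers and score equations\<close>

locale nls =
  fixes G\<^sub>0 \<alpha>\<^sub>0 a1 a2 :: real
  assumes G0: "G\<^sub>0 \<noteq> 0" "\<bar>G\<^sub>0\<bar> < 1" and a: "1 < a1" "a1 < \<alpha>\<^sub>0" "\<alpha>\<^sub>0 < a2"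
begin

definition dev :: "real \<Rightarrow> real \<Rightarrow> nat \<Rightarrow> real" where
  "dev G \<alpha> l = G\<^sub>0 * real l powr - \<alpha>\<^sub>0 - G * real l powr - \<alpha>"

text \<open>The excess of the criterion over its value at the true parameter, as a function of the
  statistics: m_l is the linear noise term and S_l the energy of the past.\<close>

definition Q :: "nat \<Rightarrow> (nat \<Rightarrow> real) \<Rightarrow> (nat \<Rightarrow> real) \<Rightarrow> real \<Rightarrow> real \<Rightarrow> real" where
  "Q L m S G \<alpha> = (\<Sum>l=1..L. 2 * m l * dev G \<alpha> l + S l * (dev G \<alpha> l)\<^sup>2)"

abbreviation err :: "real \<Rightarrow> real \<Rightarrow> real" where
  "err G \<alpha> \<equiv> \<bar>G - G\<^sub>0\<bar> + \<bar>\<alpha> - \<alpha>\<^sub>0\<bar>"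

lemma Q_true [simp]: "Q L m S G\<^sub>0 \<alpha>\<^sub>0 = 0"
  by (simp add: Q_def dev_def)

lemma dev_bound:
  assumes l: "1 \<le> l" and "1 \<le> \<alpha>"
  shows "\<bar>dev G \<alpha> l\<bar> \<le> err G \<alpha>"
proof -
  have "dev G \<alpha> l = G\<^sub>0 * (real l powr - \<alpha>\<^sub>0 - real l powr - \<alpha>) - (G - G\<^sub>0) * real l powr - \<alpha>"
    by (simp add: dev_def algebra_simps)
  then have "\<bar>dev G \<alpha> l\<bar> \<le> \<bar>G\<^sub>0\<bar> * \<bar>real l powr - \<alpha>\<^sub>0 - real l powr - \<alpha>\<bar> + \<bar>G - G\<^sub>0\<bar> * real l powr - \<alpha>"
    using abs_triangle_ineq4[of "G\<^sub>0 * (real l powr - \<alpha>\<^sub>0 - real l powr - \<alpha>)" "(G - G\<^sub>0) * real l powr - \<alpha>"]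
    by (simp add: abs_mult)
  also have "\<dots> \<le> 1 * \<bar>\<alpha>\<^sub>0 - \<alpha>\<bar> + \<bar>G - G\<^sub>0\<bar> * 1"
    using powr_diff_bounds(1)[OF l, of \<alpha>\<^sub>0 \<alpha>] ln_powr_bounds(2)[OF assms] G0 a assms
    by (intro add_mono mult_mono) auto
  finally show ?thesis
    by (simp add: abs_minus_commute)
qed

text \<open>A Lipschitz constant for recovering the parameter from \<open>dev\<close> at l = 1 and l
  = 2. At l = 1 only G matters, whence the 1; at l = 2 the slope in alpha is at least ln 2 times 2
  to the power - a2, times the size of \<open>G\<^sub>0\<close>.\<close>

definition sep :: real where
  "sep = 1 + 1 / (\<bar>G\<^sub>0\<bar> * (ln 2 * 2 powr - a2))"

lemma sep_pos: "0 < sep"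
  unfolding sep_def using G0 by (intro add_pos_nonneg) auto

lemma err_le_dev:
  assumes \<alpha>: "a1 \<le> \<alpha>" "\<alpha> \<le> a2"
  shows "err G \<alpha> \<le> sep * (\<bar>dev G \<alpha> 1\<bar> + \<bar>dev G \<alpha> 2\<bar>)"
proof -
  define \<kappa> where "\<kappa> = ln 2 * 2 powr - a2"
  have \<kappa>: "0 < \<kappa>"
    by (simp add: \<kappa>_def)
  obtain \<xi> where \<xi>: "min \<alpha>\<^sub>0 \<alpha> \<le> \<xi>" "\<xi> \<le> max \<alpha>\<^sub>0 \<alpha>"
    "2 powr - \<alpha>\<^sub>0 - 2 powr - \<alpha> = (\<alpha> - \<alpha>\<^sub>0) * (ln 2 * 2 powr - \<xi>)"
    using powr_diff_mvt[of "2 :: real" \<alpha>\<^sub>0 \<alpha>] by auto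
  have "\<kappa> \<le> ln 2 * 2 powr - \<xi>"
    unfolding \<kappa>_def using \<xi>(2) \<alpha> a by (intro mult_left_mono powr_mono) auto
  then have "\<kappa> * \<bar>\<alpha> - \<alpha>\<^sub>0\<bar> \<le> (ln 2 * 2 powr - \<xi>) * \<bar>\<alpha> - \<alpha>\<^sub>0\<bar>"
    by (intro mult_right_mono) auto
  also have "\<dots> = \<bar>2 powr - \<alpha>\<^sub>0 - 2 powr - \<alpha>\<bar>"
    unfolding \<xi>(3) by (simp add: abs_mult)
  finally have 1: "\<bar>G\<^sub>0\<bar> * (\<kappa> * \<bar>\<alpha> - \<alpha>\<^sub>0\<bar>) \<le> \<bar>G\<^sub>0\<bar> * \<bar>2 powr - \<alpha>\<^sub>0 - 2 powr - \<alpha>\<bar>"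
    by (intro mult_left_mono) auto
  have d1: "\<bar>dev G \<alpha> 1\<bar> = \<bar>G - G\<^sub>0\<bar>"
    by (simp add: dev_def)
  have "G\<^sub>0 * (2 powr - \<alpha>\<^sub>0 - 2 powr - \<alpha>) = dev G \<alpha> 2 + (G - G\<^sub>0) * 2 powr - \<alpha>"
    by (simp add: dev_def algebra_simps)
  then have "\<bar>G\<^sub>0\<bar> * \<bar>2 powr - \<alpha>\<^sub>0 - 2 powr - \<alpha>\<bar> \<le> \<bar>dev G \<alpha> 2\<bar> + \<bar>G - G\<^sub>0\<bar> * 2 powr - \<alpha>"
    using abs_triangle_ineq[of "dev G \<alpha> 2" "(G - G\<^sub>0) * 2 powr - \<alpha>"] by (simp flip: abs_mult) (simp add: abs_mult)
  also have "\<dots> \<le> \<bar>dev G \<alpha> 2\<bar> + \<bar>G - G\<^sub>0\<bar> * 1"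
    using ln_powr_bounds(2)[of 2 \<alpha>] \<alpha> a by (intro add_left_mono mult_left_mono) auto
  finally have "(\<bar>G\<^sub>0\<bar> * \<kappa>) * \<bar>\<alpha> - \<alpha>\<^sub>0\<bar> \<le> \<bar>dev G \<alpha> 1\<bar> + \<bar>dev G \<alpha> 2\<bar>"
    using 1 d1 by simp
  then have "\<bar>\<alpha> - \<alpha>\<^sub>0\<bar> \<le> (\<bar>dev G \<alpha> 1\<bar> + \<bar>dev G \<alpha> 2\<bar>) / (\<bar>G\<^sub>0\<bar> * \<kappa>)"
    using \<kappa> G0 by (simp add: pos_le_divide_eq mult_ac)
  then have "err G \<alpha> \<le> (\<bar>dev G \<alpha> 1\<bar> + \<bar>dev G \<alpha> 2\<bar>) + (\<bar>dev G \<alpha> 1\<bar> + \<bar>dev G \<alpha> 2\<bar>) / (\<bar>G\<^sub>0\<bar> * \<kappa>)"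
    using d1 by linarith
  moreover have "sep * y = y + y / (\<bar>G\<^sub>0\<bar> * \<kappa>)" for y
    by (simp add: sep_def \<kappa>_def distrib_right)
  ultimately show ?thesis
    by simp
qed

text \<open>When Q is at most 0 the quadratic part is dominated by the linear one. The former is
  bounded below through the first two multipoles by the squared error, the latter above by the error
  times the sum of the |m_l|; one factor of the error cancels.\<close>

lemma err_bound:
  assumes L: "2 \<le> L" and S: "\<And>l. 0 \<le> S l" "c \<le> S 1" "c \<le> S 2" and c: "0 < c"
    and \<alpha>: "a1 \<le> \<alpha>" "\<alpha> \<le> a2" and Q: "Q L m S G \<alpha> \<le> 0"
  shows "err G \<alpha> \<le> (4 * sep\<^sup>2 / c) * (\<Sum>l=1..L. \<bar>m l\<bar>)"
proof -
  define d x where "d = err G \<alpha>" and "x = \<bar>dev G \<alpha> 1\<bar> + \<bar>dev G \<alpha> 2\<bar>"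
  have d0: "0 \<le> d" and x0: "0 \<le> x"
    by (simp_all add: d_def x_def)
  have dx: "d \<le> sep * x"
    unfolding d_def x_def by (rule err_le_dev[OF \<alpha>])
  have "x\<^sup>2 \<le> 2 * (dev G \<alpha> 1)\<^sup>2 + 2 * (dev G \<alpha> 2)\<^sup>2"
    unfolding x_def using sum_squares_bound[of "\<bar>dev G \<alpha> 1\<bar>" "\<bar>dev G \<alpha> 2\<bar>"]
    by (simp add: power2_sum)
  then have "c * x\<^sup>2 \<le> c * (2 * (dev G \<alpha> 1)\<^sup>2 + 2 * (dev G \<alpha> 2)\<^sup>2)"
    using c by (intro mult_left_mono) auto
  also have "\<dots> = 2 * (c * (dev G \<alpha> 1)\<^sup>2 + c * (dev G \<alpha> 2)\<^sup>2)"
    by (simp add: algebra_simps)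
  also have "c * (dev G \<alpha> 1)\<^sup>2 + c * (dev G \<alpha> 2)\<^sup>2 \<le> S 1 * (dev G \<alpha> 1)\<^sup>2 + S 2 * (dev G \<alpha> 2)\<^sup>2"
    using S by (intro add_mono mult_right_mono) auto
  also have "\<dots> = (\<Sum>l\<in>{1,2}. S l * (dev G \<alpha> l)\<^sup>2)"
    by simp
  also have "\<dots> \<le> (\<Sum>l=1..L. S l * (dev G \<alpha> l)\<^sup>2)"
    using L S by (intro sum_mono2) auto
  also have "\<dots> \<le> (\<Sum>l=1..L. 2 * (- (m l * dev G \<alpha> l)))"
  proof -
    have "Q L m S G \<alpha> = (\<Sum>l=1..L. S l * (dev G \<alpha> l)\<^sup>2) - (\<Sum>l=1..L. 2 * (- (m l * dev G \<alpha> l)))"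
      unfolding Q_def sum_subtractf[symmetric] by (intro sum.cong) auto
    then show ?thesis
      using Q by linarith
  qed
  also have "\<dots> \<le> (\<Sum>l=1..L. 2 * (\<bar>m l\<bar> * d))"
  proof (intro sum_mono mult_left_mono)
    fix l assume "l \<in> {1..L}"
    then have "\<bar>dev G \<alpha> l\<bar> \<le> d"
      unfolding d_def using \<alpha> a by (intro dev_bound) auto
    then have "\<bar>m l\<bar> * \<bar>dev G \<alpha> l\<bar> \<le> \<bar>m l\<bar> * d"
      by (intro mult_left_mono) auto
    then show "- (m l * dev G \<alpha> l) \<le> \<bar>m l\<bar> * d"
      by (simp flip: abs_mult)
  qed simp
  finally have cx: "c * x\<^sup>2 \<le> 4 * (d * (\<Sum>l=1..L. \<bar>m l\<bar>))"
    by (simp add: sum_distrib_left mult_ac)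
  have "d\<^sup>2 \<le> (sep * x)\<^sup>2"
    using dx d0 by (intro power_mono) auto
  then have "c * d\<^sup>2 \<le> sep\<^sup>2 * (c * x\<^sup>2)"
    using c by (simp add: power_mult_distrib mult_ac)
  also have "\<dots> \<le> sep\<^sup>2 * (4 * (d * (\<Sum>l=1..L. \<bar>m l\<bar>)))"
    using cx by (intro mult_left_mono) auto
  finally have *: "d * (c * d) \<le> d * (4 * sep\<^sup>2 * (\<Sum>l=1..L. \<bar>m l\<bar>))"
    by (simp add: power2_eq_square mult_ac)
  show ?thesis
  proof (cases "d = 0")
    case True
    moreover have "0 \<le> (4 * sep\<^sup>2 / c) * (\<Sum>l=1..L. \<bar>m l\<bar>)"
      using c by (intro mult_nonneg_nonneg sum_nonneg) auto
    ultimately show ?thesis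
      unfolding d_def by linarith
  next
    case False
    then have "c * d \<le> 4 * sep\<^sup>2 * (\<Sum>l=1..L. \<bar>m l\<bar>)"
      using * d0 by simp
    then show ?thesis
      unfolding d_def[symmetric] using c by (simp add: field_simps)
  qed
qed

text \<open>The radius, measured by \<open>err\<close>, of a neighbourhood of the true parameter
  inside Theta; the term with the absolute value of \<open>G\<^sub>0\<close> keeps G away from the
  excluded value 0.\<close>

definition room :: real where
  "room = min (min (1 - \<bar>G\<^sub>0\<bar>) \<bar>G\<^sub>0\<bar>) (min (\<alpha>\<^sub>0 - a1) (a2 - \<alpha>\<^sub>0))"

lemma room_pos: "0 < room"
  using G0 a by (simp add: room_def)

lemma room_interior:
  assumes "err G \<alpha> < room"
  shows "G \<in> {-1<..<1} - {0}" "a1 < \<alpha>" "\<alpha> < a2"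
proof -
  have "err G \<alpha> < 1 - \<bar>G\<^sub>0\<bar>" "err G \<alpha> < \<bar>G\<^sub>0\<bar>" "err G \<alpha> < \<alpha>\<^sub>0 - a1" "err G \<alpha> < a2 - \<alpha>\<^sub>0"
    using assms by (simp_all add: room_def)
  then have "- 1 < G" "G < 1" "G \<noteq> 0" and *: "a1 < \<alpha>" "\<alpha> < a2"
    by linarith+
  then show "G \<in> {-1<..<1} - {0}"
    by simp
  show "a1 < \<alpha>" "\<alpha> < a2"
    by (fact *)+
qed

lemma true_in_Theta: "(G\<^sub>0, \<alpha>\<^sub>0) \<in> Theta a1 a2"
  using G0 a by (auto simp: Theta_def)

text \<open>Theta is not compact, so Q is minimised over the closed rectangle; there
  \<open>err_bound\<close> still holds and pushes the minimiser into the interior, hence into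
  Theta.\<close>

lemma minimizer_exists:
  assumes L: "2 \<le> L" and S: "\<And>l. 0 \<le> S l" "c \<le> S 1" "c \<le> S 2" and c: "0 < c"
    and small: "(4 * sep\<^sup>2 / c) * (\<Sum>l=1..L. \<bar>m l\<bar>) < room"
  shows "\<exists>\<theta>. is_arg_min (\<lambda>(G, \<alpha>). Q L m S G \<alpha>) (\<lambda>\<theta>. \<theta> \<in> Theta a1 a2) \<theta>"
proof -
  have "compact ({-1..1} \<times> {a1..a2} :: (real \<times> real) set)"
    by (intro compact_Times compact_Icc)
  moreover have "{-1..1} \<times> {a1..a2} \<noteq> ({} :: (real \<times> real) set)"
    using a by auto
  moreover have "continuous_on ({-1..1} \<times> {a1..a2}) (\<lambda>(G, \<alpha>). Q L m S G \<alpha>)"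
    unfolding Q_def dev_def case_prod_beta by (intro continuous_intros) auto
  ultimately obtain \<theta> where \<theta>: "\<theta> \<in> {-1..1} \<times> {a1..a2}"
    "\<forall>\<theta>'\<in>{-1..1} \<times> {a1..a2}. (\<lambda>(G, \<alpha>). Q L m S G \<alpha>) \<theta> \<le> (\<lambda>(G, \<alpha>). Q L m S G \<alpha>) \<theta>'"
    using continuous_attains_inf by blast
  obtain G \<alpha> where [simp]: "\<theta> = (G, \<alpha>)"
    by (cases \<theta>)
  have "Q L m S G \<alpha> \<le> Q L m S G\<^sub>0 \<alpha>\<^sub>0"
    using \<theta>(2)[rule_format, of "(G\<^sub>0, \<alpha>\<^sub>0)"] G0 a by (auto simp: abs_less_iff)
  then have "err G \<alpha> \<le> (4 * sep\<^sup>2 / c) * (\<Sum>l=1..L. \<bar>m l\<bar>)"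
    using \<theta>(1) by (intro err_bound[OF L S c]) auto
  then have "err G \<alpha> < room"
    using small by linarith
  then have "\<theta> \<in> Theta a1 a2"
    using room_interior[of G \<alpha>] by (auto simp: Theta_def)
  moreover have "(\<lambda>(G, \<alpha>). Q L m S G \<alpha>) \<theta> \<le> (\<lambda>(G, \<alpha>). Q L m S G \<alpha>) \<theta>'" if "\<theta>' \<in> Theta a1 a2" for \<theta>'
    using \<theta>(2) that unfolding Theta_def by fastforce
  ultimately show ?thesis
    unfolding is_arg_min_def by (meson not_le)
qed

lemma minimizer_err:
  assumes L: "2 \<le> L" and S: "\<And>l. 0 \<le> S l" "c \<le> S 1" "c \<le> S 2" and c: "0 < c"
    and min: "is_arg_min (\<lambda>(G, \<alpha>). Q L m S G \<alpha>) (\<lambda>\<theta>. \<theta> \<in> Theta a1 a2) (G, \<alpha>)"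
  shows "err G \<alpha> \<le> (4 * sep\<^sup>2 / c) * (\<Sum>l=1..L. \<bar>m l\<bar>)"
proof (rule err_bound[OF L S c])
  show "a1 \<le> \<alpha>" "\<alpha> \<le> a2"
    using min by (auto simp: is_arg_min_def Theta_def)
  show "Q L m S G \<alpha> \<le> 0"
    using min true_in_Theta Q_true[of L m S] unfolding is_arg_min_def by force
qed

lemma minimizer_score:
  assumes min: "is_arg_min (\<lambda>(G, \<alpha>). Q L m S G \<alpha>) (\<lambda>\<theta>. \<theta> \<in> Theta a1 a2) (G, \<alpha>)"
    and int: "err G \<alpha> < room"
  shows "(\<Sum>l=1..L. (m l + S l * dev G \<alpha> l) * real l powr - \<alpha>) = 0"
    and "(\<Sum>l=1..L. (m l + S l * dev G \<alpha> l) * (real l powr - \<alpha> * ln (real l))) = 0"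
proof -
  have le: "Q L m S G \<alpha> \<le> Q L m S G' \<alpha>'" if "(G', \<alpha>') \<in> Theta a1 a2" for G' \<alpha>'
    using min that unfolding is_arg_min_def by force
  have near: "(G', \<alpha>') \<in> Theta a1 a2" if "err G' \<alpha>' < room" for G' \<alpha>'
    using room_interior[OF that] by (auto simp: Theta_def)
  define \<epsilon> where "\<epsilon> = room - err G \<alpha>"
  have \<epsilon>: "0 < \<epsilon>"
    using int by (simp add: \<epsilon>_def)
  have dG: "((\<lambda>G. Q L m S G \<alpha>) has_real_derivative
      (\<Sum>l=1..L. 2 * m l * (- (real l powr - \<alpha>)) + S l * (2 * dev G \<alpha> l * (- (real l powr - \<alpha>))))) (at G)"
    unfolding Q_def dev_def by (auto intro!: derivative_eq_intros sum.cong simp: algebra_simps)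
  have "(\<Sum>l=1..L. 2 * m l * (- (real l powr - \<alpha>)) + S l * (2 * dev G \<alpha> l * (- (real l powr - \<alpha>)))) = 0"
  proof (rule DERIV_local_min[OF dG \<epsilon>], intro allI impI)
    fix G' assume "\<bar>G - G'\<bar> < \<epsilon>"
    then show "Q L m S G \<alpha> \<le> Q L m S G' \<alpha>"
      unfolding \<epsilon>_def by (intro le near) linarith
  qed
  also have "(\<Sum>l=1..L. 2 * m l * (- (real l powr - \<alpha>)) + S l * (2 * dev G \<alpha> l * (- (real l powr - \<alpha>))))
      = - 2 * (\<Sum>l=1..L. (m l + S l * dev G \<alpha> l) * real l powr - \<alpha>)"
    unfolding sum_distrib_left by (intro sum.cong) (auto simp: algebra_simps)
  finally show "(\<Sum>l=1..L. (m l + S l * dev G \<alpha> l) * real l powr - \<alpha>) = 0"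
    by simp
  have dp: "((\<lambda>t. real l powr - t) has_real_derivative - (ln (real l) * real l powr - t)) (at t)" if "1 \<le> l" for l t
    using that by (auto intro!: derivative_eq_intros simp: powr_def)
  have "((\<lambda>\<alpha>. 2 * m l * dev G \<alpha> l + S l * (dev G \<alpha> l)\<^sup>2) has_real_derivative
      2 * m l * (G * (ln (real l) * real l powr - \<alpha>))
      + S l * (2 * dev G \<alpha> l * (G * (ln (real l) * real l powr - \<alpha>)))) (at \<alpha>)"
    if l: "l \<in> {1..L}" for l
  proof -
    have "((\<lambda>\<alpha>. dev G \<alpha> l) has_real_derivative G * (ln (real l) * real l powr - \<alpha>)) (at \<alpha>)"
      unfolding dev_def using l by (auto intro!: derivative_eq_intros dp)
    then show ?thesis
      by (auto intro!: derivative_eq_intros)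
  qed
  then have d\<alpha>: "((\<lambda>\<alpha>. Q L m S G \<alpha>) has_real_derivative
      (\<Sum>l=1..L. 2 * m l * (G * (ln (real l) * real l powr - \<alpha>))
      + S l * (2 * dev G \<alpha> l * (G * (ln (real l) * real l powr - \<alpha>))))) (at \<alpha>)"
    unfolding Q_def by (rule DERIV_sum)
  have "(\<Sum>l=1..L. 2 * m l * (G * (ln (real l) * real l powr - \<alpha>))
      + S l * (2 * dev G \<alpha> l * (G * (ln (real l) * real l powr - \<alpha>)))) = 0"
  proof (rule DERIV_local_min[OF d\<alpha> \<epsilon>], intro allI impI)
    fix \<alpha>' assume "\<bar>\<alpha> - \<alpha>'\<bar> < \<epsilon>"
    then show "Q L m S G \<alpha> \<le> Q L m S G \<alpha>'"
      unfolding \<epsilon>_def by (intro le near) linarith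
  qed
  also have "(\<Sum>l=1..L. 2 * m l * (G * (ln (real l) * real l powr - \<alpha>))
      + S l * (2 * dev G \<alpha> l * (G * (ln (real l) * real l powr - \<alpha>))))
      = 2 * G * (\<Sum>l=1..L. (m l + S l * dev G \<alpha> l) * (real l powr - \<alpha> * ln (real l)))"
    unfolding sum_distrib_left by (intro sum.cong) (auto simp: algebra_simps)
  \<comment> \<open>G is not 0 near the true parameter, so the factor 2 G of the derivative in alpha
    can be cancelled.\<close>
  finally show "(\<Sum>l=1..L. (m l + S l * dev G \<alpha> l) * (real l powr - \<alpha> * ln (real l))) = 0"
    using room_interior(1)[OF int] by simp
qed

text \<open>
  The combination of the two score equations with coefficients \<open>1\<close> and \<open>- \<mu>\<close> is linearised at the
  true parameter; for \<open>\<mu> = - D' / (2 D)\<close> the coefficient of \<open>G - G\<^sub>0\<close> vanishes in the limit.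
\<close>

lemma score_linearization:
  fixes \<mu> :: real and s S m :: "nat \<Rightarrow> real"
  assumes score: "(\<Sum>l=1..L. (m l + S l * dev G \<alpha> l) * real l powr - \<alpha>) = 0"
      "(\<Sum>l=1..L. (m l + S l * dev G \<alpha> l) * (real l powr - \<alpha> * ln (real l))) = 0"
    and \<alpha>: "1 \<le> \<alpha>" and s: "\<And>l. 0 \<le> s l"
  defines "d \<equiv> err G \<alpha>"
  shows "\<bar>(\<Sum>l=1..L. m l * (real l powr - \<alpha>\<^sub>0 * (ln (real l) - \<mu>)))
      - (G - G\<^sub>0) * (\<Sum>l=1..L. s l * real l powr (- 2 * \<alpha>\<^sub>0) * (ln (real l) - \<mu>))
      + G\<^sub>0 * (\<alpha> - \<alpha>\<^sub>0) * (\<Sum>l=1..L. s l * real l powr (- 2 * \<alpha>\<^sub>0) * (ln (real l) * (ln (real l) - \<mu>)))\<bar>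
    \<le> (9 + 6 * \<bar>\<mu>\<bar>) * d * ((\<Sum>l=1..L. \<bar>m l\<bar>) + (\<Sum>l=1..L. \<bar>S l - s l\<bar>) + d * (\<Sum>l=1..L. s l))"
proof -
  define e e0 where "e l = real l powr - \<alpha> * (ln (real l) - \<mu>)"
    and "e0 l = real l powr - \<alpha>\<^sub>0 * (ln (real l) - \<mu>)" for l
  define p0 where "p0 l = real l powr - \<alpha>\<^sub>0" for l
  define \<delta> where "\<delta> l = dev G \<alpha> l" for l
  \<comment> \<open>The sum of 4 + |mu|, from the change of the score weight, and 5 (1 + |mu|), from
    the remainder of \<open>dev\<close> times that weight.\<close>
  define K where "K = 9 + 6 * \<bar>\<mu>\<bar>"
  have d0: "0 \<le> d"
    by (simp add: d_def)
  have \<alpha>0: "1 \<le> \<alpha>\<^sub>0"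
    using a by simp
  have sc: "(\<Sum>l=1..L. (m l + S l * \<delta> l) * e l) = 0"
  proof -
    have "(\<Sum>l=1..L. (m l + S l * \<delta> l) * e l)
        = (\<Sum>l=1..L. (m l + S l * dev G \<alpha> l) * (real l powr - \<alpha> * ln (real l)))
          - \<mu> * (\<Sum>l=1..L. (m l + S l * dev G \<alpha> l) * real l powr - \<alpha>)"
      unfolding sum_distrib_left sum_subtractf[symmetric]
      by (intro sum.cong) (auto simp: \<delta>_def e_def algebra_simps)
    then show ?thesis
      unfolding score by simp
  qed
  \<comment> \<open>What remains of \<open>dev\<close> after its first-order Taylor polynomial in
    (G, alpha) at the true parameter.\<close>
  define r where "r l = \<delta> l + (G - G\<^sub>0) * p0 l - G\<^sub>0 * (\<alpha> - \<alpha>\<^sub>0) * ln (real l) * p0 l" for l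
  have p02: "p0 l * p0 l = real l powr (- 2 * \<alpha>\<^sub>0)" for l
    by (simp add: p0_def flip: powr_add)
  \<comment> \<open>The score combination, which is 0, is split off. Four errors are left: the
    weight at the true parameter instead of the estimate in the noise part, S instead of s, the same
    change of weight in the drift part, and the Taylor remainder.\<close>
  have expand: "(\<Sum>l=1..L. m l * e0 l)
      - (G - G\<^sub>0) * (\<Sum>l=1..L. s l * real l powr (- 2 * \<alpha>\<^sub>0) * (ln (real l) - \<mu>))
      + G\<^sub>0 * (\<alpha> - \<alpha>\<^sub>0) * (\<Sum>l=1..L. s l * real l powr (- 2 * \<alpha>\<^sub>0) * (ln (real l) * (ln (real l) - \<mu>)))
    = (\<Sum>l=1..L. m l * (e0 l - e l) - (S l - s l) * \<delta> l * e l + s l * \<delta> l * (e0 l - e l) - s l * r l * e0 l)"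
    (is "?lhs = ?rhs")
  proof -
    have "?lhs = (\<Sum>l=1..L. m l * e0 l - (G - G\<^sub>0) * (s l * (p0 l * p0 l) * (ln (real l) - \<mu>))
       + G\<^sub>0 * (\<alpha> - \<alpha>\<^sub>0) * (s l * (p0 l * p0 l) * (ln (real l) * (ln (real l) - \<mu>))))"
      unfolding p02 by (simp add: sum_distrib_left sum_subtractf sum.distrib)
    also have "\<dots> = (\<Sum>l=1..L. (m l * (e0 l - e l) - (S l - s l) * \<delta> l * e l + s l * \<delta> l * (e0 l - e l)
        - s l * r l * e0 l) + (m l + S l * \<delta> l) * e l)"
    proof (intro sum.cong refl)
      have ring: "m * (p * A) - g * (s * (p * p) * A) + h * (s * (p * p) * (x * A))
          = (m * (p * A - e) - (S - s) * \<delta> * e + s * \<delta> * (p * A - e)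
             - s * (\<delta> + g * p - h * x * p) * (p * A)) + (m + S * \<delta>) * e"
        for m p A g s h x S \<delta> e :: real
        by (simp add: algebra_simps)
      fix l
      have e0: "e0 l = p0 l * (ln (real l) - \<mu>)"
        by (simp add: e0_def p0_def)
      show "m l * e0 l - (G - G\<^sub>0) * (s l * (p0 l * p0 l) * (ln (real l) - \<mu>))
       + G\<^sub>0 * (\<alpha> - \<alpha>\<^sub>0) * (s l * (p0 l * p0 l) * (ln (real l) * (ln (real l) - \<mu>)))
       = (m l * (e0 l - e l) - (S l - s l) * \<delta> l * e l + s l * \<delta> l * (e0 l - e l)
        - s l * r l * e0 l) + (m l + S l * \<delta> l) * e l"
        unfolding r_def e0 by (rule ring)
    qed
    also have "\<dots> = ?rhs"
      unfolding sum.distrib[of _ "\<lambda>l. (m l + S l * \<delta> l) * e l"] sc by simp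
    finally show ?thesis .
  qed
  have bounds: "\<bar>e0 l - e l\<bar> \<le> K * d" "\<bar>e l\<bar> \<le> K" "\<bar>\<delta> l\<bar> \<le> d"
      "\<bar>s l * \<delta> l * (e0 l - e l)\<bar> + \<bar>s l * r l * e0 l\<bar> \<le> K * d * (d * s l)" if l: "l \<in> {1..L}" for l
  proof -
    have l1: "1 \<le> l"
      using l by simp
    note b = ln_powr_bounds[OF l1 \<alpha>] and b0 = ln_powr_bounds[OF l1 \<alpha>0]
      and db = powr_diff_bounds[OF l1 \<alpha> \<alpha>0]
    have da: "\<bar>\<alpha> - \<alpha>\<^sub>0\<bar> \<le> d" "\<bar>G - G\<^sub>0\<bar> \<le> d"
      by (simp_all add: d_def)
    have "\<bar>e0 l - e l\<bar> = \<bar>real l powr - \<alpha> - real l powr - \<alpha>\<^sub>0\<bar> * \<bar>ln (real l) - \<mu>\<bar>"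
      unfolding e_def e0_def by (simp add: left_diff_distrib[symmetric] abs_mult abs_minus_commute)
    also have "\<dots> \<le> \<bar>real l powr - \<alpha> - real l powr - \<alpha>\<^sub>0\<bar> * (ln (real l) + \<bar>\<mu>\<bar>)"
      using b(1) by (intro mult_left_mono) auto
    also have "\<dots> = \<bar>real l powr - \<alpha> - real l powr - \<alpha>\<^sub>0\<bar> * ln (real l)
        + \<bar>real l powr - \<alpha> - real l powr - \<alpha>\<^sub>0\<bar> * \<bar>\<mu>\<bar>"
      by (simp add: distrib_left)
    also have "\<dots> \<le> 4 * \<bar>\<alpha> - \<alpha>\<^sub>0\<bar> + \<bar>\<alpha> - \<alpha>\<^sub>0\<bar> * \<bar>\<mu>\<bar>"
      using db by (intro add_mono mult_right_mono) auto
    also have "\<dots> = (4 + \<bar>\<mu>\<bar>) * \<bar>\<alpha> - \<alpha>\<^sub>0\<bar>"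
      by (simp add: algebra_simps)
    also have "\<dots> \<le> (4 + \<bar>\<mu>\<bar>) * d"
      using da by (intro mult_left_mono) auto
    finally have ee: "\<bar>e0 l - e l\<bar> \<le> (4 + \<bar>\<mu>\<bar>) * d" .
    also have "\<dots> \<le> K * d"
      unfolding K_def using d0 by (intro mult_right_mono) auto
    finally show "\<bar>e0 l - e l\<bar> \<le> K * d" .
    have en: "real l powr - \<beta> * \<bar>ln (real l) - \<mu>\<bar> \<le> 1 + \<bar>\<mu>\<bar>" if "1 \<le> \<beta>" for \<beta>
    proof -
      have "real l powr - \<beta> * \<bar>ln (real l) - \<mu>\<bar> \<le> real l powr - \<beta> * (ln (real l) + \<bar>\<mu>\<bar>)"
        using b(1) by (intro mult_left_mono) auto
      also have "\<dots> = ln (real l) * real l powr - \<beta> + real l powr - \<beta> * \<bar>\<mu>\<bar>"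
        by (simp add: algebra_simps)
      also have "\<dots> \<le> 1 + 1 * \<bar>\<mu>\<bar>"
        using ln_powr_bounds[OF l1 that] by (intro add_mono mult_right_mono) auto
      finally show ?thesis by simp
    qed
    have e1: "\<bar>e l\<bar> \<le> 1 + \<bar>\<mu>\<bar>" and e01: "\<bar>e0 l\<bar> \<le> 1 + \<bar>\<mu>\<bar>"
      using en[OF \<alpha>] en[OF \<alpha>0] by (simp_all add: e_def e0_def abs_mult)
    then show "\<bar>e l\<bar> \<le> K"
      by (simp add: K_def)
    show \<delta>d: "\<bar>\<delta> l\<bar> \<le> d"
      unfolding \<delta>_def d_def by (rule dev_bound[OF l1 \<alpha>])
    have "r l = G\<^sub>0 * (p0 l - real l powr - \<alpha> - (\<alpha> - \<alpha>\<^sub>0) * ln (real l) * p0 l) - (G - G\<^sub>0) * (real l powr - \<alpha> - p0 l)"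
      by (simp add: r_def \<delta>_def dev_def p0_def algebra_simps)
    then have "\<bar>r l\<bar> \<le> \<bar>G\<^sub>0\<bar> * \<bar>p0 l - real l powr - \<alpha> - (\<alpha> - \<alpha>\<^sub>0) * ln (real l) * p0 l\<bar>
        + \<bar>G - G\<^sub>0\<bar> * \<bar>real l powr - \<alpha> - p0 l\<bar>"
      unfolding abs_mult[symmetric] by (simp only: abs_triangle_ineq4)
    also have "\<dots> \<le> 1 * (4 * (\<alpha> - \<alpha>\<^sub>0)\<^sup>2) + d * d"
      using db G0 da d0 unfolding p0_def by (intro add_mono mult_mono) auto
    also have "(\<alpha> - \<alpha>\<^sub>0)\<^sup>2 \<le> d * d"
      using da d0 by (metis abs_le_square_iff abs_of_nonneg power2_eq_square)
    finally have rb: "\<bar>r l\<bar> \<le> 5 * (d * d)"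
      by simp
    have "\<bar>s l * \<delta> l * (e0 l - e l)\<bar> + \<bar>s l * r l * e0 l\<bar>
        = s l * (\<bar>\<delta> l\<bar> * \<bar>e0 l - e l\<bar> + \<bar>r l\<bar> * \<bar>e0 l\<bar>)"
      using s[of l] by (simp add: abs_mult distrib_left mult_ac)
    also have "\<dots> \<le> s l * (d * ((4 + \<bar>\<mu>\<bar>) * d) + 5 * (d * d) * (1 + \<bar>\<mu>\<bar>))"
      using s[of l] \<delta>d ee rb e01 d0 by (intro mult_left_mono add_mono mult_mono) auto
    also have "\<dots> = K * d * (d * s l)"
      by (simp add: K_def algebra_simps)
    finally show "\<bar>s l * \<delta> l * (e0 l - e l)\<bar> + \<bar>s l * r l * e0 l\<bar> \<le> K * d * (d * s l)" .
  qed
  have "\<bar>?lhs\<bar> \<le> (\<Sum>l=1..L. \<bar>m l * (e0 l - e l) - (S l - s l) * \<delta> l * e l + s l * \<delta> l * (e0 l - e l) - s l * r l * e0 l\<bar>)"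
    unfolding expand by (rule sum_abs)
  also have "\<dots> \<le> (\<Sum>l=1..L. K * d * (\<bar>m l\<bar> + \<bar>S l - s l\<bar> + d * s l))"
  proof (rule sum_mono)
    fix l assume l: "l \<in> {1..L}"
    have "\<bar>m l * (e0 l - e l)\<bar> \<le> \<bar>m l\<bar> * (K * d)"
      unfolding abs_mult using bounds(1)[OF l] by (intro mult_left_mono) auto
    moreover have "\<bar>(S l - s l) * \<delta> l * e l\<bar> \<le> \<bar>S l - s l\<bar> * d * K"
      unfolding abs_mult using bounds(2,3)[OF l] d0 by (intro mult_mono) auto
    ultimately have "\<bar>m l * (e0 l - e l) - (S l - s l) * \<delta> l * e l + s l * \<delta> l * (e0 l - e l) - s l * r l * e0 l\<bar>
        \<le> \<bar>m l\<bar> * (K * d) + \<bar>S l - s l\<bar> * d * K + K * d * (d * s l)"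
      using bounds(4)[OF l] by linarith
    then show "\<bar>m l * (e0 l - e l) - (S l - s l) * \<delta> l * e l + s l * \<delta> l * (e0 l - e l) - s l * r l * e0 l\<bar>
        \<le> K * d * (\<bar>m l\<bar> + \<bar>S l - s l\<bar> + d * s l)"
      by (simp add: algebra_simps)
  qed
  also have "\<dots> = K * d * ((\<Sum>l=1..L. \<bar>m l\<bar>) + (\<Sum>l=1..L. \<bar>S l - s l\<bar>) + d * (\<Sum>l=1..L. s l))"
    by (simp add: sum_distrib_left[symmetric] sum.distrib)
  finally show ?thesis
    unfolding K_def e0_def .
qed

end


subsection \<open>Linear functionals of a random field on the sphere\<close>

lemma integral_sq_le:
  fixes f :: "real^3 \<Rightarrow> real"
  assumes f: "f \<in> borel_measurable surface" and f2: "integrable surface (\<lambda>x. (f x)\<^sup>2)"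
  shows "integrable surface f" "(\<integral>x. f x \<partial>surface)\<^sup>2 \<le> 4 * pi * (\<integral>x. (f x)\<^sup>2 \<partial>surface)"
proof -
  show i: "integrable surface f"
    using f f2 by (rule surface.square_integrable_imp_integrable)
  define m where "m = (\<integral>x. f x \<partial>surface) / (4 * pi)"
  have "0 \<le> (\<integral>x. (f x - m)\<^sup>2 \<partial>surface)"
    by simp
  also have "\<dots> = (\<integral>x. (f x)\<^sup>2 - 2 * m * f x + m\<^sup>2 \<partial>surface)"
    by (simp add: power2_diff algebra_simps)
  also have "\<dots> = (\<integral>x. (f x)\<^sup>2 \<partial>surface) - 2 * m * (\<integral>x. f x \<partial>surface) + m\<^sup>2 * (4 * pi)"
    using i f2 by (simp add: measure_surface_S2)
  also have "\<dots> = (\<integral>x. (f x)\<^sup>2 \<partial>surface) - (\<integral>x. f x \<partial>surface)\<^sup>2 / (4 * pi)"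
    by (simp add: m_def power2_eq_square field_simps)
  finally show "(\<integral>x. f x \<partial>surface)\<^sup>2 \<le> 4 * pi * (\<integral>x. (f x)\<^sup>2 \<partial>surface)"
    by (simp add: field_simps)
qed

definition smear :: "(real^3 \<Rightarrow> 'w \<Rightarrow> real) \<Rightarrow> (real^3 \<Rightarrow> real) \<Rightarrow> 'w \<Rightarrow> real" where
  "smear X g \<omega> = (\<integral>x. X x \<omega> * g x \<partial>surface)"

lemma harm_coeff_smear: "harm_coeff X l m t = smear (\<lambda>x. X x t) (sph_harm l m)"
  by (simp add: fun_eq_iff harm_coeff_def smear_def)

locale sfield = prob_space M for M :: "'w measure" +
  fixes X :: "real^3 \<Rightarrow> 'w \<Rightarrow> real" and K :: real
  assumes joint [measurable]: "(\<lambda>(\<omega>, x). X x \<omega>) \<in> borel_measurable (M \<Otimes>\<^sub>M surface)"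
    and sq_int: "\<And>x. x \<in> S2 \<Longrightarrow> integrable M (\<lambda>\<omega>. (X x \<omega>)\<^sup>2)"
    and sq_le: "\<And>x. x \<in> S2 \<Longrightarrow> expectation (\<lambda>\<omega>. (X x \<omega>)\<^sup>2) \<le> K"
begin

interpretation P: pair_sigma_finite M surface ..

lemma point_measurable: "x \<in> S2 \<Longrightarrow> X x \<in> borel_measurable M"
  using measurable_compose[OF measurable_Pair2'[of x surface M] joint] by simp

lemma path_measurable: "\<omega> \<in> space M \<Longrightarrow> (\<lambda>x. X x \<omega>) \<in> borel_measurable surface"
  using measurable_compose[OF measurable_Pair1'[of \<omega> M surface] joint] by simp

lemma sq_pair: "integrable (M \<Otimes>\<^sub>M surface) (\<lambda>(\<omega>, x). (X x \<omega>)\<^sup>2)"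
proof (rule integrableI_bounded)
  have "(\<integral>\<^sup>+p. ennreal (norm ((\<lambda>(\<omega>, x). (X x \<omega>)\<^sup>2) p)) \<partial>(M \<Otimes>\<^sub>M surface))
      = (\<integral>\<^sup>+x. (\<integral>\<^sup>+\<omega>. ennreal ((X x \<omega>)\<^sup>2) \<partial>M) \<partial>surface)"
    by (subst P.nn_integral_snd[symmetric]) (auto simp: case_prod_beta)
  also have "\<dots> \<le> (\<integral>\<^sup>+x. ennreal K \<partial>surface)"
  proof (rule nn_integral_mono)
    fix x assume "x \<in> space surface"
    then have x: "x \<in> S2"
      by simp
    then have "(\<integral>\<^sup>+\<omega>. ennreal ((X x \<omega>)\<^sup>2) \<partial>M) = ennreal (expectation (\<lambda>\<omega>. (X x \<omega>)\<^sup>2))"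
      by (intro nn_integral_eq_integral sq_int) auto
    then show "(\<integral>\<^sup>+\<omega>. ennreal ((X x \<omega>)\<^sup>2) \<partial>M) \<le> ennreal K"
      using sq_le[OF x] by (simp add: ennreal_leI)
  qed
  also have "\<dots> < \<infinity>"
    by (simp add: emeasure_surface_S2 ennreal_mult_less_top)
  finally show "(\<integral>\<^sup>+p. ennreal (norm ((\<lambda>(\<omega>, x). (X x \<omega>)\<^sup>2) p)) \<partial>(M \<Otimes>\<^sub>M surface)) < \<infinity>" .
qed measurable

lemma path_sq: "AE \<omega> in M. integrable surface (\<lambda>x. (X x \<omega>)\<^sup>2)"
  using P.AE_integrable_fst'[OF sq_pair] by simp

lemma path_sq_integrable: "integrable M (\<lambda>\<omega>. \<integral>x. (X x \<omega>)\<^sup>2 \<partial>surface)"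
  using P.integrable_fst'[OF sq_pair] by simp

lemma path_sq_swap: "(\<integral>\<omega>. (\<integral>x. (X x \<omega>)\<^sup>2 \<partial>surface) \<partial>M) = (\<integral>x. (\<integral>\<omega>. (X x \<omega>)\<^sup>2 \<partial>M) \<partial>surface)"
  by (rule P.Fubini_integral[symmetric]) (use sq_pair in simp)

lemma sq_section_integrable: "integrable surface (\<lambda>x. \<integral>\<omega>. (X x \<omega>)\<^sup>2 \<partial>M)"
  using P.integrable_snd[OF sq_pair] by simp

context
  fixes g :: "real^3 \<Rightarrow> real" and c :: real
  assumes g [measurable]: "g \<in> borel_measurable surface" and gc: "\<And>x. x \<in> S2 \<Longrightarrow> \<bar>g x\<bar> \<le> c"
begin

lemma smear_measurable [measurable]: "smear X g \<in> borel_measurable M"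
  unfolding smear_def[abs_def] by measurable

lemma smear_path_sq: "AE \<omega> in M. (smear X g \<omega>)\<^sup>2 \<le> 4 * pi * c\<^sup>2 * (\<integral>x. (X x \<omega>)\<^sup>2 \<partial>surface)
    \<and> integrable surface (\<lambda>x. X x \<omega> * g x)"
  using path_sq AE_space
proof eventually_elim
  case (elim \<omega>)
  have [measurable]: "(\<lambda>x. X x \<omega>) \<in> borel_measurable surface"
    using elim by (intro path_measurable)
  have le: "(X x \<omega> * g x)\<^sup>2 \<le> c\<^sup>2 * (X x \<omega>)\<^sup>2" if "x \<in> S2" for x
  proof -
    have "(g x)\<^sup>2 \<le> c\<^sup>2"
      using gc[OF that] by (simp add: abs_le_square_iff[symmetric])
    then show ?thesis
      by (simp add: power_mult_distrib mult.commute[of _ "(g x)\<^sup>2"] mult_right_mono)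
  qed
  have i2: "integrable surface (\<lambda>x. (X x \<omega> * g x)\<^sup>2)"
    by (rule Bochner_Integration.integrable_bound[of _ "\<lambda>x. c\<^sup>2 * (X x \<omega>)\<^sup>2"])
      (use elim le in \<open>auto intro!: AE_I2 simp: abs_mult\<close>)
  have "(smear X g \<omega>)\<^sup>2 \<le> 4 * pi * (\<integral>x. (X x \<omega> * g x)\<^sup>2 \<partial>surface)"
    unfolding smear_def by (rule integral_sq_le[OF _ i2]) measurable
  also have "(\<integral>x. (X x \<omega> * g x)\<^sup>2 \<partial>surface) \<le> (\<integral>x. c\<^sup>2 * (X x \<omega>)\<^sup>2 \<partial>surface)"
    using elim i2 le by (intro integral_mono) auto
  finally have "(smear X g \<omega>)\<^sup>2 \<le> 4 * pi * c\<^sup>2 * (\<integral>x. (X x \<omega>)\<^sup>2 \<partial>surface)"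
    by simp
  moreover have "integrable surface (\<lambda>x. X x \<omega> * g x)"
    by (rule integral_sq_le(1)[OF _ i2]) measurable
  ultimately show ?case
    by blast
qed

lemma smear_sq:
  shows "integrable M (\<lambda>\<omega>. (smear X g \<omega>)\<^sup>2)"
    and "expectation (\<lambda>\<omega>. (smear X g \<omega>)\<^sup>2) \<le> 4 * pi * c\<^sup>2 * (\<integral>x. (\<integral>\<omega>. (X x \<omega>)\<^sup>2 \<partial>M) \<partial>surface)"
proof -
  have b: "AE \<omega> in M. (smear X g \<omega>)\<^sup>2 \<le> 4 * pi * c\<^sup>2 * (\<integral>x. (X x \<omega>)\<^sup>2 \<partial>surface)"
    using smear_path_sq by eventually_elim simp
  show i: "integrable M (\<lambda>\<omega>. (smear X g \<omega>)\<^sup>2)"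
  proof (rule Bochner_Integration.integrable_bound)
    show "integrable M (\<lambda>\<omega>. 4 * pi * c\<^sup>2 * (\<integral>x. (X x \<omega>)\<^sup>2 \<partial>surface))"
      using path_sq_integrable by simp
    show "AE \<omega> in M. norm ((smear X g \<omega>)\<^sup>2) \<le> norm (4 * pi * c\<^sup>2 * (\<integral>x. (X x \<omega>)\<^sup>2 \<partial>surface))"
      using b by eventually_elim simp
  qed measurable
  have "expectation (\<lambda>\<omega>. (smear X g \<omega>)\<^sup>2) \<le> expectation (\<lambda>\<omega>. 4 * pi * c\<^sup>2 * (\<integral>x. (X x \<omega>)\<^sup>2 \<partial>surface))"
    by (rule integral_mono_AE[OF i _ b]) (use path_sq_integrable in simp)
  then show "expectation (\<lambda>\<omega>. (smear X g \<omega>)\<^sup>2) \<le> 4 * pi * c\<^sup>2 * (\<integral>x. (\<integral>\<omega>. (X x \<omega>)\<^sup>2 \<partial>M) \<partial>surface)"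
    by (simp add: path_sq_swap)
qed

lemma smear_mult:
  assumes W [measurable]: "W \<in> borel_measurable M" and W2: "integrable M (\<lambda>\<omega>. (W \<omega>)\<^sup>2)"
  shows "expectation (\<lambda>\<omega>. smear X g \<omega> * W \<omega>) = (\<integral>x. expectation (\<lambda>\<omega>. X x \<omega> * W \<omega>) * g x \<partial>surface)"
    and "(\<lambda>x. expectation (\<lambda>\<omega>. X x \<omega> * W \<omega>)) \<in> borel_measurable surface"
proof -
  define f where "f \<omega> x = X x \<omega> * g x * W \<omega>" for \<omega> x
  have bound: "AE p in M \<Otimes>\<^sub>M surface. norm ((\<lambda>(\<omega>, x). f \<omega> x) p) \<le> norm (\<bar>c\<bar> * ((\<lambda>(\<omega>, x). (X x \<omega>)\<^sup>2) p + (\<lambda>(\<omega>, x). (W \<omega>)\<^sup>2) p))"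
  proof (rule AE_I2)
    fix p assume "p \<in> space (M \<Otimes>\<^sub>M surface)"
    moreover obtain \<omega> x where p: "p = (\<omega>, x)"
      by (cases p)
    ultimately have x: "x \<in> S2"
      by (simp add: space_pair_measure)
    have "2 * \<bar>X x \<omega>\<bar> * \<bar>W \<omega>\<bar> \<le> (X x \<omega>)\<^sup>2 + (W \<omega>)\<^sup>2" "0 \<le> \<bar>X x \<omega>\<bar> * \<bar>W \<omega>\<bar>"
      using sum_squares_bound[of "\<bar>X x \<omega>\<bar>" "\<bar>W \<omega>\<bar>"] by auto
    then have "\<bar>X x \<omega>\<bar> * \<bar>W \<omega>\<bar> \<le> (X x \<omega>)\<^sup>2 + (W \<omega>)\<^sup>2"
      by linarith
    then have "\<bar>g x\<bar> * (\<bar>X x \<omega>\<bar> * \<bar>W \<omega>\<bar>) \<le> \<bar>c\<bar> * ((X x \<omega>)\<^sup>2 + (W \<omega>)\<^sup>2)"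
      using gc[OF x] by (intro mult_mono) auto
    then show "norm ((\<lambda>(\<omega>, x). f \<omega> x) p) \<le> norm (\<bar>c\<bar> * ((\<lambda>(\<omega>, x). (X x \<omega>)\<^sup>2) p + (\<lambda>(\<omega>, x). (W \<omega>)\<^sup>2) p))"
      by (simp add: p f_def abs_mult mult_ac)
  qed
  have W2p: "integrable (M \<Otimes>\<^sub>M surface) (\<lambda>(\<omega>, x). (W \<omega>)\<^sup>2)"
    by (rule P.Fubini_integrable) (use W2 in \<open>auto simp: case_prod_beta\<close>)
  have fi: "integrable (M \<Otimes>\<^sub>M surface) (\<lambda>(\<omega>, x). f \<omega> x)"
  proof (rule Bochner_Integration.integrable_bound[OF _ _ bound])
    show "integrable (M \<Otimes>\<^sub>M surface) (\<lambda>p. \<bar>c\<bar> * ((\<lambda>(\<omega>, x). (X x \<omega>)\<^sup>2) p + (\<lambda>(\<omega>, x). (W \<omega>)\<^sup>2) p))"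
      by (intro integrable_mult_right Bochner_Integration.integrable_add sq_pair W2p)
  qed (simp add: f_def case_prod_beta)
  have "expectation (\<lambda>\<omega>. smear X g \<omega> * W \<omega>) = expectation (\<lambda>\<omega>. \<integral>x. f \<omega> x \<partial>surface)"
    by (simp add: smear_def f_def)
  also have "\<dots> = (\<integral>x. expectation (\<lambda>\<omega>. f \<omega> x) \<partial>surface)"
    by (rule P.Fubini_integral[symmetric]) (use fi in simp)
  also have "\<dots> = (\<integral>x. expectation (\<lambda>\<omega>. X x \<omega> * W \<omega>) * g x \<partial>surface)"
  proof (intro Bochner_Integration.integral_cong refl)
    fix x
    have "f \<omega> x = (X x \<omega> * W \<omega>) * g x" for \<omega>
      by (simp add: f_def)
    then show "expectation (\<lambda>\<omega>. f \<omega> x) = expectation (\<lambda>\<omega>. X x \<omega> * W \<omega>) * g x"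
      by (simp only: integral_mult_left_zero)
  qed
  finally show "expectation (\<lambda>\<omega>. smear X g \<omega> * W \<omega>) = (\<integral>x. expectation (\<lambda>\<omega>. X x \<omega> * W \<omega>) * g x \<partial>surface)" .
  have "(\<lambda>(x, \<omega>). X x \<omega> * W \<omega>) \<in> borel_measurable (surface \<Otimes>\<^sub>M M)"
    using measurable_compose[OF measurable_pair_swap' joint] by (simp add: case_prod_beta)
  then show "(\<lambda>x. expectation (\<lambda>\<omega>. X x \<omega> * W \<omega>)) \<in> borel_measurable surface"
    by (rule borel_measurable_lebesgue_integral)
qed

end

end

lemma smear_covariance:
  assumes X: "sfield M X K" and Y: "sfield M Y K'"
    and f: "f \<in> borel_measurable surface" "\<And>x. x \<in> S2 \<Longrightarrow> \<bar>f x\<bar> \<le> c"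
    and g: "g \<in> borel_measurable surface" "\<And>x. x \<in> S2 \<Longrightarrow> \<bar>g x\<bar> \<le> c'"
  shows "(\<integral>\<omega>. smear X f \<omega> * smear Y g \<omega> \<partial>M)
    = (\<integral>x. (\<integral>y. (\<integral>\<omega>. X x \<omega> * Y y \<omega> \<partial>M) * g y \<partial>surface) * f x \<partial>surface)"
proof -
  interpret X: sfield M X K by fact
  interpret Y: sfield M Y K' by fact
  have "(\<integral>\<omega>. smear X f \<omega> * smear Y g \<omega> \<partial>M) = (\<integral>x. (\<integral>\<omega>. X x \<omega> * smear Y g \<omega> \<partial>M) * f x \<partial>surface)"
    by (rule X.smear_mult[OF f Y.smear_measurable[OF g] Y.smear_sq(1)[OF g]])
  also have "\<dots> = (\<integral>x. (\<integral>y. (\<integral>\<omega>. X x \<omega> * Y y \<omega> \<partial>M) * g y \<partial>surface) * f x \<partial>surface)"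
  proof (rule Bochner_Integration.integral_cong)
    fix x assume "x \<in> space surface"
    then have x: "x \<in> S2"
      by simp
    have "(\<integral>\<omega>. smear Y g \<omega> * X x \<omega> \<partial>M) = (\<integral>y. (\<integral>\<omega>. Y y \<omega> * X x \<omega> \<partial>M) * g y \<partial>surface)"
      by (rule Y.smear_mult[OF g X.point_measurable[OF x] X.sq_int[OF x]])
    then show "(\<integral>\<omega>. X x \<omega> * smear Y g \<omega> \<partial>M) * f x
        = (\<integral>y. (\<integral>\<omega>. X x \<omega> * Y y \<omega> \<partial>M) * g y \<partial>surface) * f x"
      by (simp add: mult.commute)
  qed simp
  finally show ?thesis .
qed


subsection \<open>Approximation by finite linear combinations\<close>

text \<open>Composing a field with such maps leaves finitely many of its point values. Simple
  approximations of the identity in space are brought back to the sphere by normalisation; the pole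
  is the default where the approximation is 0.\<close>

lemma sphere_simple_approximation:
  obtains r :: "nat \<Rightarrow> real^3 \<Rightarrow> real^3" where
    "\<And>n. simple_function surface (r n)" "\<And>n x. r n x \<in> S2"
    "\<And>x. x \<in> S2 \<Longrightarrow> (\<lambda>n. r n x) \<longlonglongrightarrow> x"
proof -
  have id: "(\<lambda>x :: real^3. x) \<in> borel_measurable surface"
    by (intro continuous_measurable_surface continuous_intros)
  obtain F :: "nat \<Rightarrow> real^3 \<Rightarrow> real^3" where F: "\<And>n. simple_function surface (F n)"
    "\<And>x. x \<in> S2 \<Longrightarrow> (\<lambda>n. F n x) \<longlonglongrightarrow> x"
    using borel_measurable_implies_sequence_metric[OF id, of 0] unfolding space_surface by blast
  define \<rho> where "\<rho> v = (if v = 0 then axis 3 1 else v /\<^sub>R norm v)" for v :: "real^3"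
  show ?thesis
  proof (rule that[of "\<lambda>n x. \<rho> (F n x)"])
    show "simple_function surface (\<lambda>x. \<rho> (F n x))" for n
      by (rule simple_function_compose1[OF F(1)])
    show "\<rho> (F n x) \<in> S2" for n x
      by (simp add: \<rho>_def)
    show "(\<lambda>n. \<rho> (F n x)) \<longlonglongrightarrow> x" if x: "x \<in> S2" for x
    proof -
      have x1: "norm x = 1"
        using x by simp
      have "(\<lambda>n. F n x /\<^sub>R norm (F n x)) \<longlonglongrightarrow> x /\<^sub>R norm x"
        using x1 by (intro tendsto_intros F(2)[OF x]) auto
      moreover have "\<forall>\<^sub>F n in sequentially. F n x \<noteq> 0"
        using x1 by (intro tendsto_imp_eventually_ne[OF F(2)[OF x]]) auto
      then have "\<forall>\<^sub>F n in sequentially. F n x /\<^sub>R norm (F n x) = \<rho> (F n x)"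
        by eventually_elim (simp add: \<rho>_def)
      ultimately have "(\<lambda>n. \<rho> (F n x)) \<longlonglongrightarrow> x /\<^sub>R norm x"
        by (rule Lim_transform_eventually)
      then show ?thesis
        by (simp add: x1)
    qed
  qed
qed

context sfield
begin

lemma diff_sq:
  assumes "x \<in> S2" "y \<in> S2"
  shows "integrable M (\<lambda>\<omega>. (X y \<omega> - X x \<omega>)\<^sup>2)" "expectation (\<lambda>\<omega>. (X y \<omega> - X x \<omega>)\<^sup>2) \<le> 4 * K"
proof -
  have [measurable]: "X x \<in> borel_measurable M" "X y \<in> borel_measurable M"
    using point_measurable assms by auto
  have le: "(X y \<omega> - X x \<omega>)\<^sup>2 \<le> 2 * (X y \<omega>)\<^sup>2 + 2 * (X x \<omega>)\<^sup>2" for \<omega>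
    using zero_le_power2[of "X y \<omega> + X x \<omega>"] by (simp add: power2_sum power2_diff)
  have i: "integrable M (\<lambda>\<omega>. 2 * (X y \<omega>)\<^sup>2 + 2 * (X x \<omega>)\<^sup>2)"
    using sq_int assms by simp
  show *: "integrable M (\<lambda>\<omega>. (X y \<omega> - X x \<omega>)\<^sup>2)"
    by (rule Bochner_Integration.integrable_bound[OF i]) (use le in \<open>auto intro!: AE_I2\<close>)
  have "expectation (\<lambda>\<omega>. (X y \<omega> - X x \<omega>)\<^sup>2) \<le> expectation (\<lambda>\<omega>. 2 * (X y \<omega>)\<^sup>2 + 2 * (X x \<omega>)\<^sup>2)"
    by (rule integral_mono[OF * i le])
  also have "\<dots> = 2 * expectation (\<lambda>\<omega>. (X y \<omega>)\<^sup>2) + 2 * expectation (\<lambda>\<omega>. (X x \<omega>)\<^sup>2)"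
    using sq_int assms by simp
  finally show "expectation (\<lambda>\<omega>. (X y \<omega> - X x \<omega>)\<^sup>2) \<le> 4 * K"
    using sq_le[OF assms(1)] sq_le[OF assms(2)] by linarith
qed

text \<open>The sums are the integrals of the field composed with the simple maps, with weights the
  integrals of g over their level sets. The error is again a smeared field, of increments, whose
  second moment tends to 0 by mean-square continuity and dominated convergence with the constant 4
  K.\<close>

lemma smear_approximation:
  fixes g :: "real^3 \<Rightarrow> real"
  assumes ms: "\<And>x. x \<in> S2 \<Longrightarrow> ((\<lambda>y. expectation (\<lambda>\<omega>. (X y \<omega> - X x \<omega>)\<^sup>2)) \<longlongrightarrow> 0) (at x within S2)"
    and g [measurable]: "g \<in> borel_measurable surface" and gc: "\<And>x. x \<in> S2 \<Longrightarrow> \<bar>g x\<bar> \<le> c"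
  obtains A :: "nat \<Rightarrow> (real^3) set" and w :: "nat \<Rightarrow> real^3 \<Rightarrow> real" where
    "\<And>n. finite (A n)" "\<And>n. A n \<subseteq> S2"
    "\<And>n. integrable M (\<lambda>\<omega>. ((\<Sum>p\<in>A n. w n p * X p \<omega>) - smear X g \<omega>)\<^sup>2)"
    "(\<lambda>n. expectation (\<lambda>\<omega>. ((\<Sum>p\<in>A n. w n p * X p \<omega>) - smear X g \<omega>)\<^sup>2)) \<longlonglongrightarrow> 0"
proof -
  obtain r :: "nat \<Rightarrow> real^3 \<Rightarrow> real^3" where r: "\<And>n. simple_function surface (r n)"
    "\<And>n x. r n x \<in> S2" "\<And>x. x \<in> S2 \<Longrightarrow> (\<lambda>n. r n x) \<longlonglongrightarrow> x"
    using sphere_simple_approximation by blast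
  define D where "D n x \<omega> = X (r n x) \<omega> - X x \<omega>" for n x \<omega>
  have rm: "r n \<in> surface \<rightarrow>\<^sub>M surface" for n
  proof -
    have "r n \<in> surface \<rightarrow>\<^sub>M restrict_space borel S2"
      using r(2) by (intro measurable_restrict_space2 borel_measurable_simple_function r(1)) auto
    then show ?thesis
      by (simp add: measurable_cong_sets[OF refl sets_surface])
  qed
  have Df: "sfield M (D n) (4 * K)" for n
  proof
    have "(\<lambda>(\<omega>, x). (\<omega>, r n x)) \<in> M \<Otimes>\<^sub>M surface \<rightarrow>\<^sub>M M \<Otimes>\<^sub>M surface"
      using rm[of n] by measurable
    from measurable_compose[OF this joint]
    have "(\<lambda>(\<omega>, x). X (r n x) \<omega>) \<in> borel_measurable (M \<Otimes>\<^sub>M surface)"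
      by (simp add: case_prod_beta)
    then show "(\<lambda>(\<omega>, x). D n x \<omega>) \<in> borel_measurable (M \<Otimes>\<^sub>M surface)"
      using joint unfolding D_def case_prod_beta by (rule borel_measurable_diff)
    fix x assume x: "x \<in> S2"
    show "integrable M (\<lambda>\<omega>. (D n x \<omega>)\<^sup>2)" "expectation (\<lambda>\<omega>. (D n x \<omega>)\<^sup>2) \<le> 4 * K"
      unfolding D_def by (rule diff_sq[OF x r(2)])+
  qed
  define A where "A n = r n ` S2" for n
  define w where "w n p = (\<integral>x. indicator {x. r n x = p} x * g x \<partial>surface)" for n p
  have A: "finite (A n)" "A n \<subseteq> S2" for n
    using r(1)[of n] r(2) unfolding A_def simple_function_def by auto
  have ind [measurable]: "(indicator {x. r n x = p} :: _ \<Rightarrow> real) \<in> borel_measurable surface" for n p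
  proof -
    have "(\<lambda>x. if r n x = p then 1 else 0 :: real) \<in> borel_measurable surface"
      by (rule borel_measurable_simple_function[OF simple_function_compose1[OF r(1)]])
    moreover have "(\<lambda>x. if r n x = p then 1 else 0 :: real) = indicator {x. r n x = p}"
      by (auto simp: indicator_def)
    ultimately show ?thesis
      by (simp only:)
  qed
  have smear_r: "(\<integral>x. X (r n x) \<omega> * g x \<partial>surface) = (\<Sum>p\<in>A n. w n p * X p \<omega>)"
    and int_r: "integrable surface (\<lambda>x. X (r n x) \<omega> * g x)" for n \<omega>
  proof -
    have i: "integrable surface (\<lambda>x. indicator {x. r n x = p} x * g x)" for p
    proof (rule integrable_surface_bounded)
      fix x assume "x \<in> S2"
      then have "\<bar>g x\<bar> \<le> \<bar>c\<bar>"
        using gc[of x] by linarith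
      then show "\<bar>indicator {x. r n x = p} x * g x\<bar> \<le> \<bar>c\<bar>"
        by (simp add: indicator_def)
    qed measurable
    have eq: "X (r n x) \<omega> * g x = (\<Sum>p\<in>A n. X p \<omega> * (indicator {x. r n x = p} x * g x))" if "x \<in> S2" for x
    proof -
      have "(\<Sum>p\<in>A n. X p \<omega> * (indicator {x. r n x = p} x * g x))
          = (\<Sum>p\<in>A n. if p = r n x then X p \<omega> * g x else 0)"
        by (intro sum.cong) (auto simp: indicator_def)
      also have "\<dots> = X (r n x) \<omega> * g x"
        using A(1)[of n] that by (auto simp: A_def)
      finally show ?thesis ..
    qed
    have "integrable surface (\<lambda>x. \<Sum>p\<in>A n. X p \<omega> * (indicator {x. r n x = p} x * g x))"
      by (intro Bochner_Integration.integrable_sum integrable_mult_right i)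
    then show "integrable surface (\<lambda>x. X (r n x) \<omega> * g x)"
      by (subst Bochner_Integration.integrable_cong[OF refl eq]) simp_all
    have "(\<integral>x. X (r n x) \<omega> * g x \<partial>surface)
        = (\<integral>x. (\<Sum>p\<in>A n. X p \<omega> * (indicator {x. r n x = p} x * g x)) \<partial>surface)"
      by (intro Bochner_Integration.integral_cong refl eq) simp
    also have "\<dots> = (\<Sum>p\<in>A n. w n p * X p \<omega>)"
      using i by (simp add: w_def mult.commute)
    finally show "(\<integral>x. X (r n x) \<omega> * g x \<partial>surface) = (\<Sum>p\<in>A n. w n p * X p \<omega>)" .
  qed
  have Yeq: "AE \<omega> in M. (\<Sum>p\<in>A n. w n p * X p \<omega>) - smear X g \<omega> = smear (D n) g \<omega>" for n
  proof -
    have "AE \<omega> in M. (smear X g \<omega>)\<^sup>2 \<le> 4 * pi * c\<^sup>2 * (\<integral>x. (X x \<omega>)\<^sup>2 \<partial>surface)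
        \<and> integrable surface (\<lambda>x. X x \<omega> * g x)"
      by (rule smear_path_sq[OF g gc])
    then show ?thesis
    proof eventually_elim
    case (elim \<omega>)
    then show ?case
      using int_r[of n \<omega>] by (simp add: smear_def smear_r[symmetric] D_def left_diff_distrib)
    qed
  qed
  have XA [measurable]: "X p \<in> borel_measurable M" if "p \<in> A n" for p n
    using A that point_measurable by blast
  have [measurable]: "smear X g \<in> borel_measurable M"
    by (rule smear_measurable[OF g gc])
  have Dm [measurable]: "smear (D n) g \<in> borel_measurable M" for n
    by (rule sfield.smear_measurable[OF Df g gc])
  have Ym: "(\<lambda>\<omega>. ((\<Sum>p\<in>A n. w n p * X p \<omega>) - smear X g \<omega>)\<^sup>2) \<in> borel_measurable M" for n
    by measurable
  have AEsq: "AE \<omega> in M. ((\<Sum>p\<in>A n. w n p * X p \<omega>) - smear X g \<omega>)\<^sup>2 = (smear (D n) g \<omega>)\<^sup>2" for n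
    using Yeq[of n] by eventually_elim simp
  have i: "integrable M (\<lambda>\<omega>. ((\<Sum>p\<in>A n. w n p * X p \<omega>) - smear X g \<omega>)\<^sup>2)" for n
    using integrable_cong_AE[OF Ym _ AEsq] sfield.smear_sq(1)[OF Df g gc] by simp
  have E: "expectation (\<lambda>\<omega>. ((\<Sum>p\<in>A n. w n p * X p \<omega>) - smear X g \<omega>)\<^sup>2) = expectation (\<lambda>\<omega>. (smear (D n) g \<omega>)\<^sup>2)" for n
    by (rule integral_cong_AE[OF Ym _ AEsq]) measurable
  have "(\<lambda>n. \<integral>x. expectation (\<lambda>\<omega>. (D n x \<omega>)\<^sup>2) \<partial>surface) \<longlonglongrightarrow> (\<integral>x. 0 \<partial>surface)"
  proof (rule integral_dominated_convergence[where w = "\<lambda>x. 4 * K"])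
    show "(\<lambda>x. expectation (\<lambda>\<omega>. (D n x \<omega>)\<^sup>2)) \<in> borel_measurable surface" for n
      using sfield.sq_section_integrable[OF Df] by (rule borel_measurable_integrable)
    show "AE x in surface. (\<lambda>n. expectation (\<lambda>\<omega>. (D n x \<omega>)\<^sup>2)) \<longlonglongrightarrow> 0"
    proof (rule AE_I2)
      fix x assume "x \<in> space surface"
      then have x: "x \<in> S2"
        by simp
      define h where "h y = expectation (\<lambda>\<omega>. (X y \<omega> - X x \<omega>)\<^sup>2)" for y
      have "h x = 0"
        by (simp add: h_def)
      moreover have "(h \<longlongrightarrow> 0) (at x within S2)"
        unfolding h_def by (rule ms[OF x])
      ultimately have "continuous (at x within S2) h"
        by (simp only: continuous_within)
      from continuous_within_tendsto_compose'[OF this r(2) r(3)[OF x]]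
      have "(\<lambda>n. h (r n x)) \<longlonglongrightarrow> h x" .
      then show "(\<lambda>n. expectation (\<lambda>\<omega>. (D n x \<omega>)\<^sup>2)) \<longlonglongrightarrow> 0"
        unfolding \<open>h x = 0\<close> by (simp only: h_def D_def o_def)
    qed
    show "AE x in surface. norm (expectation (\<lambda>\<omega>. (D n x \<omega>)\<^sup>2)) \<le> 4 * K" for n
      using sfield.sq_le[OF Df] by (intro AE_I2) simp
  qed auto
  then have "(\<lambda>n. 4 * pi * c\<^sup>2 * (\<integral>x. expectation (\<lambda>\<omega>. (D n x \<omega>)\<^sup>2) \<partial>surface)) \<longlonglongrightarrow> 4 * pi * c\<^sup>2 * 0"
    by (intro tendsto_mult_left) simp
  then have lim: "(\<lambda>n. 4 * pi * c\<^sup>2 * (\<integral>x. expectation (\<lambda>\<omega>. (D n x \<omega>)\<^sup>2) \<partial>surface)) \<longlonglongrightarrow> 0"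
    by simp
  have le: "expectation (\<lambda>\<omega>. (smear (D n) g \<omega>)\<^sup>2)
      \<le> 4 * pi * c\<^sup>2 * (\<integral>x. expectation (\<lambda>\<omega>. (D n x \<omega>)\<^sup>2) \<partial>surface)" for n
    by (rule sfield.smear_sq(2)[OF Df g gc])
  have "(\<lambda>n. expectation (\<lambda>\<omega>. (smear (D n) g \<omega>)\<^sup>2)) \<longlonglongrightarrow> 0"
    by (rule tendsto_sandwich[OF _ _ tendsto_const lim]) (simp_all add: le always_eventually)
  then have "(\<lambda>n. expectation (\<lambda>\<omega>. ((\<Sum>p\<in>A n. w n p * X p \<omega>) - smear X g \<omega>)\<^sup>2)) \<longlonglongrightarrow> 0"
    by (simp only: E)
  then show ?thesis
    by (rule that[OF A i])
qed

text \<open>A path integral is not visibly a function of the point values in the product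
  sigma-algebra, where the laws and independence are given. Along a subsequence the approximating
  sums converge almost surely, and their limit is such a function. The map \<open>\<iota>\<close>
  re-indexes points, since later the indices are pairs of a point and a time.\<close>

lemma smear_version:
  fixes g :: "real^3 \<Rightarrow> real" and \<iota> :: "real^3 \<Rightarrow> 'i" and W :: "'i \<Rightarrow> 'w \<Rightarrow> real"
  assumes ms: "\<And>x. x \<in> S2 \<Longrightarrow> ((\<lambda>y. expectation (\<lambda>\<omega>. (X y \<omega> - X x \<omega>)\<^sup>2)) \<longlongrightarrow> 0) (at x within S2)"
    and g: "g \<in> borel_measurable surface" and gc: "\<And>x. x \<in> S2 \<Longrightarrow> \<bar>g x\<bar> \<le> c"
    and \<iota>: "\<And>x. x \<in> S2 \<Longrightarrow> \<iota> x \<in> J" and W: "\<And>x. x \<in> S2 \<Longrightarrow> W (\<iota> x) = X x"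
  shows "\<exists>F. F \<in> borel_measurable (PiM J (\<lambda>_. borel)) \<and> (AE \<omega> in M. smear X g \<omega> = F (\<lambda>j\<in>J. W j \<omega>))"
proof -
  obtain A w where A: "\<And>n. finite (A n)" "\<And>n. A n \<subseteq> S2"
    "\<And>n. integrable M (\<lambda>\<omega>. ((\<Sum>p\<in>A n. w n p * X p \<omega>) - smear X g \<omega>)\<^sup>2)"
    "(\<lambda>n. expectation (\<lambda>\<omega>. ((\<Sum>p\<in>A n. w n p * X p \<omega>) - smear X g \<omega>)\<^sup>2)) \<longlonglongrightarrow> 0"
    by (rule smear_approximation[OF ms g gc]) (assumption | rule that)+
  obtain s where s: "strict_mono s"
    "AE \<omega> in M. (\<lambda>n. ((\<Sum>p\<in>A (s n). w (s n) p * X p \<omega>) - smear X g \<omega>)\<^sup>2) \<longlonglongrightarrow> 0"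
  proof -
    have "\<exists>s. strict_mono s
        \<and> (AE \<omega> in M. (\<lambda>n. ((\<Sum>p\<in>A (s n). w (s n) p * X p \<omega>) - smear X g \<omega>)\<^sup>2) \<longlonglongrightarrow> 0)"
      by (rule tendsto_L1_AE_subseq[OF A(3)]) (use A(4) in simp)
    then show ?thesis
      by (elim exE conjE) (rule that)
  qed
  \<comment> \<open>\<open>lim\<close> is total and preserves measurability; where the sums diverge
    it takes some default value, on a set of paths of measure 0.\<close>
  define F where "F f = lim (\<lambda>n. \<Sum>p\<in>A (s n). w (s n) p * f (\<iota> p))" for f :: "'i \<Rightarrow> real"
  have "(\<lambda>f. f (\<iota> p)) \<in> borel_measurable (PiM J (\<lambda>_. borel :: real measure))" if "p \<in> A n" for n p
  proof (rule measurable_component_singleton)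
    show "\<iota> p \<in> J"
      using A(2)[of n] that \<iota> by blast
  qed
  then have F: "F \<in> borel_measurable (PiM J (\<lambda>_. borel))"
    unfolding F_def
    by (intro borel_measurable_lim_metric borel_measurable_sum borel_measurable_times borel_measurable_const)
  have "AE \<omega> in M. smear X g \<omega> = F (\<lambda>j\<in>J. W j \<omega>)"
    using s(2)
  proof eventually_elim
    case (elim \<omega>)
    have "(\<lambda>n. \<bar>(\<Sum>p\<in>A (s n). w (s n) p * X p \<omega>) - smear X g \<omega>\<bar>) \<longlonglongrightarrow> 0"
      using tendsto_real_sqrt[OF elim] by (simp only: real_sqrt_abs real_sqrt_zero)
    then have "(\<lambda>n. \<Sum>p\<in>A (s n). w (s n) p * X p \<omega>) \<longlonglongrightarrow> smear X g \<omega>"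
      by (rule LIM_zero_cancel[OF tendsto_rabs_zero_cancel])
    moreover have "(\<Sum>p\<in>A (s n). w (s n) p * X p \<omega>) = (\<Sum>p\<in>A (s n). w (s n) p * (\<lambda>j\<in>J. W j \<omega>) (\<iota> p))" for n
    proof (rule sum.cong)
      fix p assume "p \<in> A (s n)"
      then have "p \<in> S2"
        using A(2)[of "s n"] by blast
      then show "w (s n) p * X p \<omega> = w (s n) p * (\<lambda>j\<in>J. W j \<omega>) (\<iota> p)"
        using \<iota> W by (simp del: mem_sphere_0)
    qed simp
    ultimately show ?case
      unfolding F_def by (simp only: limI)
  qed
  with F show ?thesis
    by (intro exI[of _ F] conjI)
qed

end

subsection \<open>Gaussian fields\<close>

lemma char_normal_density:
  assumes "0 < \<sigma>"
  shows "char (density lborel (normal_density 0 \<sigma>)) u = exp (- (\<sigma>\<^sup>2 * u\<^sup>2) / 2)"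
proof -
  interpret N: prob_space "density lborel (normal_density 0 \<sigma>)"
    by (rule prob_space_normal_density[OF assms])
  have "distributed (density lborel (normal_density 0 \<sigma>)) lborel (\<lambda>x. (x - 0) / \<sigma>) (normal_density 0 1)"
    using N.normal_standard_normal_convert[OF assms, of "\<lambda>x. x" 0]
    by (simp add: distributed_def distr_id2)
  then have d: "distr (density lborel (normal_density 0 \<sigma>)) borel (\<lambda>x. x / \<sigma>) = std_normal_distribution"
    by (simp add: distributed_def cong: distr_cong)
  have "char (density lborel (normal_density 0 \<sigma>)) u
      = (CLINT x|density lborel (normal_density 0 \<sigma>). iexp ((\<sigma> * u) * (x / \<sigma>)))"
    unfolding char_def using assms by (intro Bochner_Integration.integral_cong) (auto simp: field_simps)
  also have "\<dots> = char (distr (density lborel (normal_density 0 \<sigma>)) borel (\<lambda>x. x / \<sigma>)) (\<sigma> * u)"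
    unfolding char_def by (subst integral_distr) auto
  also have "\<dots> = exp (- (\<sigma>\<^sup>2 * u\<^sup>2) / 2)"
    unfolding d char_std_normal_distribution by (simp add: power_mult_distrib)
  finally show ?thesis .
qed

lemma (in prob_space) gaussian_rv_sq_integrable:
  assumes "gaussian_rv M X"
  shows "X \<in> borel_measurable M" "integrable M (\<lambda>\<omega>. (X \<omega>)\<^sup>2)"
proof -
  show X [measurable]: "X \<in> borel_measurable M"
    using assms by (simp add: gaussian_rv_def)
  obtain \<mu> \<sigma> where \<sigma>: "\<sigma> \<ge> 0"
    "distr M borel X = (if \<sigma> = 0 then return borel \<mu> else density lborel (normal_density \<mu> \<sigma>))"
    using assms unfolding gaussian_rv_def by blast
  have "integrable (distr M borel X) (\<lambda>x. x\<^sup>2)"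
  proof (cases "\<sigma> = 0")
    case True
    interpret R: prob_space "return borel \<mu>"
      by (rule prob_space_return) simp
    have "integrable (return borel \<mu>) (\<lambda>x. x\<^sup>2)"
      by (rule R.integrable_const_bound[where B = "\<mu>\<^sup>2"]) (simp_all add: AE_return)
    then show ?thesis
      using \<sigma>(2) True by simp
  next
    case False
    then have s: "0 < \<sigma>"
      using \<sigma>(1) by simp
    have "integrable lborel (\<lambda>x. normal_density \<mu> \<sigma> x * x\<^sup>2)"
    proof -
      have 1: "integrable lborel (\<lambda>x. normal_density \<mu> \<sigma> x * (x - \<mu>)\<^sup>2)"
        using normal_moment_even[OF s, of \<mu> 1] by (simp add: has_bochner_integral_iff)
      have 2: "integrable lborel (\<lambda>x. normal_density \<mu> \<sigma> x * x)"
        using normal_moment_nz_1[OF s, of \<mu>] by (simp add: has_bochner_integral_iff)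
      have 3: "integrable lborel (normal_density \<mu> \<sigma>)"
        using s by (rule integrable_normal_density)
      have "(\<lambda>x. normal_density \<mu> \<sigma> x * x\<^sup>2)
          = (\<lambda>x. normal_density \<mu> \<sigma> x * (x - \<mu>)\<^sup>2 + 2 * \<mu> * (normal_density \<mu> \<sigma> x * x) - \<mu>\<^sup>2 * normal_density \<mu> \<sigma> x)"
        by (simp add: fun_eq_iff power2_diff algebra_simps power2_eq_square)
      then show ?thesis
        using 1 2 3 by simp
    qed
    then show ?thesis
      using False \<sigma>(2) by (simp add: integrable_density)
  qed
  then show "integrable M (\<lambda>\<omega>. (X \<omega>)\<^sup>2)"
    by (simp add: integrable_distr_eq)
qed

lemma (in prob_space) gaussian_rv_char:
  assumes g: "gaussian_rv M X" and c: "expectation X = 0"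
  shows "(CLINT \<omega>|M. iexp (u * X \<omega>)) = exp (- (u\<^sup>2 * expectation (\<lambda>\<omega>. (X \<omega>)\<^sup>2)) / 2)"
proof -
  have X [measurable]: "X \<in> borel_measurable M"
    using g by (simp add: gaussian_rv_def)
  obtain \<mu> \<sigma> where \<sigma>: "\<sigma> \<ge> 0"
    "distr M borel X = (if \<sigma> = 0 then return borel \<mu> else density lborel (normal_density \<mu> \<sigma>))"
    using g unfolding gaussian_rv_def by blast
  have E: "expectation X = (\<integral>x. x \<partial>distr M borel X)" "expectation (\<lambda>\<omega>. (X \<omega>)\<^sup>2) = (\<integral>x. x\<^sup>2 \<partial>distr M borel X)"
    "(CLINT \<omega>|M. iexp (u * X \<omega>)) = char (distr M borel X) u"
    unfolding char_def by (subst integral_distr; simp)+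
  show ?thesis
  proof (cases "\<sigma> = 0")
    case True
    then have "\<mu> = 0"
      using c \<sigma>(2) unfolding E by (simp add: integral_return)
    then show ?thesis
      unfolding E using True \<sigma>(2) by (simp add: integral_return char_def)
  next
    case False
    then have s: "0 < \<sigma>" and d: "distr M borel X = density lborel (normal_density \<mu> \<sigma>)"
      using \<sigma> by auto
    have "\<mu> = 0"
      using c integral_normal_moment_nz_1[OF s, of \<mu>] unfolding E d by (subst (asm) integral_density) auto
    then have d0: "distr M borel X = density lborel (normal_density 0 \<sigma>)"
      using d by simp
    have "expectation (\<lambda>\<omega>. (X \<omega>)\<^sup>2) = \<sigma>\<^sup>2"
      using normal_rv_moments(2)[OF X s d0] by (simp add: has_bochner_integral_iff)
    then show ?thesis
      unfolding E(3) d0 char_normal_density[OF s] by (simp add: mult.commute)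
  qed
qed

section \<open>Comparison of characteristic functions and of second moments\<close>

lemma norm_iexp_diff_le: "norm (iexp a - iexp b) \<le> \<bar>a - b\<bar>"
proof -
  have "exp (\<i> * of_real a) - exp (\<i> * of_real b) = exp (\<i> * of_real b) * (exp (\<i> * of_real (a - b)) - 1)"
    by (simp add: algebra_simps flip: exp_add)
  then have "norm (exp (\<i> * of_real a) - exp (\<i> * of_real b)) = 2 * \<bar>sin ((a - b) / 2)\<bar>"
    by (simp only: norm_mult dist_exp_i_1) simp
  also have "\<dots> \<le> \<bar>a - b\<bar>"
    using abs_sin_x_le_abs_x[of "(a - b) / 2"] by simp
  finally show ?thesis .
qed

lemma (in prob_space) char_diff_le_expectation:
  assumes [measurable]: "X \<in> borel_measurable M" "Y \<in> borel_measurable M"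
    and i: "integrable M (\<lambda>\<omega>. X \<omega> - Y \<omega>)"
  shows "norm ((CLINT \<omega>|M. iexp (u * X \<omega>)) - (CLINT \<omega>|M. iexp (u * Y \<omega>)))
    \<le> \<bar>u\<bar> * expectation (\<lambda>\<omega>. \<bar>X \<omega> - Y \<omega>\<bar>)"
proof -
  have e: "integrable M (\<lambda>\<omega>. iexp (u * X \<omega>))" "integrable M (\<lambda>\<omega>. iexp (u * Y \<omega>))"
    by (auto intro!: integrable_const_bound[where B = 1])
  have "norm ((CLINT \<omega>|M. iexp (u * X \<omega>)) - (CLINT \<omega>|M. iexp (u * Y \<omega>)))
      = norm (CLINT \<omega>|M. iexp (u * X \<omega>) - iexp (u * Y \<omega>))"
    using e by simp
  also have "\<dots> \<le> expectation (\<lambda>\<omega>. norm (iexp (u * X \<omega>) - iexp (u * Y \<omega>)))"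
    by (rule integral_norm_bound)
  also have "\<dots> \<le> expectation (\<lambda>\<omega>. \<bar>u\<bar> * \<bar>X \<omega> - Y \<omega>\<bar>)"
  proof (rule integral_mono)
    fix \<omega>
    show "norm (iexp (u * X \<omega>) - iexp (u * Y \<omega>)) \<le> \<bar>u\<bar> * \<bar>X \<omega> - Y \<omega>\<bar>"
      unfolding abs_mult[symmetric] right_diff_distrib by (rule norm_iexp_diff_le)
  qed (use e i in auto)
  finally show ?thesis
    by simp
qed

lemma (in prob_space) char_diff_le:
  assumes X: "X \<in> borel_measurable M" and Y: "Y \<in> borel_measurable M"
    and i: "integrable M (\<lambda>\<omega>. (X \<omega> - Y \<omega>)\<^sup>2)"
  shows "norm ((CLINT \<omega>|M. iexp (u * X \<omega>)) - (CLINT \<omega>|M. iexp (u * Y \<omega>)))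
    \<le> \<bar>u\<bar> * sqrt (expectation (\<lambda>\<omega>. (X \<omega> - Y \<omega>)\<^sup>2))"
proof -
  have d: "integrable M (\<lambda>\<omega>. X \<omega> - Y \<omega>)"
    "expectation (\<lambda>\<omega>. \<bar>X \<omega> - Y \<omega>\<bar>) \<le> sqrt (expectation (\<lambda>\<omega>. (X \<omega> - Y \<omega>)\<^sup>2))"
    using expectation_abs_le_sqrt[OF borel_measurable_diff[OF X Y] i] by auto
  have "norm ((CLINT \<omega>|M. iexp (u * X \<omega>)) - (CLINT \<omega>|M. iexp (u * Y \<omega>)))
      \<le> \<bar>u\<bar> * expectation (\<lambda>\<omega>. \<bar>X \<omega> - Y \<omega>\<bar>)"
    by (rule char_diff_le_expectation[OF X Y d(1)])
  also have "\<dots> \<le> \<bar>u\<bar> * sqrt (expectation (\<lambda>\<omega>. (X \<omega> - Y \<omega>)\<^sup>2))"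
    using d(2) by (intro mult_left_mono) auto
  finally show ?thesis .
qed

text \<open>Two points of the unit circle differ by at most 2, which is used on A; elsewhere the
  exponential is Lipschitz. Closeness only off an event is what the linearisation of the estimator
  will provide.\<close>

lemma (in prob_space) char_diff_le_event:
  assumes [measurable]: "X \<in> borel_measurable M" "Y \<in> borel_measurable M" "A \<in> events"
    and close: "AE \<omega> in M. \<omega> \<notin> A \<longrightarrow> \<bar>X \<omega> - Y \<omega>\<bar> \<le> \<rho>" and \<rho>: "0 \<le> \<rho>"
  shows "norm ((CLINT \<omega>|M. iexp (u * X \<omega>)) - (CLINT \<omega>|M. iexp (u * Y \<omega>))) \<le> 2 * prob A + \<bar>u\<bar> * \<rho>"
proof -
  have e: "integrable M (\<lambda>\<omega>. iexp (u * X \<omega>))" "integrable M (\<lambda>\<omega>. iexp (u * Y \<omega>))"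
    by (auto intro!: integrable_const_bound[where B = 1])
  have "norm ((CLINT \<omega>|M. iexp (u * X \<omega>)) - (CLINT \<omega>|M. iexp (u * Y \<omega>)))
      = norm (CLINT \<omega>|M. iexp (u * X \<omega>) - iexp (u * Y \<omega>))"
    using e by simp
  also have "\<dots> \<le> expectation (\<lambda>\<omega>. norm (iexp (u * X \<omega>) - iexp (u * Y \<omega>)))"
    by (rule integral_norm_bound)
  also have "\<dots> \<le> expectation (\<lambda>\<omega>. 2 * indicator A \<omega> + \<bar>u\<bar> * \<rho>)"
  proof (rule integral_mono_AE)
    show "AE \<omega> in M. norm (iexp (u * X \<omega>) - iexp (u * Y \<omega>)) \<le> 2 * indicator A \<omega> + \<bar>u\<bar> * \<rho>"
      using close
    proof eventually_elim
      case (elim \<omega>)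
      show ?case
      proof (cases "\<omega> \<in> A")
        case True
        have "norm (iexp (u * X \<omega>) - iexp (u * Y \<omega>)) \<le> 2"
          using norm_triangle_ineq4[of "iexp (u * X \<omega>)" "iexp (u * Y \<omega>)"] by simp
        moreover have "0 \<le> \<bar>u\<bar> * \<rho>"
          using \<rho> by simp
        ultimately show ?thesis
          using True by simp
      next
        case False
        have "norm (iexp (u * X \<omega>) - iexp (u * Y \<omega>)) \<le> \<bar>u\<bar> * \<bar>X \<omega> - Y \<omega>\<bar>"
          unfolding abs_mult[symmetric] right_diff_distrib by (rule norm_iexp_diff_le)
        also have "\<dots> \<le> \<bar>u\<bar> * \<rho>"
          using elim False by (intro mult_left_mono) auto
        finally show ?thesis
          using False by simp
      qed
    qed
  qed (use e in \<open>auto simp: emeasure_eq_measure\<close>)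
  also have "\<dots> = 2 * prob A + \<bar>u\<bar> * \<rho>"
    by (simp add: prob_space emeasure_eq_measure)
  finally show ?thesis .
qed


lemma expectation_mult_sq_le:
  fixes X Y :: "'w \<Rightarrow> real"
  assumes X: "X \<in> borel_measurable M" "integrable M (\<lambda>\<omega>. (X \<omega>)\<^sup>2)"
    and Y: "Y \<in> borel_measurable M" "integrable M (\<lambda>\<omega>. (Y \<omega>)\<^sup>2)"
  shows "(\<integral>\<omega>. X \<omega> * Y \<omega> \<partial>M)\<^sup>2 \<le> (\<integral>\<omega>. (X \<omega>)\<^sup>2 \<partial>M) * (\<integral>\<omega>. (Y \<omega>)\<^sup>2 \<partial>M)"
proof -
  define p q s where "p = (\<integral>\<omega>. (X \<omega>)\<^sup>2 \<partial>M)" and "q = (\<integral>\<omega>. (Y \<omega>)\<^sup>2 \<partial>M)" and "s = (\<integral>\<omega>. X \<omega> * Y \<omega> \<partial>M)"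
  have q0: "0 \<le> q"
    by (simp add: q_def)
  have i: "integrable M (\<lambda>\<omega>. X \<omega> * Y \<omega>)"
    by (rule integrable_mult_squares[OF X(1) Y(1) X(2) Y(2)])
  have "0 \<le> (\<integral>\<omega>. (q * X \<omega> - s * Y \<omega>)\<^sup>2 \<partial>M)"
    by simp
  also have "\<dots> = (\<integral>\<omega>. q\<^sup>2 * (X \<omega>)\<^sup>2 - 2 * q * s * (X \<omega> * Y \<omega>) + s\<^sup>2 * (Y \<omega>)\<^sup>2 \<partial>M)"
    by (simp add: power2_diff power_mult_distrib algebra_simps)
  also have "\<dots> = q\<^sup>2 * p - 2 * q * s * s + s\<^sup>2 * q"
    using X(2) Y(2) i by (simp add: p_def q_def s_def)
  also have "\<dots> = q * (p * q - s\<^sup>2)"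
    by (simp add: power2_eq_square algebra_simps)
  finally have *: "0 \<le> q * (p * q - s\<^sup>2)" .
  show ?thesis
  proof (cases "q = 0")
    case False
    then have "0 \<le> p * q - s\<^sup>2"
      using * q0 by (simp add: zero_le_mult_iff)
    then show ?thesis
      by (simp add: p_def q_def s_def)
  next
    case True
    then have "AE \<omega> in M. (Y \<omega>)\<^sup>2 = 0"
      using Y(2) unfolding q_def by (subst (asm) integral_nonneg_eq_0_iff_AE) auto
    then have "s = (\<integral>\<omega>. 0 \<partial>M)"
      unfolding s_def using X Y by (intro integral_cong_AE) auto
    then show ?thesis
      using True by (simp add: p_def q_def s_def)
  qed
qed

lemma tendsto_second_moment:
  fixes X :: "nat \<Rightarrow> 'w \<Rightarrow> real"
  assumes X: "\<And>n. X n \<in> borel_measurable M" "\<And>n. integrable M (\<lambda>\<omega>. (X n \<omega>)\<^sup>2)"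
    and Y: "Y \<in> borel_measurable M" "integrable M (\<lambda>\<omega>. (Y \<omega>)\<^sup>2)"
    and D: "\<And>n. integrable M (\<lambda>\<omega>. (X n \<omega> - Y \<omega>)\<^sup>2)"
    and lim: "(\<lambda>n. \<integral>\<omega>. (X n \<omega> - Y \<omega>)\<^sup>2 \<partial>M) \<longlonglongrightarrow> 0"
  shows "(\<lambda>n. \<integral>\<omega>. (X n \<omega>)\<^sup>2 \<partial>M) \<longlonglongrightarrow> (\<integral>\<omega>. (Y \<omega>)\<^sup>2 \<partial>M)"
proof -
  define d v where "d n = (\<integral>\<omega>. (X n \<omega> - Y \<omega>)\<^sup>2 \<partial>M)" and "v = (\<integral>\<omega>. (Y \<omega>)\<^sup>2 \<partial>M)" for n
  define c where "c n = (\<integral>\<omega>. (X n \<omega> - Y \<omega>) * Y \<omega> \<partial>M)" for n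
  have [measurable]: "X n \<in> borel_measurable M" "Y \<in> borel_measurable M" for n
    using X Y by auto
  have "(\<lambda>n. sqrt (d n * v)) \<longlonglongrightarrow> sqrt (0 * v)"
    using lim unfolding d_def by (intro tendsto_intros)
  then have s0: "(\<lambda>n. sqrt (d n * v)) \<longlonglongrightarrow> 0"
    by simp
  have cb: "\<bar>c n\<bar> \<le> sqrt (d n * v)" for n
    unfolding c_def d_def v_def using expectation_mult_sq_le[OF _ D Y, of n]
    by (intro real_le_rsqrt) auto
  have c0: "c \<longlonglongrightarrow> 0"
    by (rule tendsto_rabs_zero_cancel, rule tendsto_sandwich[OF _ _ tendsto_const s0])
      (simp_all add: cb)
  have eq: "(\<integral>\<omega>. (X n \<omega>)\<^sup>2 \<partial>M) = d n + 2 * c n + v" for n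
  proof -
    have i: "integrable M (\<lambda>\<omega>. (X n \<omega> - Y \<omega>) * Y \<omega>)"
      by (rule integrable_mult_squares[OF _ _ D Y(2)]) measurable
    have "(\<integral>\<omega>. (X n \<omega>)\<^sup>2 \<partial>M) = (\<integral>\<omega>. (X n \<omega> - Y \<omega>)\<^sup>2 + 2 * ((X n \<omega> - Y \<omega>) * Y \<omega>) + (Y \<omega>)\<^sup>2 \<partial>M)"
      by (intro Bochner_Integration.integral_cong refl) (simp add: power2_eq_square algebra_simps)
    also have "\<dots> = d n + 2 * c n + v"
      using D[of n] i Y(2) by (simp add: d_def c_def v_def)
    finally show ?thesis .
  qed
  have "(\<lambda>n. d n + 2 * c n + v) \<longlonglongrightarrow> 0 + 2 * 0 + v"
    using lim c0 unfolding d_def by (intro tendsto_intros)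
  then show ?thesis
    unfolding eq v_def by simp
qed

subsection \<open>Isotropic fields\<close>

lemma gaussian_process_single:
  assumes "gaussian_process M I X" "i \<in> I"
  shows "gaussian_rv M (X i)"
  using assms(1)[unfolded gaussian_process_def, rule_format, of "{i}" "\<lambda>_. 1"] assms(2) by simp

lemma process_law_product:
  assumes eq: "process_law M I X = process_law M I Y"
    and X: "\<And>i. i \<in> I \<Longrightarrow> X i \<in> borel_measurable M" and Y: "\<And>i. i \<in> I \<Longrightarrow> Y i \<in> borel_measurable M"
    and ij: "i \<in> I" "j \<in> I"
  shows "(\<integral>\<omega>. X i \<omega> * X j \<omega> \<partial>M) = (\<integral>\<omega>. Y i \<omega> * Y j \<omega> \<partial>M)"
proof -
  have f: "(\<lambda>f. f i * f j) \<in> borel_measurable (PiM I (\<lambda>_. borel :: real measure))"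
    using ij by (intro borel_measurable_times measurable_component_singleton)
  have law: "(\<integral>\<omega>. W i \<omega> * W j \<omega> \<partial>M) = (\<integral>f. f i * f j \<partial>process_law M I W)"
    if W: "\<And>i. i \<in> I \<Longrightarrow> W i \<in> borel_measurable M" for W :: "'a \<Rightarrow> 'b \<Rightarrow> real"
  proof -
    have "(\<lambda>\<omega>. \<lambda>i\<in>I. W i \<omega>) \<in> M \<rightarrow>\<^sub>M PiM I (\<lambda>_. borel)"
      by (intro measurable_restrict W)
    from integral_distr[OF this f] show ?thesis
      unfolding process_law_def using ij by simp
  qed
  show ?thesis
    using law[of X, OF X] law[of Y, OF Y] eq by simp
qed

lemma rotation_to_pole:
  assumes "x \<in> S2"
  obtains R :: "real^3^3" where "rotation_matrix R" "R *v x = axis 3 1"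
proof -
  obtain s t where "rotx t *v (rotz s *v x) = axis 3 1"
    using rotate_to_pole[OF assms] by (elim exE)
  moreover have "rotation_matrix (rotx t ** rotz s)"
    using rotation_rotx[of t] rotation_rotz[of s]
    by (simp add: rotation_matrix_def orthogonal_matrix_mul det_mul)
  ultimately show ?thesis
    by (intro that[of "rotx t ** rotz s"]) (simp_all add: matrix_vector_mul_assoc)
qed

lemma pole_in_S2: "axis 3 1 \<in> (S2 :: (real^3) set)"
  by simp

context sfield
begin

lemma smear_add:
  assumes f: "f \<in> borel_measurable surface" "\<And>x. x \<in> S2 \<Longrightarrow> \<bar>f x\<bar> \<le> a"
    and g: "g \<in> borel_measurable surface" "\<And>x. x \<in> S2 \<Longrightarrow> \<bar>g x\<bar> \<le> b"
  shows "AE \<omega> in M. smear X (\<lambda>x. f x + g x) \<omega> = smear X f \<omega> + smear X g \<omega>"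
proof -
  have "AE \<omega> in M. (smear X f \<omega>)\<^sup>2 \<le> 4 * pi * a\<^sup>2 * (\<integral>x. (X x \<omega>)\<^sup>2 \<partial>surface) \<and> integrable surface (\<lambda>x. X x \<omega> * f x)"
    by (rule smear_path_sq[OF f])
  moreover have "AE \<omega> in M. (smear X g \<omega>)\<^sup>2 \<le> 4 * pi * b\<^sup>2 * (\<integral>x. (X x \<omega>)\<^sup>2 \<partial>surface) \<and> integrable surface (\<lambda>x. X x \<omega> * g x)"
    by (rule smear_path_sq[OF g])
  ultimately show ?thesis
    by eventually_elim (simp add: smear_def distrib_left)
qed

lemma smear_scale: "smear X (\<lambda>x. c * f x) \<omega> = c * smear X f \<omega>"
proof -
  have "X x \<omega> * (c * f x) = c * (X x \<omega> * f x)" for x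
    by simp
  then show ?thesis
    unfolding smear_def by (simp only: integral_mult_right_zero)
qed

lemma continuous_bound:
  assumes "continuous_on UNIV (f :: real^3 \<Rightarrow> real)"
  shows "\<exists>a. f \<in> borel_measurable surface \<and> (\<forall>x\<in>S2. \<bar>f x\<bar> \<le> a)"
proof -
  have "continuous_on S2 f"
    using assms by (rule continuous_on_subset) simp
  from continuous_bounded_S2[OF this] obtain a where "\<forall>x\<in>S2. \<bar>f x\<bar> \<le> a"
    by (elim exE conjE)
  then show ?thesis
    by (intro exI[of _ a] conjI continuous_measurable_surface[OF assms])
qed

lemma smear_continuous:
  assumes "continuous_on UNIV f"
  shows "smear X f \<in> borel_measurable M" "integrable M (\<lambda>\<omega>. (smear X f \<omega>)\<^sup>2)"
proof -
  obtain a where f: "f \<in> borel_measurable surface" "\<And>x. x \<in> S2 \<Longrightarrow> \<bar>f x\<bar> \<le> a"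
    using continuous_bound[OF assms] by (elim exE conjE) (rule that, assumption, erule (1) bspec)
  show "smear X f \<in> borel_measurable M"
    by (rule smear_measurable[OF f])
  show "integrable M (\<lambda>\<omega>. (smear X f \<omega>)\<^sup>2)"
    by (rule smear_sq(1)[OF f])
qed

lemma smear_sum:
  assumes "finite J" "\<And>j. j \<in> J \<Longrightarrow> continuous_on UNIV (f j)"
  shows "AE \<omega> in M. smear X (\<lambda>x. \<Sum>j\<in>J. f j x) \<omega> = (\<Sum>j\<in>J. smear X (f j) \<omega>)"
  using assms
proof (induction J)
  case empty
  then show ?case by (simp add: smear_def)
next
  case (insert i J)
  have c: "continuous_on UNIV (f i)" "continuous_on UNIV (\<lambda>x. \<Sum>j\<in>J. f j x)"
    using insert.prems by (auto intro!: continuous_on_sum)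
  obtain a where f: "f i \<in> borel_measurable surface" "\<And>x. x \<in> S2 \<Longrightarrow> \<bar>f i x\<bar> \<le> a"
    using continuous_bound[OF c(1)] by (elim exE conjE) (rule that, assumption, erule (1) bspec)
  obtain b where g: "(\<lambda>x. \<Sum>j\<in>J. f j x) \<in> borel_measurable surface" "\<And>x. x \<in> S2 \<Longrightarrow> \<bar>\<Sum>j\<in>J. f j x\<bar> \<le> b"
    using continuous_bound[OF c(2)] by (elim exE conjE) (rule that, assumption, erule (1) bspec)
  have "AE \<omega> in M. smear X (\<lambda>x. f i x + (\<Sum>j\<in>J. f j x)) \<omega> = smear X (f i) \<omega> + smear X (\<lambda>x. \<Sum>j\<in>J. f j x) \<omega>"
    by (rule smear_add[OF f g])
  moreover have "AE \<omega> in M. smear X (\<lambda>x. \<Sum>j\<in>J. f j x) \<omega> = (\<Sum>j\<in>J. smear X (f j) \<omega>)"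
    using insert.prems by (intro insert.IH) auto
  ultimately show ?case
    unfolding sum.insert[OF insert.hyps] by eventually_elim simp
qed

lemma product_bound:
  assumes "x \<in> S2" "y \<in> S2"
  shows "\<bar>expectation (\<lambda>\<omega>. X x \<omega> * X y \<omega>)\<bar> \<le> K"
proof -
  have K: "0 \<le> K"
  proof -
    have "0 \<le> expectation (\<lambda>\<omega>. (X x \<omega>)\<^sup>2)"
      by simp
    then show ?thesis
      using sq_le[OF assms(1)] by linarith
  qed
  have "(expectation (\<lambda>\<omega>. X x \<omega> * X y \<omega>))\<^sup>2 \<le> expectation (\<lambda>\<omega>. (X x \<omega>)\<^sup>2) * expectation (\<lambda>\<omega>. (X y \<omega>)\<^sup>2)"
    by (rule expectation_mult_sq_le[OF point_measurable[OF assms(1)] sq_int[OF assms(1)]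
          point_measurable[OF assms(2)] sq_int[OF assms(2)]])
  also have "\<dots> \<le> K * K"
    using sq_le[OF assms(1)] sq_le[OF assms(2)] K by (intro mult_mono) auto
  finally show ?thesis
    using K by (intro abs_le_square_iff[THEN iffD2, of _ K, unfolded abs_of_nonneg[OF K]]) (simp add: power2_eq_square)
qed

text \<open>By Fubini the form is a double surface integral against the covariance of point values.
  The bound K on that covariance and the total mass 4 pi, taken twice, give the constant; invariance
  follows by rotating both integration variables.\<close>

lemma smear_invariant_form:
  assumes rot: "\<And>R x y. rotation_matrix R \<Longrightarrow> x \<in> S2 \<Longrightarrow> y \<in> S2 \<Longrightarrow>
      expectation (\<lambda>\<omega>. X (R *v x) \<omega> * X (R *v y) \<omega>) = expectation (\<lambda>\<omega>. X x \<omega> * X y \<omega>)"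
  shows "invariant_form (\<lambda>f g. expectation (\<lambda>\<omega>. smear X f \<omega> * smear X g \<omega>)) ((4 * pi)\<^sup>2 * K)"
proof
  note sf = sfield_axioms
  fix f g h :: "real^3 \<Rightarrow> real"
  assume f: "continuous_on UNIV f" and g: "continuous_on UNIV g"
  obtain a where a: "f \<in> borel_measurable surface" "\<And>x. x \<in> S2 \<Longrightarrow> \<bar>f x\<bar> \<le> a"
    using continuous_bound[OF f] by (elim exE conjE) (rule that, assumption, erule (1) bspec)
  obtain b where b: "g \<in> borel_measurable surface" "\<And>x. x \<in> S2 \<Longrightarrow> \<bar>g x\<bar> \<le> b"
    using continuous_bound[OF g] by (elim exE conjE) (rule that, assumption, erule (1) bspec)
  note [measurable] = smear_continuous(1)[OF f] smear_continuous(1)[OF g]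
  {
    assume h: "continuous_on UNIV h"
    note [measurable] = smear_continuous(1)[OF h]
    have [measurable]: "smear X (\<lambda>x. f x + g x) \<in> borel_measurable M"
      by (intro smear_continuous continuous_intros f g)
    have "expectation (\<lambda>\<omega>. smear X (\<lambda>x. f x + g x) \<omega> * smear X h \<omega>)
        = expectation (\<lambda>\<omega>. smear X f \<omega> * smear X h \<omega> + smear X g \<omega> * smear X h \<omega>)"
    proof (rule integral_cong_AE)
      have "AE \<omega> in M. smear X (\<lambda>x. f x + g x) \<omega> = smear X f \<omega> + smear X g \<omega>"
        by (rule smear_add[OF a b])
      then show "AE \<omega> in M. smear X (\<lambda>x. f x + g x) \<omega> * smear X h \<omega>
          = smear X f \<omega> * smear X h \<omega> + smear X g \<omega> * smear X h \<omega>"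
        by eventually_elim (simp add: distrib_right)
    qed measurable
    also have "\<dots> = expectation (\<lambda>\<omega>. smear X f \<omega> * smear X h \<omega>) + expectation (\<lambda>\<omega>. smear X g \<omega> * smear X h \<omega>)"
      by (intro Bochner_Integration.integral_add integrable_mult_squares smear_continuous f g h)
    finally show "expectation (\<lambda>\<omega>. smear X (\<lambda>x. f x + g x) \<omega> * smear X h \<omega>)
      = expectation (\<lambda>\<omega>. smear X f \<omega> * smear X h \<omega>) + expectation (\<lambda>\<omega>. smear X g \<omega> * smear X h \<omega>)" .
  }
  show "expectation (\<lambda>\<omega>. smear X (\<lambda>x. c * f x) \<omega> * smear X g \<omega>)
      = c * expectation (\<lambda>\<omega>. smear X f \<omega> * smear X g \<omega>)" for c
    by (simp add: smear_scale mult.assoc)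
  show "expectation (\<lambda>\<omega>. smear X f \<omega> * smear X g \<omega>) = expectation (\<lambda>\<omega>. smear X g \<omega> * smear X f \<omega>)"
    by (simp add: mult.commute)
  {
    fix a b
    assume a: "\<And>x. x \<in> S2 \<Longrightarrow> \<bar>f x\<bar> \<le> a" and b: "\<And>x. x \<in> S2 \<Longrightarrow> \<bar>g x\<bar> \<le> b"
    have fm: "f \<in> borel_measurable surface" and gm: "g \<in> borel_measurable surface"
      by (intro continuous_measurable_surface f g)+
    have a0: "0 \<le> a" and b0: "0 \<le> b"
      using a[OF pole_in_S2] b[OF pole_in_S2] by linarith+
    define \<gamma> where "\<gamma> x = expectation (\<lambda>\<omega>. X x \<omega> * smear X g \<omega>)" for x
    have \<gamma>_eq: "\<gamma> x = (\<integral>y. expectation (\<lambda>\<omega>. X y \<omega> * X x \<omega>) * g y \<partial>surface)" if x: "x \<in> S2" for x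
      unfolding \<gamma>_def using smear_mult(1)[OF gm b point_measurable[OF x] sq_int[OF x]]
      by (simp add: mult.commute)
    have \<gamma>_le: "\<bar>\<gamma> x\<bar> \<le> 4 * pi * (K * b)" if x: "x \<in> S2" for x
      unfolding \<gamma>_eq[OF x]
    proof (rule integral_surface_bounded)
      show "(\<lambda>y. expectation (\<lambda>\<omega>. X y \<omega> * X x \<omega>) * g y) \<in> borel_measurable surface"
        by (intro borel_measurable_times gm smear_mult(2)[OF gm b point_measurable[OF x] sq_int[OF x]])
      fix y assume y: "y \<in> S2"
      show "\<bar>expectation (\<lambda>\<omega>. X y \<omega> * X x \<omega>) * g y\<bar> \<le> K * b"
        unfolding abs_mult using product_bound[OF y x] b[OF y] by (intro mult_mono) auto
    qed
    have "expectation (\<lambda>\<omega>. smear X f \<omega> * smear X g \<omega>) = (\<integral>x. \<gamma> x * f x \<partial>surface)"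
      unfolding \<gamma>_def by (rule smear_mult(1)[OF fm a smear_continuous[OF g]])
    also have "\<bar>\<dots>\<bar> \<le> 4 * pi * (4 * pi * (K * b) * a)"
    proof (rule integral_surface_bounded)
      show "(\<lambda>x. \<gamma> x * f x) \<in> borel_measurable surface"
        unfolding \<gamma>_def by (intro borel_measurable_times fm smear_mult(2)[OF fm a smear_continuous[OF g]])
      fix x assume x: "x \<in> S2"
      show "\<bar>\<gamma> x * f x\<bar> \<le> 4 * pi * (K * b) * a"
        unfolding abs_mult using \<gamma>_le[OF x] a[OF x] order_trans[OF abs_ge_zero \<gamma>_le[OF x]]
        by (intro mult_mono) auto
    qed
    finally show "\<bar>expectation (\<lambda>\<omega>. smear X f \<omega> * smear X g \<omega>)\<bar> \<le> (4 * pi)\<^sup>2 * K * a * b"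
      by (simp add: power2_eq_square mult_ac)
  }
  {
    fix R :: "real^3^3"
    assume R: "rotation_matrix R"
    have cR: "continuous_on UNIV (\<lambda>x. q (R *v x))" if "continuous_on UNIV q" for q :: "real^3 \<Rightarrow> real"
      using that by (rule continuous_on_compose2[where g = q]) (auto intro: matrix_vector_mult_linear_continuous_on)
    obtain a' where a': "(\<lambda>x. f (R *v x)) \<in> borel_measurable surface" "\<And>x. x \<in> S2 \<Longrightarrow> \<bar>f (R *v x)\<bar> \<le> a'"
      using continuous_bound[OF cR[OF f]] by (elim exE conjE) (rule that, assumption, erule (1) bspec)
    obtain b' where b': "(\<lambda>x. g (R *v x)) \<in> borel_measurable surface" "\<And>x. x \<in> S2 \<Longrightarrow> \<bar>g (R *v x)\<bar> \<le> b'"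
      using continuous_bound[OF cR[OF g]] by (elim exE conjE) (rule that, assumption, erule (1) bspec)
    define \<gamma> where "\<gamma> x = expectation (\<lambda>\<omega>. X x \<omega> * smear X g \<omega>)" for x
    have inner: "(\<integral>y. expectation (\<lambda>\<omega>. X x \<omega> * X y \<omega>) * g (R *v y) \<partial>surface) = \<gamma> (R *v x)" if x: "x \<in> S2" for x
    proof -
      have Rx: "R *v x \<in> S2"
        by (rule rotation_in_S2[OF R x])
      have "(\<integral>y. expectation (\<lambda>\<omega>. X x \<omega> * X y \<omega>) * g (R *v y) \<partial>surface)
          = (\<integral>y. expectation (\<lambda>\<omega>. X (R *v y) \<omega> * X (R *v x) \<omega>) * g (R *v y) \<partial>surface)"
      proof (rule Bochner_Integration.integral_cong)
        fix y assume "y \<in> space surface"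
        then have y: "y \<in> S2"
          by (simp only: space_surface)
        show "expectation (\<lambda>\<omega>. X x \<omega> * X y \<omega>) * g (R *v y)
            = expectation (\<lambda>\<omega>. X (R *v y) \<omega> * X (R *v x) \<omega>) * g (R *v y)"
          unfolding rot[OF R y x] by (simp add: mult.commute)
      qed simp
      also have "\<dots> = (\<integral>y. expectation (\<lambda>\<omega>. X y \<omega> * X (R *v x) \<omega>) * g y \<partial>surface)"
        by (rule integral_surface_rotate[OF R])
          (intro borel_measurable_times b smear_mult(2)[OF b point_measurable[OF Rx] sq_int[OF Rx]])
      also have "\<dots> = \<gamma> (R *v x)"
        unfolding \<gamma>_def using smear_mult(1)[OF b point_measurable[OF Rx] sq_int[OF Rx]]
        by (simp add: mult.commute)
      finally show ?thesis .
    qed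
    have "expectation (\<lambda>\<omega>. smear X (\<lambda>x. f (R *v x)) \<omega> * smear X (\<lambda>x. g (R *v x)) \<omega>)
        = (\<integral>x. (\<integral>y. expectation (\<lambda>\<omega>. X x \<omega> * X y \<omega>) * g (R *v y) \<partial>surface) * f (R *v x) \<partial>surface)"
      by (rule smear_covariance[OF sf sf a' b'])
    also have "\<dots> = (\<integral>x. \<gamma> (R *v x) * f (R *v x) \<partial>surface)"
    proof (rule Bochner_Integration.integral_cong)
      fix x assume "x \<in> space surface"
      then have x: "x \<in> S2"
        by (simp only: space_surface)
      show "(\<integral>y. expectation (\<lambda>\<omega>. X x \<omega> * X y \<omega>) * g (R *v y) \<partial>surface) * f (R *v x) = \<gamma> (R *v x) * f (R *v x)"
        by (simp only: inner[OF x])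
    qed simp
    also have "\<dots> = (\<integral>x. \<gamma> x * f x \<partial>surface)"
      by (rule integral_surface_rotate[OF R])
        (unfold \<gamma>_def, intro borel_measurable_times a smear_mult(2)[OF a smear_continuous[OF g]])
    also have "\<dots> = expectation (\<lambda>\<omega>. smear X f \<omega> * smear X g \<omega>)"
      unfolding \<gamma>_def by (rule smear_mult(1)[OF a smear_continuous[OF g], symmetric])
    finally show "expectation (\<lambda>\<omega>. smear X (\<lambda>x. f (R *v x)) \<omega> * smear X (\<lambda>x. g (R *v x)) \<omega>)
        = expectation (\<lambda>\<omega>. smear X f \<omega> * smear X g \<omega>)" .
  }
qed

text \<open>The approximating finite sums are normal and centered, and L2 convergence carries both
  their characteristic functions and their variances to the limit. The formula covers a variance of
  0 as well.\<close>

lemma smear_gaussian_char: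
  assumes ms: "\<And>x. x \<in> S2 \<Longrightarrow> ((\<lambda>y. expectation (\<lambda>\<omega>. (X y \<omega> - X x \<omega>)\<^sup>2)) \<longlongrightarrow> 0) (at x within S2)"
    and gauss: "gaussian_process M S2 X" and cent: "centered M S2 X"
    and g: "continuous_on UNIV g"
  shows "(CLINT \<omega>|M. iexp (u * smear X g \<omega>)) = exp (- (u\<^sup>2 * expectation (\<lambda>\<omega>. (smear X g \<omega>)\<^sup>2)) / 2)"
proof -
  obtain c where c: "g \<in> borel_measurable surface" "\<And>x. x \<in> S2 \<Longrightarrow> \<bar>g x\<bar> \<le> c"
    using continuous_bound[OF g] by (elim exE conjE) (rule that, assumption, erule (1) bspec)
  obtain A w where A: "\<And>n. finite (A n)" "\<And>n. A n \<subseteq> S2"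
    "\<And>n. integrable M (\<lambda>\<omega>. ((\<Sum>p\<in>A n. w n p * X p \<omega>) - smear X g \<omega>)\<^sup>2)"
    "(\<lambda>n. expectation (\<lambda>\<omega>. ((\<Sum>p\<in>A n. w n p * X p \<omega>) - smear X g \<omega>)\<^sup>2)) \<longlonglongrightarrow> 0"
    by (rule smear_approximation[OF ms c]) (assumption | rule that)+
  define Y where "Y n \<omega> = (\<Sum>p\<in>A n. w n p * X p \<omega>)" for n \<omega>
  have gY: "gaussian_rv M (Y n)" for n
    unfolding Y_def using gauss A unfolding gaussian_process_def by simp
  have Ym: "Y n \<in> borel_measurable M" "integrable M (\<lambda>\<omega>. (Y n \<omega>)\<^sup>2)" for n
    using gaussian_rv_sq_integrable[OF gY] by auto
  have "expectation (Y n) = (\<Sum>p\<in>A n. w n p * expectation (X p))" for n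
  proof -
    have "integrable M (X p)" if "p \<in> A n" for p
    proof -
      have p: "p \<in> S2"
        using A(2) that by blast
      show ?thesis
        by (rule expectation_abs_le_sqrt(1)[OF point_measurable[OF p] sq_int[OF p]])
    qed
    then show ?thesis
      unfolding Y_def by simp
  qed
  moreover have "expectation (X p) = 0" if "p \<in> A n" for p n
  proof -
    have "p \<in> S2"
      using A(2) that by blast
    then show ?thesis
      using cent by (simp only: centered_def)
  qed
  ultimately have "expectation (Y n) = 0" for n
    by simp
  then have cY: "(CLINT \<omega>|M. iexp (u * Y n \<omega>)) = exp (- (u\<^sup>2 * expectation (\<lambda>\<omega>. (Y n \<omega>)\<^sup>2)) / 2)" for n
    by (rule gaussian_rv_char[OF gY])
  have D: "integrable M (\<lambda>\<omega>. (Y n \<omega> - smear X g \<omega>)\<^sup>2)" for n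
    using A(3)[of n] by (simp only: Y_def)
  have D0: "(\<lambda>n. expectation (\<lambda>\<omega>. (Y n \<omega> - smear X g \<omega>)\<^sup>2)) \<longlonglongrightarrow> 0"
    using A(4) by (simp only: Y_def)
  have "(\<lambda>n. expectation (\<lambda>\<omega>. (Y n \<omega>)\<^sup>2)) \<longlonglongrightarrow> expectation (\<lambda>\<omega>. (smear X g \<omega>)\<^sup>2)"
    by (rule tendsto_second_moment[OF Ym smear_continuous[OF g] D D0])
  then have 1: "(\<lambda>n. complex_of_real (exp (- (u\<^sup>2 * expectation (\<lambda>\<omega>. (Y n \<omega>)\<^sup>2)) / 2)))
      \<longlonglongrightarrow> complex_of_real (exp (- (u\<^sup>2 * expectation (\<lambda>\<omega>. (smear X g \<omega>)\<^sup>2)) / 2))"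
    by (intro tendsto_intros) auto
  have "(\<lambda>n. \<bar>u\<bar> * sqrt (expectation (\<lambda>\<omega>. (Y n \<omega> - smear X g \<omega>)\<^sup>2))) \<longlonglongrightarrow> \<bar>u\<bar> * sqrt 0"
    by (intro tendsto_intros D0)
  then have s0: "(\<lambda>n. \<bar>u\<bar> * sqrt (expectation (\<lambda>\<omega>. (Y n \<omega> - smear X g \<omega>)\<^sup>2))) \<longlonglongrightarrow> 0"
    by simp
  have "(\<lambda>n. (CLINT \<omega>|M. iexp (u * Y n \<omega>)) - (CLINT \<omega>|M. iexp (u * smear X g \<omega>))) \<longlonglongrightarrow> 0"
    by (rule Lim_null_comparison[OF always_eventually s0])
      (intro allI char_diff_le Ym smear_continuous[OF g] D)
  then have 2: "(\<lambda>n. CLINT \<omega>|M. iexp (u * Y n \<omega>)) \<longlonglongrightarrow> (CLINT \<omega>|M. iexp (u * smear X g \<omega>))"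
    by (rule LIM_zero_cancel)
  show ?thesis
    using LIMSEQ_unique[OF 2] 1 unfolding cY by simp
qed

end


subsection \<open>Eigenfunctions of the autoregressive operator\<close>

lemma zonal_kernel_measurable:
  assumes "continuous_on UNIV (q :: real \<Rightarrow> real)"
  shows "(\<lambda>(x, y). q (x \<bullet> y)) \<in> borel_measurable (surface \<Otimes>\<^sub>M surface)"
proof -
  have id: "(\<lambda>x :: real^3. x) \<in> borel_measurable surface"
    by (intro continuous_measurable_surface continuous_intros)
  have "(\<lambda>p. fst p \<bullet> snd p) \<in> borel_measurable (surface \<Otimes>\<^sub>M surface)"
    by (intro borel_measurable_inner measurable_compose[OF measurable_fst id] measurable_compose[OF measurable_snd id])
  from measurable_compose[OF this borel_measurable_continuous_onI[OF assms]]
  show ?thesis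
    by (simp add: case_prod_beta)
qed

lemma inner_S2: "x \<in> S2 \<Longrightarrow> y \<in> S2 \<Longrightarrow> x \<bullet> y \<in> {-1..1}"
  using Cauchy_Schwarz_ineq2[of x y] by (auto simp: abs_le_iff)

lemma continuous_inner_kernel:
  "continuous_on UNIV (q :: real \<Rightarrow> real) \<Longrightarrow> continuous_on UNIV (\<lambda>x :: real^3. q (x \<bullet> y))"
  by (rule continuous_on_compose2[where g = q]) (auto intro!: continuous_intros)

lemma continuous_bounded_interval:
  assumes "continuous_on UNIV (q :: real \<Rightarrow> real)"
  shows "\<exists>C\<ge>0. \<forall>x\<in>S2. \<forall>y\<in>S2. \<bar>q (x \<bullet> (y :: real^3))\<bar> \<le> C"
proof -
  have "compact (q ` {-1..1})"
    by (rule compact_continuous_image[OF continuous_on_subset[OF assms]]) auto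
  then obtain C where C: "\<forall>t\<in>{-1..1}. \<bar>q t\<bar> \<le> C"
    using compact_imp_bounded bounded_iff[of "q ` {-1..1}"] by fastforce
  have "0 \<le> C"
    using C[rule_format, of 0] by (meson abs_ge_zero atLeastAtMost_iff neg_le_0_iff_le order_trans zero_le_one)
  then show ?thesis
    using C inner_S2 by blast
qed

lemma zonal_sph_harm:
  assumes m: "m \<in> {- int l..int l}"
  shows "integrable surface (\<lambda>x. zonal l' x y * sph_harm l m x)"
    and "(\<integral>x. zonal l' x y * sph_harm l m x \<partial>surface) = (if l' = l then sph_harm l m y else 0)"
proof -
  have i: "integrable surface (\<lambda>x. sph_harm l' m' x * sph_harm l m x)" if "m' \<in> {- int l'..int l'}" for m'
    using that m by (intro integrable_surface_continuous continuous_on_mult) auto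
  have eq: "zonal l' x y * sph_harm l m x
      = (\<Sum>m' = - int l'..int l'. sph_harm l' m' y * (sph_harm l' m' x * sph_harm l m x))" for x
    unfolding zonal_def sum_distrib_right by (intro sum.cong) auto
  show "integrable surface (\<lambda>x. zonal l' x y * sph_harm l m x)"
    unfolding eq by (intro Bochner_Integration.integrable_sum integrable_mult_right i)
  have "(\<integral>x. zonal l' x y * sph_harm l m x \<partial>surface)
      = (\<Sum>m' = - int l'..int l'. sph_harm l' m' y * (\<integral>x. sph_harm l' m' x * sph_harm l m x \<partial>surface))"
    unfolding eq using i by simp
  also have "\<dots> = (\<Sum>m' = - int l'..int l'. if m' = m then (if l' = l then sph_harm l' m' y else 0) else 0)"
    using m by (intro sum.cong refl) (simp add: sph_harm_orthonormal)
  also have "\<dots> = (if l' = l then sph_harm l m y else 0)"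
    using m by simp
  finally show "(\<integral>x. zonal l' x y * sph_harm l m x \<partial>surface) = (if l' = l then sph_harm l m y else 0)" .
qed

interpretation SS: pair_sigma_finite surface surface ..

text \<open>Outside \<open>[-1, 1]\<close> the kernel \<open>k\<close> is arbitrary and need not be measurable.\<close>

definition extend_kernel :: "(real \<Rightarrow> real) \<Rightarrow> real \<Rightarrow> real" where
  "extend_kernel k t = k (max (-1) (min 1 t))"

lemma extend_kernel_eq: "x \<in> S2 \<Longrightarrow> y \<in> S2 \<Longrightarrow> extend_kernel k (x \<bullet> y) = k (x \<bullet> y)"
  using inner_S2[of x y] by (simp add: extend_kernel_def)

lemma continuous_extend_kernel:
  assumes "continuous_on {-1..1} k"
  shows "continuous_on UNIV (extend_kernel k)"
  unfolding extend_kernel_def by (rule continuous_on_compose2[OF assms]) (auto intro!: continuous_intros)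

text \<open>For n at least l the n-th partial sum of the expansion has the eigenvalue
  \<open>\<phi> l\<close> exactly, by the addition theorem and orthonormality. So the defect h is
  the same for all these n, while its L2 norm is bounded by a constant times the distance of k from
  the partial sum, which tends to 0. As convergence is in L2, the conclusion is for almost every
  y.\<close>

lemma kernel_eigenfunction:
  assumes k: "continuous_on {-1..1} k" and e: "legendre_expansion k \<phi>"
    and l: "1 \<le> l" and m: "m \<in> {- int l..int l}"
  shows "AE y in surface. (\<integral>x. extend_kernel k (x \<bullet> y) * sph_harm l m x \<partial>surface) = \<phi> l * sph_harm l m y"
proof -
  define k' where "k' = extend_kernel k"
  define Y where "Y = sph_harm l m"
  have k'c: "continuous_on UNIV k'"
    unfolding k'_def by (rule continuous_extend_kernel[OF k])
  have Yc: "continuous_on UNIV Y"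
    unfolding Y_def by (rule continuous_sph_harm)
  have [measurable]: "Y \<in> borel_measurable surface"
    by (rule continuous_measurable_surface[OF Yc])
  have "continuous_on S2 Y"
    using Yc by (rule continuous_on_subset) simp
  from continuous_bounded_S2[OF this] obtain c where c: "0 \<le> c" "\<forall>x\<in>S2. \<bar>Y x\<bar> \<le> c"
    by (elim exE conjE)
  define p where "p n t = (\<Sum>l = 1..n. \<phi> l * real (2 * l + 1) / (4 * pi) * poly (legendre l) t)" for n t
  define q where "q n t = k' t - p n t" for n t
  have qc: "continuous_on UNIV (q n)" for n
    unfolding q_def[abs_def] p_def by (intro continuous_intros k'c)
  have qi: "integrable surface (\<lambda>x. q n (x \<bullet> y) * Y x)" for n y
    by (intro integrable_surface_continuous continuous_on_mult continuous_inner_kernel qc Yc)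
  have q2i: "integrable surface (\<lambda>x. (q n (x \<bullet> y))\<^sup>2)" for n y
    by (intro integrable_surface_continuous continuous_on_power continuous_inner_kernel qc)
  define h where "h y = (\<integral>x. k' (x \<bullet> y) * Y x \<partial>surface) - \<phi> l * Y y" for y
  have h_eq: "h y = (\<integral>x. q n (x \<bullet> y) * Y x \<partial>surface)" if y: "y \<in> S2" and n: "l \<le> n" for y n
  proof -
    have ki: "integrable surface (\<lambda>x. k' (x \<bullet> y) * Y x)"
      by (intro integrable_surface_continuous continuous_on_mult continuous_inner_kernel k'c Yc)
    have pz: "p n (x \<bullet> y) * Y x = (\<Sum>l' = 1..n. \<phi> l' * (zonal l' x y * Y x))" if x: "x \<in> S2" for x
      unfolding p_def sum_distrib_right
      by (intro sum.cong refl) (simp only: addition_theorem[OF x y] mult_ac times_divide_eq_right times_divide_eq_left)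
    have zi: "integrable surface (\<lambda>x. zonal l' x y * Y x)" for l'
      unfolding Y_def by (rule zonal_sph_harm(1)[OF m])
    have "(\<integral>x. q n (x \<bullet> y) * Y x \<partial>surface)
        = (\<integral>x. k' (x \<bullet> y) * Y x - (\<Sum>l' = 1..n. \<phi> l' * (zonal l' x y * Y x)) \<partial>surface)"
    proof (rule Bochner_Integration.integral_cong)
      fix x assume "x \<in> space surface"
      then have x: "x \<in> S2"
        by (simp only: space_surface)
      show "q n (x \<bullet> y) * Y x = k' (x \<bullet> y) * Y x - (\<Sum>l' = 1..n. \<phi> l' * (zonal l' x y * Y x))"
        unfolding pz[OF x, symmetric] q_def left_diff_distrib ..
    qed simp
    also have "\<dots> = (\<integral>x. k' (x \<bullet> y) * Y x \<partial>surface) - (\<Sum>l' = 1..n. \<phi> l' * (\<integral>x. zonal l' x y * Y x \<partial>surface))"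
      using ki zi by simp
    also have "(\<Sum>l' = 1..n. \<phi> l' * (\<integral>x. zonal l' x y * Y x \<partial>surface)) = (\<Sum>l' = 1..n. if l' = l then \<phi> l' * Y y else 0)"
      unfolding Y_def zonal_sph_harm(2)[OF m] by (intro sum.cong) auto
    also have "\<dots> = \<phi> l * Y y"
      using l n by simp
    finally show ?thesis
      by (simp add: h_def)
  qed
  have hm [measurable]: "h \<in> borel_measurable surface"
  proof -
    have "(\<lambda>(y, x). k' (x \<bullet> y) * Y x) \<in> borel_measurable (surface \<Otimes>\<^sub>M surface)"
      using zonal_kernel_measurable[OF k'c] unfolding case_prod_beta inner_commute[of "fst _"]
      by (intro borel_measurable_times measurable_compose[OF measurable_snd]) auto
    then have "(\<lambda>y. \<integral>x. k' (x \<bullet> y) * Y x \<partial>surface) \<in> borel_measurable surface"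
      by (rule surface.borel_measurable_lebesgue_integral)
    then show ?thesis
      unfolding h_def[abs_def] by measurable
  qed
  have q2p: "integrable (surface \<Otimes>\<^sub>M surface) (\<lambda>(x, y). (q n (x \<bullet> y))\<^sup>2)" for n
  proof -
    obtain C where C: "0 \<le> C" "\<forall>x\<in>S2. \<forall>y\<in>S2. \<bar>q n (x \<bullet> (y :: real^3))\<bar> \<le> C"
      using continuous_bounded_interval[OF qc[of n]] by (elim exE conjE)
    have fin: "finite_measure (surface \<Otimes>\<^sub>M surface)"
      by (rule finite_measure_pair_measure) unfold_locales
    show ?thesis
    proof (rule finite_measure.integrable_const_bound[OF fin, where B = "C\<^sup>2"])
      show "AE p in surface \<Otimes>\<^sub>M surface. norm ((\<lambda>(x, y). (q n (x \<bullet> y))\<^sup>2) p) \<le> C\<^sup>2"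
      proof (rule AE_I2)
        fix p assume "p \<in> space (surface \<Otimes>\<^sub>M surface)"
        then have p: "fst p \<in> S2" "snd p \<in> S2"
          unfolding space_pair_measure space_surface by (auto simp del: mem_sphere_0)
        show "norm ((\<lambda>(x, y). (q n (x \<bullet> y))\<^sup>2) p) \<le> C\<^sup>2"
          using C(2)[rule_format, OF p] C(1) by (simp add: case_prod_beta abs_le_square_iff[symmetric])
      qed
      show "(\<lambda>(x, y). (q n (x \<bullet> y))\<^sup>2) \<in> borel_measurable (surface \<Otimes>\<^sub>M surface)"
        using zonal_kernel_measurable[OF qc[of n]] unfolding case_prod_beta by (intro borel_measurable_power)
    qed
  qed
  have h_le: "(h y)\<^sup>2 \<le> 4 * pi * c\<^sup>2 * (\<integral>x. (q n (x \<bullet> y))\<^sup>2 \<partial>surface)" if y: "y \<in> S2" and n: "l \<le> n" for y n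
  proof -
    have i2: "integrable surface (\<lambda>x. (q n (x \<bullet> y) * Y x)\<^sup>2)"
      by (intro integrable_surface_continuous continuous_on_power continuous_on_mult continuous_inner_kernel qc Yc)
    have "(h y)\<^sup>2 \<le> 4 * pi * (\<integral>x. (q n (x \<bullet> y) * Y x)\<^sup>2 \<partial>surface)"
      unfolding h_eq[OF y n] by (rule integral_sq_le[OF borel_measurable_integrable[OF qi] i2])
    also have "(\<integral>x. (q n (x \<bullet> y) * Y x)\<^sup>2 \<partial>surface) \<le> (\<integral>x. c\<^sup>2 * (q n (x \<bullet> y))\<^sup>2 \<partial>surface)"
    proof (rule integral_mono[OF i2])
      fix x assume "x \<in> space surface"
      then have x: "x \<in> S2"
        by (simp only: space_surface)
      have "(Y x)\<^sup>2 \<le> c\<^sup>2"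
        using c(2)[rule_format, OF x] c(1) by (simp add: abs_le_square_iff[symmetric])
      then show "(q n (x \<bullet> y) * Y x)\<^sup>2 \<le> c\<^sup>2 * (q n (x \<bullet> y))\<^sup>2"
        by (simp add: power_mult_distrib mult.commute mult_right_mono)
    qed (use q2i in simp)
    finally show ?thesis
      by simp
  qed
  have hb: "integrable surface (\<lambda>y. (h y)\<^sup>2)"
    and hn: "(\<integral>y. (h y)\<^sup>2 \<partial>surface) \<le> 4 * pi * c\<^sup>2 * (\<integral>p. (\<lambda>(x, y). (q n (x \<bullet> y))\<^sup>2) p \<partial>(surface \<Otimes>\<^sub>M surface))"
    if n: "l \<le> n" for n
  proof -
    have i: "integrable surface (\<lambda>y. 4 * pi * c\<^sup>2 * (\<integral>x. (q n (x \<bullet> y))\<^sup>2 \<partial>surface))"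
      using SS.integrable_snd[OF q2p[of n]] by simp
    have le: "(h y)\<^sup>2 \<le> 4 * pi * c\<^sup>2 * (\<integral>x. (q n (x \<bullet> y))\<^sup>2 \<partial>surface)" if "y \<in> space surface" for y
      using that h_le[OF _ n] by (simp only: space_surface)
    show hi: "integrable surface (\<lambda>y. (h y)\<^sup>2)"
    proof (rule Bochner_Integration.integrable_bound[OF i])
      show "AE y in surface. norm ((h y)\<^sup>2) \<le> norm (4 * pi * c\<^sup>2 * (\<integral>x. (q n (x \<bullet> y))\<^sup>2 \<partial>surface))"
        by (rule AE_I2) (use le in simp)
    qed measurable
    have "(\<integral>y. (h y)\<^sup>2 \<partial>surface) \<le> (\<integral>y. 4 * pi * c\<^sup>2 * (\<integral>x. (q n (x \<bullet> y))\<^sup>2 \<partial>surface) \<partial>surface)"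
      by (rule integral_mono[OF hi i le])
    also have "\<dots> = 4 * pi * c\<^sup>2 * (\<integral>y. (\<integral>x. (q n (x \<bullet> y))\<^sup>2 \<partial>surface) \<partial>surface)"
      by simp
    also have "(\<integral>y. (\<integral>x. (q n (x \<bullet> y))\<^sup>2 \<partial>surface) \<partial>surface) = (\<integral>p. (\<lambda>(x, y). (q n (x \<bullet> y))\<^sup>2) p \<partial>(surface \<Otimes>\<^sub>M surface))"
      using SS.integral_snd[OF q2p[of n]] by simp
    finally show "(\<integral>y. (h y)\<^sup>2 \<partial>surface) \<le> 4 * pi * c\<^sup>2 * (\<integral>p. (\<lambda>(x, y). (q n (x \<bullet> y))\<^sup>2) p \<partial>(surface \<Otimes>\<^sub>M surface))" .
  qed
  have "(\<lambda>n. \<integral>p. (\<lambda>(x, y). (q n (x \<bullet> y))\<^sup>2) p \<partial>(surface \<Otimes>\<^sub>M surface)) \<longlonglongrightarrow> 0"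
  proof -
    have "(\<integral>p. (\<lambda>(x, y). (q n (x \<bullet> y))\<^sup>2) p \<partial>(surface \<Otimes>\<^sub>M surface))
        = (\<integral>(x, y). (k (x \<bullet> y) - (\<Sum>l = 1..n. \<phi> l * real (2 * l + 1) / (4 * pi) * poly (legendre l) (x \<bullet> y)))\<^sup>2
        \<partial>(surface \<Otimes>\<^sub>M surface))" for n
    proof (rule Bochner_Integration.integral_cong)
      fix p assume "p \<in> space (surface \<Otimes>\<^sub>M surface)"
      then have p: "fst p \<in> S2" "snd p \<in> S2"
        unfolding space_pair_measure space_surface by (auto simp del: mem_sphere_0)
      show "(\<lambda>(x, y). (q n (x \<bullet> y))\<^sup>2) p
        = (\<lambda>(x, y). (k (x \<bullet> y) - (\<Sum>l = 1..n. \<phi> l * real (2 * l + 1) / (4 * pi) * poly (legendre l) (x \<bullet> y)))\<^sup>2) p"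
        using extend_kernel_eq[OF p, of k] by (simp add: case_prod_beta q_def p_def k'_def)
    qed simp
    then show ?thesis
      using e unfolding legendre_expansion_def by simp
  qed
  then have "(\<lambda>n. 4 * pi * c\<^sup>2 * (\<integral>p. (\<lambda>(x, y). (q n (x \<bullet> y))\<^sup>2) p \<partial>(surface \<Otimes>\<^sub>M surface))) \<longlonglongrightarrow> 4 * pi * c\<^sup>2 * 0"
    by (rule tendsto_mult_left)
  then have "(\<integral>y. (h y)\<^sup>2 \<partial>surface) \<le> 4 * pi * c\<^sup>2 * 0"
    by (rule LIMSEQ_le_const) (intro exI[of _ l] allI impI hn)
  moreover have "0 \<le> (\<integral>y. (h y)\<^sup>2 \<partial>surface)"
    by simp
  ultimately have "(\<integral>y. (h y)\<^sup>2 \<partial>surface) = 0"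
    by linarith
  then have "AE y in surface. (h y)\<^sup>2 = 0"
    using integral_nonneg_eq_0_iff_AE[OF hb[OF order_refl]] by simp
  then show ?thesis
    by eventually_elim (simp add: h_def k'_def Y_def)
qed


subsection \<open>The harmonic coefficients of the process\<close>

lemma (in prob_space) indep_var_AE:
  assumes i: "indep_var S X N Y" and X': "X' \<in> M \<rightarrow>\<^sub>M S" and Y': "Y' \<in> M \<rightarrow>\<^sub>M N"
    and "AE \<omega> in M. X \<omega> = X' \<omega>" "AE \<omega> in M. Y \<omega> = Y' \<omega>"
  shows "indep_var S X' N Y'"
proof -
  have m: "X \<in> M \<rightarrow>\<^sub>M S" "Y \<in> M \<rightarrow>\<^sub>M N"
    and d: "distr M S X \<Otimes>\<^sub>M distr M N Y = distr M (S \<Otimes>\<^sub>M N) (\<lambda>x. (X x, Y x))"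
    using i unfolding indep_var_distribution_eq by auto
  have "distr M S X = distr M S X'" "distr M N Y = distr M N Y'"
    by (intro distr_cong_AE refl assms m)+
  moreover have "AE \<omega> in M. (X \<omega>, Y \<omega>) = (X' \<omega>, Y' \<omega>)"
    using assms(4,5) by eventually_elim simp
  then have "distr M (S \<Otimes>\<^sub>M N) (\<lambda>x. (X x, Y x)) = distr M (S \<Otimes>\<^sub>M N) (\<lambda>x. (X' x, Y' x))"
    by (intro distr_cong_AE refl measurable_Pair m X' Y')
  ultimately show ?thesis
    unfolding indep_var_distribution_eq using d X' Y' by simp
qed

locale sphar = prob_space M for M :: "'w measure" +
  fixes T Z :: "real^3 \<Rightarrow> int \<Rightarrow> 'w \<Rightarrow> real" and k :: "real \<Rightarrow> real" and \<phi> CZ :: "nat \<Rightarrow> real"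
  assumes sphar1: "sphar1 M k \<phi> T Z" and spectrum: "has_power_spectrum M Z CZ"
begin

lemma kernel: "continuous_on {-1..1} k" "legendre_expansion k \<phi>"
  and T_joint: "spherical_field M T" and T_gauss: "gaussian_process M (S2 \<times> UNIV) (\<lambda>(x, t). T x t)"
  and T_ms: "ms_continuous M T" and T_iso: "isotropic_stationary M T"
  and Z_noise: "gaussian_white_noise M Z"
  and Z_T_indep: "\<And>t. indep_var (\<Pi>\<^sub>M p\<in>S2 \<times> {t}. borel) (\<lambda>\<omega>. \<lambda>(x, s)\<in>S2 \<times> {t}. Z x s \<omega>)
        (\<Pi>\<^sub>M p\<in>S2 \<times> {..<t}. borel) (\<lambda>\<omega>. \<lambda>(x, s)\<in>S2 \<times> {..<t}. T x s \<omega>)"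
  and equation: "\<And>x t. x \<in> S2 \<Longrightarrow> AE \<omega> in M. T x t \<omega> = kernel_op k (\<lambda>y. T y (t - 1) \<omega>) x + Z x t \<omega>"
  using sphar1 unfolding sphar1_def by (elim conjE; blast)+

lemma Z_joint: "spherical_field M Z" and Z_gauss: "gaussian_process M S2 (\<lambda>x. Z x t)"
  and Z_cent: "centered M S2 (\<lambda>x. Z x t)"
  and Z_iso: "rotation_matrix R \<Longrightarrow> process_law M S2 (\<lambda>x. Z (R *v x) t) = process_law M S2 (\<lambda>x. Z x t)"
  using Z_noise unfolding gaussian_white_noise_def by (elim conjE; blast)+

lemma T_rv: "x \<in> S2 \<Longrightarrow> gaussian_rv M (T x t)"
  using gaussian_process_single[OF T_gauss, of "(x, t)"] by (simp del: mem_sphere_0)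

lemma Z_rv: "x \<in> S2 \<Longrightarrow> gaussian_rv M (Z x t)"
  using gaussian_process_single[OF Z_gauss] .

lemma T_law:
  assumes R: "rotation_matrix R" and xy: "x \<in> S2" "y \<in> S2"
  shows "expectation (\<lambda>\<omega>. T (R *v x) (t + \<tau>) \<omega> * T (R *v y) (t + \<tau>) \<omega>) = expectation (\<lambda>\<omega>. T x t \<omega> * T y t \<omega>)"
proof -
  have law: "process_law M (S2 \<times> UNIV) (\<lambda>(x, t). T (R *v x) (t + \<tau>)) = process_law M (S2 \<times> UNIV) (\<lambda>(x, t). T x t)"
    using T_iso R unfolding isotropic_stationary_def by (simp del: mem_sphere_0)
  have m1: "(\<lambda>(x, t). T (R *v x) (t + \<tau>)) p \<in> borel_measurable M" if "p \<in> S2 \<times> UNIV" for p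
    using gaussian_rv_sq_integrable(1)[OF T_rv[OF rotation_in_S2[OF R, of "fst p"]]] that
    by (auto simp: case_prod_beta simp del: mem_sphere_0)
  have m2: "(\<lambda>(x, t). T x t) p \<in> borel_measurable M" if "p \<in> S2 \<times> UNIV" for p
    using gaussian_rv_sq_integrable(1)[OF T_rv[of "fst p"]] that
    by (auto simp: case_prod_beta simp del: mem_sphere_0)
  show ?thesis
    using process_law_product[OF law m1 m2, of "(x, t)" "(y, t)"] xy by (simp del: mem_sphere_0)
qed

lemma Z_law:
  assumes R: "rotation_matrix R" and xy: "x \<in> S2" "y \<in> S2"
  shows "expectation (\<lambda>\<omega>. Z (R *v x) t \<omega> * Z (R *v y) t \<omega>) = expectation (\<lambda>\<omega>. Z x t \<omega> * Z y t \<omega>)"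
  by (rule process_law_product[OF Z_iso[OF R]])
    (intro gaussian_rv_sq_integrable(1)[OF Z_rv] rotation_in_S2[OF R] xy; assumption)+

definition KT :: real where "KT = expectation (\<lambda>\<omega>. (T (axis 3 1) 0 \<omega>)\<^sup>2)"
definition KZ :: "int \<Rightarrow> real" where "KZ t = expectation (\<lambda>\<omega>. (Z (axis 3 1) t \<omega>)\<^sup>2)"

lemma T_sfield: "sfield M (\<lambda>x. T x t) KT"
proof unfold_locales
  show "(\<lambda>(\<omega>, x). T x t \<omega>) \<in> borel_measurable (M \<Otimes>\<^sub>M surface)"
    using T_joint by (simp add: spherical_field_def)
  fix x assume x: "x \<in> S2"
  show "integrable M (\<lambda>\<omega>. (T x t \<omega>)\<^sup>2)"
    by (rule gaussian_rv_sq_integrable(2)[OF T_rv[OF x]])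
  obtain R where R: "rotation_matrix R" "R *v x = axis 3 1"
    using rotation_to_pole[OF x] .
  show "expectation (\<lambda>\<omega>. (T x t \<omega>)\<^sup>2) \<le> KT"
    using T_law[OF R(1) x x, of t "- t"] by (simp add: KT_def R(2) power2_eq_square)
qed

lemma Z_sfield: "sfield M (\<lambda>x. Z x t) (KZ t)"
proof unfold_locales
  show "(\<lambda>(\<omega>, x). Z x t \<omega>) \<in> borel_measurable (M \<Otimes>\<^sub>M surface)"
    using Z_joint by (simp add: spherical_field_def)
  fix x assume x: "x \<in> S2"
  show "integrable M (\<lambda>\<omega>. (Z x t \<omega>)\<^sup>2)"
    by (rule gaussian_rv_sq_integrable(2)[OF Z_rv[OF x]])
  obtain R where R: "rotation_matrix R" "R *v x = axis 3 1"
    using rotation_to_pole[OF x] .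
  show "expectation (\<lambda>\<omega>. (Z x t \<omega>)\<^sup>2) \<le> KZ t"
    using Z_law[OF R(1) x x, of t] by (simp add: KZ_def R(2) power2_eq_square)
qed

lemma T_ms_at: "x \<in> S2 \<Longrightarrow> ((\<lambda>y. expectation (\<lambda>\<omega>. (T y t \<omega> - T x t \<omega>)\<^sup>2)) \<longlongrightarrow> 0) (at x within S2)"
  using T_ms by (simp only: ms_continuous_def)

lemma kernel_op_smear:
  assumes "x \<in> S2"
  shows "kernel_op k (\<lambda>y. T y t \<omega>) x = smear (\<lambda>y. T y t) (\<lambda>y. extend_kernel k (x \<bullet> y)) \<omega>"
  unfolding kernel_op_def smear_def
proof (rule Bochner_Integration.integral_cong)
  fix y assume "y \<in> space surface"
  then have "y \<in> S2"
    by (simp only: space_surface)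
  from extend_kernel_eq[OF assms this]
  show "k (x \<bullet> y) * T y t \<omega> = T y t \<omega> * extend_kernel k (x \<bullet> y)"
    by simp
qed simp

text \<open>Mean-square continuity of the noise is inherited from the process through the equation.\<close>

lemma Z_ms_at:
  assumes x: "x \<in> S2"
  shows "((\<lambda>y. expectation (\<lambda>\<omega>. (Z y t \<omega> - Z x t \<omega>)\<^sup>2)) \<longlongrightarrow> 0) (at x within S2)"
proof -
  interpret T': sfield M "\<lambda>x. T x (t - 1)" KT
    by (rule T_sfield)
  interpret T: sfield M "\<lambda>x. T x t" KT
    by (rule T_sfield)
  interpret Z: sfield M "\<lambda>x. Z x t" "KZ t"
    by (rule Z_sfield)
  define k' where "k' = extend_kernel k"
  have kc: "continuous_on UNIV k'"
    unfolding k'_def by (rule continuous_extend_kernel[OF kernel(1)])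
  define h where "h y u = k' (y \<bullet> u) - k' (x \<bullet> u)" for y u :: "real^3"
  have row: "(\<lambda>u. k' (y \<bullet> u)) \<in> borel_measurable surface" for y
    using continuous_measurable_surface[OF continuous_inner_kernel[OF kc, of y]] by (simp add: inner_commute)
  have hm: "h y \<in> borel_measurable surface" for y
    unfolding h_def[abs_def] by (intro borel_measurable_diff row)
  obtain C where C: "\<forall>y\<in>S2. \<forall>u\<in>S2. \<bar>k' (y \<bullet> (u :: real^3))\<bar> \<le> C"
    using continuous_bounded_interval[OF kc] by (elim exE conjE)
  define S where "S = 4 * pi * (\<integral>x. expectation (\<lambda>\<omega>. (T x (t - 1) \<omega>)\<^sup>2) \<partial>surface)"
  have S0: "0 \<le> S"
    unfolding S_def by simp
  \<comment> \<open>Subtracting the equations at y and x leaves the increment of T and the preceding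
    field smeared against the increment \<open>h y\<close> of the kernel, which is uniformly
    small.\<close>
  have bound: "expectation (\<lambda>\<omega>. (Z y t \<omega> - Z x t \<omega>)\<^sup>2)
      \<le> 2 * expectation (\<lambda>\<omega>. (T y t \<omega> - T x t \<omega>)\<^sup>2) + 2 * (S * \<delta>\<^sup>2)"
    if y: "y \<in> S2" and \<delta>: "\<And>u. u \<in> S2 \<Longrightarrow> \<bar>h y u\<bar> \<le> \<delta>" for y \<delta>
  proof -
    define W where "W = smear (\<lambda>x. T x (t - 1)) (h y)"
    have W: "W \<in> borel_measurable M" "integrable M (\<lambda>\<omega>. (W \<omega>)\<^sup>2)"
      "expectation (\<lambda>\<omega>. (W \<omega>)\<^sup>2) \<le> 4 * pi * \<delta>\<^sup>2 * (\<integral>x. expectation (\<lambda>\<omega>. (T x (t - 1) \<omega>)\<^sup>2) \<partial>surface)"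
      unfolding W_def by (rule T'.smear_measurable[OF hm \<delta>] T'.smear_sq[OF hm \<delta>]; assumption)+
    have rows: "\<bar>k' (v \<bullet> u)\<bar> \<le> C" if "v \<in> S2" "u \<in> S2" for v u :: "real^3"
      using C that by blast
    have rowx: "\<bar>(- 1) * k' (x \<bullet> u)\<bar> \<le> C" if "u \<in> S2" for u
      using rows[OF x that] by simp
    have "AE \<omega> in M. smear (\<lambda>x. T x (t - 1)) (\<lambda>u. k' (y \<bullet> u) + (- 1) * k' (x \<bullet> u)) \<omega>
        = smear (\<lambda>x. T x (t - 1)) (\<lambda>u. k' (y \<bullet> u)) \<omega> + smear (\<lambda>x. T x (t - 1)) (\<lambda>u. (- 1) * k' (x \<bullet> u)) \<omega>"
      by (rule T'.smear_add[OF row rows[OF y] borel_measurable_times[OF borel_measurable_const row] rowx])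
    then have "AE \<omega> in M. W \<omega> = smear (\<lambda>x. T x (t - 1)) (\<lambda>u. k' (y \<bullet> u)) \<omega> - smear (\<lambda>x. T x (t - 1)) (\<lambda>u. k' (x \<bullet> u)) \<omega>"
      unfolding T'.smear_scale W_def h_def[abs_def] by eventually_elim simp
    then have "AE \<omega> in M. (Z y t \<omega> - Z x t \<omega>)\<^sup>2 \<le> 2 * (T y t \<omega> - T x t \<omega>)\<^sup>2 + 2 * (W \<omega>)\<^sup>2"
      using equation[OF x, of t] equation[OF y, of t]
    proof eventually_elim
      case (elim \<omega>)
      have "Z y t \<omega> - Z x t \<omega> = (T y t \<omega> - T x t \<omega>) - W \<omega>"
        using elim by (simp only: kernel_op_smear[OF x] kernel_op_smear[OF y] k'_def)
      moreover have "(a - b)\<^sup>2 \<le> 2 * a\<^sup>2 + 2 * b\<^sup>2" for a b :: real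
        using zero_le_power2[of "a + b"] by (simp add: power2_sum power2_diff)
      ultimately show ?case
        by (simp only:)
    qed
    then have "expectation (\<lambda>\<omega>. (Z y t \<omega> - Z x t \<omega>)\<^sup>2) \<le> expectation (\<lambda>\<omega>. 2 * (T y t \<omega> - T x t \<omega>)\<^sup>2 + 2 * (W \<omega>)\<^sup>2)"
      using W T.diff_sq(1)[OF x y] by (intro integral_mono_AE Z.diff_sq(1)[OF x y]) auto
    also have "\<dots> = 2 * expectation (\<lambda>\<omega>. (T y t \<omega> - T x t \<omega>)\<^sup>2) + 2 * expectation (\<lambda>\<omega>. (W \<omega>)\<^sup>2)"
      using W T.diff_sq(1)[OF x y] by simp
    finally show ?thesis
      using W(3) by (simp add: S_def mult_ac)
  qed
  have uc: "uniformly_continuous_on {-1..1} k'"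
    using kc by (intro compact_uniformly_continuous continuous_on_subset[OF kc]) auto
  show ?thesis
  proof (rule tendstoI)
    fix \<epsilon> :: real assume \<epsilon>: "0 < \<epsilon>"
    \<comment> \<open>S + 1 avoids a division by 0. The smeared term then contributes at most half
      of epsilon, and the increment of T less than a quarter.\<close>
    define \<delta> where "\<delta> = sqrt (\<epsilon> / (4 * (S + 1)))"
    have \<delta>: "0 < \<delta>" "2 * (S * \<delta>\<^sup>2) < \<epsilon> / 2 + \<epsilon> / 4"
    proof -
      show "0 < \<delta>"
        using \<epsilon> S0 by (simp add: \<delta>_def)
      have "\<delta>\<^sup>2 = \<epsilon> / (4 * (S + 1))"
        using \<epsilon> S0 by (simp add: \<delta>_def)
      then have "4 * \<delta>\<^sup>2 + 2 * (2 * (S * \<delta>\<^sup>2)) = \<epsilon>"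
        using S0 by (simp add: field_simps)
      then have "2 * (S * \<delta>\<^sup>2) \<le> \<epsilon> / 2"
        using zero_le_power2[of \<delta>] by linarith
      then show "2 * (S * \<delta>\<^sup>2) < \<epsilon> / 2 + \<epsilon> / 4"
        using \<epsilon> by linarith
    qed
    obtain \<eta> where \<eta>: "0 < \<eta>" "\<forall>s\<in>{-1..1}. \<forall>s'\<in>{-1..1}. dist s' s < \<eta> \<longrightarrow> dist (k' s') (k' s) < \<delta>"
      using uc \<delta>(1) unfolding uniformly_continuous_on_def by meson
    have "\<forall>\<^sub>F y in at x within S2. dist y x < \<eta> \<and> y \<in> S2"
      using \<eta>(1) by (auto simp: eventually_at simp del: mem_sphere_0)
    moreover have "\<forall>\<^sub>F y in at x within S2. dist (expectation (\<lambda>\<omega>. (T y t \<omega> - T x t \<omega>)\<^sup>2)) 0 < \<epsilon> / 8"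
      using T_ms_at[OF x] \<epsilon> by (intro tendstoD) auto
    ultimately show "\<forall>\<^sub>F y in at x within S2. dist (expectation (\<lambda>\<omega>. (Z y t \<omega> - Z x t \<omega>)\<^sup>2)) 0 < \<epsilon>"
    proof eventually_elim
      case (elim y)
      then have y: "y \<in> S2"
        by blast
      have "\<bar>h y u\<bar> \<le> \<delta>" if u: "u \<in> S2" for u
      proof -
        have "\<bar>(y - x) \<bullet> u\<bar> \<le> norm (y - x) * norm u"
          by (rule Cauchy_Schwarz_ineq2)
        then have "dist (y \<bullet> u) (x \<bullet> u) < \<eta>"
          using elim u by (simp add: dist_norm inner_diff_left)
        from \<eta>(2)[rule_format, OF inner_S2[OF x u] inner_S2[OF y u] this]
        show ?thesis
          by (simp add: h_def dist_real_def)
      qed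
      from bound[OF y this]
      have "expectation (\<lambda>\<omega>. (Z y t \<omega> - Z x t \<omega>)\<^sup>2) \<le> 2 * expectation (\<lambda>\<omega>. (T y t \<omega> - T x t \<omega>)\<^sup>2) + 2 * (S * \<delta>\<^sup>2)" .
      moreover have "expectation (\<lambda>\<omega>. (T y t \<omega> - T x t \<omega>)\<^sup>2) < \<epsilon> / 8"
        using elim by simp
      ultimately have "expectation (\<lambda>\<omega>. (Z y t \<omega> - Z x t \<omega>)\<^sup>2) < \<epsilon>"
        using \<delta>(2) by linarith
      then show ?case
        by simp
    qed
  qed
qed

lemma coeff_measurable:
  "harm_coeff T l m t \<in> borel_measurable M" "harm_coeff Z l m t \<in> borel_measurable M"
    "integrable M (\<lambda>\<omega>. (harm_coeff T l m t \<omega>)\<^sup>2)"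
  unfolding harm_coeff_smear
  by (rule sfield.smear_continuous[OF T_sfield continuous_sph_harm]
      sfield.smear_continuous[OF Z_sfield continuous_sph_harm])+

text \<open>The equation holds for each x outside a null set that may depend on x. Exchanging the
  two almost-everywhere quantifiers by Fubini lets it be integrated over the sphere along almost
  every path; for this the smeared term must be jointly measurable.\<close>

lemma pointwise_equation_path:
  "AE \<omega> in M. AE x in surface. T x t \<omega> = smear (\<lambda>y. T y (t - 1)) (\<lambda>y. extend_kernel k (x \<bullet> y)) \<omega> + Z x t \<omega>"
proof -
  interpret P: pair_sigma_finite M surface ..
  have c: "continuous_on UNIV (extend_kernel k)"
    by (rule continuous_extend_kernel[OF kernel(1)])
  have Tm: "(\<lambda>(\<omega>, x). T x s \<omega>) \<in> borel_measurable (M \<Otimes>\<^sub>M surface)" for s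
    by (rule sfield.joint[OF T_sfield])
  have Zm: "(\<lambda>(\<omega>, x). Z x s \<omega>) \<in> borel_measurable (M \<Otimes>\<^sub>M surface)" for s
    by (rule sfield.joint[OF Z_sfield])
  have f1: "(\<lambda>p. (fst (fst p), snd p)) \<in> (M \<Otimes>\<^sub>M surface) \<Otimes>\<^sub>M surface \<rightarrow>\<^sub>M M \<Otimes>\<^sub>M surface"
    and f2: "(\<lambda>p. (snd (fst p), snd p)) \<in> (M \<Otimes>\<^sub>M surface) \<Otimes>\<^sub>M surface \<rightarrow>\<^sub>M surface \<Otimes>\<^sub>M surface"
    by measurable
  have "(\<lambda>p. T (snd p) (t - 1) (fst (fst p)) * extend_kernel k (snd (fst p) \<bullet> snd p))
      \<in> borel_measurable ((M \<Otimes>\<^sub>M surface) \<Otimes>\<^sub>M surface)"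
    using measurable_compose[OF f1 Tm[of "t - 1"]] measurable_compose[OF f2 zonal_kernel_measurable[OF c]]
    unfolding case_prod_beta fst_conv snd_conv by (rule borel_measurable_times)
  then have "(\<lambda>(p, y). T y (t - 1) (fst p) * extend_kernel k (snd p \<bullet> y))
      \<in> borel_measurable ((M \<Otimes>\<^sub>M surface) \<Otimes>\<^sub>M surface)"
    by (simp add: case_prod_beta)
  then have km: "(\<lambda>p. smear (\<lambda>y. T y (t - 1)) (\<lambda>y. extend_kernel k (snd p \<bullet> y)) (fst p)) \<in> borel_measurable (M \<Otimes>\<^sub>M surface)"
    unfolding smear_def by (rule surface.borel_measurable_lebesgue_integral)
  define D where "D p = T (snd p) t (fst p)
      - (smear (\<lambda>y. T y (t - 1)) (\<lambda>y. extend_kernel k (snd p \<bullet> y)) (fst p) + Z (snd p) t (fst p))" for p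
  have D: "D \<in> borel_measurable (M \<Otimes>\<^sub>M surface)"
    unfolding D_def using Tm[of t] Zm[of t] km unfolding case_prod_beta
    by (intro borel_measurable_diff borel_measurable_add)
  have "AE x in surface. AE \<omega> in M. D (\<omega>, x) = 0"
  proof (rule AE_I2)
    fix x assume "x \<in> space surface"
    then have x: "x \<in> S2"
      by (simp only: space_surface)
    show "AE \<omega> in M. D (\<omega>, x) = 0"
      using equation[OF x, of t] by eventually_elim (simp add: D_def kernel_op_smear[OF x])
  qed
  moreover have "{p \<in> space (M \<Otimes>\<^sub>M surface). D p = 0} \<in> sets (M \<Otimes>\<^sub>M surface)"
    using D by measurable
  ultimately have "AE \<omega> in M. AE x in surface. D (\<omega>, x) = 0"
    by (subst P.AE_commute) (simp_all add: space_pair_measure)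
  then show ?thesis
  proof eventually_elim
    case (elim \<omega>)
    then show ?case
      by eventually_elim (simp add: D_def)
  qed
qed

text \<open>On a path whose square is integrable, Fubini moves the kernel from the field to the
  harmonic, which is an eigenfunction.\<close>

lemma coeff_equation:
  assumes l: "1 \<le> l" and m: "m \<in> {- int l..int l}"
  shows "AE \<omega> in M. harm_coeff T l m t \<omega> = \<phi> l * harm_coeff T l m (t - 1) \<omega> + harm_coeff Z l m t \<omega>"
proof -
  define Y where "Y = sph_harm l m"
  define q where "q = extend_kernel k"
  have qc: "continuous_on UNIV q"
    unfolding q_def by (rule continuous_extend_kernel[OF kernel(1)])
  have Yc: "continuous_on UNIV Y"
    unfolding Y_def by (rule continuous_sph_harm)
  obtain c where Yb: "Y \<in> borel_measurable surface" "\<forall>x\<in>S2. \<bar>Y x\<bar> \<le> c"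
    using sfield.continuous_bound[OF T_sfield Yc] by (elim exE conjE)
  obtain C where C: "\<forall>x\<in>S2. \<forall>y\<in>S2. \<bar>q (x \<bullet> (y :: real^3))\<bar> \<le> C"
    using continuous_bounded_interval[OF qc] by (elim exE conjE)
  have eig: "AE y in surface. (\<integral>x. q (x \<bullet> y) * Y x \<partial>surface) = \<phi> l * Y y"
    unfolding q_def Y_def by (rule kernel_eigenfunction[OF kernel l m])
  have "AE \<omega> in M. (smear (\<lambda>x. Z x t) Y \<omega>)\<^sup>2 \<le> 4 * pi * c\<^sup>2 * (\<integral>x. (Z x t \<omega>)\<^sup>2 \<partial>surface)
      \<and> integrable surface (\<lambda>x. Z x t \<omega> * Y x)"
    by (rule sfield.smear_path_sq[OF Z_sfield Yb(1)]) (use Yb(2) in \<open>erule bspec\<close>)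
  moreover have "AE \<omega> in M. integrable surface (\<lambda>x. (T x (t - 1) \<omega>)\<^sup>2)"
    by (rule sfield.path_sq[OF T_sfield])
  ultimately show ?thesis
    using pointwise_equation_path[of t] AE_space
  proof eventually_elim
    case (elim \<omega>)
    define f where "f y = T y (t - 1) \<omega>" for y
    have fm [measurable]: "f \<in> borel_measurable surface"
      unfolding f_def using sfield.path_measurable[OF T_sfield] elim by blast
    have Tm: "(\<lambda>x. T x t \<omega>) \<in> borel_measurable surface" and Zm: "(\<lambda>x. Z x t \<omega>) \<in> borel_measurable surface"
      using sfield.path_measurable[OF T_sfield] sfield.path_measurable[OF Z_sfield] elim by blast+
    have fi: "integrable surface f"
      using integral_sq_le(1)[OF fm] elim by (simp add: f_def)
    define F where "F x y = f y * q (x \<bullet> y) * Y x" for x y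
    have Fm: "(\<lambda>(x, y). F x y) \<in> borel_measurable (surface \<Otimes>\<^sub>M surface)"
      using zonal_kernel_measurable[OF qc] unfolding F_def case_prod_beta
      by (intro borel_measurable_times measurable_compose[OF measurable_snd fm] measurable_compose[OF measurable_fst Yb(1)])
    have fp: "integrable (surface \<Otimes>\<^sub>M surface) (\<lambda>(x, y). \<bar>C\<bar> * \<bar>c\<bar> * f y)"
    proof (rule SS.Fubini_integrable)
      show "(\<lambda>(x, y). \<bar>C\<bar> * \<bar>c\<bar> * f y) \<in> borel_measurable (surface \<Otimes>\<^sub>M surface)"
        by measurable
    qed (use fi in \<open>simp_all\<close>)
    have Fi: "integrable (surface \<Otimes>\<^sub>M surface) (\<lambda>(x, y). F x y)"
    proof (rule Bochner_Integration.integrable_bound[OF fp Fm], rule AE_I2)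
      fix p assume "p \<in> space (surface \<Otimes>\<^sub>M surface)"
      then have p: "fst p \<in> S2" "snd p \<in> S2"
        unfolding space_pair_measure space_surface by (auto simp del: mem_sphere_0)
      have "\<bar>q (fst p \<bullet> snd p)\<bar> * \<bar>Y (fst p)\<bar> \<le> \<bar>C\<bar> * \<bar>c\<bar>"
        using C[rule_format, OF p] Yb(2)[rule_format, OF p(1)] by (intro mult_mono) auto
      then have "\<bar>f (snd p)\<bar> * (\<bar>q (fst p \<bullet> snd p)\<bar> * \<bar>Y (fst p)\<bar>) \<le> \<bar>f (snd p)\<bar> * (\<bar>C\<bar> * \<bar>c\<bar>)"
        by (intro mult_left_mono) auto
      then show "norm ((\<lambda>(x, y). F x y) p) \<le> norm ((\<lambda>(x, y). \<bar>C\<bar> * \<bar>c\<bar> * f y) p)"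
        by (simp add: case_prod_beta F_def abs_mult mult_ac)
    qed
    have inner: "(\<integral>y. F x y \<partial>surface) = smear (\<lambda>y. T y (t - 1)) (\<lambda>y. q (x \<bullet> y)) \<omega> * Y x" for x
      unfolding F_def smear_def f_def by (rule integral_mult_left_zero)
    have Ki: "integrable surface (\<lambda>x. smear (\<lambda>y. T y (t - 1)) (\<lambda>y. q (x \<bullet> y)) \<omega> * Y x)"
      using SS.integrable_fst'[OF Fi] by (simp add: inner)
    have "(\<integral>x. smear (\<lambda>y. T y (t - 1)) (\<lambda>y. q (x \<bullet> y)) \<omega> * Y x \<partial>surface) = (\<integral>x. (\<integral>y. F x y \<partial>surface) \<partial>surface)"
      by (simp only: inner)
    also have "\<dots> = (\<integral>y. (\<integral>x. F x y \<partial>surface) \<partial>surface)"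
      by (rule SS.Fubini_integral[symmetric, OF Fi])
    also have "\<dots> = (\<integral>y. \<phi> l * (f y * Y y) \<partial>surface)"
    proof (rule integral_cong_AE)
      show "(\<lambda>y. \<integral>x. F x y \<partial>surface) \<in> borel_measurable surface"
        using SS.integrable_snd[OF Fi] by (rule borel_measurable_integrable)
      show "(\<lambda>y. \<phi> l * (f y * Y y)) \<in> borel_measurable surface"
        by (intro borel_measurable_times borel_measurable_const fm Yb)
      show "AE y in surface. (\<integral>x. F x y \<partial>surface) = \<phi> l * (f y * Y y)"
        using eig
      proof eventually_elim
        case (elim y)
        have "(\<integral>x. F x y \<partial>surface) = (\<integral>x. f y * (q (x \<bullet> y) * Y x) \<partial>surface)"
          by (simp add: F_def mult.assoc)
        also have "\<dots> = f y * (\<phi> l * Y y)"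
          by (simp only: integral_mult_right_zero elim)
        finally show ?case
          by simp
      qed
    qed
    also have "\<dots> = \<phi> l * (\<integral>y. f y * Y y \<partial>surface)"
      by (rule integral_mult_right_zero)
    finally have K: "(\<integral>x. smear (\<lambda>y. T y (t - 1)) (\<lambda>y. q (x \<bullet> y)) \<omega> * Y x \<partial>surface)
        = \<phi> l * harm_coeff T l m (t - 1) \<omega>"
      by (simp add: harm_coeff_def f_def Y_def)
    have Km: "(\<lambda>x. smear (\<lambda>y. T y (t - 1)) (\<lambda>y. q (x \<bullet> y)) \<omega> * Y x + Z x t \<omega> * Y x) \<in> borel_measurable surface"
      by (intro borel_measurable_add borel_measurable_integrable[OF Ki] borel_measurable_times Zm Yb(1))
    have "harm_coeff T l m t \<omega> = (\<integral>x. smear (\<lambda>y. T y (t - 1)) (\<lambda>y. q (x \<bullet> y)) \<omega> * Y x + Z x t \<omega> * Y x \<partial>surface)"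
      unfolding harm_coeff_def Y_def[symmetric]
    proof (rule integral_cong_AE[OF borel_measurable_times[OF Tm Yb(1)] Km])
      have "AE x in surface. T x t \<omega> = smear (\<lambda>y. T y (t - 1)) (\<lambda>y. q (x \<bullet> y)) \<omega> + Z x t \<omega>"
        using elim by (simp add: q_def)
      then show "AE x in surface. T x t \<omega> * Y x = smear (\<lambda>y. T y (t - 1)) (\<lambda>y. q (x \<bullet> y)) \<omega> * Y x + Z x t \<omega> * Y x"
        by eventually_elim (simp only: distrib_right)
    qed
    also have "\<dots> = (\<integral>x. smear (\<lambda>y. T y (t - 1)) (\<lambda>y. q (x \<bullet> y)) \<omega> * Y x \<partial>surface) + (\<integral>x. Z x t \<omega> * Y x \<partial>surface)"
      using Ki elim by (intro Bochner_Integration.integral_add) auto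
    finally show ?case
      unfolding K by (simp only: harm_coeff_def Y_def)
  qed
qed

lemma noise_covariance:
  assumes "m \<in> {- int l..int l}" "m' \<in> {- int l'..int l'}" "1 \<le> l"
  shows "expectation (\<lambda>\<omega>. harm_coeff Z l m t \<omega> * harm_coeff Z l' m' t \<omega>) = (if l = l' \<and> m = m' then CZ l else 0)"
proof -
  have "invariant_form (\<lambda>f g. expectation (\<lambda>\<omega>. smear (\<lambda>x. Z x t) f \<omega> * smear (\<lambda>x. Z x t) g \<omega>)) ((4 * pi)\<^sup>2 * KZ t)"
    by (rule sfield.smear_invariant_form[OF Z_sfield]) (rule Z_law)
  from invariant_form.sph_harm_values[OF this assms(1,2)]
  have "expectation (\<lambda>\<omega>. harm_coeff Z l m t \<omega> * harm_coeff Z l' m' t \<omega>)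
      = (if l = l' \<and> m = m' then expectation (\<lambda>\<omega>. harm_coeff Z l 0 t \<omega> * harm_coeff Z l 0 t \<omega>) else 0)"
    unfolding harm_coeff_smear .
  moreover have "expectation (\<lambda>\<omega>. (harm_coeff Z l 0 t \<omega>)\<^sup>2) = CZ l"
    using spectrum assms(3) unfolding has_power_spectrum_def by simp
  ultimately show ?thesis
    unfolding power2_eq_square by (simp only:)
qed

lemma coeff_variance:
  "expectation (\<lambda>\<omega>. (harm_coeff T l m t \<omega>)\<^sup>2) = expectation (\<lambda>\<omega>. (harm_coeff T l m 0 \<omega>)\<^sup>2)"
proof -
  obtain c where Yb: "sph_harm l m \<in> borel_measurable surface" "\<forall>x\<in>S2. \<bar>sph_harm l m x\<bar> \<le> c"
    using sfield.continuous_bound[OF T_sfield continuous_sph_harm[of UNIV l m]] by (elim exE conjE)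
  have Yb2: "\<bar>sph_harm l m x\<bar> \<le> c" if "x \<in> S2" for x
    using Yb(2) that by (rule bspec)
  have R: "rotation_matrix (mat 1 :: real^3^3)"
    by (simp add: rotation_matrix_def orthogonal_matrix_id)
  have cov: "expectation (\<lambda>\<omega>. (harm_coeff T l m s \<omega>)\<^sup>2) = (\<integral>x. (\<integral>y. expectation (\<lambda>\<omega>. T x s \<omega> * T y s \<omega>)
      * sph_harm l m y \<partial>surface) * sph_harm l m x \<partial>surface)" for s
    using smear_covariance[OF T_sfield T_sfield Yb(1) Yb2 Yb(1) Yb2, of s s]
    unfolding harm_coeff_smear by (simp add: power2_eq_square)
  have same: "expectation (\<lambda>\<omega>. T x t \<omega> * T y t \<omega>) = expectation (\<lambda>\<omega>. T x 0 \<omega> * T y 0 \<omega>)" if "x \<in> S2" "y \<in> S2" for x y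
    using T_law[OF R that, of 0 t] by simp
  show ?thesis
    unfolding cov
  proof (intro Bochner_Integration.integral_cong refl)
    fix x assume "x \<in> space surface"
    then have x: "x \<in> S2"
      by (simp only: space_surface)
    have "(\<integral>y. expectation (\<lambda>\<omega>. T x t \<omega> * T y t \<omega>) * sph_harm l m y \<partial>surface)
        = (\<integral>y. expectation (\<lambda>\<omega>. T x 0 \<omega> * T y 0 \<omega>) * sph_harm l m y \<partial>surface)"
    proof (intro Bochner_Integration.integral_cong refl)
      fix y assume "y \<in> space surface"
      then have "y \<in> S2"
        by (simp only: space_surface)
      then show "expectation (\<lambda>\<omega>. T x t \<omega> * T y t \<omega>) * sph_harm l m y = expectation (\<lambda>\<omega>. T x 0 \<omega> * T y 0 \<omega>) * sph_harm l m y"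
        by (simp only: same[OF x])
    qed
    then show "(\<integral>y. expectation (\<lambda>\<omega>. T x t \<omega> * T y t \<omega>) * sph_harm l m y \<partial>surface) * sph_harm l m x
        = (\<integral>y. expectation (\<lambda>\<omega>. T x 0 \<omega> * T y 0 \<omega>) * sph_harm l m y \<partial>surface) * sph_harm l m x"
      by (simp only:)
  qed
qed

lemma innov_coeff:
  assumes "1 \<le> l" "m \<in> {- int l..int l}"
  shows "AE \<omega> in M. innov (\<lambda>(l, m). \<phi> l) (\<lambda>(l, m) t. harm_coeff T l m (int t)) (l, m) t \<omega>
    = harm_coeff Z l m (int (Suc t)) \<omega>"
  using coeff_equation[OF assms, of "int (Suc t)"] by eventually_elim (simp add: innov_def)

abbreviation "modes \<equiv> {(l, m). (1 :: nat) \<le> l \<and> m \<in> {- int l..int l}}"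

text \<open>A linear combination of noise coefficients at one time is the noise smeared against the
  same combination of harmonics, hence has a normal characteristic function; by
  \<open>noise_covariance\<close> its variance has only diagonal terms.\<close>

lemma innov_coeff_char:
  assumes J: "finite J" "J \<subseteq> modes"
  shows "(CLINT \<omega>|M. iexp (\<Sum>j\<in>J. c j * innov (\<lambda>(l, m). \<phi> l) (\<lambda>(l, m) t. harm_coeff T l m (int t)) j t \<omega>))
    = exp (- (\<Sum>j\<in>J. (c j)\<^sup>2 * (\<lambda>(l, m). CZ l) j) / 2)"
proof -
  interpret Z: sfield M "\<lambda>x. Z x (int (Suc t))" "KZ (int (Suc t))"
    by (rule Z_sfield)
  define z where "z j = harm_coeff Z (fst j) (snd j) (int (Suc t))" for j
  define e where "e j = innov (\<lambda>(l, m). \<phi> l) (\<lambda>(l, m) t. harm_coeff T l m (int t)) j t" for j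
  define g where "g x = (\<Sum>j\<in>J. c j * sph_harm (fst j) (snd j) x)" for x
  have zm [measurable]: "z j \<in> borel_measurable M" and z2: "integrable M (\<lambda>\<omega>. (z j \<omega>)\<^sup>2)" for j
    unfolding z_def harm_coeff_smear by (rule Z.smear_continuous[OF continuous_sph_harm])+
  have em [measurable]: "e j \<in> borel_measurable M" for j
    unfolding e_def innov_def[abs_def] case_prod_beta
    by (intro borel_measurable_diff borel_measurable_times borel_measurable_const coeff_measurable)
  have gc: "continuous_on UNIV g"
    unfolding g_def[abs_def] by (intro continuous_on_sum continuous_on_mult_left continuous_sph_harm)
  have ez: "AE \<omega> in M. \<forall>j\<in>J. e j \<omega> = z j \<omega>"
  proof (rule AE_finite_allI[OF J(1)])
    fix j assume "j \<in> J"
    then have "1 \<le> fst j" "snd j \<in> {- int (fst j)..int (fst j)}"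
      using J(2) by auto
    from innov_coeff[OF this, of t] show "AE \<omega> in M. e j \<omega> = z j \<omega>"
      by (simp add: e_def z_def)
  qed
  have gz: "AE \<omega> in M. smear (\<lambda>x. Z x (int (Suc t))) g \<omega> = (\<Sum>j\<in>J. c j * z j \<omega>)"
    using Z.smear_sum[OF J(1), of "\<lambda>j x. c j * sph_harm (fst j) (snd j) x"]
    unfolding g_def[abs_def] z_def harm_coeff_smear Z.smear_scale
    by (simp add: continuous_on_mult_left)
  have gm [measurable]: "smear (\<lambda>x. Z x (int (Suc t))) g \<in> borel_measurable M"
    by (rule Z.smear_continuous[OF gc])
  have "(CLINT \<omega>|M. iexp (\<Sum>j\<in>J. c j * e j \<omega>)) = (CLINT \<omega>|M. iexp (1 * smear (\<lambda>x. Z x (int (Suc t))) g \<omega>))"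
  proof (rule integral_cong_AE)
    show "AE \<omega> in M. iexp (\<Sum>j\<in>J. c j * e j \<omega>) = iexp (1 * smear (\<lambda>x. Z x (int (Suc t))) g \<omega>)"
      using ez gz by eventually_elim simp
  qed measurable
  also have "\<dots> = exp (- (1\<^sup>2 * expectation (\<lambda>\<omega>. (smear (\<lambda>x. Z x (int (Suc t))) g \<omega>)\<^sup>2)) / 2)"
    by (rule Z.smear_gaussian_char[OF Z_ms_at Z_gauss Z_cent gc])
  also have "expectation (\<lambda>\<omega>. (smear (\<lambda>x. Z x (int (Suc t))) g \<omega>)\<^sup>2) = expectation (\<lambda>\<omega>. (\<Sum>j\<in>J. c j * z j \<omega>)\<^sup>2)"
  proof (rule integral_cong_AE)
    show "AE \<omega> in M. (smear (\<lambda>x. Z x (int (Suc t))) g \<omega>)\<^sup>2 = (\<Sum>j\<in>J. c j * z j \<omega>)\<^sup>2"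
      using gz by eventually_elim simp
  qed measurable
  also have "\<dots> = expectation (\<lambda>\<omega>. \<Sum>i\<in>J. \<Sum>j\<in>J. c i * c j * (z i \<omega> * z j \<omega>))"
    by (simp add: power2_eq_square sum_product mult_ac)
  also have "\<dots> = (\<Sum>i\<in>J. \<Sum>j\<in>J. c i * c j * expectation (\<lambda>\<omega>. z i \<omega> * z j \<omega>))"
  proof -
    have "integrable M (\<lambda>\<omega>. z i \<omega> * z j \<omega>)" for i j
      by (rule integrable_mult_squares[OF zm zm z2 z2])
    then show ?thesis
      by simp
  qed
  also have "\<dots> = (\<Sum>i\<in>J. \<Sum>j\<in>J. if j = i then (c i)\<^sup>2 * CZ (fst i) else 0)"
  proof (intro sum.cong refl)
    fix i j assume "i \<in> J" "j \<in> J"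
    then have "1 \<le> fst i" "snd i \<in> {- int (fst i)..int (fst i)}" "snd j \<in> {- int (fst j)..int (fst j)}"
      using J(2) by auto
    from noise_covariance[OF this(2,3,1), of "int (Suc t)"]
    have "expectation (\<lambda>\<omega>. z i \<omega> * z j \<omega>) = (if j = i then CZ (fst i) else 0)"
      unfolding z_def prod_eq_iff by (auto simp: prod_eq_iff)
    then show "c i * c j * expectation (\<lambda>\<omega>. z i \<omega> * z j \<omega>) = (if j = i then (c i)\<^sup>2 * CZ (fst i) else 0)"
      by (simp add: power2_eq_square)
  qed
  also have "\<dots> = (\<Sum>j\<in>J. (c j)\<^sup>2 * CZ (fst j))"
    using J(1) by simp
  finally show ?thesis
    by (simp add: e_def case_prod_beta)
qed

text \<open>The hypothesis is about point values of Z and of the past of T.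
  \<open>smear_version\<close> writes the coefficients, up to null sets, as measurable functions of
  these, the innovations being almost surely the coefficients of Z; independence passes to functions
  and to almost surely equal variables.\<close>

lemma coeff_indep:
  assumes J: "finite J" "J \<subseteq> modes"
  shows "indep_var (PiM (J \<times> {Suc t}) (\<lambda>_. borel))
      (\<lambda>\<omega>. \<lambda>(j, s)\<in>J \<times> {Suc t}. innov (\<lambda>(l, m). \<phi> l) (\<lambda>(l, m) t. harm_coeff T l m (int t)) j t \<omega>)
      (PiM (J \<times> {..t}) (\<lambda>_. borel)) (\<lambda>\<omega>. \<lambda>(j, s)\<in>J \<times> {..t}. (\<lambda>(l, m) t. harm_coeff T l m (int t)) j s \<omega>)"
proof -
  define t' where "t' = int (Suc t)"
  define e where "e j = innov (\<lambda>(l, m). \<phi> l) (\<lambda>(l, m) t. harm_coeff T l m (int t)) j t" for j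
  define a where "a j s = harm_coeff T (fst j) (snd j) (int s)" for j :: "nat \<times> int" and s
  define ZP where "ZP \<omega> = (\<lambda>(x, s)\<in>S2 \<times> {t'}. Z x s \<omega>)" for \<omega>
  define TP where "TP \<omega> = (\<lambda>(x, s)\<in>S2 \<times> {..<t'}. T x s \<omega>)" for \<omega>
  have bound: "\<exists>c. \<forall>x\<in>S2. \<bar>sph_harm l m x\<bar> \<le> c" for l m
    using sfield.continuous_bound[OF T_sfield continuous_sph_harm[of UNIV l m]] by (elim exE conjE) (rule exI)
  have Ym: "sph_harm l m \<in> borel_measurable surface" for l m
    by (rule continuous_measurable_surface[OF continuous_sph_harm])
  have vZ: "\<exists>F. F \<in> borel_measurable (\<Pi>\<^sub>M p\<in>S2 \<times> {t'}. borel) \<and> (AE \<omega> in M. harm_coeff Z l m t' \<omega> = F (ZP \<omega>))" for l m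
  proof -
    obtain c where c: "\<forall>x\<in>S2. \<bar>sph_harm l m x\<bar> \<le> c"
      using bound[of l m] by (elim exE)
    have "\<exists>F. F \<in> borel_measurable (\<Pi>\<^sub>M p\<in>S2 \<times> {t'}. borel)
        \<and> (AE \<omega> in M. smear (\<lambda>x. Z x t') (sph_harm l m) \<omega> = F (\<lambda>p\<in>S2 \<times> {t'}. (\<lambda>(x, s). Z x s) p \<omega>))"
    proof (rule sfield.smear_version[OF Z_sfield Z_ms_at Ym, where c = c and \<iota> = "\<lambda>x. (x, t')"])
      show "\<bar>sph_harm l m x\<bar> \<le> c" if "x \<in> S2" for x
        using c that by (rule bspec)
    qed (auto simp del: mem_sphere_0)
    moreover have "(\<lambda>p\<in>S2 \<times> {t'}. (\<lambda>(x, s). Z x s) p \<omega>) = ZP \<omega>" for \<omega>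
      unfolding ZP_def by (rule restrict_ext) auto
    ultimately show ?thesis
      unfolding harm_coeff_smear by (simp only:)
  qed
  have vT: "\<exists>F. F \<in> borel_measurable (\<Pi>\<^sub>M p\<in>S2 \<times> {..<t'}. borel) \<and> (AE \<omega> in M. harm_coeff T l m s \<omega> = F (TP \<omega>))"
    if s: "s < t'" for l m s
  proof -
    obtain c where c: "\<forall>x\<in>S2. \<bar>sph_harm l m x\<bar> \<le> c"
      using bound[of l m] by (elim exE)
    have "\<exists>F. F \<in> borel_measurable (\<Pi>\<^sub>M p\<in>S2 \<times> {..<t'}. borel)
        \<and> (AE \<omega> in M. smear (\<lambda>x. T x s) (sph_harm l m) \<omega> = F (\<lambda>p\<in>S2 \<times> {..<t'}. (\<lambda>(x, s). T x s) p \<omega>))"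
    proof (rule sfield.smear_version[OF T_sfield T_ms_at Ym, where c = c and \<iota> = "\<lambda>x. (x, s)"])
      show "\<bar>sph_harm l m x\<bar> \<le> c" if "x \<in> S2" for x
        using c that by (rule bspec)
    qed (use s in \<open>auto simp del: mem_sphere_0\<close>)
    moreover have "(\<lambda>p\<in>S2 \<times> {..<t'}. (\<lambda>(x, s). T x s) p \<omega>) = TP \<omega>" for \<omega>
      unfolding TP_def by (rule restrict_ext) auto
    ultimately show ?thesis
      unfolding harm_coeff_smear by (simp only:)
  qed
  have "\<exists>FZ. \<forall>j. FZ j \<in> borel_measurable (\<Pi>\<^sub>M p\<in>S2 \<times> {t'}. borel)
      \<and> (AE \<omega> in M. harm_coeff Z (fst j) (snd j) t' \<omega> = FZ j (ZP \<omega>))"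
    by (intro choice allI vZ)
  then obtain FZ where FZ: "\<And>j. FZ j \<in> borel_measurable (\<Pi>\<^sub>M p\<in>S2 \<times> {t'}. borel)"
    "\<And>j. AE \<omega> in M. harm_coeff Z (fst j) (snd j) t' \<omega> = FZ j (ZP \<omega>)"
    by blast
  have "\<exists>FT. \<forall>p. snd p \<le> t \<longrightarrow> FT p \<in> borel_measurable (\<Pi>\<^sub>M p\<in>S2 \<times> {..<t'}. borel)
      \<and> (AE \<omega> in M. harm_coeff T (fst (fst p)) (snd (fst p)) (int (snd p)) \<omega> = FT p (TP \<omega>))"
    by (intro choice allI) (use vT in \<open>auto simp: t'_def\<close>)
  then obtain FT where FT: "\<And>p. snd p \<le> t \<Longrightarrow> FT p \<in> borel_measurable (\<Pi>\<^sub>M p\<in>S2 \<times> {..<t'}. borel)"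
    "\<And>p. snd p \<le> t \<Longrightarrow> AE \<omega> in M. harm_coeff T (fst (fst p)) (snd (fst p)) (int (snd p)) \<omega> = FT p (TP \<omega>)"
    by blast
  have base: "indep_var (\<Pi>\<^sub>M p\<in>S2 \<times> {t'}. borel) ZP (\<Pi>\<^sub>M p\<in>S2 \<times> {..<t'}. borel) TP"
    unfolding ZP_def TP_def by (rule Z_T_indep)
  have comp: "indep_var (PiM (J \<times> {Suc t}) (\<lambda>_. borel)) ((\<lambda>f. \<lambda>p\<in>J \<times> {Suc t}. FZ (fst p) f) \<circ> ZP)
      (PiM (J \<times> {..t}) (\<lambda>_. borel)) ((\<lambda>f. \<lambda>p\<in>J \<times> {..t}. FT p f) \<circ> TP)"
    by (rule indep_var_compose[OF base]; rule measurable_restrict) (auto intro: FZ(1) FT(1))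
  show ?thesis
    unfolding e_def[symmetric]
  proof (rule indep_var_AE[OF comp])
    have em: "e j \<in> borel_measurable M" for j
      unfolding e_def innov_def[abs_def] case_prod_beta
      by (intro borel_measurable_diff borel_measurable_times borel_measurable_const coeff_measurable)
    show "(\<lambda>\<omega>. \<lambda>(j, s)\<in>J \<times> {Suc t}. e j \<omega>) \<in> M \<rightarrow>\<^sub>M PiM (J \<times> {Suc t}) (\<lambda>_. borel)"
      unfolding case_prod_beta by (intro measurable_restrict em)
    show "(\<lambda>\<omega>. \<lambda>(j, s)\<in>J \<times> {..t}. (\<lambda>(l, m) t. harm_coeff T l m (int t)) j s \<omega>) \<in> M \<rightarrow>\<^sub>M PiM (J \<times> {..t}) (\<lambda>_. borel)"
      unfolding case_prod_beta by (intro measurable_restrict coeff_measurable)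
    have "AE \<omega> in M. \<forall>j\<in>J. e j \<omega> = FZ j (ZP \<omega>)"
    proof (rule AE_finite_allI[OF J(1)])
      fix j assume "j \<in> J"
      then have j: "1 \<le> fst j" "snd j \<in> {- int (fst j)..int (fst j)}"
        using J(2) by auto
      show "AE \<omega> in M. e j \<omega> = FZ j (ZP \<omega>)"
        using innov_coeff[OF j, of t] FZ(2)[of j] by eventually_elim (simp add: e_def t'_def)
    qed
    then show "AE \<omega> in M. ((\<lambda>f. \<lambda>p\<in>J \<times> {Suc t}. FZ (fst p) f) \<circ> ZP) \<omega> = (\<lambda>(j, s)\<in>J \<times> {Suc t}. e j \<omega>)"
    proof eventually_elim
      case (elim \<omega>)
      then show ?case
        unfolding o_def by (intro restrict_ext) auto
    qed
    have "AE \<omega> in M. \<forall>p\<in>J \<times> {..t}. harm_coeff T (fst (fst p)) (snd (fst p)) (int (snd p)) \<omega> = FT p (TP \<omega>)"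
      by (rule AE_finite_allI) (use J(1) FT(2) in auto)
    then show "AE \<omega> in M. ((\<lambda>f. \<lambda>p\<in>J \<times> {..t}. FT p f) \<circ> TP) \<omega>
        = (\<lambda>(j, s)\<in>J \<times> {..t}. (\<lambda>(l, m) t. harm_coeff T l m (int t)) j s \<omega>)"
    proof eventually_elim
      case (elim \<omega>)
      then show ?case
        unfolding o_def by (intro restrict_ext) (auto simp: case_prod_beta)
    qed
  qed
qed

lemma ar_array_coeff:
  assumes r: "\<And>l. 1 \<le> l \<Longrightarrow> \<bar>\<phi> l\<bar> \<le> r" "r < 1" and CZ: "\<And>l. 1 \<le> l \<Longrightarrow> 0 < CZ l"
  shows "ar_array M (\<lambda>(l, m) t. harm_coeff T l m (int t)) (\<lambda>(l, m). \<phi> l)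
    (\<lambda>(l, m). expectation (\<lambda>\<omega>. (harm_coeff T l m 0 \<omega>)\<^sup>2)) (\<lambda>(l, m). CZ l) modes r"
proof unfold_locales
  let ?a = "\<lambda>(l, m) t. harm_coeff T l m (int t)" and ?p = "\<lambda>(l :: nat, m :: int). \<phi> l" and ?cz = "\<lambda>(l :: nat, m :: int). CZ l"
  show am: "?a j t \<in> borel_measurable M" for j t
    unfolding case_prod_beta by (rule coeff_measurable)
  show "\<bar>?p j\<bar> \<le> r" if "j \<in> modes" for j
    using that r(1) by auto
  show "r < 1"
    by fact
  show pos: "0 < ?cz j" if "j \<in> modes" for j
    using that CZ by auto
  show "has_bochner_integral M (\<lambda>\<omega>. (?a j t \<omega>)\<^sup>2) ((\<lambda>(l, m). expectation (\<lambda>\<omega>. (harm_coeff T l m 0 \<omega>)\<^sup>2)) j)" for j t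
    using coeff_measurable(3) coeff_variance by (simp add: has_bochner_integral_iff case_prod_beta)
  show ch: "(CLINT \<omega>|M. iexp (\<Sum>j\<in>J. c j * innov ?p ?a j t \<omega>)) = exp (- (\<Sum>j\<in>J. (c j)\<^sup>2 * ?cz j) / 2)"
    if "finite J" "J \<subseteq> modes" for J c t
    by (rule innov_coeff_char[OF that])
  show "indep_var (PiM (J \<times> {Suc t}) (\<lambda>_. borel)) (\<lambda>\<omega>. \<lambda>(j, s)\<in>J \<times> {Suc t}. innov ?p ?a j t \<omega>)
      (PiM (J \<times> {..t}) (\<lambda>_. borel)) (\<lambda>\<omega>. \<lambda>(j, s)\<in>J \<times> {..t}. ?a j s \<omega>)"
    if "finite J" "J \<subseteq> modes" for J t
    by (rule coeff_indep[OF that])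
  show "distr M borel (innov ?p ?a j t) = density lborel (normal_density 0 (sqrt (?cz j)))" if j: "j \<in> modes" for j t
  \<comment> \<open>A one-element index set in \<open>innov_coeff_char\<close> gives the
    characteristic function of a single innovation.\<close>
  proof (rule Levy_uniqueness)
    have m [measurable]: "innov ?p ?a j t \<in> borel_measurable M"
      unfolding innov_def[abs_def] by (intro borel_measurable_diff borel_measurable_times borel_measurable_const am)
    show "real_distribution (distr M borel (innov ?p ?a j t))"
      by (rule real_distribution_distr[OF m])
    have s: "0 < sqrt (?cz j)"
      using pos[OF j] by simp
    interpret N: prob_space "density lborel (normal_density 0 (sqrt (?cz j)))"
      by (rule prob_space_normal_density[OF s])
    show "real_distribution (density lborel (normal_density 0 (sqrt (?cz j))))"
      by unfold_locales simp_all
    show "char (distr M borel (innov ?p ?a j t)) = char (density lborel (normal_density 0 (sqrt (?cz j))))"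
    proof
      fix u
      have "char (distr M borel (innov ?p ?a j t)) u = (CLINT \<omega>|M. iexp (\<Sum>i\<in>{j}. u * innov ?p ?a i t \<omega>))"
        unfolding char_def by (subst integral_distr) auto
      also have "\<dots> = exp (- (\<Sum>i\<in>{j}. u\<^sup>2 * ?cz i) / 2)"
        by (rule ch) (use j in auto)
      also have "\<dots> = char (density lborel (normal_density 0 (sqrt (?cz j)))) u"
        unfolding char_normal_density[OF s] using pos[OF j] by (simp add: mult.commute)
      finally show "char (distr M borel (innov ?p ?a j t)) u = char (density lborel (normal_density 0 (sqrt (?cz j)))) u" .
    qed
  qed
qed

end


subsection \<open>Sums over multipoles\<close>

text \<open>The bridge between the unordered sums over l in the asymptotic variance and the limits
  of partial sums that the estimates use; absolute convergence makes the two agree.\<close>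

lemma bounded_weight_sum:
  fixes b g :: "nat \<Rightarrow> real"
  assumes b: "\<And>l. 0 \<le> b l" "summable b" and g: "\<And>l. 1 \<le> l \<Longrightarrow> \<bar>g l\<bar> \<le> K"
  shows "(\<lambda>l. b l * g l) summable_on {1..}"
    and "(\<lambda>n. \<Sum>l=1..n. b l * g l) \<longlonglongrightarrow> (\<Sum>\<^sub>\<infinity>l\<in>{1..}. b l * g l)"
proof -
  define f where "f l = (if 1 \<le> l then b l * g l else 0)" for l
  have "summable (\<lambda>l. norm (f l))"
  proof (rule summable_comparison_test'[where N = 0])
    show "summable (\<lambda>l. \<bar>K\<bar> * b l)"
      using b(2) by (rule summable_mult)
    fix l :: nat
    have "\<bar>b l * g l\<bar> \<le> \<bar>K\<bar> * b l" if "1 \<le> l"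
    proof -
      have "b l * \<bar>g l\<bar> \<le> b l * \<bar>K\<bar>"
        using g[OF that] b(1)[of l] by (intro mult_left_mono) auto
      then show ?thesis
        using b(1)[of l] by (simp add: abs_mult mult.commute)
    qed
    then show "norm (norm (f l)) \<le> \<bar>K\<bar> * b l"
      using b(1)[of l] by (simp add: f_def)
  qed
  then have s: "f summable_on UNIV"
    by (rule norm_summable_imp_summable_on)
  then have "(f has_sum infsum f UNIV) UNIV"
    by (rule has_sum_infsum)
  then have "(\<lambda>n. sum f {..<n}) \<longlonglongrightarrow> infsum f UNIV"
    using has_sum_imp_sums unfolding sums_def by blast
  then have "(\<lambda>n. sum f {..<Suc n}) \<longlonglongrightarrow> infsum f UNIV"
    by (rule LIMSEQ_Suc)
  moreover have "sum f {..<Suc n} = (\<Sum>l=1..n. b l * g l)" for n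
    by (rule sum.mono_neutral_cong_right) (auto simp: f_def)
  moreover have "infsum f UNIV = (\<Sum>\<^sub>\<infinity>l\<in>{1..}. b l * g l)"
    by (rule infsum_cong_neutral) (auto simp: f_def)
  ultimately show "(\<lambda>n. \<Sum>l=1..n. b l * g l) \<longlonglongrightarrow> (\<Sum>\<^sub>\<infinity>l\<in>{1..}. b l * g l)"
    by simp
  have "f summable_on UNIV \<longleftrightarrow> (\<lambda>l. b l * g l) summable_on {1..}"
    by (rule summable_on_cong_neutral) (auto simp: f_def)
  then show "(\<lambda>l. b l * g l) summable_on {1..}"
    using s by blast
qed

lemma sum_int_shift:
  fixes f :: "int \<Rightarrow> 'a::comm_monoid_add"
  shows "(\<Sum>t = 1..int N. f t) = (\<Sum>t<N. f (int (Suc t)))"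
  by (rule sum.reindex_bij_witness[of _ "\<lambda>t. int (Suc t)" "\<lambda>t. nat t - 1"]) auto

lemma is_arg_min_shift:
  fixes f g :: "'a \<Rightarrow> real"
  assumes "\<And>\<theta>. P \<theta> \<Longrightarrow> f \<theta> = \<kappa> + g \<theta>"
  shows "is_arg_min f P = is_arg_min g P"
  using assms by (auto simp: is_arg_min_def fun_eq_iff)

section \<open>The model: its variances and the limits of the multipole sums\<close>

locale nls_sphar = sphar M T Z k \<phi> CZ + nls G\<^sub>0 \<alpha>\<^sub>0 a1 a2
  for M :: "'w measure" and T Z k \<phi> CZ G\<^sub>0 \<alpha>\<^sub>0 a1 a2 +
  fixes H \<gamma> :: real and L :: "nat \<Rightarrow> nat" and Ghat \<alpha>hat :: "nat \<Rightarrow> 'w \<Rightarrow> real"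
  assumes phi: "\<And>l. 1 \<le> l \<Longrightarrow> \<phi> l = G\<^sub>0 * real l powr - \<alpha>\<^sub>0"
    and CZ: "\<And>l. 1 \<le> l \<Longrightarrow> CZ l = H * real l powr - \<gamma>"
    and H: "0 < H" and \<gamma>: "2 < \<gamma>"
    and L: "filterlim L at_top sequentially"
    and est: "nls_estimator M T a1 a2 L Ghat \<alpha>hat"
begin

lemma CZ_pos: "1 \<le> l \<Longrightarrow> 0 < CZ l"
  using H by (simp add: CZ)

lemma phi_le: "1 \<le> l \<Longrightarrow> \<bar>\<phi> l\<bar> \<le> \<bar>G\<^sub>0\<bar>"
  using ln_powr_bounds(2)[of l \<alpha>\<^sub>0] a by (simp add: phi abs_mult mult_left_le)

sublocale AR: ar_array M "\<lambda>(l, m) t. harm_coeff T l m (int t)" "\<lambda>(l, m). \<phi> l"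
  "\<lambda>(l, m). expectation (\<lambda>\<omega>. (harm_coeff T l m 0 \<omega>)\<^sup>2)" "\<lambda>(l, m). CZ l" modes "\<bar>G\<^sub>0\<bar>"
  by (rule ar_array_coeff[OF phi_le G0(2) CZ_pos])

definition c :: "nat \<Rightarrow> real" where "c = power_spectrum M T"

text \<open>That the variance does not depend on m is read off from
  \<open>variance_stationary\<close>: it is determined by the noise variance and the autoregressive
  coefficient, which depend on l alone.\<close>

lemma c_eq:
  assumes "1 \<le> l" "m \<in> {- int l..int l}"
  shows "expectation (\<lambda>\<omega>. (harm_coeff T l m 0 \<omega>)\<^sup>2) = c l" "CZ l = (1 - (\<phi> l)\<^sup>2) * c l"
    "0 < c l" "CZ l \<le> c l"
proof -
  have in_modes: "(l, m) \<in> modes" "(l, 0) \<in> modes"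
    using assms by auto
  have p: "0 < 1 - (\<phi> l)\<^sup>2"
    using AR.phi_sq[OF in_modes(1)] by simp
  show CZc: "CZ l = (1 - (\<phi> l)\<^sup>2) * c l"
    using AR.variance_stationary[OF in_modes(2)] by (simp add: c_def power_spectrum_def)
  have "CZ l = (1 - (\<phi> l)\<^sup>2) * expectation (\<lambda>\<omega>. (harm_coeff T l m 0 \<omega>)\<^sup>2)"
    using AR.variance_stationary[OF in_modes(1)] by simp
  with CZc show "expectation (\<lambda>\<omega>. (harm_coeff T l m 0 \<omega>)\<^sup>2) = c l"
    using p by simp
  show "0 < c l" "CZ l \<le> c l"
    using AR.C_pos[OF in_modes(2)] by (simp_all add: c_def power_spectrum_def)
qed

definition b :: "nat \<Rightarrow> real" where "b l = real (2 * l + 1) * c l"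

lemma b_nonneg: "0 \<le> b l"
  by (simp add: b_def c_def power_spectrum_def)

lemma b_pos: "1 \<le> l \<Longrightarrow> 0 < b l"
  using c_eq(3)[of l 0] by (simp add: b_def)

text \<open>The factor 1 - \<open>(\<phi> l)\<^sup>2\<close> is bounded away from 0, so b_l is at
  most a constant times l to the power 1 - gamma, and gamma > 2.\<close>

lemma b_summable: "summable b"
proof (rule summable_comparison_test'[where N = 1])
  show "summable (\<lambda>l. 3 * H / (1 - G\<^sub>0\<^sup>2) * real l powr (1 - \<gamma>))"
    using \<gamma> by (intro summable_mult) (simp add: summable_real_powr_iff)
  have G: "0 < 1 - G\<^sub>0\<^sup>2"
    using G0 by (simp add: abs_square_less_1)
  fix l :: nat assume l: "1 \<le> l"
  have "(\<phi> l)\<^sup>2 \<le> G\<^sub>0\<^sup>2"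
    using phi_le[OF l] by (simp add: abs_le_square_iff)
  then have "(1 - G\<^sub>0\<^sup>2) * c l \<le> (1 - (\<phi> l)\<^sup>2) * c l"
    using c_eq(3)[OF l, of 0] by (intro mult_right_mono) auto
  also have "\<dots> = H * real l powr - \<gamma>"
    using c_eq(2)[OF l, of 0] CZ[OF l] by simp
  finally have c: "c l \<le> H / (1 - G\<^sub>0\<^sup>2) * real l powr - \<gamma>"
    using G by (simp add: field_simps)
  have "b l \<le> (3 * real l) * (H / (1 - G\<^sub>0\<^sup>2) * real l powr - \<gamma>)"
    unfolding b_def using l c c_eq(3)[OF l, of 0] by (intro mult_mono) auto
  also have "\<dots> = 3 * H / (1 - G\<^sub>0\<^sup>2) * (real l powr 1 * real l powr - \<gamma>)"
    using l by simp
  also have "real l powr 1 * real l powr - \<gamma> = real l powr (1 - \<gamma>)"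
    by (subst powr_add[symmetric]) simp
  finally show "norm (b l) \<le> 3 * H / (1 - G\<^sub>0\<^sup>2) * real l powr (1 - \<gamma>)"
    using b_nonneg[of l] by simp
qed

definition Btot :: real where "Btot = (\<Sum>\<^sub>\<infinity>l\<in>{1..}. b l)"

lemma Btot:
  "(\<lambda>n. \<Sum>l=1..n. b l) \<longlonglongrightarrow> Btot" "(\<Sum>l=1..n. b l) \<le> Btot" "0 \<le> Btot"
proof -
  have s: "(\<lambda>l. b l * 1) summable_on {1..}" "(\<lambda>n. \<Sum>l=1..n. b l * 1) \<longlonglongrightarrow> (\<Sum>\<^sub>\<infinity>l\<in>{1..}. b l * 1)"
    using bounded_weight_sum[OF b_nonneg b_summable, of "\<lambda>_. 1" 1] by auto
  show lim: "(\<lambda>n. \<Sum>l=1..n. b l) \<longlonglongrightarrow> Btot"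
    using s(2) by (simp add: Btot_def)
  have "incseq (\<lambda>n. \<Sum>l=1..n. b l)"
    by (rule incseq_SucI) (simp add: b_nonneg)
  then show le: "(\<Sum>l=1..n. b l) \<le> Btot" for n
    using lim by (rule incseq_le)
  show "0 \<le> Btot"
    using le[of 0] by simp
qed

abbreviation p0 :: "nat \<Rightarrow> real" where
  "p0 l \<equiv> real l powr (- 2 * \<alpha>\<^sub>0)"

lemma p0_bounds:
  assumes "1 \<le> l"
  shows "0 \<le> p0 l" "p0 l \<le> 1" "0 \<le> ln (real l)" "p0 l * ln (real l) \<le> 1" "p0 l * (ln (real l))\<^sup>2 \<le> 4"
  using ln_powr_bounds[OF assms, of "2 * \<alpha>\<^sub>0"] a by (simp_all add: mult.commute)

text \<open>The mean of log l under the weights \<open>b l * p0 l\<close>.\<close>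

definition \<mu> :: real where "\<mu> = - D'_fun c \<alpha>\<^sub>0 / (2 * D_fun c \<alpha>\<^sub>0)"

text \<open>The corresponding variance of log l, not normalised by the total weight. Up to sign and
  the factor \<open>G\<^sub>0\<close> it is the slope of the centered score in alpha.\<close>

definition \<Delta> :: real where "\<Delta> = (\<Sum>\<^sub>\<infinity>l\<in>{1..}. b l * (p0 l * (ln (real l) - \<mu>)\<^sup>2))"

lemma D_lim: "(\<lambda>n. \<Sum>l=1..n. b l * p0 l) \<longlonglongrightarrow> D_fun c \<alpha>\<^sub>0"
proof -
  have "(\<lambda>n. \<Sum>l=1..n. b l * p0 l) \<longlonglongrightarrow> (\<Sum>\<^sub>\<infinity>l\<in>{1..}. b l * p0 l)"
    using p0_bounds by (intro bounded_weight_sum[OF b_nonneg b_summable, where K = 1]) auto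
  then show ?thesis
    by (simp add: D_fun_def b_def)
qed

lemma D'_lim: "(\<lambda>n. \<Sum>l=1..n. b l * (p0 l * ln (real l))) \<longlonglongrightarrow> - D'_fun c \<alpha>\<^sub>0 / 2"
proof -
  have "(\<lambda>n. \<Sum>l=1..n. b l * (p0 l * ln (real l))) \<longlonglongrightarrow> (\<Sum>\<^sub>\<infinity>l\<in>{1..}. b l * (p0 l * ln (real l)))"
    using p0_bounds by (intro bounded_weight_sum[OF b_nonneg b_summable, where K = 1]) auto
  then show ?thesis
    by (simp add: D'_fun_def b_def mult.assoc)
qed

lemma D_pos: "0 < D_fun c \<alpha>\<^sub>0"
proof -
  have "b 1 \<le> (\<Sum>l=1..n. b l * p0 l)" if "1 \<le> n" for n
  proof -
    have "(\<Sum>l\<in>{1}. b l * p0 l) \<le> (\<Sum>l=1..n. b l * p0 l)"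
      using that b_nonneg by (intro sum_mono2) auto
    then show ?thesis by simp
  qed
  then have "b 1 \<le> D_fun c \<alpha>\<^sub>0"
    by (intro LIMSEQ_le_const[OF D_lim] exI[of _ 1]) auto
  then show ?thesis
    using b_pos[of 1] by simp
qed

lemma drift_lim: "(\<lambda>n. \<Sum>l=1..n. b l * p0 l * (ln (real l) - \<mu>)) \<longlonglongrightarrow> 0"
proof -
  have "(\<lambda>n. (\<Sum>l=1..n. b l * (p0 l * ln (real l))) - \<mu> * (\<Sum>l=1..n. b l * p0 l))
      \<longlonglongrightarrow> - D'_fun c \<alpha>\<^sub>0 / 2 - \<mu> * D_fun c \<alpha>\<^sub>0"
    by (intro tendsto_intros D_lim D'_lim)
  moreover have "- D'_fun c \<alpha>\<^sub>0 / 2 - \<mu> * D_fun c \<alpha>\<^sub>0 = 0"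
    using D_pos by (simp add: \<mu>_def)
  moreover have "(\<Sum>l=1..n. b l * (p0 l * ln (real l))) - \<mu> * (\<Sum>l=1..n. b l * p0 l)
      = (\<Sum>l=1..n. b l * p0 l * (ln (real l) - \<mu>))" for n
    unfolding sum_distrib_left sum_subtractf[symmetric] by (intro sum.cong) (auto simp: algebra_simps)
  ultimately show ?thesis
    by simp
qed

lemma score_weight_bound:
  assumes "1 \<le> l"
  shows "\<bar>p0 l * (ln (real l) - \<mu>)\<^sup>2\<bar> \<le> 4 + 2 * \<bar>\<mu>\<bar> + \<mu>\<^sup>2"
proof -
  note pb = p0_bounds[OF assms]
  have "p0 l * (ln (real l) - \<mu>)\<^sup>2 = p0 l * (ln (real l))\<^sup>2 - 2 * \<mu> * (p0 l * ln (real l)) + \<mu>\<^sup>2 * p0 l"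
    by (simp add: power2_diff algebra_simps)
  also have "\<dots> \<le> 4 + 2 * \<bar>\<mu>\<bar> + \<mu>\<^sup>2 * 1"
  proof -
    have "(- \<mu>) * (p0 l * ln (real l)) \<le> \<bar>\<mu>\<bar> * (p0 l * ln (real l))"
      using pb by (intro mult_right_mono mult_nonneg_nonneg) auto
    then have "- (2 * \<mu> * (p0 l * ln (real l))) \<le> 2 * \<bar>\<mu>\<bar> * (p0 l * ln (real l))"
      unfolding mult.assoc mult_minus_left by linarith
    also have "\<dots> \<le> 2 * \<bar>\<mu>\<bar> * 1"
      using pb by (intro mult_left_mono) auto
    finally have "- (2 * \<mu> * (p0 l * ln (real l))) \<le> 2 * \<bar>\<mu>\<bar>"
      by simp
    moreover have "\<mu>\<^sup>2 * p0 l \<le> \<mu>\<^sup>2 * 1"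
      using pb by (intro mult_left_mono) auto
    ultimately show ?thesis
      using pb(5) by linarith
  qed
  finally show ?thesis
    using pb by simp
qed

lemma \<Delta>_lim: "(\<lambda>n. \<Sum>l=1..n. b l * (p0 l * (ln (real l) - \<mu>)\<^sup>2)) \<longlonglongrightarrow> \<Delta>"
  unfolding \<Delta>_def by (rule bounded_weight_sum[OF b_nonneg b_summable score_weight_bound])

lemma slope_lim: "(\<lambda>n. \<Sum>l=1..n. b l * p0 l * (ln (real l) * (ln (real l) - \<mu>))) \<longlonglongrightarrow> \<Delta>"
proof -
  have "(\<lambda>n. (\<Sum>l=1..n. b l * (p0 l * (ln (real l) - \<mu>)\<^sup>2)) + \<mu> * (\<Sum>l=1..n. b l * p0 l * (ln (real l) - \<mu>)))
      \<longlonglongrightarrow> \<Delta> + \<mu> * 0"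
    by (intro tendsto_intros \<Delta>_lim drift_lim)
  moreover have "(\<Sum>l=1..n. b l * (p0 l * (ln (real l) - \<mu>)\<^sup>2)) + \<mu> * (\<Sum>l=1..n. b l * p0 l * (ln (real l) - \<mu>))
      = (\<Sum>l=1..n. b l * p0 l * (ln (real l) * (ln (real l) - \<mu>)))" for n
    unfolding sum_distrib_left sum.distrib[symmetric]
    by (intro sum.cong) (auto simp: algebra_simps power2_eq_square)
  ultimately show ?thesis
    by simp
qed

text \<open>log 1 and log 2 are different, so at least one of the first two terms is positive,
  whatever the value of mu.\<close>

lemma positive_weighted_sum:
  assumes g: "\<And>l. 1 \<le> l \<Longrightarrow> 0 < g l"
    and lim: "(\<lambda>n. \<Sum>l=1..n. g l * (p0 l * (ln (real l) - \<mu>)\<^sup>2)) \<longlonglongrightarrow> S"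
  shows "0 < S"
proof -
  define f where "f l = g l * (p0 l * (ln (real l) - \<mu>)\<^sup>2)" for l
  have f0: "0 \<le> f l" if "1 \<le> l" for l
    unfolding f_def using g[OF that] by (intro mult_nonneg_nonneg) auto
  have "f 1 + f 2 \<le> (\<Sum>l=1..n. f l)" if n: "2 \<le> n" for n
  proof -
    have "(\<Sum>l\<in>{1, 2}. f l) \<le> (\<Sum>l=1..n. f l)"
      using n f0 by (intro sum_mono2) auto
    then show ?thesis by simp
  qed
  then have "f 1 + f 2 \<le> S"
    using lim unfolding f_def[symmetric] by (intro LIMSEQ_le_const[OF _ exI[of _ 2]]) auto
  moreover have "0 < f 1 + f 2"
  proof (cases "\<mu> = 0")
    case True
    then have "0 < f 2"
      using g[of 2] by (simp add: f_def)
    then show ?thesis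
      using f0[of 1] by linarith
  next
    case False
    then have "0 < f 1"
      using g[of 1] by (simp add: f_def)
    then show ?thesis
      using f0[of 2] by linarith
  qed
  ultimately show ?thesis
    by linarith
qed

lemma \<Delta>_pos: "0 < \<Delta>"
  by (rule positive_weighted_sum[OF b_pos \<Delta>_lim])

text \<open>The limit variance of the normalised score \<open>U\<close>, in contrast to
  \<open>\<Delta>\<close>, with the noise spectrum as an additional weight.\<close>

definition V :: real where
  "V = (\<Sum>\<^sub>\<infinity>l\<in>{1..}. b l * (CZ l * (p0 l * (ln (real l) - \<mu>)\<^sup>2)))"

lemma V_lim: "(\<lambda>n. \<Sum>l=1..n. b l * (CZ l * (p0 l * (ln (real l) - \<mu>)\<^sup>2))) \<longlonglongrightarrow> V"
  unfolding V_def
proof (rule bounded_weight_sum[OF b_nonneg b_summable])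
  fix l :: nat assume l: "1 \<le> l"
  have "CZ l \<le> H * 1"
    unfolding CZ[OF l] using H \<gamma> ln_powr_bounds(2)[OF l, of \<gamma>] by (intro mult_left_mono) auto
  then show "\<bar>CZ l * (p0 l * (ln (real l) - \<mu>)\<^sup>2)\<bar> \<le> H * (4 + 2 * \<bar>\<mu>\<bar> + \<mu>\<^sup>2)"
    unfolding abs_mult[of "CZ l"] using CZ_pos[OF l] score_weight_bound[OF l] H by (intro mult_mono) auto
qed

lemma V_pos: "0 < V"
proof (rule positive_weighted_sum)
  show "(\<lambda>n. \<Sum>l=1..n. (b l * CZ l) * (p0 l * (ln (real l) - \<mu>)\<^sup>2)) \<longlonglongrightarrow> V"
    using V_lim by (simp only: mult.assoc)
qed (use b_pos CZ_pos in simp)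

text \<open>The bracket 2 log l + D' / D is 2 (log l - mu), so the numerator is 4 V, the denominator
  the square of \<open>4 * \<Delta>\<close>, and the powers of 2 cancel against the leading
  4.\<close>

lemma asymp_var_eq: "asymp_var c CZ G\<^sub>0 \<alpha>\<^sub>0 = V / (G\<^sub>0 * \<Delta>)\<^sup>2"
proof -
  have \<mu>: "(2 * ln (real l) + D'_fun c \<alpha>\<^sub>0 / D_fun c \<alpha>\<^sub>0)\<^sup>2 = 4 * (ln (real l) - \<mu>)\<^sup>2" for l
  proof -
    have "2 * ln (real l) + D'_fun c \<alpha>\<^sub>0 / D_fun c \<alpha>\<^sub>0 = 2 * (ln (real l) - \<mu>)"
      by (simp add: \<mu>_def)
    then show ?thesis
      by (simp only: power_mult_distrib) simp
  qed
  have 1: "(\<Sum>\<^sub>\<infinity>l\<in>{1..}. (2 * ln (real l) + D'_fun c \<alpha>\<^sub>0 / D_fun c \<alpha>\<^sub>0)\<^sup>2 * p0 l * real (2 * l + 1) * c l * CZ l) = 4 * V"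
    unfolding \<mu> V_def infsum_cmult_right'[symmetric]
    by (intro infsum_cong) (simp add: b_def mult_ac)
  have 2: "(\<Sum>\<^sub>\<infinity>l\<in>{1..}. (2 * ln (real l) + D'_fun c \<alpha>\<^sub>0 / D_fun c \<alpha>\<^sub>0)\<^sup>2 * p0 l * real (2 * l + 1) * c l) = 4 * \<Delta>"
    unfolding \<mu> \<Delta>_def infsum_cmult_right'[symmetric]
    by (intro infsum_cong) (simp add: b_def mult_ac)
  show ?thesis
    unfolding asymp_var_def 1 2 by (simp add: power_mult_distrib divide_simps)
qed

end


context nls_sphar
begin

subsection \<open>Linearization of the estimator\<close>

definition cross :: "nat \<Rightarrow> nat \<Rightarrow> 'w \<Rightarrow> real" where
  "cross N l \<omega> = (\<Sum>m = - int l..int l. AR.cross_mean N (l, m) \<omega>)"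

definition square :: "nat \<Rightarrow> nat \<Rightarrow> 'w \<Rightarrow> real" where
  "square N l \<omega> = (\<Sum>m = - int l..int l. AR.square_mean N (l, m) \<omega>)"

lemma cross_square_measurable [measurable]:
  "cross N l \<in> borel_measurable M" "square N l \<in> borel_measurable M"
  unfolding cross_def[abs_def] square_def[abs_def] by measurable

lemma square_nonneg: "0 \<le> square N l \<omega>"
  unfolding square_def AR.square_mean_def by (intro sum_nonneg divide_nonneg_nonneg) auto

text \<open>A residual is the innovation plus \<open>dev\<close> times the past value. Expanding the
  square separates a part free of the parameter; the constant is quantified before G and alpha, as
  minimisation requires.\<close>

lemma criterion_eq:
  assumes N: "1 \<le> N"
  shows "\<exists>\<kappa>. \<forall>G \<alpha>. nls_criterion T L' N \<omega> (G, \<alpha>)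
    = \<kappa> + Q L' (\<lambda>l. cross N l \<omega>) (\<lambda>l. square N l \<omega>) G \<alpha>"
proof -
  define A where "A l m t = harm_coeff T l m (int t) \<omega>" for l m t
  define E where "E l m t = AR.e (l, m) t \<omega>" for l m t
  define \<kappa> where "\<kappa> = (\<Sum>l = 1..L'. \<Sum>m = - int l..int l. (\<Sum>t<N. (E l m t)\<^sup>2) / real N)"
  have mode: "(\<Sum>t<N. (A l m (Suc t) - G * real l powr - \<alpha> * A l m t)\<^sup>2) / real N
      = (\<Sum>t<N. (E l m t)\<^sup>2) / real N + (2 * AR.cross_mean N (l, m) \<omega> * dev G \<alpha> l
        + AR.square_mean N (l, m) \<omega> * (dev G \<alpha> l)\<^sup>2)"
    if l: "1 \<le> l" for l m G \<alpha>
  proof -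
    have "(A l m (Suc t) - G * real l powr - \<alpha> * A l m t)\<^sup>2
        = (E l m t)\<^sup>2 + (2 * dev G \<alpha> l * (E l m t * A l m t) + (dev G \<alpha> l)\<^sup>2 * (A l m t)\<^sup>2)" for t
    proof -
      have "A l m (Suc t) - G * real l powr - \<alpha> * A l m t = E l m t + dev G \<alpha> l * A l m t"
        by (simp add: A_def E_def innov_def dev_def phi[OF l] algebra_simps)
      then show ?thesis
        by (simp add: power2_eq_square algebra_simps)
    qed
    then have "(\<Sum>t<N. (A l m (Suc t) - G * real l powr - \<alpha> * A l m t)\<^sup>2)
        = (\<Sum>t<N. (E l m t)\<^sup>2) + (2 * dev G \<alpha> l * (\<Sum>t<N. E l m t * A l m t) + (dev G \<alpha> l)\<^sup>2 * (\<Sum>t<N. (A l m t)\<^sup>2))"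
      by (simp add: sum.distrib sum_distrib_left)
    then show ?thesis
      by (simp add: AR.cross_mean_def AR.square_mean_def A_def E_def add_divide_distrib mult_ac)
  qed
  have "nls_criterion T L' N \<omega> (G, \<alpha>) = \<kappa> + Q L' (\<lambda>l. cross N l \<omega>) (\<lambda>l. square N l \<omega>) G \<alpha>" for G \<alpha>
  proof -
    have "nls_criterion T L' N \<omega> (G, \<alpha>) = (\<Sum>t<N. \<Sum>l = 1..L'. \<Sum>m = - int l..int l.
        (A l m (Suc t) - G * real l powr - \<alpha> * A l m t)\<^sup>2) / real N"
      unfolding nls_criterion_def prod.case sum_int_shift A_def by simp
    also have "\<dots> = (\<Sum>l = 1..L'. \<Sum>m = - int l..int l. \<Sum>t<N. (A l m (Suc t) - G * real l powr - \<alpha> * A l m t)\<^sup>2) / real N"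
      by (subst sum.swap, subst sum.swap) (rule refl)
    also have "\<dots> = (\<Sum>l = 1..L'. \<Sum>m = - int l..int l.
        (\<Sum>t<N. (A l m (Suc t) - G * real l powr - \<alpha> * A l m t)\<^sup>2) / real N)"
      by (simp only: sum_divide_distrib[of _ "{1..L'}"] sum_divide_distrib[of _ "{- int _..int _}"])
    also have "\<dots> = (\<Sum>l = 1..L'. \<Sum>m = - int l..int l. (\<Sum>t<N. (E l m t)\<^sup>2) / real N
        + (2 * AR.cross_mean N (l, m) \<omega> * dev G \<alpha> l + AR.square_mean N (l, m) \<omega> * (dev G \<alpha> l)\<^sup>2))"
      by (intro sum.cong refl mode) auto
    also have "\<dots> = \<kappa> + Q L' (\<lambda>l. cross N l \<omega>) (\<lambda>l. square N l \<omega>) G \<alpha>"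
      unfolding \<kappa>_def Q_def cross_def square_def sum.distrib sum_distrib_right sum_distrib_left ..
    finally show ?thesis .
  qed
  then show ?thesis
    by blast
qed

definition W :: "nat \<Rightarrow> 'w \<Rightarrow> real" where "W N \<omega> = (\<Sum>l = 1..L N. \<bar>cross N l \<omega>\<bar>)"
definition V' :: "nat \<Rightarrow> 'w \<Rightarrow> real" where "V' N \<omega> = (\<Sum>l = 1..L N. \<bar>square N l \<omega> - b l\<bar>)"

lemma WV_measurable [measurable]: "W N \<in> borel_measurable M" "V' N \<in> borel_measurable M"
  unfolding W_def[abs_def] V'_def[abs_def] by measurable

lemma cross_bound:
  assumes l: "1 \<le> l"
  shows "integrable M (cross N l)" "expectation (\<lambda>\<omega>. \<bar>cross N l \<omega>\<bar>) \<le> b l / sqrt (real N)"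
proof -
  have j: "(l, m) \<in> modes" if "m \<in> {- int l..int l}" for m
    using l that by auto
  have i: "integrable M (AR.cross_mean N (l, m))"
    and e: "expectation (\<lambda>\<omega>. \<bar>AR.cross_mean N (l, m) \<omega>\<bar>) \<le> c l / sqrt (real N)" if m: "m \<in> {- int l..int l}" for m
  proof -
    show "integrable M (AR.cross_mean N (l, m))"
      by (rule AR.cross_mean_bound[OF j[OF m]])
    have "expectation (\<lambda>\<omega>. \<bar>AR.cross_mean N (l, m) \<omega>\<bar>) \<le> sqrt (CZ l * c l) / sqrt (real N)"
      using AR.cross_mean_bound(2)[OF j[OF m], of N] c_eq(1)[OF l m] by simp
    also have "sqrt (CZ l * c l) \<le> sqrt (c l * c l)"
      using c_eq[OF l m] by (intro real_sqrt_le_mono mult_right_mono) auto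
    finally show "expectation (\<lambda>\<omega>. \<bar>AR.cross_mean N (l, m) \<omega>\<bar>) \<le> c l / sqrt (real N)"
      using c_eq(3)[OF l m] by (simp add: divide_right_mono)
  qed
  show "integrable M (cross N l)"
    unfolding cross_def[abs_def] using i by auto
  have "expectation (\<lambda>\<omega>. \<bar>cross N l \<omega>\<bar>) \<le> expectation (\<lambda>\<omega>. \<Sum>m = - int l..int l. \<bar>AR.cross_mean N (l, m) \<omega>\<bar>)"
    unfolding cross_def using i
    by (intro integral_mono integrable_abs Bochner_Integration.integrable_sum sum_abs) auto
  also have "\<dots> = (\<Sum>m = - int l..int l. expectation (\<lambda>\<omega>. \<bar>AR.cross_mean N (l, m) \<omega>\<bar>))"
    using i by (intro Bochner_Integration.integral_sum) auto
  also have "\<dots> \<le> (\<Sum>m = - int l..int l. c l / sqrt (real N))"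
    by (intro sum_mono e)
  also have "\<dots> = b l / sqrt (real N)"
    by (simp add: b_def)
  finally show "expectation (\<lambda>\<omega>. \<bar>cross N l \<omega>\<bar>) \<le> b l / sqrt (real N)" .
qed

definition \<kappa> :: real where "\<kappa> = 6 / (1 - G\<^sub>0\<^sup>2)"

lemma square_bound:
  assumes l: "1 \<le> l" and N: "1 \<le> N"
  shows "integrable M (square N l)" "expectation (\<lambda>\<omega>. \<bar>square N l \<omega> - b l\<bar>) \<le> \<kappa> * b l / sqrt (real N)"
proof -
  have j: "(l, m) \<in> modes" if "m \<in> {- int l..int l}" for m
    using l that by auto
  have i: "integrable M (AR.square_mean N (l, m))"
    and e: "expectation (\<lambda>\<omega>. \<bar>AR.square_mean N (l, m) \<omega> - c l\<bar>) \<le> \<kappa> * c l / sqrt (real N)" if m: "m \<in> {- int l..int l}" for m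
    using AR.square_mean_bound[OF j[OF m] N] c_eq(1)[OF l m] by (simp_all add: \<kappa>_def)
  show i': "integrable M (square N l)"
    unfolding square_def[abs_def] using i by auto
  have eq: "square N l \<omega> - b l = (\<Sum>m = - int l..int l. AR.square_mean N (l, m) \<omega> - c l)" for \<omega>
    by (simp add: square_def sum_subtractf b_def)
  have "expectation (\<lambda>\<omega>. \<bar>square N l \<omega> - b l\<bar>) \<le> expectation (\<lambda>\<omega>. \<Sum>m = - int l..int l. \<bar>AR.square_mean N (l, m) \<omega> - c l\<bar>)"
    unfolding eq using i
    by (intro integral_mono integrable_abs Bochner_Integration.integrable_sum Bochner_Integration.integrable_diff sum_abs) auto
  also have "\<dots> = (\<Sum>m = - int l..int l. expectation (\<lambda>\<omega>. \<bar>AR.square_mean N (l, m) \<omega> - c l\<bar>))"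
    using i by (intro Bochner_Integration.integral_sum) auto
  also have "\<dots> \<le> (\<Sum>m = - int l..int l. \<kappa> * c l / sqrt (real N))"
    by (intro sum_mono e)
  also have "\<dots> = \<kappa> * b l / sqrt (real N)"
    by (simp add: b_def)
  finally show "expectation (\<lambda>\<omega>. \<bar>square N l \<omega> - b l\<bar>) \<le> \<kappa> * b l / sqrt (real N)" .
qed

lemma W_bound: "integrable M (W N)" "expectation (W N) \<le> Btot / sqrt (real N)"
proof -
  show "integrable M (W N)"
    unfolding W_def[abs_def] using cross_bound(1) by (intro Bochner_Integration.integrable_sum integrable_abs) auto
  have "expectation (W N) = (\<Sum>l = 1..L N. expectation (\<lambda>\<omega>. \<bar>cross N l \<omega>\<bar>))"
    unfolding W_def using cross_bound(1) by (intro Bochner_Integration.integral_sum integrable_abs) auto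
  also have "\<dots> \<le> (\<Sum>l = 1..L N. b l / sqrt (real N))"
    using cross_bound(2) by (intro sum_mono) auto
  also have "\<dots> = (\<Sum>l = 1..L N. b l) / sqrt (real N)"
    by (simp only: sum_divide_distrib)
  also have "\<dots> \<le> Btot / sqrt (real N)"
    using Btot(2) by (intro divide_right_mono) auto
  finally show "expectation (W N) \<le> Btot / sqrt (real N)" .
qed

lemma \<kappa>_pos: "0 < \<kappa>"
  unfolding \<kappa>_def using G0 by (simp add: abs_square_less_1)

lemma V'_bound:
  assumes N: "1 \<le> N"
  shows "integrable M (V' N)" "expectation (V' N) \<le> \<kappa> * Btot / sqrt (real N)"
proof -
  have i: "integrable M (\<lambda>\<omega>. \<bar>square N l \<omega> - b l\<bar>)" if "1 \<le> l" for l
    using square_bound(1)[OF that N] by (intro integrable_abs Bochner_Integration.integrable_diff) auto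
  show "integrable M (V' N)"
    unfolding V'_def[abs_def] using i by (intro Bochner_Integration.integrable_sum) auto
  have "expectation (V' N) = (\<Sum>l = 1..L N. expectation (\<lambda>\<omega>. \<bar>square N l \<omega> - b l\<bar>))"
    unfolding V'_def using i by (intro Bochner_Integration.integral_sum) auto
  also have "\<dots> \<le> (\<Sum>l = 1..L N. \<kappa> * b l / sqrt (real N))"
    using square_bound(2)[OF _ N] by (intro sum_mono) auto
  also have "\<dots> = \<kappa> * (\<Sum>l = 1..L N. b l) / sqrt (real N)"
    by (simp only: sum_divide_distrib sum_distrib_left)
  also have "\<dots> \<le> \<kappa> * Btot / sqrt (real N)"
    using Btot(2) \<kappa>_pos by (intro divide_right_mono mult_left_mono) auto
  finally show "expectation (V' N) \<le> \<kappa> * Btot / sqrt (real N)" .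
qed

text \<open>The exceptional event at level x. By Markov its probability is at most a constant over
  x, for every N; x is sent to infinity after N.\<close>

definition bad :: "nat \<Rightarrow> real \<Rightarrow> 'w set" where
  "bad N x = {\<omega> \<in> space M. x / sqrt (real N) < W N \<omega> \<or> x / sqrt (real N) < V' N \<omega>}"

lemma bad_measurable [measurable]: "bad N x \<in> events"
  unfolding bad_def by measurable

lemma prob_bad:
  assumes N: "1 \<le> N" and x: "0 < x"
  shows "prob (bad N x) \<le> (1 + \<kappa>) * Btot / x"
proof -
  have y: "0 < x / sqrt (real N)"
    using N x by simp
  have 0: "0 \<le> W N \<omega>" "0 \<le> V' N \<omega>" for \<omega>
    unfolding W_def V'_def by (intro sum_nonneg; simp)+
  have "prob (bad N x) \<le> prob ({\<omega> \<in> space M. x / sqrt (real N) \<le> W N \<omega>} \<union> {\<omega> \<in> space M. x / sqrt (real N) \<le> V' N \<omega>})"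
    unfolding bad_def by (intro finite_measure_mono) auto
  also have "\<dots> \<le> prob {\<omega> \<in> space M. x / sqrt (real N) \<le> W N \<omega>} + prob {\<omega> \<in> space M. x / sqrt (real N) \<le> V' N \<omega>}"
    by (intro measure_Un_le) measurable
  also have "\<dots> \<le> expectation (W N) / (x / sqrt (real N)) + expectation (V' N) / (x / sqrt (real N))"
    using 0 y by (intro add_mono integral_Markov_inequality_measure[where A = "{}"] W_bound(1) V'_bound(1)[OF N]) auto
  also have "\<dots> \<le> (Btot / sqrt (real N)) / (x / sqrt (real N)) + (\<kappa> * Btot / sqrt (real N)) / (x / sqrt (real N))"
    using W_bound(2) V'_bound(2)[OF N] y by (intro add_mono divide_right_mono) auto
  also have "\<dots> = (1 + \<kappa>) * Btot / x"
    using N x by (simp add: field_simps)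
  finally show ?thesis .
qed

definition U :: "nat \<Rightarrow> 'w \<Rightarrow> real" where
  "U N \<omega> = sqrt (real N) * (\<Sum>l = 1..L N. cross N l \<omega> * (real l powr - \<alpha>\<^sub>0 * (ln (real l) - \<mu>)))"

definition Y :: "nat \<Rightarrow> 'w \<Rightarrow> real" where
  "Y N \<omega> = sqrt (real N) * (\<alpha>hat N \<omega> - \<alpha>\<^sub>0)"

lemma U_measurable [measurable]: "U N \<in> borel_measurable M"
  unfolding U_def[abs_def] by measurable

lemma Y_measurable: "1 < N \<Longrightarrow> Y N \<in> borel_measurable M"
  using est unfolding nls_estimator_def Y_def[abs_def]
  by (intro borel_measurable_times borel_measurable_diff borel_measurable_const) auto

text \<open>The constant of \<open>err_bound\<close> when S_1 and S_2 are bounded below by half of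
  the smaller of b_1 and b_2, as they are off the exceptional event for large N.\<close>

definition K1 :: real where "K1 = 4 * sep\<^sup>2 / (min (b 1) (b 2) / 2)"

text \<open>Off the exceptional event sqrt N times \<open>err\<close> is at most
  \<open>K1 * x\<close>. This multiplies, in turn, the coefficient of the error in G, which tends to
  0 by the choice of mu, the deviation of the slope from its limit, and the remainder of
  \<open>score_linearization\<close>.\<close>

definition \<rho> :: "real \<Rightarrow> nat \<Rightarrow> real" where
  "\<rho> x N = K1 * x * \<bar>\<Sum>l = 1..L N. b l * p0 l * (ln (real l) - \<mu>)\<bar>
    + K1 * x * \<bar>(\<Sum>l = 1..L N. b l * p0 l * (ln (real l) * (ln (real l) - \<mu>))) - \<Delta>\<bar>
    + (9 + 6 * \<bar>\<mu>\<bar>) * (K1 * x) * ((2 * x + K1 * x * Btot) / sqrt (real N))"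

lemma K1_pos: "0 < K1"
  unfolding K1_def using sep_pos b_pos[of 1] b_pos[of 2] by (intro divide_pos_pos mult_pos_pos) (auto simp: min_def)

lemma sqrt_N_tendsto: "(\<lambda>N. x / sqrt (real N)) \<longlonglongrightarrow> 0"
  by (intro real_tendsto_divide_at_top[OF tendsto_const] filterlim_compose[OF sqrt_at_top filterlim_real_sequentially])

lemma \<rho>_tendsto: "(\<rho> x) \<longlonglongrightarrow> 0"
proof -
  have 1: "(\<lambda>N. \<Sum>l = 1..L N. b l * p0 l * (ln (real l) - \<mu>)) \<longlonglongrightarrow> 0"
    by (rule filterlim_compose[OF drift_lim L])
  have 2: "(\<lambda>N. \<Sum>l = 1..L N. b l * p0 l * (ln (real l) * (ln (real l) - \<mu>))) \<longlonglongrightarrow> \<Delta>"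
    by (rule filterlim_compose[OF slope_lim L])
  have "(\<lambda>N. K1 * x * \<bar>\<Sum>l = 1..L N. b l * p0 l * (ln (real l) - \<mu>)\<bar>
    + K1 * x * \<bar>(\<Sum>l = 1..L N. b l * p0 l * (ln (real l) * (ln (real l) - \<mu>))) - \<Delta>\<bar>
    + (9 + 6 * \<bar>\<mu>\<bar>) * (K1 * x) * ((2 * x + K1 * x * Btot) / sqrt (real N)))
    \<longlonglongrightarrow> K1 * x * \<bar>0\<bar> + K1 * x * \<bar>\<Delta> - \<Delta>\<bar> + (9 + 6 * \<bar>\<mu>\<bar>) * (K1 * x) * 0"
    by (intro tendsto_intros 1 2 sqrt_N_tendsto)
  then show ?thesis
    unfolding \<rho>_def[abs_def] by simp
qed

lemma \<rho>_nonneg: "0 < x \<Longrightarrow> 0 \<le> \<rho> x N"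
  unfolding \<rho>_def using K1_pos Btot(3) by (intro add_nonneg_nonneg mult_nonneg_nonneg divide_nonneg_nonneg) auto

text \<open>Off the exceptional event and for large N the statistics meet the hypotheses of
  \<open>minimizer_exists\<close>, so the estimator is a true minimiser, interior, and satisfies the
  score equations; these are linearised and multiplied by sqrt N.\<close>

lemma linearization:
  assumes x: "0 < x"
  shows "\<forall>\<^sub>F N in sequentially. AE \<omega> in M. \<omega> \<notin> bad N x \<longrightarrow> \<bar>U N \<omega> - (- G\<^sub>0 * \<Delta>) * Y N \<omega>\<bar> \<le> \<rho> x N"
proof -
  \<comment> \<open>Half of the smaller limit: a deviation of S_1 and S_2 from b_1 and b_2 below it
    leaves both of them at least this large.\<close>
  define \<beta> where "\<beta> = min (b 1) (b 2) / 2"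
  have \<beta>: "0 < \<beta>" "2 * \<beta> \<le> b 1" "2 * \<beta> \<le> b 2"
    using b_pos[of 1] b_pos[of 2] by (auto simp: \<beta>_def)
  have "\<forall>\<^sub>F N in sequentially. x / sqrt (real N) < \<beta>"
    by (rule order_tendstoD(2)[OF sqrt_N_tendsto \<beta>(1)])
  moreover have "\<forall>\<^sub>F N in sequentially. (K1 * x) / sqrt (real N) < room"
    by (rule order_tendstoD(2)[OF sqrt_N_tendsto room_pos])
  moreover have "\<forall>\<^sub>F N in sequentially. 2 \<le> L N"
    using L by (auto simp: filterlim_at_top)
  ultimately show ?thesis
    using eventually_gt_at_top[of 1]
  proof eventually_elim
    case (elim N)
    have "AE \<omega> in M. (\<exists>\<theta>. is_arg_min (nls_criterion T (L N) N \<omega>) (\<lambda>\<theta>. \<theta> \<in> Theta a1 a2) \<theta>) \<longrightarrow>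
           is_arg_min (nls_criterion T (L N) N \<omega>) (\<lambda>\<theta>. \<theta> \<in> Theta a1 a2) (Ghat N \<omega>, \<alpha>hat N \<omega>)"
      using est elim(4) unfolding nls_estimator_def by blast
    then show ?case
      using AE_space
    proof eventually_elim
      case (elim \<omega>)
      show ?case
      proof
        assume "\<omega> \<notin> bad N x"
        then have WV: "W N \<omega> \<le> x / sqrt (real N)" "V' N \<omega> \<le> x / sqrt (real N)"
          using elim(2) by (auto simp: bad_def)
        have N: "1 \<le> N" and N0: "0 < sqrt (real N)"
          using \<open>1 < N\<close> by auto
        define m S where "m l = cross N l \<omega>" and "S l = square N l \<omega>" for l
        have W_eq: "(\<Sum>l=1..L N. \<bar>m l\<bar>) = W N \<omega>" and V'_eq: "(\<Sum>l=1..L N. \<bar>S l - b l\<bar>) = V' N \<omega>"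
          by (simp_all add: W_def V'_def m_def S_def)
        have Sl: "\<beta> \<le> S l" if "l = 1 \<or> l = 2" for l
        proof -
          have "(\<Sum>l\<in>{l}. \<bar>S l - b l\<bar>) \<le> V' N \<omega>"
            unfolding V'_eq[symmetric] using that \<open>2 \<le> L N\<close> by (intro sum_mono2) auto
          then have "\<bar>S l - b l\<bar> < \<beta>"
            using WV(2) \<open>x / sqrt (real N) < \<beta>\<close> by simp
          then show ?thesis
            using \<beta> that by auto
        qed
        have S: "0 \<le> S l" "\<beta> \<le> S 1" "\<beta> \<le> S 2" for l
          using Sl by (auto simp: S_def square_nonneg)
        have K1: "K1 = 4 * sep\<^sup>2 / \<beta>"
          by (simp add: K1_def \<beta>_def)
        have KW: "K1 * W N \<omega> \<le> K1 * x / sqrt (real N)"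
          using mult_left_mono[OF WV(1), of K1] K1_pos by simp
        then have small: "(4 * sep\<^sup>2 / \<beta>) * (\<Sum>l=1..L N. \<bar>m l\<bar>) < room"
          unfolding W_eq K1[symmetric] using \<open>K1 * x / sqrt (real N) < room\<close> by linarith
        obtain \<kappa>' where \<kappa>': "\<forall>G \<alpha>. nls_criterion T (L N) N \<omega> (G, \<alpha>) = \<kappa>' + Q (L N) m S G \<alpha>"
          using criterion_eq[OF N, of "L N" \<omega>] unfolding m_def S_def by blast
        have min_eq: "is_arg_min (nls_criterion T (L N) N \<omega>) (\<lambda>\<theta>. \<theta> \<in> Theta a1 a2)
            = is_arg_min (\<lambda>(G, \<alpha>). Q (L N) m S G \<alpha>) (\<lambda>\<theta>. \<theta> \<in> Theta a1 a2)"
          by (rule is_arg_min_shift[where \<kappa> = \<kappa>']) (use \<kappa>' in \<open>auto simp: case_prod_beta split: prod.split\<close>)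
        define G \<alpha> where "G = Ghat N \<omega>" and "\<alpha> = \<alpha>hat N \<omega>"
        \<comment> \<open>The estimator is only constrained where a minimiser exists, so existence
          has to be established before the definition can be used.\<close>
        have min: "is_arg_min (\<lambda>(G, \<alpha>). Q (L N) m S G \<alpha>) (\<lambda>\<theta>. \<theta> \<in> Theta a1 a2) (G, \<alpha>)"
          using elim(1) minimizer_exists[OF \<open>2 \<le> L N\<close> S \<beta>(1) small] unfolding min_eq G_def \<alpha>_def by blast
        have d: "err G \<alpha> \<le> K1 * W N \<omega>"
          using minimizer_err[OF \<open>2 \<le> L N\<close> S \<beta>(1) min] unfolding W_eq K1 .
        then have int: "err G \<alpha> < room"
          using small unfolding W_eq K1 by linarith
        have \<alpha>1: "1 \<le> \<alpha>"
          using room_interior(2)[OF int] a by simp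
        have factor: "n * (k * e * q + e * y + e * z) = (n * e) * (k * q + y + z)"
          "e * (k * q + y + z) = e * y + e * z + k * e * q" for n k e q y z :: real
          by (simp_all add: algebra_simps)
        define Ad Sd where "Ad = (\<Sum>l = 1..L N. b l * p0 l * (ln (real l) - \<mu>))"
          and "Sd = (\<Sum>l = 1..L N. b l * p0 l * (ln (real l) * (ln (real l) - \<mu>)))"
        define u where "u = (\<Sum>l = 1..L N. m l * (real l powr - \<alpha>\<^sub>0 * (ln (real l) - \<mu>)))"
        define e where "e = err G \<alpha>"
        have e: "0 \<le> e" "\<bar>G - G\<^sub>0\<bar> \<le> e" "\<bar>\<alpha> - \<alpha>\<^sub>0\<bar> \<le> e"
          by (simp_all add: e_def)
        have es: "sqrt (real N) * e \<le> K1 * x"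
        proof -
          have "e \<le> K1 * x / sqrt (real N)"
            using d KW unfolding e_def by linarith
          then show ?thesis
            using N0 by (simp add: pos_le_divide_eq mult.commute)
        qed
        have lin: "\<bar>u - (G - G\<^sub>0) * Ad + G\<^sub>0 * (\<alpha> - \<alpha>\<^sub>0) * Sd\<bar>
            \<le> (9 + 6 * \<bar>\<mu>\<bar>) * e * (W N \<omega> + V' N \<omega> + e * (\<Sum>l=1..L N. b l))"
          using score_linearization[where s = b, OF minimizer_score[OF min int] \<alpha>1 b_nonneg, of \<mu>]
          unfolding W_eq V'_eq u_def Ad_def Sd_def e_def .
        have eB: "W N \<omega> + V' N \<omega> + e * (\<Sum>l=1..L N. b l) \<le> (2 * x + K1 * x * Btot) / sqrt (real N)"
        proof -
          have "e * (\<Sum>l=1..L N. b l) \<le> e * Btot"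
            using e(1) Btot(2) by (intro mult_left_mono) auto
          also have "\<dots> \<le> (K1 * x / sqrt (real N)) * Btot"
            using d KW Btot(3) unfolding e_def by (intro mult_right_mono) auto
          finally show ?thesis
            using WV by (simp add: add_divide_distrib)
        qed
        have "U N \<omega> - (- G\<^sub>0 * \<Delta>) * Y N \<omega>
          = sqrt (real N) * ((u - (G - G\<^sub>0) * Ad + G\<^sub>0 * (\<alpha> - \<alpha>\<^sub>0) * Sd) + (G - G\<^sub>0) * Ad - G\<^sub>0 * (\<alpha> - \<alpha>\<^sub>0) * (Sd - \<Delta>))"
          by (simp add: U_def Y_def u_def m_def \<alpha>_def algebra_simps)
        also have "\<bar>\<dots>\<bar> = sqrt (real N) * \<bar>(u - (G - G\<^sub>0) * Ad + G\<^sub>0 * (\<alpha> - \<alpha>\<^sub>0) * Sd) + (G - G\<^sub>0) * Ad - G\<^sub>0 * (\<alpha> - \<alpha>\<^sub>0) * (Sd - \<Delta>)\<bar>"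
          using N0 by (simp only: abs_mult abs_of_pos)
        also have "\<dots> \<le> sqrt (real N) * ((9 + 6 * \<bar>\<mu>\<bar>) * e * ((2 * x + K1 * x * Btot) / sqrt (real N)) + e * \<bar>Ad\<bar> + e * \<bar>Sd - \<Delta>\<bar>)"
        proof (intro mult_left_mono)
          have "\<bar>(G - G\<^sub>0) * Ad\<bar> \<le> e * \<bar>Ad\<bar>"
            unfolding abs_mult using e by (intro mult_right_mono) auto
          moreover have "\<bar>G\<^sub>0 * (\<alpha> - \<alpha>\<^sub>0) * (Sd - \<Delta>)\<bar> \<le> 1 * e * \<bar>Sd - \<Delta>\<bar>"
            unfolding abs_mult using e G0 by (intro mult_right_mono mult_mono) auto
          moreover have "(9 + 6 * \<bar>\<mu>\<bar>) * e * (W N \<omega> + V' N \<omega> + e * (\<Sum>l=1..L N. b l))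
              \<le> (9 + 6 * \<bar>\<mu>\<bar>) * e * ((2 * x + K1 * x * Btot) / sqrt (real N))"
            using e(1) eB by (intro mult_left_mono) auto
          ultimately show "\<bar>(u - (G - G\<^sub>0) * Ad + G\<^sub>0 * (\<alpha> - \<alpha>\<^sub>0) * Sd) + (G - G\<^sub>0) * Ad - G\<^sub>0 * (\<alpha> - \<alpha>\<^sub>0) * (Sd - \<Delta>)\<bar>
            \<le> (9 + 6 * \<bar>\<mu>\<bar>) * e * ((2 * x + K1 * x * Btot) / sqrt (real N)) + e * \<bar>Ad\<bar> + e * \<bar>Sd - \<Delta>\<bar>"
            using lin by linarith
        qed simp
        also have "\<dots> = (sqrt (real N) * e) * ((9 + 6 * \<bar>\<mu>\<bar>) * ((2 * x + K1 * x * Btot) / sqrt (real N)) + \<bar>Ad\<bar> + \<bar>Sd - \<Delta>\<bar>)"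
          by (rule factor)
        also have "\<dots> \<le> (K1 * x) * ((9 + 6 * \<bar>\<mu>\<bar>) * ((2 * x + K1 * x * Btot) / sqrt (real N)) + \<bar>Ad\<bar> + \<bar>Sd - \<Delta>\<bar>)"
          using es K1_pos x Btot(3)
          by (intro mult_right_mono add_nonneg_nonneg mult_nonneg_nonneg divide_nonneg_nonneg) auto
        also have "\<dots> = \<rho> x N"
          unfolding \<rho>_def Ad_def Sd_def by (rule factor)
        finally show "\<bar>U N \<omega> - (- G\<^sub>0 * \<Delta>) * Y N \<omega>\<bar> \<le> \<rho> x N" .
      qed
    qed
  qed
qed

end


context nls_sphar
begin

subsection \<open>Asymptotic normality\<close>

abbreviation cf :: "('w \<Rightarrow> real) \<Rightarrow> real \<Rightarrow> complex" where
  "cf X u \<equiv> (CLINT \<omega>|M. iexp (u * X \<omega>))"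

abbreviation score_weight :: "nat \<Rightarrow> real" where
  "score_weight l \<equiv> real l powr - \<alpha>\<^sub>0 * (ln (real l) - \<mu>)"

lemma score_weight:
  assumes "1 \<le> l"
  shows "\<bar>score_weight l\<bar> \<le> 1 + \<bar>\<mu>\<bar>" "(score_weight l)\<^sup>2 = p0 l * (ln (real l) - \<mu>)\<^sup>2"
proof -
  note lb = ln_powr_bounds[OF assms, of \<alpha>\<^sub>0]
  have "\<bar>score_weight l\<bar> = real l powr - \<alpha>\<^sub>0 * \<bar>ln (real l) - \<mu>\<bar>"
    by (simp add: abs_mult)
  also have "\<dots> \<le> real l powr - \<alpha>\<^sub>0 * (ln (real l) + \<bar>\<mu>\<bar>)"
    using lb(1) a by (intro mult_left_mono) auto
  also have "\<dots> = ln (real l) * real l powr - \<alpha>\<^sub>0 + \<bar>\<mu>\<bar> * real l powr - \<alpha>\<^sub>0"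
    by (simp add: algebra_simps)
  also have "\<dots> \<le> 1 + \<bar>\<mu>\<bar> * 1"
    using lb a by (intro add_mono mult_left_mono) auto
  finally show "\<bar>score_weight l\<bar> \<le> 1 + \<bar>\<mu>\<bar>"
    by simp
  have "(real l powr - \<alpha>\<^sub>0)\<^sup>2 = p0 l"
    using assms by (simp add: power2_eq_square flip: powr_add)
  then show "(score_weight l)\<^sup>2 = p0 l * (ln (real l) - \<mu>)\<^sup>2"
    by (simp add: power_mult_distrib)
qed

definition trunc_U :: "nat \<Rightarrow> nat \<Rightarrow> 'w \<Rightarrow> real" where
  "trunc_U n N \<omega> = sqrt (real N) * (\<Sum>l = 1..n. cross N l \<omega> * score_weight l)"

lemma trunc_U_measurable [measurable]: "trunc_U n N \<in> borel_measurable M"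
  unfolding trunc_U_def[abs_def] by measurable

text \<open>In L1 the omitted multipoles contribute at most a constant times a tail of the summable
  b_l: the factor sqrt N cancels against the rate of \<open>cross_bound\<close>, so the bound is
  uniform in N.\<close>

lemma cf_trunc_U:
  assumes n: "n \<le> L N" and N: "1 \<le> N"
  shows "norm (cf (U N) u - cf (trunc_U n N) u) \<le> \<bar>u\<bar> * ((1 + \<bar>\<mu>\<bar>) * (Btot - (\<Sum>l = 1..n. b l)))"
proof -
  have split: "{1..L N} = {1..n} \<union> {n<..L N}" "{1..n} \<inter> {n<..L N} = {}"
    using n by auto
  have diff: "U N \<omega> - trunc_U n N \<omega> = sqrt (real N) * (\<Sum>l\<in>{n<..L N}. cross N l \<omega> * score_weight l)" for \<omega>
    unfolding U_def trunc_U_def split(1) by (subst sum.union_disjoint) (use split(2) in \<open>auto simp: algebra_simps\<close>)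
  have i: "integrable M (cross N l)" if "l \<in> {n<..L N}" for l
    using that by (intro cross_bound(1)) auto
  have int: "integrable M (\<lambda>\<omega>. U N \<omega> - trunc_U n N \<omega>)"
    unfolding diff using i by auto
  have "expectation (\<lambda>\<omega>. \<bar>U N \<omega> - trunc_U n N \<omega>\<bar>)
      \<le> expectation (\<lambda>\<omega>. sqrt (real N) * (\<Sum>l\<in>{n<..L N}. (1 + \<bar>\<mu>\<bar>) * \<bar>cross N l \<omega>\<bar>))"
  proof (intro integral_mono integrable_abs int)
    show "integrable M (\<lambda>\<omega>. sqrt (real N) * (\<Sum>l\<in>{n<..L N}. (1 + \<bar>\<mu>\<bar>) * \<bar>cross N l \<omega>\<bar>))"
      using i by (intro integrable_mult_right Bochner_Integration.integrable_sum integrable_abs)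
    fix \<omega>
    have "\<bar>\<Sum>l\<in>{n<..L N}. cross N l \<omega> * score_weight l\<bar> \<le> (\<Sum>l\<in>{n<..L N}. \<bar>cross N l \<omega> * score_weight l\<bar>)"
      by (rule sum_abs)
    also have "\<dots> \<le> (\<Sum>l\<in>{n<..L N}. (1 + \<bar>\<mu>\<bar>) * \<bar>cross N l \<omega>\<bar>)"
    proof (rule sum_mono)
      fix l assume "l \<in> {n<..L N}"
      then have "\<bar>score_weight l\<bar> * \<bar>cross N l \<omega>\<bar> \<le> (1 + \<bar>\<mu>\<bar>) * \<bar>cross N l \<omega>\<bar>"
        by (intro mult_right_mono score_weight) auto
      then show "\<bar>cross N l \<omega> * score_weight l\<bar> \<le> (1 + \<bar>\<mu>\<bar>) * \<bar>cross N l \<omega>\<bar>"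
        unfolding abs_mult[of "cross N l \<omega>"] by (simp only: mult.commute)
    qed
    finally show "\<bar>U N \<omega> - trunc_U n N \<omega>\<bar> \<le> sqrt (real N) * (\<Sum>l\<in>{n<..L N}. (1 + \<bar>\<mu>\<bar>) * \<bar>cross N l \<omega>\<bar>)"
      unfolding diff abs_mult[of "sqrt _"] by (simp add: mult_left_mono)
  qed
  also have "\<dots> = sqrt (real N) * (\<Sum>l\<in>{n<..L N}. (1 + \<bar>\<mu>\<bar>) * expectation (\<lambda>\<omega>. \<bar>cross N l \<omega>\<bar>))"
    using i by (simp add: Bochner_Integration.integral_sum)
  also have "\<dots> \<le> sqrt (real N) * (\<Sum>l\<in>{n<..L N}. (1 + \<bar>\<mu>\<bar>) * (b l / sqrt (real N)))"
    using cross_bound(2) by (intro mult_left_mono sum_mono) auto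
  also have "\<dots> = (1 + \<bar>\<mu>\<bar>) * (\<Sum>l\<in>{n<..L N}. b l)"
    using N by (simp add: sum_distrib_left)
  also have "(\<Sum>l\<in>{n<..L N}. b l) = (\<Sum>l = 1..L N. b l) - (\<Sum>l = 1..n. b l)"
    unfolding split(1) by (subst sum.union_disjoint) (use split(2) in auto)
  also have "(1 + \<bar>\<mu>\<bar>) * \<dots> \<le> (1 + \<bar>\<mu>\<bar>) * (Btot - (\<Sum>l = 1..n. b l))"
    using Btot(2) by (intro mult_left_mono) auto
  finally have e: "expectation (\<lambda>\<omega>. \<bar>U N \<omega> - trunc_U n N \<omega>\<bar>) \<le> (1 + \<bar>\<mu>\<bar>) * (Btot - (\<Sum>l = 1..n. b l))" .
  show ?thesis
    by (rule order_trans[OF char_diff_le_expectation[OF U_measurable trunc_U_measurable int] mult_left_mono[OF e abs_ge_zero]])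
qed

definition trunc_V :: "nat \<Rightarrow> real" where
  "trunc_V n = (\<Sum>l = 1..n. b l * (CZ l * (p0 l * (ln (real l) - \<mu>)\<^sup>2)))"

lemma cf_trunc_U_tendsto: "(\<lambda>N. cf (trunc_U n N) u) \<longlonglongrightarrow> exp (- u\<^sup>2 * trunc_V n / 2)"
proof -
  define J where "J = Sigma {1..n} (\<lambda>l. {- int l..int l})"
  define w where "w = (\<lambda>(l, m :: int). score_weight l)"
  define r where "r = (1 + exp (u\<^sup>2 / 2)) * (1 + u\<^sup>2 / 2) *
      (\<Sum>j\<in>J. (w j)\<^sup>2 * (case j of (l, m) \<Rightarrow> CZ l) * (6 / (1 - \<bar>G\<^sub>0\<bar>\<^sup>2)
        * (case j of (l, m) \<Rightarrow> expectation (\<lambda>\<omega>. (harm_coeff T l m 0 \<omega>)\<^sup>2))))"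
  have J: "finite J" "J \<subseteq> modes"
    by (auto simp: J_def)
  have U_eq: "trunc_U n N \<omega> = sqrt (real N) * (\<Sum>j\<in>J. w j * AR.cross_mean N j \<omega>)" for N \<omega>
  proof -
    have "(\<Sum>l = 1..n. cross N l \<omega> * score_weight l)
        = (\<Sum>l = 1..n. \<Sum>m = - int l..int l. w (l, m) * AR.cross_mean N (l, m) \<omega>)"
      unfolding cross_def w_def prod.case sum_distrib_right by (simp only: mult.commute[of "score_weight _"])
    also have "\<dots> = (\<Sum>j\<in>J. w j * AR.cross_mean N j \<omega>)"
      unfolding J_def by (subst sum.Sigma) (simp_all add: case_prod_beta)
    finally show ?thesis
      by (simp only: trunc_U_def)
  qed
  have V_eq: "(\<Sum>j\<in>J. (w j)\<^sup>2 * (case j of (l, m) \<Rightarrow> CZ l)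
      * (case j of (l, m) \<Rightarrow> expectation (\<lambda>\<omega>. (harm_coeff T l m 0 \<omega>)\<^sup>2))) = trunc_V n"
  proof -
    have "(\<Sum>j\<in>J. (w j)\<^sup>2 * (case j of (l, m) \<Rightarrow> CZ l)
        * (case j of (l, m) \<Rightarrow> expectation (\<lambda>\<omega>. (harm_coeff T l m 0 \<omega>)\<^sup>2)))
      = (\<Sum>(l, m)\<in>J. p0 l * (ln (real l) - \<mu>)\<^sup>2 * CZ l * c l)"
      by (intro sum.cong refl) (auto simp: J_def w_def c_eq(1) score_weight(2))
    also have "\<dots> = (\<Sum>l = 1..n. \<Sum>m = - int l..int l. p0 l * (ln (real l) - \<mu>)\<^sup>2 * CZ l * c l)"
      unfolding J_def by (subst sum.Sigma) auto
    also have "\<dots> = trunc_V n"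
      unfolding trunc_V_def by (intro sum.cong) (auto simp: b_def mult_ac)
    finally show ?thesis .
  qed
  have bound: "norm (cf (trunc_U n N) u - exp (- u\<^sup>2 * trunc_V n / 2)) \<le> r / sqrt (real N)" if "1 \<le> N" for N
    using AR.clt_bound[OF J that, of u w] unfolding V_eq U_eq r_def
    by (simp only: sum_divide_distrib times_divide_eq_right sum_distrib_left mult.assoc)
  show ?thesis
  proof (rule Lim_null_comparison[THEN LIM_zero_cancel])
    show "\<forall>\<^sub>F N in sequentially. norm (cf (trunc_U n N) u - exp (- u\<^sup>2 * trunc_V n / 2)) \<le> r / sqrt (real N)"
      using eventually_ge_at_top[of 1] by eventually_elim (rule bound)
  qed (rule sqrt_N_tendsto)
qed

text \<open>An exchange of limits: first n is fixed so that the approximation is good, then N tends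
  to infinity. It serves twice, with n the truncation of the score and with n the level of the
  exceptional event.\<close>

lemma tendsto_by_approximation:
  fixes f :: "nat \<Rightarrow> 'b :: metric_space"
  assumes g: "\<And>n. (g n) \<longlonglongrightarrow> l n" and l: "l \<longlonglongrightarrow> l'"
    and \<delta>: "\<delta> \<longlonglongrightarrow> (0 :: real)" and fg: "\<And>n. \<forall>\<^sub>F N in sequentially. dist (f N) (g n N) \<le> \<delta> n"
  shows "f \<longlonglongrightarrow> l'"
proof (rule tendstoI)
  fix \<epsilon> :: real assume \<epsilon>: "0 < \<epsilon>"
  then have \<epsilon>3: "0 < \<epsilon> / 3"
    by simp
  have "\<forall>\<^sub>F n in sequentially. \<delta> n < \<epsilon> / 3 \<and> dist (l n) l' < \<epsilon> / 3"
    using order_tendstoD(2)[OF \<delta> \<epsilon>3] tendstoD[OF l \<epsilon>3] by eventually_elim simp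
  then obtain n where n: "\<delta> n < \<epsilon> / 3" "dist (l n) l' < \<epsilon> / 3"
    using eventually_happens'[OF sequentially_bot] by blast
  show "\<forall>\<^sub>F N in sequentially. dist (f N) l' < \<epsilon>"
    using fg[of n] tendstoD[OF g \<epsilon>3, of n]
  proof eventually_elim
    case (elim N)
    then show ?case
      using dist_triangle[of "f N" l' "g n N"] dist_triangle[of "g n N" l' "l n"] n by linarith
  qed
qed

lemma cf_U_tendsto: "(\<lambda>N. cf (U N) u) \<longlonglongrightarrow> exp (- u\<^sup>2 * V / 2)"
proof (rule tendsto_by_approximation[OF cf_trunc_U_tendsto])
  show "(\<lambda>n. complex_of_real (exp (- u\<^sup>2 * trunc_V n / 2))) \<longlonglongrightarrow> exp (- u\<^sup>2 * V / 2)"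
    unfolding trunc_V_def by (intro tendsto_intros V_lim) auto
  have "(\<lambda>n. \<bar>u\<bar> * ((1 + \<bar>\<mu>\<bar>) * (Btot - (\<Sum>l = 1..n. b l)))) \<longlonglongrightarrow> \<bar>u\<bar> * ((1 + \<bar>\<mu>\<bar>) * (Btot - Btot))"
    by (intro tendsto_intros Btot(1))
  then show "(\<lambda>n. \<bar>u\<bar> * ((1 + \<bar>\<mu>\<bar>) * (Btot - (\<Sum>l = 1..n. b l)))) \<longlonglongrightarrow> 0"
    by simp
  fix n
  have "\<forall>\<^sub>F N in sequentially. n \<le> L N"
    using L by (auto simp: filterlim_at_top)
  then show "\<forall>\<^sub>F N in sequentially. dist (cf (U N) u) (cf (trunc_U n N) u)
      \<le> \<bar>u\<bar> * ((1 + \<bar>\<mu>\<bar>) * (Btot - (\<Sum>l = 1..n. b l)))"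
    using eventually_ge_at_top[of 1] by eventually_elim (simp only: dist_norm cf_trunc_U)
qed

text \<open>The approximating sequence is the same for every n; only the quality of the
  approximation varies, through the level of the exceptional event.\<close>

lemma cf_Y_tendsto: "(\<lambda>N. cf (Y N) u) \<longlonglongrightarrow> exp (- (asymp_var c CZ G\<^sub>0 \<alpha>\<^sub>0 * u\<^sup>2) / 2)"
proof -
  \<comment> \<open>U is close to K times Y, so the characteristic function of Y at u is compared
    with that of U at u / K.\<close>
  define K where "K = - G\<^sub>0 * \<Delta>"
  have K: "K \<noteq> 0"
    using G0 \<Delta>_pos by (simp add: K_def)
  have cf_Y: "cf (Y N) u = cf (\<lambda>\<omega>. K * Y N \<omega>) (u / K)" for N
    using K by simp
  show ?thesis
  proof (rule tendsto_by_approximation)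
    show "(\<lambda>N. cf (U N) (u / K)) \<longlonglongrightarrow> exp (- (u / K)\<^sup>2 * V / 2)" for n :: nat
      by (rule cf_U_tendsto)
    have "- (u / K)\<^sup>2 * V / 2 = - (asymp_var c CZ G\<^sub>0 \<alpha>\<^sub>0 * u\<^sup>2) / 2"
      unfolding asymp_var_eq by (simp add: K_def power_divide power_mult_distrib)
    then show "(\<lambda>n. complex_of_real (exp (- (u / K)\<^sup>2 * V / 2))) \<longlonglongrightarrow> exp (- (asymp_var c CZ G\<^sub>0 \<alpha>\<^sub>0 * u\<^sup>2) / 2)"
      by (simp only: tendsto_const)
    have "(\<lambda>n. (2 * (1 + \<kappa>) * Btot + 1) * inverse (real (Suc n))) \<longlonglongrightarrow> (2 * (1 + \<kappa>) * Btot + 1) * 0"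
      by (intro tendsto_intros LIMSEQ_inverse_real_of_nat)
    then show "(\<lambda>n. (2 * (1 + \<kappa>) * Btot + 1) * inverse (real (Suc n))) \<longlonglongrightarrow> 0"
      by simp
    fix n
    \<comment> \<open>The level grows with n. Twice the probability of the exceptional event and the
      linearisation error, made smaller than 1 / x for large N, add up to the claimed bound.\<close>
    define x where "x = real (Suc n)"
    have x: "0 < x"
      by (simp add: x_def)
    have "(\<lambda>N. \<bar>u / K\<bar> * \<rho> x N) \<longlonglongrightarrow> \<bar>u / K\<bar> * 0"
      by (intro tendsto_intros \<rho>_tendsto)
    then have "\<forall>\<^sub>F N in sequentially. \<bar>u / K\<bar> * \<rho> x N < inverse x"
      using x by (intro order_tendstoD(2)) auto
    with linearization[OF x, folded K_def] eventually_gt_at_top[of 1]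
    show "\<forall>\<^sub>F N in sequentially. dist (cf (Y N) u) (cf (U N) (u / K))
        \<le> (2 * (1 + \<kappa>) * Btot + 1) * inverse (real (Suc n))"
      unfolding x_def[symmetric]
    proof eventually_elim
      case (elim N)
      have "(\<lambda>\<omega>. K * Y N \<omega>) \<in> borel_measurable M"
        using Y_measurable[OF elim(2)] by measurable
      then have "dist (cf (U N) (u / K)) (cf (\<lambda>\<omega>. K * Y N \<omega>) (u / K)) \<le> 2 * prob (bad N x) + \<bar>u / K\<bar> * \<rho> x N"
        unfolding dist_norm
        by (intro char_diff_le_event[OF U_measurable _ bad_measurable elim(1)] \<rho>_nonneg x)
      also have "\<dots> \<le> 2 * ((1 + \<kappa>) * Btot / x) + inverse x"
        using prob_bad[of N x] elim(2,3) x by (intro add_mono mult_left_mono) auto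
      also have "\<dots> = (2 * (1 + \<kappa>) * Btot + 1) * inverse x"
        by (simp add: divide_inverse algebra_simps)
      finally show ?case
        unfolding cf_Y by (simp only: dist_commute)
    qed
  qed
qed

lemma clt:
  "weak_conv_m (\<lambda>N. distr M borel (\<lambda>\<omega>. sqrt (real N) * (\<alpha>hat N \<omega> - \<alpha>\<^sub>0)))
    (density lborel (normal_density 0 (sqrt (asymp_var c CZ G\<^sub>0 \<alpha>\<^sub>0))))"
proof -
  define \<sigma> where "\<sigma> = sqrt (asymp_var c CZ G\<^sub>0 \<alpha>\<^sub>0)"
  define N' where "N' = density lborel (normal_density 0 \<sigma>)"
  have var: "0 < asymp_var c CZ G\<^sub>0 \<alpha>\<^sub>0"
    unfolding asymp_var_eq using V_pos G0 \<Delta>_pos by simp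
  then have \<sigma>: "0 < \<sigma>" "\<sigma>\<^sup>2 = asymp_var c CZ G\<^sub>0 \<alpha>\<^sub>0"
    by (simp_all add: \<sigma>_def)
  interpret N': real_distribution N'
    unfolding N'_def using prob_space_normal_density[OF \<sigma>(1), of 0]
    by (simp add: real_distribution_def real_distribution_axioms_def)
  \<comment> \<open>The estimator is known to be measurable only for N > 1. The limit law fills in
    for the remaining N, so that every member of the sequence is a real distribution as
    \<open>levy_continuity\<close> requires.\<close>
  define P where "P N = (if 1 < N then distr M borel (Y N) else N')" for N
  have "weak_conv_m P N'"
  proof (rule levy_continuity)
    show "real_distribution (P N)" for N
      unfolding P_def using N'.real_distribution_axioms real_distribution_distr[OF Y_measurable] by simp
    show "real_distribution N'"
      by (rule N'.real_distribution_axioms)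
    fix u
    have "\<forall>\<^sub>F N in sequentially. char (P N) u = cf (Y N) u"
      using eventually_gt_at_top[of 1]
    proof eventually_elim
      case (elim N)
      show ?case
        unfolding P_def char_def using elim
        by (simp add: integral_distr[OF Y_measurable[OF elim]])
    qed
    moreover have "char N' u = exp (- (asymp_var c CZ G\<^sub>0 \<alpha>\<^sub>0 * u\<^sup>2) / 2)"
      unfolding N'_def using char_normal_density[OF \<sigma>(1), of u] \<sigma>(2) by simp
    ultimately show "(\<lambda>N. char (P N) u) \<longlonglongrightarrow> char N' u"
      using cf_Y_tendsto[of u] by (simp add: tendsto_cong)
  qed
  then have lim: "(\<lambda>N. cdf (P N) z) \<longlonglongrightarrow> cdf N' z" if "isCont (cdf N') z" for z
    using that unfolding weak_conv_m_def weak_conv_def by blast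
  have eq: "\<forall>\<^sub>F N in sequentially.
      cdf (P N) z = cdf (distr M borel (\<lambda>\<omega>. sqrt (real N) * (\<alpha>hat N \<omega> - \<alpha>\<^sub>0))) z" for z
    using eventually_gt_at_top[of 1] by eventually_elim (simp add: P_def Y_def[abs_def])
  have "(\<lambda>N. cdf (distr M borel (\<lambda>\<omega>. sqrt (real N) * (\<alpha>hat N \<omega> - \<alpha>\<^sub>0))) z) \<longlonglongrightarrow> cdf N' z"
    if "isCont (cdf N') z" for z
    by (rule Lim_transform_eventually[OF lim[OF that] eq])
  then show ?thesis
    unfolding weak_conv_m_def weak_conv_def N'_def \<sigma>_def by blast
qed

end

theorem theorem3p9:
  fixes M :: "'w measure"
    and T Z :: "real^3 \<Rightarrow> int \<Rightarrow> 'w \<Rightarrow> real"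
    and k :: "real \<Rightarrow> real" and \<phi> CZ :: "nat \<Rightarrow> real"
    and G\<^sub>0 \<alpha>\<^sub>0 a1 a2 H \<gamma> :: real
    and L :: "nat \<Rightarrow> nat"
    and Ghat \<alpha>hat :: "nat \<Rightarrow> 'w \<Rightarrow> real"
  assumes "prob_space M"
    and "sphar1 M k \<phi> T Z"
    and "\<And>l. l \<ge> 1 \<Longrightarrow> \<phi> l = G\<^sub>0 * real l powr (- \<alpha>\<^sub>0)"
    and "0 < \<bar>G\<^sub>0\<bar>" and "\<bar>G\<^sub>0\<bar> < 1"
    and "1 < a1" and "a1 < a2"
    and "a1 < \<alpha>\<^sub>0" and "\<alpha>\<^sub>0 < a2"
    and "has_power_spectrum M Z CZ"
    and "\<And>l. l \<ge> 1 \<Longrightarrow> CZ l = H * real l powr (- \<gamma>)"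
    and "H > 0" and "\<gamma> > 2"
    and "filterlim L at_top sequentially"
    and "(\<lambda>N. (ln (real (L N)))\<^sup>2 / sqrt (real N)) \<longlonglongrightarrow> 0"
    and "nls_estimator M T a1 a2 L Ghat \<alpha>hat"
  shows "weak_conv_m
           (\<lambda>N. distr M borel (\<lambda>\<omega>. sqrt (real N) * (\<alpha>hat N \<omega> - \<alpha>\<^sub>0)))
           (density lborel
              (normal_density 0 (sqrt (asymp_var (power_spectrum M T) CZ G\<^sub>0 \<alpha>\<^sub>0))))"
proof -
  interpret prob_space M
    by fact
  interpret nls_sphar M T Z k \<phi> CZ G\<^sub>0 \<alpha>\<^sub>0 a1 a2 H \<gamma> L Ghat \<alpha>hat
    by unfold_locales (use assms in auto)
  show ?thesis
    using clt unfolding c_def .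
qed

end
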